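(* Let $\beta\in(0,1)$ and $c>0$. Let $X=(X(t);t\ge 0)$ be a reflected Brownian motion started from $0$, let $S=(S(t);t\ge 0)$ be a $\beta$-stable subordinator independent of $X$ with $\mathbb{E}[\exp(-\lambda S(t))]=\exp(-ct\lambda^\beta)$ for all $t,\lambda>0$, let $E(t)=\inf\{u: S(u)>t\}$ be its right-continuous inverse, and let $X^*(t)=X(E(t))$. Fix $t>0$. Then the ordered lengths of the relatively open intervals (connected components) of $\{u\in[0,t]: X^*(u)>0\}$, say $U_1(t)\ge U_2(t)\ge\cdots>0$, are distributed as $t$ times a $\operatorname{PD}(\beta/2,0)$ random variable: $$\left(\frac{U_1(t)}{t},\frac{U_2(t)}{t},\dots\right)\overset{d}{=}\operatorname{PD}\left(\frac{\beta}{2},0\right).$$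
   Context: Poisson-Dirichlet distribution: for $\alpha\in(0,1)$, let $\sigma$ be an $\alpha$-stable subordinator and let $J_1\ge J_2\ge\cdots>0$ be the decreasing rearrangement of all the jumps of $\sigma$ on the time interval $[0,1]$. Then $\operatorname{PD}(\alpha,0)$ is the law of the vector $V=(V_1,V_2,\dots)$ with $V_n=J_n/\sigma(1)=J_n/\sum_i J_i$, a random element of the infinite simplex $\{(x_j)\in[0,1]^\infty: x_1\ge x_2\ge\cdots\ge 0,\ \sum_j x_j=1\}$. Intervals include the (almost surely unfinished) last one with right endpoint $t$. *)

theory Defs
  imports "HOL-Probability.Probability"
begin

section \<open>Processes\<close>

text \<open>Real-valued processes with time set \<open>[0,\<infinity>)\<close> are functions \<open>X :: real \<Rightarrow> 'a \<Rightarrow> real\<close> of which only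
  the values at nonnegative times matter.  The law of a process is the law of its path in the
  product space below, so equality of laws is equality of all finite-dimensional distributions.\<close>

definition path_space :: "(real \<Rightarrow> real) measure" where
  "path_space = (\<Pi>\<^sub>M s\<in>{0..}. borel)"

definition sample_path :: "(real \<Rightarrow> 'a \<Rightarrow> real) \<Rightarrow> 'a \<Rightarrow> real \<Rightarrow> real" where
  "sample_path X \<omega> = (\<lambda>s\<in>{0..}. X s \<omega>)"

locale independent_increments = prob_space M for M :: "'a measure" +
  fixes X :: "real \<Rightarrow> 'a \<Rightarrow> real"
  assumes random_variable: "\<And>s. 0 \<le> s \<Longrightarrow> X s \<in> borel_measurable M"
    and starts_at_0: "AE \<omega> in M. X 0 \<omega> = 0"
    and indep_increments: "\<And>(u :: nat \<Rightarrow> real) n. 0 \<le> u 0 \<Longrightarrow> mono u \<Longrightarrow>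
      indep_vars (\<lambda>_. borel) (\<lambda>i \<omega>. X (u (Suc i)) \<omega> - X (u i) \<omega>) {..<n}"

locale brownian_motion = independent_increments M B
  for M :: "'a measure" and B :: "real \<Rightarrow> 'a \<Rightarrow> real" +
  assumes normal_increments: "\<And>s r. 0 \<le> s \<Longrightarrow> s < r \<Longrightarrow>
      distributed M lborel (\<lambda>\<omega>. B r \<omega> - B s \<omega>) (normal_density 0 (sqrt (r - s)))"
    and continuous_paths: "AE \<omega> in M. continuous_on {0..} (\<lambda>s. B s \<omega>)"

text \<open>A continuous process with the law of \<open>\<bar>B\<bar>\<close>, for \<open>B\<close> a standard Brownian motion started
  from \<open>0\<close>.  The process \<open>B\<close> may live on another probability space; since only its law matters, it
  is no restriction that this is a space of functions \<open>real \<Rightarrow> real\<close>.\<close>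

definition reflected_brownian_motion :: "'a measure \<Rightarrow> (real \<Rightarrow> 'a \<Rightarrow> real) \<Rightarrow> bool" where
  "reflected_brownian_motion M X \<longleftrightarrow>
     prob_space M \<and> (\<forall>s\<ge>0. X s \<in> borel_measurable M) \<and>
     (AE \<omega> in M. continuous_on {0..} (\<lambda>s. X s \<omega>)) \<and>
     (\<exists>(N :: (real \<Rightarrow> real) measure) B. brownian_motion N B \<and>
        distr M path_space (sample_path X) = distr N path_space (sample_path (\<lambda>s \<omega>. \<bar>B s \<omega>\<bar>)))"

locale subordinator = independent_increments M S
  for M :: "'a measure" and S :: "real \<Rightarrow> 'a \<Rightarrow> real" +
  assumes stationary_increments: "\<And>s h. 0 \<le> s \<Longrightarrow> 0 \<le> h \<Longrightarrow>
      distr M borel (\<lambda>\<omega>. S (s + h) \<omega> - S s \<omega>) = distr M borel (S h)"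
    and nondecreasing_paths: "AE \<omega> in M. mono_on {0..} (\<lambda>s. S s \<omega>)"
    and right_continuous_paths: "AE \<omega> in M. \<forall>s\<ge>0. continuous (at_right s) (\<lambda>r. S r \<omega>)"

locale stable_subordinator = subordinator M S
  for M :: "'a measure" and \<alpha> c :: real and S :: "real \<Rightarrow> 'a \<Rightarrow> real" +
  assumes index: "0 < \<alpha>" "\<alpha> < 1"
    and scale_pos: "0 < c"
    and laplace_transform: "\<And>s \<theta>. 0 < s \<Longrightarrow> 0 < \<theta> \<Longrightarrow>
      expectation (\<lambda>\<omega>. exp (- \<theta> * S s \<omega>)) = exp (- c * s * \<theta> powr \<alpha>)"

definition right_inverse :: "(real \<Rightarrow> 'a \<Rightarrow> real) \<Rightarrow> real \<Rightarrow> 'a \<Rightarrow> real" where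
  "right_inverse S s \<omega> = Inf {u. 0 \<le> u \<and> S u \<omega> > s}"

definition time_change :: "(real \<Rightarrow> 'a \<Rightarrow> real) \<Rightarrow> (real \<Rightarrow> 'a \<Rightarrow> real) \<Rightarrow> real \<Rightarrow> 'a \<Rightarrow> real" where
  "time_change X E s \<omega> = X (E s \<omega>) \<omega>"


section \<open>Ranking\<close>

text \<open>The decreasing rearrangement, with multiplicities, of the positive values among
  \<open>f i\<close> for \<open>i \<in> I\<close>, counted from \<open>n = 0\<close> and continued by \<open>0\<close> if there are only finitely many.\<close>

definition ranked :: "('i \<Rightarrow> real) \<Rightarrow> 'i set \<Rightarrow> nat \<Rightarrow> real" where
  "ranked f I n = Inf {x. 0 \<le> x \<and> finite {i\<in>I. f i > x} \<and> card {i\<in>I. f i > x} \<le> n}"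

lemma ranked_eq_enumeration:
  fixes f :: "'i \<Rightarrow> real" and e :: "nat \<Rightarrow> 'i"
  assumes bij: "bij_betw e UNIV {i\<in>I. f i > 0}" and dec: "decseq (\<lambda>n. f (e n))"
  shows "ranked f I n = f (e n)"
  unfolding ranked_def
proof (rule cInf_eq_minimum)
  have pos: "f (e k) > 0" "e k \<in> I" for k
    using bij by (auto simp: bij_betw_def)
  have sub: "{i\<in>I. f i > f (e n)} \<subseteq> e ` {..<n}"
  proof
    fix i assume i: "i \<in> {i\<in>I. f i > f (e n)}"
    then have "i \<in> {i\<in>I. f i > 0}" using pos(1)[of n] by auto
    then obtain k where k: "i = e k" using bij by (auto simp: bij_betw_def)
    have "\<not> n \<le> k" using i k decseqD[OF dec, of n k] by auto
    then show "i \<in> e ` {..<n}" using k by auto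
  qed
  have "card {i\<in>I. f i > f (e n)} \<le> card (e ` {..<n})"
    using sub by (intro card_mono) auto
  also have "\<dots> \<le> n" using card_image_le[of "{..<n}" e] by simp
  finally show "f (e n) \<in> {x. 0 \<le> x \<and> finite {i\<in>I. f i > x} \<and> card {i\<in>I. f i > x} \<le> n}"
    using pos(1)[of n] finite_subset[OF sub] by auto
next
  fix x assume x: "x \<in> {x. 0 \<le> x \<and> finite {i\<in>I. f i > x} \<and> card {i\<in>I. f i > x} \<le> n}"
  show "f (e n) \<le> x"
  proof (rule ccontr)
    assume less: "\<not> f (e n) \<le> x"
    have "e ` {..n} \<subseteq> {i\<in>I. f i > x}"
    proof
      fix i assume "i \<in> e ` {..n}"
      then obtain k where k: "k \<le> n" "i = e k" by auto
      have "e k \<in> I" using bij by (auto simp: bij_betw_def)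
      then show "i \<in> {i\<in>I. f i > x}" using k less decseqD[OF dec, of k n] by auto
    qed
    then have "card (e ` {..n}) \<le> card {i\<in>I. f i > x}" using x by (intro card_mono) auto
    moreover have "card (e ` {..n}) = Suc n"
      using bij by (subst card_image) (auto simp: bij_betw_def inj_on_def)
    ultimately show False using x by auto
  qed
qed

text \<open>Each component of a set of reals is an interval, whose Lebesgue measure is its length.\<close>

definition positivity_lengths :: "(real \<Rightarrow> 'a \<Rightarrow> real) \<Rightarrow> real \<Rightarrow> 'a \<Rightarrow> nat \<Rightarrow> real" where
  "positivity_lengths Y t \<omega> = ranked (measure lborel) (components {u \<in> {0..t}. Y u \<omega> > 0})"


section \<open>The Poisson--Dirichlet distribution\<close>

definition jump :: "(real \<Rightarrow> 'a \<Rightarrow> real) \<Rightarrow> 'a \<Rightarrow> real \<Rightarrow> real" where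
  "jump S \<omega> s = S s \<omega> - Lim (at_left s) (\<lambda>r. S r \<omega>)"

definition ranked_jumps :: "(real \<Rightarrow> 'a \<Rightarrow> real) \<Rightarrow> 'a \<Rightarrow> nat \<Rightarrow> real" where
  "ranked_jumps S \<omega> = ranked (jump S \<omega>) {0<..1}"

text \<open>Random sequences built from path properties that hold only almost surely need not be measurable
  on the exceptional null set, whence the completion.  For measurable \<open>V\<close> it has no effect
  (\<open>distr_completion\<close>).\<close>

definition sequence_law :: "'a measure \<Rightarrow> ('a \<Rightarrow> nat \<Rightarrow> real) \<Rightarrow> (nat \<Rightarrow> real) measure" where
  "sequence_law M V = distr (completion M) (\<Pi>\<^sub>M n\<in>UNIV. borel) V"

text \<open>The law \<open>PD(\<alpha>,0)\<close> of the normalised ranked jumps of an \<open>\<alpha>\<close>-stable subordinator up to time \<open>1\<close>.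
  It depends neither on the scale \<open>c\<close> nor on the choice of \<open>\<sigma>\<close>.\<close>

definition poisson_dirichlet :: "real \<Rightarrow> (nat \<Rightarrow> real) measure" where
  "poisson_dirichlet \<alpha> = (THE \<mu>. \<exists>(N :: (real \<Rightarrow> real) measure) c \<sigma>.
     stable_subordinator N \<alpha> c \<sigma> \<and>
     \<mu> = sequence_law N (\<lambda>\<omega> n. ranked_jumps \<sigma> \<omega> n / \<sigma> 1 \<omega>))"

end

theory Submission
  imports Defs "HOL-Real_Asymp.Real_Asymp"
begin

text \<open>Both sides are identified through their Laplace functionals.  A ranked sequence is determined by
  the expectations of \<open>exp (- \<Sum>\<^sub>i f (x\<^sub>i))\<close>, where \<open>f\<close> runs through the continuous functions vanishing
  near \<open>0\<close>.  On the interval side let \<open>T\<^sub>0 = 0\<close>, and let \<open>T\<^sub>k\<^sub>+\<^sub>1\<close> be the first zero of \<open>X\<close> after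
  \<open>T\<^sub>k + \<delta>\<close>.  The points \<open>S (T\<^sub>k)\<close> form a renewal process of zeros of \<open>X\<^sup>*\<close>, the zeros become dense in the
  zero set as \<open>\<delta>\<close> tends to \<open>0\<close>, and the renewal equation gives the Laplace transform in \<open>t\<close> of the
  functional.  On the side of the subordinator, size biasing by \<open>\<sigma> 1\<close> gives the same transform of the
  functional of the normalised jumps scaled by \<open>t\<close>.\<close>

section \<open>Laplace transforms and weak convergence\<close>

text \<open>Cutting the last interval at \<open>t\<close> hides the renewal structure at a fixed
  time. Integration against \<open>exp (- l * t)\<close> restores it: complete cycles give a
  geometric series, the unfinished one a primitive. The step is \<delta> = 1 / 4 ^ n because a
  Brownian path then sits at a distance of order 1 / 2 ^ n from 0, and
  \<open>2 ^ n * (1 - E exp (- \<theta> * cycle))\<close> tends to a constant times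
  \<open>\<theta> powr (\<beta> / 2)\<close>. Brownian zeros contribute the factor 1/2 of the index
  and the subordinator the factor \<beta>. So the cycle laws converge vaguely to a stable jump
  measure, and the constant cancels in the renewal quotient. To survive this limit, sums of
  \<open>f\<close> over intervals are written with \<open>f y = y * h y\<close> as integrals over
  \<open>u\<close> of \<open>h\<close> of the length of the interval around \<open>u\<close>. Since
  \<open>X\<close> is given only through its law, Brownian facts are formulated for paths at dyadic
  times and transferred by that law. The definite description in \<open>poisson_dirichlet\<close>
  requires some stable subordinator of index \<beta>/2 to exist; \<open>S\<close> at Brownian
  hitting times is one.\<close>

abbreviation (input) seq_tends_to :: "(nat => 'a::topological_space) => 'a => bool" (infix "---->" 60) where
 "f ----> l == (f \<longlongrightarrow> l) sequentially"

lemma polynomial_approx: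
 fixes g :: "real => real"
 assumes "continuous_on {0..1} g" "0 < e"
 obtains a :: "nat => real" and n :: nat where "!!y. y : {0..1} ==> \<bar>g y - (\<Sum>i\<le>n. a i * y ^ i)\<bar> < e"
proof -
 obtain p where p: "real_polynomial_function p" "!!y. y : {0..1} ==> \<bar>g y - p y\<bar> < e"
  using Stone_Weierstrass_real_polynomial_function[of "{0..1::real}" g e] assms by auto
 then show ?thesis
  using that by (auto simp: real_polynomial_function_iff_sum)
qed

lemma exp_neg_nat: "exp (- real k * x) = exp (- x) ^ k" for x :: real
 by (metis exp_of_nat_mult mult_minus_left mult_minus_right)

lemma laplace_integral_poly:
 assumes "finite_measure mu" "sets mu = sets borel" "AE x in mu. 0 <= (x::real)"
 shows "(LINT x|mu. (\<Sum>i\<le>n. a i * exp (- x) ^ i)) = (\<Sum>i\<le>n. a i * (LINT x|mu. exp (- real i * x)))"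
  and "integrable mu (%x. \<Sum>i\<le>n. a i * exp (- x) ^ i)"
proof -
 interpret finite_measure mu by fact
 note [measurable_cong] = assms(2)
 have i: "integrable mu (%x. exp (- real i * x))" for i
  using assms(3) by (intro integrable_const_bound[where B=1]) (auto elim!: eventually_mono)
 show "(LINT x|mu. (\<Sum>i\<le>n. a i * exp (- x) ^ i)) = (\<Sum>i\<le>n. a i * (LINT x|mu. exp (- real i * x)))"
  "integrable mu (%x. \<Sum>i\<le>n. a i * exp (- x) ^ i)"
  using i by (simp_all add: exp_neg_nat[symmetric] integral_mult_right)
qed

lemma laplace_poly_error:
 fixes g :: "real => real"
 assumes rh: "finite_measure rh" "sets rh = sets borel" "AE x in rh. 0 <= (x::real)"
  and g: "continuous_on {0..1} g" "g : borel_measurable borel"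
  and a: "!!y. y : {0..1} ==> \<bar>g y - (\<Sum>i\<le>n. a i * y ^ i)\<bar> < e"
 shows "\<bar>(LINT x|rh. g (exp (- x))) - (LINT x|rh. (\<Sum>i\<le>n. a i * exp (- x) ^ i))\<bar> <= e * measure rh (space rh)"
proof -
 let ?A = "%x. \<Sum>i\<le>n. a i * exp (- x) ^ i"
 interpret finite_measure rh by fact
 note [measurable_cong] = rh(2)
 note [measurable] = g(2)
 have "bounded (g ` {0..1})"
  using g by (intro compact_imp_bounded compact_continuous_image) auto
 then obtain B where B: "!!y. y : {0..1} ==> \<bar>g y\<bar> <= B" unfolding bounded_iff by fastforce
 have i: "integrable rh (%x. g (exp (- x)))"
  using rh(3) by (intro integrable_const_bound[where B=B]) (auto elim!: eventually_mono intro!: B)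
 note p = laplace_integral_poly[OF rh, of a n]
 have "\<bar>(LINT x|rh. g (exp (- x))) - (LINT x|rh. ?A x)\<bar>
  = \<bar>\<integral>x. g (exp (- x)) - (?A x) \<partial>rh\<bar>"
  using i p(2) by simp
 also have "... <= (LINT x|rh. \<bar>g (exp (- x)) - (?A x)\<bar>)"
  by (rule integral_abs_bound)
 also have "... <= (LINT x|rh. e)"
  using i p(2) rh(3) by (intro integral_mono_AE) (auto elim!: eventually_mono intro!: less_imp_le a)
 finally show ?thesis by (simp add: mult.commute)
qed

text \<open>Under y = exp (- x) integer Laplace transforms become moments of measures on [0,1],
  where polynomials are uniformly dense. The point y = 0 is the image of infinity, so continuity of
  \<open>g\<close> there takes the place of tightness.\<close>

lemma laplace_convergence:
 fixes g :: "real => real" and rh' :: "nat => real measure"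
 assumes rh': "!!n. finite_measure (rh' n)" "!!n. sets (rh' n) = sets borel" "!!n. AE x in rh' n. 0 <= x"
  and rh: "finite_measure rh" "sets rh = sets borel" "AE x in rh. 0 <= x"
  and lim: "!!k::nat. (%n. \<integral>x. exp (- real k * x) \<partial>rh' n) ----> (LINT x|rh. exp (- real k * x))"
  and g: "continuous_on {0..1} g" "g : borel_measurable borel"
 shows "(%n. \<integral>x. g (exp (- x)) \<partial>rh' n) ----> (LINT x|rh. g (exp (- x)))"
proof (rule LIMSEQ_I)
 let ?A = "%n a x. \<Sum>i\<le>n. a i * exp (- x) ^ i"
 let ?B = "\<integral>x. g (exp (- x)) \<partial>rh"
 fix r :: real assume r: "0 < r"
 define K where "K = measure rh (space rh)"
 have K: "0 <= K" by (simp add: K_def)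
 \<comment> \<open>The transform at k = 0 is the total mass, so the masses are eventually below K +
   1. This e then makes each of the two approximation errors at most r / 4.\<close>
 define e where "e = r / (4 * (1 + K))"
 have e: "0 < e" using r K by (simp add: e_def)
 have eK: "e * (1 + K) = r / 4" using K by (simp add: e_def field_simps)
 obtain a :: "nat => real" and n :: nat where a: "!!y. y : {0..1} ==> \<bar>g y - (\<Sum>i\<le>n. a i * y ^ i)\<bar> < e"
  using polynomial_approx[OF g(1) e] by blast
 have mass: "(%n. measure (rh' n) (space (rh' n))) ----> K"
  using lim[of 0] by (simp add: K_def)
 have "(%m. \<integral>x. ?A n a x \<partial>rh' m) ----> (LINT x|rh. ?A n a x)"
  unfolding laplace_integral_poly(1)[OF rh'] laplace_integral_poly(1)[OF rh]
  by (intro tendsto_intros lim)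
 then have "\<forall>\<^sub>F m in sequentially. \<bar>(LINT x|rh' m. ?A n a x) - (LINT x|rh. ?A n a x)\<bar> < r / 4"
  using tendstoD[of _ _ _ "r / 4"] r by (fastforce simp: dist_real_def)
 moreover have "\<forall>\<^sub>F m in sequentially. measure (rh' m) (space (rh' m)) < K + 1"
  using order_tendstoD(2)[OF mass, of "K + 1"] by simp
 ultimately have "\<forall>\<^sub>F m in sequentially. norm ((LINT x|rh' m. g (exp (- x))) - ?B) < r"
 proof eventually_elim
  case (elim m)
  have "e * measure (rh' m) (space (rh' m)) <= e * (1 + K)" "e * K <= e * (1 + K)"
   using elim(2) e by (auto intro!: mult_left_mono)
  then show ?case
   using elim(1) laplace_poly_error[OF rh'(1,2,3)[of m] g a] laplace_poly_error[OF rh g a] r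
   unfolding eK K_def[symmetric] real_norm_def by linarith
 qed
 then show "\<exists>no. \<forall>n\<ge>no. norm ((LINT x|rh' n. g (exp (- x))) - ?B) < r"
  by (simp add: eventually_sequentially)
qed

lemma laplace_integral_continuous:
 fixes g :: "real => real"
 assumes mu: "finite_measure mu" "sets mu = sets borel" "AE x in mu. 0 <= (x::real)"
  and nu: "finite_measure nu" "sets nu = sets borel" "AE x in nu. 0 <= (x::real)"
  and eq: "!!k::nat. (LINT x|mu. exp (- real k * x)) = (LINT x|nu. exp (- real k * x))"
  and g: "continuous_on UNIV g"
 shows "(LINT x|mu. g (exp (- x))) = (LINT x|nu. g (exp (- x)))"
proof -
 have "(%n::nat. \<integral>x. g (exp (- x)) \<partial>mu) ----> (LINT x|nu. g (exp (- x)))"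
  by (intro laplace_convergence mu nu continuous_on_subset[OF g] borel_measurable_continuous_onI[OF g])
    (simp_all only: eq tendsto_const subset_UNIV)
 then show ?thesis using LIMSEQ_unique tendsto_const by blast
qed

text \<open>For fixed \<open>a\<close> these increase with \<open>n\<close> to the indicator of
  \<open>{a<..}\<close>. They stand in for indicators wherever a continuous function vanishing up to
  \<open>a\<close> is required.\<close>

definition ramp :: "real => nat => real => real" where
 "ramp a n x = max 0 (min 1 (real n * (x - a)))"

lemma ramp_bounds: "0 <= ramp a n x" "ramp a n x <= 1"
 by (auto simp: ramp_def)

lemma ramp_zero: "x <= a ==> ramp a n x = 0"
 using mult_nonneg_nonpos[of "real n" "x - a"] by (auto simp: ramp_def)

lemma continuous_on_ramp: "continuous_on S (ramp a n)"
 unfolding ramp_def by (intro continuous_intros)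

lemma continuous_ramp [continuous_intros]: "continuous_on S f ==> continuous_on S (%x. ramp a n (f x))"
 unfolding ramp_def by (intro continuous_intros)

lemma ramp_measurable [measurable]: "ramp a n : borel_measurable borel"
 unfolding ramp_def by simp

lemma ramp_tendsto: "(%n. ramp a n x) ----> (if x > a then 1 else 0)"
proof (cases "x > a")
 case True
 then obtain k :: nat where k: "1 / (x - a) < real k" using reals_Archimedean2 by blast
 have "ramp a n x = 1" if "k <= n" for n
 proof -
  have "1 < real n * (x - a)"
   using True k that
   by (smt (verit, best) divide_less_eq of_nat_mono)
  then show ?thesis by (simp add: ramp_def)
 qed
 then have "eventually (%n. ramp a n x = 1) sequentially"
  by (auto simp: eventually_sequentially)
 then show ?thesis using True by (simp add: tendsto_eventually)
qed (simp add: ramp_zero)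

text \<open>The complement of a ramp at exp (- a), taken at exp (- x), decreases to the indicator of
  \<open>{a..}\<close>. So closed half-lines get equal mass, and open ones are increasing unions of
  closed ones.\<close>

lemma laplace_unique:
 assumes mu: "finite_measure mu" "sets mu = sets borel" "AE x in mu. 0 <= (x::real)"
  and nu: "finite_measure nu" "sets nu = sets borel" "AE x in nu. 0 <= (x::real)"
  and eq: "!!k::nat. (LINT x|mu. exp (- real k * x)) = (LINT x|nu. exp (- real k * x))"
 shows "mu = nu"
proof (rule measure_eqI_lessThan)
 let ?A = "%a rh. %n. \<integral>x. 1 - ramp (exp (- a)) n (exp (- x)) \<partial>rh"
 interpret M: finite_measure mu by fact
 interpret N: finite_measure nu by fact
 note [measurable_cong] = mu(2) nu(2)
 show "sets mu = sets borel" "sets nu = sets borel" by fact+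
 have lim: "(?A a rh) ----> measure rh {a..}"
  if rh: "finite_measure rh" "sets rh = sets borel" for rh and a :: real
 proof -
  interpret finite_measure rh by fact
  note [measurable_cong] = rh(2)
  have "(?A a rh) ----> (LINT x|rh. indicator {a..} x)"
  proof (rule integral_dominated_convergence[where w="%_. 1"])
   show "AE x in rh. (%n. 1 - ramp (exp (- a)) n (exp (- x))) ----> indicator {a..} x"
   proof (rule AE_I2)
    fix x
    show "(%n. 1 - ramp (exp (- a)) n (exp (- x))) ----> indicator {a..} x"
     using tendsto_diff[OF tendsto_const[of 1] ramp_tendsto[of "exp (- a)" "exp (- x)"]]
     by (auto simp: indicator_def split: if_splits)
   qed
  qed (auto simp: ramp_bounds)
  then show ?thesis using rh(2) by simp
 qed
 have ge: "measure mu {a..} = measure nu {a..}" for a :: real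
 proof (rule LIMSEQ_unique[OF lim[OF mu(1,2)]])
  show "(%n. \<integral>x. 1 - ramp (exp (- a)) n (exp (- x)) \<partial>mu) ----> measure nu {a..}"
   using lim[OF nu(1,2), of a]
   by (subst laplace_integral_continuous[OF mu nu eq, of "%y. 1 - ramp (exp (- a)) _ y"])
     (auto intro!: continuous_intros)
 qed
 fix a :: real
 show "emeasure mu {a<..} < \<infinity>" by (simp add: M.emeasure_eq_measure)
 have un: "{a<..} = (\<Union>n::nat. {a + 1 / real (Suc n)..})" for a :: real
 proof safe
  fix x assume "a < x"
  then obtain n where "1 / real (Suc n) < x - a" using nat_approx_posE[of "x - a"] by auto
  then show "x : (\<Union>n::nat. {a + 1 / real (Suc n)..})" by (intro UN_I[of n]) auto
 next
  fix x and n :: nat assume "a + 1 / real (Suc n) <= x"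
  moreover have "0 < 1 / real (Suc n)" by simp
  ultimately show "a < x" by linarith
 qed
 have L: "(%n. measure rh {a + 1 / real (Suc n)..}) ----> measure rh {a<..}"
  if rh: "finite_measure rh" "sets rh = sets borel" for rh
 proof -
  interpret finite_measure rh by fact
  show ?thesis unfolding un[of a]
  proof (rule finite_Lim_measure_incseq)
   show "incseq (%n. {a + 1 / real (Suc n)..})"
   proof (rule incseq_SucI)
    fix n :: nat
    have "1 / real (Suc (Suc n)) <= 1 / real (Suc n)" by (rule divide_left_mono) auto
    then show "{a + 1 / real (Suc n)..} \<subseteq> {a + 1 / real (Suc (Suc n))..}" by auto
   qed
  qed (simp add: rh(2) image_subset_iff)
 qed
 have "measure mu {a<..} = measure nu {a<..}"
  using LIMSEQ_unique[OF L[OF mu(1,2)]] L[OF nu(1,2)] by (simp add: ge)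
 then show "emeasure mu {a<..} = emeasure nu {a<..}"
  by (simp add: M.emeasure_eq_measure N.emeasure_eq_measure)
qed

lemma continuous_unique:
 assumes mu: "finite_measure mu" "sets mu = sets borel"
  and nu: "finite_measure nu" "sets nu = sets (borel :: real measure)"
  and eq: "!!g :: real => real. continuous_on UNIV g ==> (!!x. 0 <= g x & g x <= 1) ==> (LINT x|mu. g x) = (LINT x|nu. g x)"
 shows "mu = nu"
proof (rule measure_eqI_lessThan)
 interpret M: finite_measure mu by fact
 interpret N: finite_measure nu by fact
 show "sets mu = sets borel" "sets nu = sets borel" by fact+
 fix a :: real
 show "emeasure mu {a<..} < \<infinity>" by (simp add: M.emeasure_eq_measure)
 have lim: "(%n. \<integral>x. ramp a n x \<partial>rh) ----> measure rh {a<..}"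
  if rh: "finite_measure rh" "sets rh = sets borel" for rh
 proof -
  interpret finite_measure rh by fact
  note [measurable_cong] = rh(2)
  have "(%n. \<integral>x. ramp a n x \<partial>rh) ----> (LINT x|rh. indicator {a<..} x)"
  proof (rule integral_dominated_convergence[where w="%_. 1"])
   show "AE x in rh. (%n. ramp a n x) ----> indicator {a<..} x"
   proof (rule AE_I2)
    fix x show "(%n. ramp a n x) ----> indicator {a<..} x"
     using ramp_tendsto[of a x] by (auto simp: indicator_def)
   qed
  qed (auto simp: ramp_bounds)
  then show ?thesis using rh(2) by simp
 qed
 have "measure mu {a<..} = measure nu {a<..}"
 proof -
  have "(LINT x|mu. ramp a n x) = (LINT x|nu. ramp a n x)" for n
   using eq[of "ramp a n"] by (simp add: continuous_on_ramp ramp_bounds)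
  then show ?thesis using LIMSEQ_unique[OF lim[OF mu]] lim[OF nu] by simp
 qed
 then show "emeasure mu {a<..} = emeasure nu {a<..}"
  by (simp add: M.emeasure_eq_measure N.emeasure_eq_measure)
qed

section \<open>Classes of test functions that determine laws\<close>

text \<open>Values in [0,1] on \<open>S\<close> make a product of test functions the density of a
  finite measure, which is what the exchange argument for joint laws needs.\<close>

definition determining :: "(real => real) set => real set => bool" where
 "determining C S \<longleftrightarrow> C ~= {} \<and>
   (\<forall>ph\<in>C. ph : borel_measurable borel & (\<forall>x\<in>S. 0 <= ph x & ph x <= 1)) \<and>
   (\<forall>mu nu. finite_measure mu --> finite_measure nu --> sets mu = sets borel --> sets nu = sets borel \<longrightarrow>
    (AE x in mu. x : S) --> (AE x in nu. x : S) \<longrightarrow>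
    (\<forall>ph\<in>C. (LINT x|mu. ph x) = (LINT x|nu. ph x)) --> mu = nu)"

lemma determining_laplace: "determining (range (%(k::nat) x. exp (- real k * x))) {0..}"
 unfolding determining_def
 by (intro conjI ballI allI impI; (rule laplace_unique)?) (auto simp: image_iff)

lemma determining_continuous: "determining {g. continuous_on UNIV g & (\<forall>x. 0 <= g x & g x <= 1)} UNIV"
 unfolding determining_def
 by (intro conjI ballI allI impI; (rule continuous_unique)?)
   (auto simp: borel_measurable_continuous_onI intro!: exI[of _ "%_. 0"])

text \<open>This is the law of \<open>Y j\<close> under the density formed by all other factors:
  indicators for the coordinates already exchanged, test functions for those still to come. Varying
  the factor at \<open>j\<close> is then integration against one fixed finite measure.\<close>

lemma weighted_law:
 fixes M :: "'z measure" and C :: "(real => real) set" and Y :: "'i => 'z => real"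
 assumes det: "determining C S" and S: "S : sets borel" and M: "prob_space M" and fin: "finite L"
  and Ym: "!!i. i : insert j (K \<union> L) ==> Y i : borel_measurable M"
  and Y: "!!i. i : insert j L ==> AE x in M. Y i x : S"
  and ph: "!!i. ph i : C" and A: "!!i. i : K ==> A i : sets borel"
 obtains mu where "finite_measure mu" "sets mu = sets borel" "AE x in mu. x : S"
  "!!ps. ps : borel_measurable borel ==> (LINT x|mu. ps x) =
   (LINT x|M. ps (Y j x) * ((\<Prod>i\<in>K. indicator (A i) (Y i x)) * (\<Prod>i\<in>L. ph i (Y i x))))"
proof -
 let ?A = "%x. \<Prod>i\<in>L. ph i (Y i x)"
 let ?B = "%x. \<Prod>i\<in>K. indicator (A i) (Y i x) :: real"
 interpret prob_space M by fact
 have C: "ph i : borel_measurable borel" "!!x. x : S ==> 0 <= ph i x & ph i x <= 1" for i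
  using det ph by (auto simp: determining_def)
 let ?w = "%x. (\<Prod>i\<in>K. indicator (A i) (Y i x)) * (?A x) :: real"
 have wm [measurable]: "?w : borel_measurable M"
  using Ym A by (intro borel_measurable_times borel_measurable_prod measurable_compose[OF Ym C(1)] measurable_compose[OF Ym borel_measurable_indicator]) auto
 have "AE x in M. \<forall>i\<in>L. Y i x : S" using Y fin by (intro AE_finite_allI) auto
 then have w: "AE x in M. 0 <= ?w x & ?w x <= 1"
 proof eventually_elim
  case (elim x)
  have "0 <= ?B x" "?B x <= 1"
   by (auto intro!: prod_nonneg prod_le_1)
  moreover have "0 <= ?A x" "?A x <= 1"
   using C(2) elim by (auto intro!: prod_nonneg prod_le_1)
  ultimately show ?case by (auto intro!: mult_le_one)
 qed
 have [measurable]: "Y j : borel_measurable M" using Ym by auto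
 define mu where "mu = distr (density M (%x. ennreal (?w x))) borel (Y j)"
 show ?thesis
 proof
  have "emeasure mu (space mu) = (\<integral>\<^sup>+x. ennreal (?w x) \<partial>M)"
   using wm by (simp add: mu_def emeasure_distr emeasure_density cong: nn_integral_cong)
  also have "... <= (\<integral>\<^sup>+x. 1 \<partial>M)"
   using w by (intro nn_integral_mono_AE) (auto elim!: eventually_mono)
  also have "... < \<infinity>" by (simp add: emeasure_space_1)
  finally show "finite_measure mu" by (intro finite_measureI) auto
  show "sets mu = sets borel" by (simp add: mu_def)
  have "AE x in density M (%x. ennreal (?w x)). Y j x : S"
   using Y[of j] wm by (subst AE_density) (auto elim!: eventually_mono)
  then show "AE x in mu. x : S" unfolding mu_def
   using S by (subst AE_distr_iff) auto
  fix ps :: "real => real" assume [measurable]: "ps : borel_measurable borel"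
  show "(LINT x|mu. ps x) = (LINT x|M. ps (Y j x) * ?w x)"
   unfolding mu_def using w wm
   by (subst integral_distr, simp, simp, subst integral_density) (auto simp: ac_simps elim!: eventually_mono)
 qed
qed

lemma measure_all_in:
 fixes Z :: "'i => 'z => real"
 assumes "finite J"
 shows "measure P {x\<in>space P. \<forall>i\<in>J. Z i x : A i} = (LINT x|P. (\<Prod>i\<in>J. indicator (A i) (Z i x)))"
proof -
 have "(\<Prod>i\<in>J. indicator (A i) (z i)) = (if \<forall>i\<in>J. z i : A i then 1 else (0::real))" for z
  using assms by (induction J rule: finite_induct) auto
 then have "(LINT x|P. (\<Prod>i\<in>J. indicator (A i) (Z i x))) = (\<integral>x. indicator {x\<in>space P. \<forall>i\<in>J. Z i x : A i} x \<partial>P :: real)"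
  by (intro Bochner_Integration.integral_cong) (auto simp: indicator_def)
 also have "... = measure P ({x\<in>space P. \<forall>i\<in>J. Z i x : A i} \<inter> space P)"
  by (rule Bochner_Integration.integral_indicator)
 also have "{x\<in>space P. \<forall>i\<in>J. Z i x : A i} \<inter> space P = {x\<in>space P. \<forall>i\<in>J. Z i x : A i}" by blast
 finally show ?thesis ..
qed

text \<open>A joint law is recovered from product test functions by replacing one test function at a time
 by an indicator.\<close>

lemma determining_joint:
 fixes X :: "'i => 'a => real" and Y :: "'i => 'b => real"
 assumes det: "determining C S" and S: "S : sets borel" and M: "prob_space M" and N: "prob_space N"
  and Xm: "!!i. i : J ==> X i : borel_measurable M" and Ym: "!!i. i : J ==> Y i : borel_measurable N"
  and X: "!!i. i : J ==> AE x in M. X i x : S" and Y: "!!i. i : J ==> AE x in N. Y i x : S"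
  and eq: "!!ph. (!!i. ph i : C) ==> (LINT x|M. (\<Prod>i\<in>J. ph i (X i x))) = (LINT x|N. (\<Prod>i\<in>J. ph i (Y i x)))"
  and J: "finite J" and A: "!!i. i : J ==> A i : sets borel"
 shows "measure M {x\<in>space M. \<forall>i\<in>J. X i x : A i} = measure N {x\<in>space N. \<forall>i\<in>J. Y i x : A i}"
proof -
 let ?L = "%K ph z. (\<Prod>i\<in>K. indicator (A i) (z i)) * (\<Prod>i\<in>J - K. ph i (z i)) :: real"
 have key: "(LINT x|M. ?L K ph (%i. X i x)) = (LINT x|N. ?L K ph (%i. Y i x))"
  if "K \<subseteq> J" "!!i. ph i : C" for K ph
  using finite_subset[OF that(1) J] that
 proof (induction K arbitrary: ph rule: finite_induct)
  case empty
  then show ?case using eq[of ph] by simp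
 next
  case (insert j K)
  let ?w = "%z. (\<Prod>i\<in>K. indicator (A i) (z i)) * (\<Prod>i\<in>J - insert j K. ph i (z i)) :: real"
  have sub: "i : J" if "i : insert j (K \<union> (J - insert j K))" for i using that insert.prems(1) by auto
  have sub': "i : J" if "i : insert j (J - insert j K)" for i using that insert.prems(1) by auto
  have L: "finite (J - insert j K)" using J by simp
  have AK: "A i : sets borel" if "i : K" for i using A that insert.prems(1) by auto
  obtain mu where mu: "finite_measure mu" "sets mu = sets borel" "AE x in mu. x : S"
   "!!ps. ps : borel_measurable borel ==> (LINT x|mu. ps x) = (LINT x|M. ps (X j x) * ?w (%i. X i x))"
   using weighted_law[where Y=X and j=j and K=K and ph=ph and A=A, OF det S M L Xm[OF sub] X[OF sub'] insert.prems(2) AK] by blast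
  obtain nu where nu: "finite_measure nu" "sets nu = sets borel" "AE x in nu. x : S"
   "!!ps. ps : borel_measurable borel ==> (LINT x|nu. ps x) = (LINT x|N. ps (Y j x) * ?w (%i. Y i x))"
   using weighted_law[where Y=Y and j=j and K=K and ph=ph and A=A, OF det S N L Ym[OF sub] Y[OF sub'] insert.prems(2) AK] by blast
  \<comment> \<open>With \<open>ps\<close> as the j-th test function the induction hypothesis for
    \<open>K\<close> is exactly equality of these integrals. The two measures therefore agree, and
    an indicator may be put at \<open>j\<close>.\<close>
  have "(LINT x|mu. ps x) = (LINT x|nu. ps x)" if ps: "ps : C" for ps
  proof -
   have e: "J - K = insert j (J - insert j K)" using insert by auto
   have "(\<Prod>i\<in>J - K. (ph(j := ps)) i (z i)) = ps (z j) * (\<Prod>i\<in>J - insert j K. (ph(j := ps)) i (z i))" for z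
    by (subst e) (use L in simp)
   moreover have "(\<Prod>i\<in>J - insert j K. (ph(j := ps)) i (z i)) = (\<Prod>i\<in>J - insert j K. ph i (z i))" for z
    by (rule prod.cong) auto
   ultimately have s: "?L K (ph(j := ps)) z = ps (z j) * ?w z" for z by (simp only: mult.left_commute)
   have "(ph(j := ps)) i : C" for i using insert.prems(2) ps by simp
   from insert.IH[of "ph(j := ps)", OF _ this] insert.prems(1) show ?thesis
    using det ps unfolding s by (simp add: mu(4) nu(4) determining_def)
  qed
  then have "mu = nu" using det mu(1-3) nu(1-3) by (auto simp: determining_def)
  then have "(LINT x|mu. indicator (A j) x) = (\<integral>x. indicator (A j) x \<partial>nu :: real)" by simp
  moreover have "?L (insert j K) ph z = indicator (A j) (z j) * ?w z" for z using insert.hyps by (simp add: mult.assoc)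
  moreover have "A j : sets borel" using A insert.prems(1) by simp
  ultimately show ?case by (simp only: mu(4) nu(4) borel_measurable_indicator)
 qed
 obtain ph0 where "ph0 : C" using det by (auto simp: determining_def)
 with key[of J "%_. ph0"] show ?thesis by (simp add: measure_all_in[OF J])
qed

lemma determining_law:
 fixes X :: "'i => 'a => real" and Y :: "'i => 'b => real"
 assumes det: "determining C S" and S: "S : sets borel" and M: "prob_space M" and N: "prob_space N"
  and X: "!!i. i : I ==> X i : borel_measurable M" and Y: "!!i. i : I ==> Y i : borel_measurable N"
  and eq: "!!J ph. finite J ==> J \<subseteq> I ==> (!!i. ph i : C) ==> (LINT x|M. (\<Prod>i\<in>J. ph i (X i x))) = (LINT x|N. (\<Prod>i\<in>J. ph i (Y i x)))"
  and XS: "!!i. i : I ==> AE x in M. X i x : S" and YS: "!!i. i : I ==> AE x in N. Y i x : S"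
 shows "distr M (\<Pi>\<^sub>M i\<in>I. borel) (%x. \<lambda>i\<in>I. X i x) = distr N (\<Pi>\<^sub>M i\<in>I. borel) (%x. \<lambda>i\<in>I. Y i x)"
proof (rule measure_eqI_PiM_infinite[where I=I and M="%_. borel"])
 let ?A = "\<Pi>\<^sub>M i\<in>I. borel"
 let ?B = "%x. \<lambda>i\<in>I. X i x"
 let ?C = "%x. \<lambda>i\<in>I. Y i x"
 interpret M: prob_space M by fact
 interpret N: prob_space N by fact
 have Xm: "?B : M \<rightarrow>\<^sub>M ?A" using X by (rule measurable_restrict)
 have Ym: "?C : N \<rightarrow>\<^sub>M ?A" using Y by (rule measurable_restrict)
 show "finite_measure (distr M ?A ?B)"
  using M.prob_space_distr[OF Xm] by (rule prob_space.finite_measure)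
 fix J and A :: "'i => real set" assume J: "finite J" "J \<subseteq> I" and A: "!!i. i : J ==> A i : sets borel"
 let ?E = "prod_emb I (%_. borel) J (Pi\<^sub>E J A) :: ('i => real) set"
 have E: "?E : sets (\<Pi>\<^sub>M i\<in>I. borel :: real measure)" using J A by (intro sets_PiM_I) auto
 have v: "?B -` ?E \<inter> space M = {x\<in>space M. \<forall>i\<in>J. X i x : A i}"
  "?C -` ?E \<inter> space N = {x\<in>space N. \<forall>i\<in>J. Y i x : A i}"
  using J(2) by (auto simp: prod_emb_def PiE_iff subset_iff extensional_def restrict_def)
 have "measure M {x\<in>space M. \<forall>i\<in>J. X i x : A i} = measure N {x\<in>space N. \<forall>i\<in>J. Y i x : A i}"
  by (rule determining_joint[OF det S M N]) (use J X Y XS YS eq A in auto)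
 then show "emeasure (distr M ?A ?B) ?E = emeasure (distr N ?A ?C) ?E"
  using E Xm Ym v by (simp add: emeasure_distr M.emeasure_eq_measure N.emeasure_eq_measure)
qed auto

section \<open>Stable jump measures and vague convergence to them\<close>

text \<open>Up to a constant factor, the jump measure of an \<alpha>-stable subordinator.\<close>

definition levy :: "real => real measure" where
 "levy \<alpha> = density lborel (%x. ennreal (indicator {0<..} x * x powr (- 1 - \<alpha>)))"

lemma sets_levy [simp, measurable_cong]: "sets (levy \<alpha>) = sets borel"
 by (simp add: levy_def)

lemma space_levy [simp]: "space (levy \<alpha>) = UNIV"
 by (simp add: levy_def)

lemma nn_integral_levy:
 assumes [measurable]: "F : borel_measurable borel"
 shows "(\<integral>\<^sup>+x. F x \<partial>levy \<alpha>) = (\<integral>\<^sup>+x. ennreal (indicator {0<..} x * x powr (- 1 - \<alpha>)) * F x \<partial>lborel)"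
 unfolding levy_def by (subst nn_integral_density) auto

lemma AE_levy_pos: "AE x in levy \<alpha>. 0 < x"
 unfolding levy_def by (subst AE_density) (auto simp: indicator_def)

lemma nn_integral_levy_scale:
 assumes [measurable]: "F : borel_measurable borel" and r: "0 < r"
 shows "(\<integral>\<^sup>+x. F (r * x) \<partial>levy \<alpha>) = ennreal (r powr \<alpha>) * (\<integral>\<^sup>+x. F x \<partial>levy \<alpha>)"
proof -
 let ?A = "%x. indicator {0<..} x * x powr (- 1 - \<alpha>)"
 let ?B = "\<integral>\<^sup>+x. F (r * x) \<partial>levy \<alpha>"
 let ?C = "\<integral>\<^sup>+x. F x \<partial>levy \<alpha>"
 let ?D = "%x. indicator {0<..} (r * x) * (r * x) powr (- 1 - \<alpha>)"
 have "?C = (\<integral>\<^sup>+x. ennreal (?A x) * F x \<partial>lborel)"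
  by (rule nn_integral_levy) simp
 also have "... = ennreal r * (\<integral>\<^sup>+x. ennreal (?D x) * F (r * x) \<partial>lborel)"
  using r by (subst nn_integral_real_affine[where c=r and t=0]) auto
 also have "... = ennreal r * (\<integral>\<^sup>+x. ennreal (r powr (- 1 - \<alpha>)) * (ennreal (?A x) * F (r * x)) \<partial>lborel)"
 proof -
  have "ennreal (?D x) * F (r * x) =
   ennreal (r powr (- 1 - \<alpha>)) * (ennreal (?A x) * F (r * x))" for x
   using r by (cases "0 < x") (simp_all add: powr_mult ennreal_mult' mult.assoc zero_less_mult_iff)
  then show ?thesis by simp
 qed
 also have "... = ennreal r * ennreal (r powr (- 1 - \<alpha>)) * ?B"
  by (subst nn_integral_cmult) (auto simp: nn_integral_levy mult.assoc)
 also have "ennreal r * ennreal (r powr (- 1 - \<alpha>)) = ennreal (r powr (- \<alpha>))"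
  using r by (simp add: ennreal_mult'[symmetric] powr_diff powr_minus field_simps)
 finally have "ennreal (r powr \<alpha>) * ?C = ennreal (r powr \<alpha>) * ennreal (r powr (- \<alpha>)) * ?B"
  by (simp add: mult.assoc)
 also have "ennreal (r powr \<alpha>) * ennreal (r powr (- \<alpha>)) = 1"
  using r by (simp add: ennreal_mult'[symmetric] powr_minus)
 finally show ?thesis by simp
qed

lemma nn_integral_powr_tail:
 assumes "0 < \<alpha>" "0 < v"
 shows "(\<integral>\<^sup>+x. ennreal (indicator {v..} x * x powr (- 1 - \<alpha>)) \<partial>lborel) = ennreal (v powr (- \<alpha>) / \<alpha>)"
proof -
 have "((%x. x powr (- 1 - \<alpha>)) has_integral (v powr (- \<alpha>) / \<alpha>)) {v..}"
  using has_integral_powr_to_inf[of "- 1 - \<alpha>" v] assms by simp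
 from nn_integral_has_integral_lebesgue[OF _ this]
 show ?thesis by simp
qed

lemma nn_integral_powr_head:
 assumes "\<alpha> < 1" "0 < v"
 shows "(\<integral>\<^sup>+x. ennreal (indicator {0..v} x * x powr (- \<alpha>)) \<partial>lborel) = ennreal (v powr (1 - \<alpha>) / (1 - \<alpha>))"
proof -
 have "((%x. x powr (- \<alpha>)) has_integral (v powr (1 - \<alpha>) / (1 - \<alpha>))) {0..v}"
  using has_integral_powr_from_0[of "- \<alpha>" v] assms by simp
 from nn_integral_has_integral_lebesgue[OF _ this]
 show ?thesis by simp
qed

text \<open>Integration by parts in the form of Fubini: the mass that \<open>levy \<alpha>\<close>
  gives to \<open>{v..}\<close> is \<open>v powr (- \<alpha>) / \<alpha>\<close>.\<close>

lemma nn_integral_levy_primitive: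
 assumes [measurable]: "k : borel_measurable borel" and \<alpha>: "0 < \<alpha>"
 shows "(\<integral>\<^sup>+x. (\<integral>\<^sup>+v. indicator {0<..x} v * k v \<partial>lborel) \<partial>levy \<alpha>) =
  ennreal (1 / \<alpha>) * (\<integral>\<^sup>+v. ennreal (indicator {0<..} v * v powr (- \<alpha>)) * k v \<partial>lborel)"
proof -
 let ?A = "%v. \<integral>\<^sup>+x. ennreal (indicator {0<..} x * x powr (- 1 - \<alpha>)) * (indicator {0<..x} v * k v) \<partial>lborel"
 let ?B = "%v. indicator {0<..} v * v powr (- \<alpha>)"
 have [measurable]: "(%x. \<integral>\<^sup>+v. indicator {0<..x} v * k v \<partial>lborel) : borel_measurable borel"
  by (rule lborel.borel_measurable_nn_integral) (simp add: indicator_def, measurable)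
 have "(\<integral>\<^sup>+x. (\<integral>\<^sup>+v. indicator {0<..x} v * k v \<partial>lborel) \<partial>levy \<alpha>) =
  (\<integral>\<^sup>+x. (\<integral>\<^sup>+v. ennreal (indicator {0<..} x * x powr (- 1 - \<alpha>)) * (indicator {0<..x} v * k v) \<partial>lborel) \<partial>lborel)"
  by (subst nn_integral_levy) (auto simp: nn_integral_cmult)
 also have "... = (\<integral>\<^sup>+v. ?A v \<partial>lborel)"
  by (rule lborel_pair.Fubini') (simp add: indicator_def split_beta', measurable)
 also have "... = (\<integral>\<^sup>+v. ennreal (1 / \<alpha>) * (ennreal (?B v) * k v) \<partial>lborel)"
 proof (rule nn_integral_cong)
  fix v :: real
  have "?A v =
   (\<integral>\<^sup>+x. ennreal (indicator {v..} x * x powr (- 1 - \<alpha>)) * (indicator {0<..} v * k v) \<partial>lborel)"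
   by (intro nn_integral_cong) (auto simp: indicator_def)
  also have "... = (\<integral>\<^sup>+x. ennreal (indicator {v..} x * x powr (- 1 - \<alpha>)) \<partial>lborel) * (indicator {0<..} v * k v)"
   by (rule nn_integral_multc) auto
  also have "... = ennreal (1 / \<alpha>) * (ennreal (?B v) * k v)"
  proof (cases "0 < v")
   case True
   then show ?thesis using \<alpha>
    by (simp add: nn_integral_powr_tail ennreal_mult'[symmetric] flip: mult.assoc)
  qed simp
  finally show "?A v = ennreal (1 / \<alpha>) * (ennreal (?B v) * k v)" .
 qed
 also have "... = ennreal (1 / \<alpha>) * (\<integral>\<^sup>+v. ennreal (?B v) * k v \<partial>lborel)"
  by (rule nn_integral_cmult) auto
 finally show ?thesis .
qed

text \<open>The integrand is at most x near 0 and at most 1 far out; the head converges because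
  \<alpha> < 1 and the tail because \<alpha> > 0.\<close>

lemma integrable_levy_one_minus_exp:
 assumes "0 < \<alpha>" "\<alpha> < 1"
 shows "integrable (levy \<alpha>) (%x. 1 - exp (- x))"
proof (rule integrableI_nonneg)
 let ?A = "\<integral>\<^sup>+x. ennreal (1 - exp (- x)) \<partial>levy \<alpha>"
 show "AE x in levy \<alpha>. 0 <= 1 - exp (- x)"
  using AE_levy_pos by eventually_elim simp
 have "?A =
   (\<integral>\<^sup>+x. ennreal (indicator {0<..} x * x powr (- 1 - \<alpha>)) * ennreal (1 - exp (- x)) \<partial>lborel)"
  by (rule nn_integral_levy) simp
 also have "... <= (\<integral>\<^sup>+x. ennreal (indicator {0..1} x * x powr (- \<alpha>)) + ennreal (indicator {1..} x * x powr (- 1 - \<alpha>)) \<partial>lborel)"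
 proof (rule nn_integral_mono)
  fix x :: real
  have "1 - exp (- x) <= x" using exp_ge_add_one_self[of "- x"] by simp
  then have "x powr (- 1 - \<alpha>) * (1 - exp (- x)) <= x powr (- 1 - \<alpha>) * x" if "0 < x"
   using that by (intro mult_left_mono) auto
  moreover have "x powr (- 1 - \<alpha>) * x = x powr (- \<alpha>)" if "0 < x"
   using that by (simp add: powr_diff powr_minus field_simps)
  moreover have "x powr (- 1 - \<alpha>) * (1 - exp (- x)) <= x powr (- 1 - \<alpha>) * 1" if "0 < x"
   using that by (intro mult_left_mono) auto
  moreover have "- 1 <= exp (- 1 :: real)" by (rule order_trans[of _ 0]) auto
  ultimately show "ennreal (indicator {0<..} x * x powr (- 1 - \<alpha>)) * ennreal (1 - exp (- x)) \<le>
   ennreal (indicator {0..1} x * x powr (- \<alpha>)) + ennreal (indicator {1..} x * x powr (- 1 - \<alpha>))"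
   by (cases "0 < x"; cases "x <= 1")
    (auto simp: indicator_def ennreal_mult'[symmetric] ennreal_plus[symmetric] simp del: ennreal_plus intro!: ennreal_leI order_trans[of _ "x powr (- \<alpha>)" "x powr (- \<alpha>) + _"])
 qed
 also have "... = ennreal (1 / (1 - \<alpha>)) + ennreal (1 / \<alpha>)"
  using assms nn_integral_powr_tail[of \<alpha> 1] nn_integral_powr_head[of \<alpha> 1]
  by (subst nn_integral_add) auto
 also have "... < \<infinity>" by (simp add: less_top)
 finally show "?A < \<infinity>" .
qed simp

text \<open>Equal to Gamma (1 - \<alpha>) / \<alpha>. A subordinator with Laplace exponent
  \<open>c * th powr \<alpha>\<close> has the jump measure \<open>c / levy_const \<alpha>\<close>
  times \<open>levy \<alpha>\<close>.\<close>

definition levy_const :: "real => real" where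
 "levy_const \<alpha> = (LINT x|levy \<alpha>. 1 - exp (- x))"

lemma levy_const_pos:
 assumes "0 < \<alpha>" "\<alpha> < 1"
 shows "0 < levy_const \<alpha>"
proof -
 have nn: "AE x in levy \<alpha>. 0 <= 1 - exp (- x)"
  using AE_levy_pos by eventually_elim simp
 then have "0 <= levy_const \<alpha>" unfolding levy_const_def by (rule integral_nonneg_AE)
 moreover have "levy_const \<alpha> ~= 0"
 proof
  assume "levy_const \<alpha> = 0"
  then have "AE x in levy \<alpha>. 1 - exp (- x) = 0"
   using integral_nonneg_eq_0_iff_AE[OF integrable_levy_one_minus_exp[OF assms] nn] by (simp add: levy_const_def)
  then have "AE x in levy \<alpha>. False"
   using AE_levy_pos by eventually_elim auto
  then have "AE x in lborel. x <= (0::real)"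
   unfolding levy_def
  proof (subst (asm) AE_density)
   assume "AE x in lborel. 0 < ennreal (indicator {0<..} x * x powr (- 1 - \<alpha>)) --> False"
   then show ?thesis
   proof eventually_elim
    case (elim x)
    then show ?case by (cases "0 < x") auto
   qed
  qed simp
  then have "AE x in lborel. x \<notin> {0<..<1::real}" by eventually_elim auto
  then have "{0<..<1::real} : null_sets lborel" by (subst AE_iff_null_sets) auto
  then show False by (auto simp: null_sets_def)
 qed
 ultimately show ?thesis by simp
qed

lemma nn_integral_levy_exp:
 assumes "0 < \<alpha>" "\<alpha> < 1" "0 <= th"
 shows "(\<integral>\<^sup>+x. ennreal (1 - exp (- th * x)) \<partial>levy \<alpha>) = ennreal (th powr \<alpha> * levy_const \<alpha>)"
proof (cases "th = 0")
 case False
 have nn: "AE x in levy \<alpha>. 0 <= 1 - exp (- x)"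
  using AE_levy_pos by eventually_elim simp
 have "(\<integral>\<^sup>+x. ennreal (1 - exp (- x)) \<partial>levy \<alpha>) = ennreal (levy_const \<alpha>)"
  unfolding levy_const_def by (rule nn_integral_eq_integral[OF integrable_levy_one_minus_exp nn]) fact+
 then show ?thesis
  using nn_integral_levy_scale[of "%x. ennreal (1 - exp (- x))" th \<alpha>] False assms
  by (simp add: ennreal_mult')
qed (use assms in simp)

lemma integral_levy_exp:
 assumes "0 < \<alpha>" "\<alpha> < 1" "0 <= th"
 shows "integrable (levy \<alpha>) (%x. 1 - exp (- th * x))"
  "(LINT x|levy \<alpha>. 1 - exp (- th * x)) = th powr \<alpha> * levy_const \<alpha>"
proof -
 have nn: "AE x in levy \<alpha>. 0 <= 1 - exp (- th * x)"
  using AE_levy_pos by eventually_elim (use assms(3) in simp)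
 then show i: "integrable (levy \<alpha>) (%x. 1 - exp (- th * x))"
  by (intro integrableI_nonneg) (simp_all only: nn_integral_levy_exp[OF assms] ennreal_less_top infinity_ennreal_def, simp)
 show "(LINT x|levy \<alpha>. 1 - exp (- th * x)) = th powr \<alpha> * levy_const \<alpha>"
  using nn_integral_eq_integral[OF i nn] levy_const_pos[OF assms(1,2)] integral_nonneg_AE[OF nn]
  unfolding nn_integral_levy_exp[OF assms] by (subst (asm) ennreal_inj) auto
qed


text \<open>Jump measures may be infinite near 0. The weight 1 - exp (- x) makes them finite, and
  the integer Laplace transforms of the weighted measure are differences of consecutive values of
  the Laplace exponent.\<close>

lemma density_one_minus_exp:
 fixes nu :: "real measure" and w :: real
 assumes s [measurable_cong]: "sets nu = sets borel" and pos: "AE x in nu. 0 <= x" and w: "0 <= w"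
  and int: "!!k::nat. integrable nu (%x. 1 - exp (- real k * x))"
 defines "D \<equiv> density nu (%x. ennreal (w * (1 - exp (- x))))"
 shows "finite_measure D" "sets D = sets borel" "AE x in D. 0 <= x"
  and "!!ps. ps : borel_measurable borel ==> (LINT x|D. ps x) = w * (LINT x|nu. (1 - exp (- x)) * ps x)"
  and "!!k::nat. (LINT x|D. exp (- real k * x)) =
   w * ((LINT x|nu. 1 - exp (- real (Suc k) * x)) - (LINT x|nu. 1 - exp (- real k * x)))"
proof -
 have nn: "AE x in nu. 0 <= w * (1 - exp (- x))"
  using pos by eventually_elim (use w in simp)
 have i1: "integrable nu (%x. w * (1 - exp (- x)))" using int[of 1] by simp
 have "emeasure D (space D) = (\<integral>\<^sup>+x. ennreal (w * (1 - exp (- x))) \<partial>nu)"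
  by (simp add: D_def emeasure_density cong: nn_integral_cong)
 also have "... = ennreal (LINT x|nu. w * (1 - exp (- x)))"
  by (rule nn_integral_eq_integral[OF i1 nn])
 finally show "finite_measure D" by (intro finite_measureI) simp
 show "sets D = sets borel" by (simp add: D_def s)
 show "AE x in D. 0 <= x" unfolding D_def
  using pos by (subst AE_density) (auto elim!: eventually_mono)
 show D: "(LINT x|D. ps x) = w * (LINT x|nu. (1 - exp (- x)) * ps x)" if [measurable]: "ps : borel_measurable borel" for ps
  unfolding D_def by (subst integral_density) (auto simp: nn mult.assoc)
 show "(LINT x|D. exp (- real k * x)) =
   w * ((LINT x|nu. 1 - exp (- real (Suc k) * x)) - (LINT x|nu. 1 - exp (- real k * x)))" for k
 proof -
  have "(LINT x|D. exp (- real k * x)) = w * (LINT x|nu. (1 - exp (- real (Suc k) * x)) - (1 - exp (- real k * x)))"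
   by (subst D) (auto simp: algebra_simps exp_diff exp_minus exp_add divide_inverse intro!: arg_cong2[where f="(*)"] Bochner_Integration.integral_cong)
  then show ?thesis unfolding Bochner_Integration.integral_diff[OF int int] .
 qed
qed

text \<open>Dividing by the weight 1 - exp (- x) leaves a function of y = exp (- x). Its limits for
  x tending to infinity and to 0 supply the values at y = 0 and y = 1 and make it continuous on the
  whole compact interval.\<close>

lemma ratio_function:
 fixes H :: "real => real"
 assumes [measurable]: "H : borel_measurable borel" and c: "continuous_on {0<..} H" and H0: "H 0 = 0"
  and L0: "((%x. H x / (1 - exp (- x))) \<longlongrightarrow> L0) (at_right 0)"
  and L1: "((%x. H x / (1 - exp (- x))) \<longlongrightarrow> L1) at_top"
 obtains g where "continuous_on {0..1} g" "g : borel_measurable borel"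
  "!!x. 0 <= x ==> H x = (1 - exp (- x)) * g (exp (- x))"
proof
 let ?A = "%y. H (- ln y) / (1 - exp (- (- ln y)))"
 let ?B = "%y::real. 0 < y & y < 1"
 let ?C = "%g. %y. H (- ln y) / (1 - exp (- (- ln y))) = g y"
 let ?D = "%y. H (- ln y) / (1 - y)"
 define g where "g y = (if y <= 0 then L1 else if 1 <= y then L0 else H (- ln y) / (1 - y))" for y
 show "g : borel_measurable borel" unfolding g_def by measurable
 show "H x = (1 - exp (- x)) * g (exp (- x))" if "0 <= x" for x
  using that H0 by (cases "x = 0") (auto simp: g_def not_le)
 show "continuous_on {0..1} g"
 proof (rule continuous_on_IccI)
  have "filterlim (%y::real. - ln y) at_top (at_right 0)"
   by real_asymp
  from filterlim_compose[OF L1 this]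
  have "(?A \<longlongrightarrow> L1) (at_right 0)" .
  moreover have "eventually ?B (at_right 0)"
   by (auto simp: eventually_at_right_field intro!: exI[of _ 1])
  then have "eventually (?C g) (at_right 0)"
   by eventually_elim (simp add: g_def)
  moreover have "g 0 = L1" by (simp add: g_def)
  ultimately show "(g \<longlongrightarrow> g 0) (at_right 0)"
   by (metis Lim_transform_eventually)
  have "filterlim (%y::real. - ln y) (at_right 0) (at_left 1)"
   by real_asymp
  from filterlim_compose[OF L0 this]
  have "(?A \<longlongrightarrow> L0) (at_left 1)" .
  moreover have "eventually ?B (at_left 1)"
   by (auto simp: eventually_at_left_field intro!: exI[of _ 0])
  then have "eventually (?C g) (at_left 1)"
   by eventually_elim (simp add: g_def)
  moreover have "g 1 = L0" by (simp add: g_def)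
  ultimately show "(g \<longlongrightarrow> g 1) (at_left 1)"
   by (metis Lim_transform_eventually)
  fix y :: real assume y: "0 < y" "y < 1"
  have "isCont H (- ln y)"
   using c y by (auto simp: continuous_on_eq_continuous_at)
  moreover have "isCont (%y. - ln y) y" using y by (intro continuous_intros) simp
  ultimately have "isCont (%y. H (- ln y)) y" by (rule isCont_o2[rotated])
  moreover have "isCont (%y. 1 - y) y" by (intro continuous_intros)
  ultimately have "isCont ?D y"
   using y by (intro isCont_divide) auto
  then have "(?D \<longlongrightarrow> g y) (at y)"
   using y by (simp add: isCont_def g_def)
  moreover have "eventually (%y. y : {0<..<1}) (at y)"
   using y by (intro eventually_at_in_open') auto
  then have "eventually (%y. H (- ln y) / (1 - y) = g y) (at y)"
   by eventually_elim (simp add: g_def)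
  ultimately show "(g \<longlongrightarrow> g y) (at y)"
   by (metis Lim_transform_eventually)
 qed simp
qed

text \<open>A limit theorem for infinitesimal laws. After weighting by 1 - exp (- x) both sides are
  finite measures, and convergence of the integer Laplace exponents becomes convergence of their
  moments in exp (- x). The factor \<open>C / levy_const \<alpha>\<close> is the one that gives the
  limit measure the exponent \<open>C * k powr \<alpha>\<close>.\<close>

lemma vague_limit:
 fixes nu :: "nat => real measure" and H :: "real => real"
 assumes \<alpha>: "0 < \<alpha>" "\<alpha> < 1"
  and nu: "!!n. finite_measure (nu n)" "!!n. sets (nu n) = sets borel" "!!n. AE x in nu n. 0 <= x"
  and a: "!!n. 0 <= a n" and C: "0 < C"
  and lim: "!!k::nat. (%n. a n * (LINT x|nu n. 1 - exp (- real k * x))) ----> C * real k powr \<alpha>"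
  and H: "H : borel_measurable borel" "continuous_on {0<..} H" "H 0 = 0"
  and L: "((%x. H x / (1 - exp (- x))) \<longlongrightarrow> L0) (at_right 0)"
   "((%x. H x / (1 - exp (- x))) \<longlongrightarrow> L1) at_top"
 shows "(%n. a n * (LINT x|nu n. H x)) ----> C / levy_const \<alpha> * (LINT x|levy \<alpha>. H x)"
proof -
 let ?A = "\<integral>x. H x \<partial>levy \<alpha>"
 let ?B = "%k. real (Suc k) powr \<alpha> - real k powr \<alpha>"
 obtain g where g: "continuous_on {0..1} g" "g : borel_measurable borel"
  and Hg: "!!x. 0 <= x ==> H x = (1 - exp (- x)) * g (exp (- x))"
  using ratio_function[OF H L] by blast
 have gm: "(%x. g (exp (- x))) : borel_measurable borel"
  by (rule measurable_compose[OF _ g(2)]) simp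
 have em: "(%x. exp (- real k * x)) : borel_measurable borel" for k by simp
 have int: "integrable (nu n) (%x. 1 - exp (- real k * x))" for n k
 proof -
  interpret finite_measure "nu n" by (rule nu)
  show ?thesis using nu(3)[of n]
   by (intro integrable_const_bound[where B=1]) (auto elim!: eventually_mono simp: nu(2) measurable_cong_sets[OF nu(2) refl])
 qed
 have lpos: "AE x in levy \<alpha>. 0 <= x" using AE_levy_pos by eventually_elim simp
 let ?w = "C / levy_const \<alpha>"
 have w: "0 < ?w" using C levy_const_pos[OF \<alpha>] by simp
 note A = density_one_minus_exp[OF nu(2,3) a int]
 note B = density_one_minus_exp[OF sets_levy lpos less_imp_le[OF w] integral_levy_exp(1)[OF \<alpha> of_nat_0_le_iff]]
 have B6: "(\<integral>x. exp (- real k * x) \<partial>density (levy \<alpha>) (%x. ennreal (?w * (1 - exp (- x))))) = C * ?B k" for k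
 proof -
  have "?w * ((LINT x|levy \<alpha>. 1 - exp (- real (Suc k) * x)) - (LINT x|levy \<alpha>. 1 - exp (- real k * x))) =
   C * ?B k"
   using levy_const_pos[OF \<alpha>]
   unfolding integral_levy_exp(2)[OF \<alpha> of_nat_0_le_iff] by (simp add: field_simps)
  with B(5)[of k] show ?thesis by (rule trans)
 qed
 have "(%n. \<integral>x. g (exp (- x)) \<partial>density (nu n) (%x. ennreal (a n * (1 - exp (- x))))) ---->
   (\<integral>x. g (exp (- x)) \<partial>density (levy \<alpha>) (%x. ennreal (?w * (1 - exp (- x)))))"
 proof (rule laplace_convergence[OF A(1,2,3) B(1,2,3) _ g])
  fix k :: nat
  show "(%n. \<integral>x. exp (- real k * x) \<partial>density (nu n) (%x. ennreal (a n * (1 - exp (- x))))) ---->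
   (\<integral>x. exp (- real k * x) \<partial>density (levy \<alpha>) (%x. ennreal (?w * (1 - exp (- x)))))"
   using tendsto_diff[OF lim[of "Suc k"] lim[of k]]
   unfolding A(5) B6 by (simp only: right_diff_distrib)
 qed
 moreover have "(LINT x|nu n. (1 - exp (- x)) * g (exp (- x))) = (LINT x|nu n. H x)" for n
 proof (rule integral_cong_AE)
  show "AE x in nu n. (1 - exp (- x)) * g (exp (- x)) = H x"
   using nu(3)[of n] by eventually_elim (simp add: Hg)
 qed (use H(1) gm in \<open>simp_all add: measurable_cong_sets[OF nu(2) refl]\<close>)
 moreover have "(LINT x|levy \<alpha>. (1 - exp (- x)) * g (exp (- x))) = ?A"
 proof (rule integral_cong_AE)
  show "AE x in levy \<alpha>. (1 - exp (- x)) * g (exp (- x)) = H x"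
   using lpos by eventually_elim (simp add: Hg)
 qed (use H(1) gm in simp_all)
 ultimately show "(%n. a n * (LINT x|nu n. H x)) ----> ?w * ?A"
  by (simp only: A(4)[OF gm] B(4)[OF gm])
qed

lemma ratio_integrable:
 fixes H :: "real => real"
 assumes \<alpha>: "0 < \<alpha>" "\<alpha> < 1"
  and H: "H : borel_measurable borel" "continuous_on {0<..} H" "H 0 = 0"
  and L: "((%x. H x / (1 - exp (- x))) \<longlongrightarrow> L0) (at_right 0)"
   "((%x. H x / (1 - exp (- x))) \<longlongrightarrow> L1) at_top"
 shows "integrable (levy \<alpha>) H"
proof -
 obtain g where g: "continuous_on {0..1} g" "g : borel_measurable borel"
  and Hg: "!!x. 0 <= x ==> H x = (1 - exp (- x)) * g (exp (- x))"
  using ratio_function[OF H L] by blast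
 have "bounded (g ` {0..1})"
  using g by (intro compact_imp_bounded compact_continuous_image) auto
 then obtain K where K: "!!y. y : {0..1} ==> \<bar>g y\<bar> <= K" unfolding bounded_iff by fastforce
 show ?thesis
 proof (rule Bochner_Integration.integrable_bound)
  show "integrable (levy \<alpha>) (%x. K * (1 - exp (- x)))"
   using integrable_levy_one_minus_exp[OF \<alpha>] by simp
  show "AE x in levy \<alpha>. norm (H x) <= norm (K * (1 - exp (- x)))"
   using AE_levy_pos
  proof eventually_elim
   case (elim x)
   have "\<bar>g (exp (- x))\<bar> <= K" using elim by (intro K) auto
   then have "\<bar>g (exp (- x))\<bar> * \<bar>1 - exp (- x)\<bar> <= \<bar>K\<bar> * \<bar>1 - exp (- x)\<bar>" by (intro mult_right_mono) auto
   then show ?case using elim by (simp add: Hg abs_mult mult.commute)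
  qed
 qed (use H(1) in simp)
qed

section \<open>Component intervals and ranked lengths\<close>

text \<open>The inserted 0 anchors the first interval and keeps the supremum meaningful when no
  point of \<open>Z\<close> lies before \<open>u\<close>.\<close>

definition left_end :: "real set => real => real" where
 "left_end Z u = Sup (insert 0 (Z \<inter> {..<u}))"

definition right_end :: "real set => real => real" where
 "right_end Z u = Inf (Z \<inter> {u<..})"

text \<open>For \<open>u\<close> in \<open>{0..t}\<close> outside a closed \<open>Z\<close> this is
  the length of the interval around \<open>u\<close>; the minimum with \<open>t\<close> treats the
  unfinished last interval.\<close>

definition gap :: "real set => real => real => real" where
 "gap Z t u = min t (right_end Z u) - left_end Z u"

text \<open>Makes every \<open>right_end\<close> the infimum of a nonempty set.\<close>

definition unbounded_above :: "real set => bool" where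
 "unbounded_above Z \<longleftrightarrow> (\<forall>u. \<exists>z\<in>Z. u < z)"

lemma left_end_bdd: "bdd_above (insert 0 (Z \<inter> {..<u::real}))"
 by (auto intro!: bdd_aboveI[of _ "max 0 u"])

lemma right_end_bdd: "bdd_below (Z \<inter> {u<..})" for u :: real
 by (auto intro!: bdd_belowI[of _ u] less_imp_le)

lemma left_end_upper: "z : Z ==> z < u ==> z <= left_end Z u"
 unfolding left_end_def by (rule cSup_upper[OF _ left_end_bdd]) auto

lemma left_end_nonneg: "0 <= left_end Z u"
 unfolding left_end_def by (rule cSup_upper[OF _ left_end_bdd]) auto

lemma left_end_least: "0 <= b ==> (!!z. z : Z ==> z < u ==> z <= b) ==> left_end Z u <= b"
 unfolding left_end_def by (rule cSup_least) auto

lemma right_end_lower: "z : Z ==> u < z ==> right_end Z u <= z"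
 unfolding right_end_def by (rule cInf_lower[OF _ right_end_bdd]) auto

lemma right_end_greatest:
 "unbounded_above Z ==> (!!z. z : Z ==> u < z ==> b <= z) ==> b <= right_end Z u"
 unfolding right_end_def by (rule cInf_greatest) (auto simp: unbounded_above_def)

lemma left_end_measurable [measurable]: "left_end Z : borel_measurable borel"
proof (rule borel_measurable_mono, rule monoI)
 fix u v :: real assume "u <= v"
 then show "left_end Z u <= left_end Z v"
  by (intro left_end_least left_end_nonneg left_end_upper) auto
qed

lemma right_end_measurable:
 assumes "unbounded_above Z"
 shows "right_end Z : borel_measurable borel"
proof (rule borel_measurable_mono, rule monoI)
 fix u v :: real assume "u <= v"
 then show "right_end Z u <= right_end Z v"
  by (intro right_end_greatest[OF assms] right_end_lower) auto
qed

lemma gap_measurable: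
 assumes "unbounded_above Z"
 shows "gap Z t : borel_measurable borel"
 unfolding gap_def using right_end_measurable[OF assms] by measurable

lemma cell_ends:
 assumes "mono q" "q 0 = 0" "q k < u" "u < q (Suc k)" "unbounded_above (range q)"
 shows "left_end (range q) u = q k" "right_end (range q) u = q (Suc k)"
proof -
 have le: "j <= k" if "q j < u" for j
  using that assms(4) monoD[OF assms(1), of "Suc k" j] by (cases "j <= k") (auto simp: not_le Suc_le_eq)
 have ge: "Suc k <= j" if "u < q j" for j
  using that assms(3) monoD[OF assms(1), of j k] by (cases "Suc k <= j") (auto simp: not_le less_Suc_eq_le)
 have "0 <= q k" using monoD[OF assms(1), of 0 k] assms(2) by simp
 then show "left_end (range q) u = q k"
  using assms(3) by (intro antisym left_end_least left_end_upper) (auto intro!: monoD[OF assms(1)] le)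
 show "right_end (range q) u = q (Suc k)"
  using assms(4) by (intro antisym right_end_greatest[OF assms(5)] right_end_lower) (auto intro!: monoD[OF assms(1)] ge)
qed

lemma integrable_Icc_const: "integrable lborel (%u. indicator {a..b::real} u * (B::real))"
 by (intro integrable_mult_left integrable_real_indicator) (auto simp: emeasure_lborel_Icc_eq)

text \<open>An interval of length y carries the constant value \<open>h y\<close> over a set of
  measure y, hence contributes \<open>y * h y = f y\<close> to the integral of
  \<open>h (gap Z t u)\<close> over \<open>u\<close>. Sums of \<open>f\<close> over interval lengths
  are thereby integrals. That \<open>h\<close> vanishes up to \<open>et\<close> leaves finitely many
  intervals, and its bound allows dominated convergence.\<close>

locale gap_test =
 fixes h f :: "real => real" and et B :: real
 assumes eta: "0 < et" and h0: "!!y. y <= et ==> h y = 0"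
  and h_bound: "!!y. 0 <= h y & h y <= B" and h_cont: "continuous_on UNIV h"
  and f_def: "!!y. f y = y * h y"
begin

lemma h_measurable [measurable]: "h : borel_measurable borel"
 using h_cont by (rule borel_measurable_continuous_onI)

lemma f_cont: "continuous_on UNIV f"
 using h_cont by (simp add: f_def[abs_def] continuous_on_mult)

lemma f_measurable [measurable]: "f : borel_measurable borel"
 using f_cont by (rule borel_measurable_continuous_onI)

lemma f_zero: "y <= et ==> f y = 0"
 by (simp add: f_def h0)

lemma f_nonneg: "0 <= f y"
 using h_bound[of y] h0[of y] eta by (cases "y <= et") (auto simp: f_def)

lemma gap_integrable:
 assumes "unbounded_above Z"
 shows "integrable lborel (%u. indicator {a..b} u * h (gap Z t u))"
proof (rule Bochner_Integration.integrable_bound)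
 show "integrable lborel (%u. indicator {a..b} u * B)" by (rule integrable_Icc_const)
 show "(%u. indicator {a..b} u * h (gap Z t u)) : borel_measurable lborel"
  using gap_measurable[OF assms] by measurable
 show "AE u in lborel. norm (indicator {a..b} u * h (gap Z t u)) <= norm (indicator {a..b} u * B)"
  using h_bound by (auto simp: indicator_def intro!: AE_I2) (smt (verit) h_bound)
qed

lemma cell_sum_eq_integral:
 assumes q: "mono q" "q 0 = 0" "unbounded_above (range q)" and t: "0 <= t"
 shows "(\<Sum>k<m. f (min t (q (Suc k)) - min t (q k))) =
  (LINT u|lborel. indicator {0..min t (q m)} u * h (gap (range q) t u))"
proof (induction m)
 case 0
 have "AE u in lborel. indicator {0..0::real} u * h (gap (range q) t u) = 0"
  using AE_lborel_singleton[of "0::real"] by eventually_elim (simp add: indicator_def)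
 then show ?case
  using t q(2) by (simp add: integral_eq_zero_AE)
next
 case (Suc m)
 let ?a = "min t (q m)" and ?b = "min t (q (Suc m))"
 let ?g = "%u. h (gap (range q) t u)"
 have ab: "0 <= ?a" "?a <= ?b"
  using t monoD[OF q(1), of 0 m] monoD[OF q(1), of m "Suc m"] q(2) by auto
 have i: "integrable lborel (%u. indicator {a..b} u * ?g u)" for a b
  by (rule gap_integrable[OF q(3)])
 have "(LINT u|lborel. indicator {0..?b} u * ?g u) =
  (LINT u|lborel. indicator {0..?a} u * ?g u + indicator {?a..?b} u * ?g u)"
 proof (rule integral_cong_AE)
  show "AE u in lborel. indicator {0..?b} u * ?g u = indicator {0..?a} u * ?g u + indicator {?a..?b} u * ?g u"
   using AE_lborel_singleton[of ?a] by eventually_elim (use ab in \<open>auto simp: indicator_def\<close>)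
 qed (use i in \<open>auto intro: borel_measurable_integrable\<close>)
 also have "... = (LINT u|lborel. indicator {0..?a} u * ?g u) + (LINT u|lborel. indicator {?a..?b} u * ?g u)"
  by (rule Bochner_Integration.integral_add[OF i i])
 also have "(LINT u|lborel. indicator {?a..?b} u * ?g u) = (LINT u|lborel. indicator {?a..?b} u * h (?b - ?a))"
 proof (rule integral_cong_AE)
  show "AE u in lborel. indicator {?a..?b} u * ?g u = indicator {?a..?b} u * h (?b - ?a)"
   using AE_lborel_singleton[of ?a] AE_lborel_singleton[of ?b]
  proof eventually_elim
   case (elim u)
   show ?case
   proof (cases "?a <= u & u <= ?b")
    case True
    then have "q m < u" "u < q (Suc m)" "q m <= t" using elim by auto
    from cell_ends[OF q(1,2) this(1,2) q(3)] this(3) show ?thesis by (simp add: gap_def min_def)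
   qed (auto simp: indicator_def)
  qed
 qed (use i in \<open>auto intro: borel_measurable_integrable\<close>)
 also have "... = f (?b - ?a)" using ab by (simp add: f_def)
 finally show ?case using Suc.IH by simp
qed

text \<open>For fixed \<open>u\<close> the ends of the grid cell around \<open>u\<close> converge to
  the ends of the interval of \<open>Z\<close>: the grid lies in \<open>Z\<close>, so its cells are
  at least as large, and its points approach every point of \<open>Z\<close>.\<close>

lemma gap_integral_limit:
 assumes p: "!!n. mono (p n)" "!!n. p n 0 = 0" "!!n. unbounded_above (range (p n))"
  and Z: "!!n k. p n k : Z" and dense: "!!z e. z : Z ==> 0 < e ==> \<forall>\<^sub>F n in sequentially. \<exists>k. \<bar>p n k - z\<bar> < e"
 shows "(%n. \<integral>u. indicator {0..t} u * h (gap (range (p n)) t u) \<partial>lborel) ---->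
  (LINT u|lborel. indicator {0..t} u * h (gap Z t u))"
proof (rule integral_dominated_convergence[where w="%u. indicator {0..t} u * B"])
 have unb: "unbounded_above Z" using p(3)[of 0] Z by (fastforce simp: unbounded_above_def)
 show "(%u. indicator {0..t} u * h (gap Z t u)) : borel_measurable lborel"
  "(%u. indicator {0..t} u * h (gap (range (p n)) t u)) : borel_measurable lborel" for n
  using gap_measurable[OF unb] gap_measurable[OF p(3)] by measurable
 show "integrable lborel (%u. indicator {0..t} u * B)" by (rule integrable_Icc_const)
 show "AE u in lborel. norm (indicator {0..t} u * h (gap (range (p n)) t u)) <= indicator {0..t} u * B" for n
  using h_bound by (auto simp: indicator_def intro!: AE_I2)
 have L: "(%n. left_end (range (p n)) u) ----> left_end Z u" for u
 proof (rule LIMSEQ_I)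
  fix r :: real assume r: "0 < r"
  have "\<forall>\<^sub>F n in sequentially. left_end Z u - r < left_end (range (p n)) u"
  proof (cases "left_end Z u - r < 0")
   case True
   then show ?thesis using left_end_nonneg[of "range (p _)" u] by (intro always_eventually allI) (rule less_le_trans)
  next
   case False
   have "\<exists>z\<in>insert 0 (Z \<inter> {..<u}). left_end Z u - r / 2 < z"
    using less_cSup_iff[of "insert 0 (Z \<inter> {..<u})" "left_end Z u - r / 2"] left_end_bdd[of Z u] r
    unfolding left_end_def by auto
   then obtain z where z: "z : Z" "z < u" "left_end Z u - r / 2 < z"
    using False r by auto
   have "\<forall>\<^sub>F n in sequentially. \<exists>k. \<bar>p n k - z\<bar> < min (r / 2) (u - z)"
    by (rule dense[OF z(1)]) (use r z in simp)
   then show ?thesis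
   proof eventually_elim
    case (elim n)
    then obtain k where k: "\<bar>p n k - z\<bar> < r / 2" "\<bar>p n k - z\<bar> < u - z" by auto
    then have "p n k <= left_end (range (p n)) u" by (intro left_end_upper) auto
    then show ?case using k z(3) by linarith
   qed
  qed
  moreover have "left_end (range (p n)) u <= left_end Z u" for n
   using Z by (intro left_end_least left_end_nonneg left_end_upper) auto
  ultimately have "\<forall>\<^sub>F n in sequentially. norm (left_end (range (p n)) u - left_end Z u) < r"
   by (elim eventually_mono) (smt (verit) real_norm_def)
  then show "\<exists>no. \<forall>n\<ge>no. norm (left_end (range (p n)) u - left_end Z u) < r"
   by (simp add: eventually_sequentially)
 qed
 have R: "(%n. right_end (range (p n)) u) ----> right_end Z u" for u
 proof (rule LIMSEQ_I)
  fix r :: real assume r: "0 < r"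
  have "\<exists>z\<in>Z \<inter> {u<..}. z < right_end Z u + r / 2"
   using cInf_less_iff[of "Z \<inter> {u<..}" "right_end Z u + r / 2"] right_end_bdd[of Z u] unb r
   unfolding right_end_def by (auto simp: unbounded_above_def)
  then obtain z where z: "z : Z" "u < z" "z < right_end Z u + r / 2" by auto
  have "\<forall>\<^sub>F n in sequentially. \<exists>k. \<bar>p n k - z\<bar> < min (r / 2) (z - u)"
   by (rule dense[OF z(1)]) (use r z in simp)
  then have "\<forall>\<^sub>F n in sequentially. right_end (range (p n)) u < right_end Z u + r"
  proof eventually_elim
   case (elim n)
   then obtain k where k: "\<bar>p n k - z\<bar> < r / 2" "\<bar>p n k - z\<bar> < z - u" by auto
   then have "right_end (range (p n)) u <= p n k" by (intro right_end_lower) auto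
   then show ?case using k z(3) by linarith
  qed
  moreover have "right_end Z u <= right_end (range (p n)) u" for n
   using Z by (intro right_end_greatest p(3) right_end_lower) auto
  ultimately have "\<forall>\<^sub>F n in sequentially. norm (right_end (range (p n)) u - right_end Z u) < r"
   by (elim eventually_mono) (smt (verit) real_norm_def)
  then show "\<exists>no. \<forall>n\<ge>no. norm (right_end (range (p n)) u - right_end Z u) < r"
   by (simp add: eventually_sequentially)
 qed
 have "(%n. h (gap (range (p n)) t u)) ----> h (gap Z t u)" for u
  unfolding gap_def
  by (rule continuous_on_tendsto_compose[OF h_cont]) (auto intro!: tendsto_intros L R)
 then show "AE u in lborel. (%n. indicator {0..t} u * h (gap (range (p n)) t u)) ----> indicator {0..t} u * h (gap Z t u)"
  by (intro AE_I2 tendsto_mult_left)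
qed

lemma gap_integral_tendsto_time:
 assumes unb: "unbounded_above Z" and s: "s ----> t" and s0: "!!n. 0 <= s n"
 shows "(%n. \<integral>u. indicator {0..s n} u * h (gap Z (s n) u) \<partial>lborel) ---->
  (LINT u|lborel. indicator {0..t} u * h (gap Z t u))"
proof -
 obtain K where K: "!!n. s n <= K" using s convergentI convergent_imp_Bseq Bseq_def
  by (metis abs_le_D1 real_norm_def)
 show ?thesis
 proof (rule integral_dominated_convergence[where w="%u. indicator {0..K} u * B"])
  show "(%u. indicator {0..t} u * h (gap Z t u)) : borel_measurable lborel"
   "(%u. indicator {0..s n} u * h (gap Z (s n) u)) : borel_measurable lborel" for n
   using gap_measurable[OF unb] by measurable
  show "integrable lborel (%u. indicator {0..K} u * B)" by (rule integrable_Icc_const)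
  show "AE u in lborel. norm (indicator {0..s n} u * h (gap Z (s n) u)) <= indicator {0..K} u * B" for n
   using h_bound K[of n] by (intro AE_I2) (auto simp: indicator_def intro: order_trans)
  show "AE u in lborel. (%n. indicator {0..s n} u * h (gap Z (s n) u)) ----> indicator {0..t} u * h (gap Z t u)"
   \<comment> \<open>Only at u = t can the indicators of \<open>{0..s n}\<close> fail to
     converge.\<close>
   using AE_lborel_singleton[of t]
  proof eventually_elim
   case (elim u)
   have "(%n. indicator {0..s n} u :: real) ----> indicator {0..t} u"
   proof (cases "u < t")
    case True
    then have "\<forall>\<^sub>F n in sequentially. u < s n" by (rule order_tendstoD(1)[OF s])
    then have "\<forall>\<^sub>F n in sequentially. indicator {0..s n} u = (indicator {0..t} u :: real)"
     by eventually_elim (use True in \<open>auto simp: indicator_def\<close>)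
    then show ?thesis by (rule tendsto_eventually)
   next
    case False
    then have "\<forall>\<^sub>F n in sequentially. s n < u" using elim by (intro order_tendstoD(2)[OF s]) auto
    then have "\<forall>\<^sub>F n in sequentially. indicator {0..s n} u = (indicator {0..t} u :: real)"
     by eventually_elim (use False elim in \<open>auto simp: indicator_def\<close>)
    then show ?thesis by (rule tendsto_eventually)
   qed
   moreover have "(%n. h (gap Z (s n) u)) ----> h (gap Z t u)"
    unfolding gap_def by (rule continuous_on_tendsto_compose[OF h_cont]) (auto intro!: tendsto_intros s)
   ultimately show ?case by (rule tendsto_mult)
  qed
 qed
qed

end

text \<open>Closedness puts both ends of the interval around \<open>u\<close> into \<open>Z\<close>,
  and a connected set containing \<open>u\<close> that avoids \<open>Z\<close> cannot cross
  them.\<close>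

lemma connected_component_gap:
 assumes Z: "closed Z" "0 : Z" "unbounded_above Z" and u: "u : {0..t} - Z"
 shows "connected_component_set ({0..t} - Z) u = {0..t} \<inter> {left_end Z u<..<right_end Z u}" (is "_ = ?D")
  and "measure lborel ({0..t} \<inter> {left_end Z u<..<right_end Z u}) = gap Z t u"
  and "u : {0..t} \<inter> {left_end Z u<..<right_end Z u}"
proof -
 have u0: "0 < u" using u Z(2) by (cases "u = 0") auto
 have "left_end Z u : insert 0 (Z \<inter> {..u})"
  unfolding left_end_def
 proof (rule subsetD[OF _ closed_contains_Sup[OF _ left_end_bdd]])
  have "insert 0 (Z \<inter> {..<u}) = Z \<inter> {..u}" using u u0 Z(2) by auto (metis le_less)
  then show "closed (insert 0 (Z \<inter> {..<u}))" using Z(1) by (simp add: closed_Int)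
 qed auto
 then have l: "left_end Z u : Z" "left_end Z u < u"
  using u Z(2) u0 by (auto simp: less_le)
 have ne: "Z \<inter> {u<..} ~= {}" using Z(3) by (auto simp: unbounded_above_def)
 have eq: "Z \<inter> {u<..} = Z \<inter> {u..}" using u by auto (metis le_less)
 have "right_end Z u : Z \<inter> {u..}"
  using closed_contains_Inf[OF ne right_end_bdd] Z(1) unfolding right_end_def eq by (simp add: closed_Int)
 then have r: "right_end Z u : Z" "u < right_end Z u" using u by (auto simp: le_less)
 show uD: "u : ?D" using u l r by auto
 have sub: "?D \<subseteq> {0..t} - Z"
 proof
  fix z assume z: "z : ?D"
  have "z \<notin> Z" using left_end_upper[of z Z u] right_end_lower[of z Z u] u z
   by (cases z u rule: linorder_cases) auto
  then show "z : {0..t} - Z" using z by auto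
 qed
 have "connected ?D"
  by (intro convex_connected convex_Int) auto
 then have "?D \<subseteq> connected_component_set ({0..t} - Z) u"
  by (rule connected_component_maximal[OF uD _ sub])
 moreover have "connected_component_set ({0..t} - Z) u \<subseteq> ?D"
 proof
  fix x assume x: "x : connected_component_set ({0..t} - Z) u"
  let ?T = "connected_component_set ({0..t} - Z) u"
  have T: "connected ?T" "?T \<subseteq> {0..t} - Z" "u : ?T"
   using connected_component_subset[of "{0..t} - Z" u] u by auto
  have "\<not> x <= left_end Z u"
  proof
   assume "x <= left_end Z u"
   then have "left_end Z u : ?T" using connected_contains_Icc[OF T(1) x T(3)] l
    by (meson atLeastAtMost_iff less_imp_le subsetD)
   then show False using T(2) l by auto
  qed
  moreover have "\<not> right_end Z u <= x"
  proof
   assume "right_end Z u <= x"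
   then have "right_end Z u : ?T" using connected_contains_Icc[OF T(1) T(3) x] r
    by (meson atLeastAtMost_iff less_imp_le subsetD)
   then show False using T(2) r by auto
  qed
  ultimately show "x : ?D" using x T(2) by auto
 qed
 ultimately show "connected_component_set ({0..t} - Z) u = ?D" by blast
 have l0: "0 <= left_end Z u" by (rule left_end_nonneg)
 show "measure lborel ?D = gap Z t u"
 proof (cases "right_end Z u <= t")
  case True
  then have "?D = {left_end Z u<..<right_end Z u}" using l0 by auto
  then show ?thesis using True l r by (simp add: gap_def)
 next
  case False
  then have "?D = {left_end Z u<..t}" using l0 by auto
  then show ?thesis using False l r u by (simp add: gap_def)
 qed
qed

text \<open>The measures of finitely many members add up to at most t, so there are at most t / c of
  them.\<close>

lemma finite_disjoint_large:
 fixes A :: "'i => real set"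
 assumes disj: "disjoint_family_on A I" and A: "!!i. i : I ==> A i : sets lborel" "!!i. i : I ==> A i \<subseteq> {0..t}"
  and c: "0 < c" "!!i. i : I ==> c < measure lborel (A i)"
 shows "finite I"
proof (cases "0 <= t")
 case True
 have "finite I & card I <= nat \<lfloor>t / c\<rfloor>"
 proof (rule finite_if_finite_subsets_card_bdd)
  fix G assume G: "G \<subseteq> I" "finite G"
  have fin: "emeasure lborel (A i) ~= \<infinity>" if "i : G" for i
   using emeasure_mono[of "A i" "{0..t}" lborel] A(2)[of i] that G by (auto simp: emeasure_lborel_Icc_eq top_unique)
  have "c * card G <= (\<Sum>i\<in>G. measure lborel (A i))"
   using sum_mono[of G "%_. c" "%i. measure lborel (A i)"] c(2) G by (auto simp: mult.commute less_imp_le subset_iff)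
  also have "... = measure lborel (\<Union>i\<in>G. A i)"
   using G A fin disjoint_family_on_mono[OF G(1) disj]
   by (intro measure_finite_Union[symmetric]) auto
  also have "... <= measure lborel {0..t}"
   using A G sets.finite_UN[OF G(2), of A lborel] by (intro measure_mono_fmeasurable) (auto simp: fmeasurable_def emeasure_lborel_Icc_eq)
  also have "... = t" using True by simp
  finally have "real (card G) <= t / c" using c by (simp add: field_simps)
  then show "card G <= nat \<lfloor>t / c\<rfloor>" by (simp add: le_nat_floor)
 qed
 then show ?thesis ..
next
 case False
 have "I = {}"
 proof (rule ccontr)
  assume "I ~= {}"
  then obtain i where i: "i : I" by auto
  then have "A i = {}" using A(2)[OF i] False by auto
  then show False using c(2)[OF i] c(1) by simp
 qed
 then show ?thesis by simp
qed

text \<open>The open intervals between \<open>left_end Z u\<close> and \<open>u\<close> are nonempty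
  and pairwise disjoint for different such points.\<close>

lemma countable_left_isolated:
 shows "countable {u : Z. left_end Z u < u}" (is "countable ?K")
proof -
 let ?A = "%u. {left_end Z u<..<u}"
 have "countable (?A ` ?K)"
 proof (rule countable_disjoint_open_subsets)
  show "pairwise disjnt (?A ` ?K)"
   unfolding pairwise_def disjnt_def
  proof (intro ballI impI)
   fix A B assume "A : ?A ` ?K" "B : ?A ` ?K" "A ~= B"
   then obtain u v where *: "u : Z" "v : Z" "u ~= v" "A = {left_end Z u<..<u}" "B = {left_end Z v<..<v}"
    by auto
   then show "A \<inter> B = {}"
    using left_end_upper[of u Z v] left_end_upper[of v Z u]
    by (cases u v rule: linorder_cases) auto
  qed
 qed auto
 moreover have "inj_on ?A ?K"
  by (rule inj_onI) (metis (no_types, lifting) cSup_greaterThanLessThan mem_Collect_eq)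
 ultimately show ?thesis by (metis countable_image_inj_on)
qed

lemma countable_right_isolated:
 shows "countable {u : Z. u < right_end Z u}" (is "countable ?K")
proof -
 let ?A = "%u. {u<..<right_end Z u}"
 have "countable (?A ` ?K)"
 proof (rule countable_disjoint_open_subsets)
  show "pairwise disjnt (?A ` ?K)"
   unfolding pairwise_def disjnt_def
  proof (intro ballI impI)
   fix A B assume "A : ?A ` ?K" "B : ?A ` ?K" "A ~= B"
   then obtain u v where *: "u : Z" "v : Z" "u ~= v" "A = {u<..<right_end Z u}" "B = {v<..<right_end Z v}"
    by auto
   then show "A \<inter> B = {}"
    using right_end_lower[of u Z v] right_end_lower[of v Z u]
    by (cases u v rule: linorder_cases) auto
  qed
 qed auto
 moreover have "inj_on ?A ?K"
  by (rule inj_onI) (metis (no_types, lifting) cInf_greaterThanLessThan mem_Collect_eq)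
 ultimately show ?thesis by (metis countable_image_inj_on)
qed

lemma component_facts:
 assumes Z: "closed Z" "0 : Z" "unbounded_above Z" and C: "C : components ({0..t} - Z)"
 shows "C : sets lborel" "C \<subseteq> {0..t} - Z" "!!u. u : C ==> gap Z t u = measure lborel C"
  "emeasure lborel C < \<infinity>"
proof -
 obtain v where v: "v : {0..t} - Z" "C = connected_component_set ({0..t} - Z) v"
  using C by (auto simp: components_def)
 show sub: "C \<subseteq> {0..t} - Z" using v connected_component_subset by blast
 show C': "C : sets lborel" using connected_component_gap(1)[OF Z v(1)] v(2) by simp
 show "gap Z t u = measure lborel C" if u: "u : C" for u
 proof -
  have uO: "u : {0..t} - Z" using sub u by blast
  have "C = connected_component_set ({0..t} - Z) u"
   using u v(2) by (simp add: connected_component_eq)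
  then show ?thesis using connected_component_gap(1,2)[OF Z uO] by simp
 qed
 have "emeasure lborel C <= emeasure lborel {0..t}" using sub by (intro emeasure_mono) auto
 also have "... < \<infinity>" by (simp add: emeasure_lborel_Icc_eq)
 finally show "emeasure lborel C < \<infinity>" .
qed

lemma finite_large_components:
 assumes Z: "closed Z" "0 : Z" "unbounded_above Z" and c: "0 < c"
 shows "finite {C : components ({0..t} - Z). c < measure lborel C}"
proof (rule finite_disjoint_large[where A="%C. C" and t=t and c=c])
 show "disjoint_family_on (%C. C) {C : components ({0..t} - Z). c < measure lborel C}"
  using components_nonoverlap by (fastforce simp: disjoint_family_on_def)
next
 fix C assume "C : {C : components ({0..t} - Z). c < measure lborel C}"
 then have C: "C : components ({0..t} - Z)" "c < measure lborel C" by auto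
 show "C : sets lborel" "C \<subseteq> {0..t}" "c < measure lborel C"
  using component_facts(1,2)[OF Z C(1)] C(2) by auto
qed (rule c)

text \<open>Apart from the countably many points of \<open>Z\<close> that are isolated on one side,
  a point of \<open>Z\<close> has a nonpositive gap, where \<open>h\<close> vanishes. A point
  outside \<open>Z\<close> lies in exactly one component, whose length is the gap there. So
  \<open>Z\<close> contributes nothing, whatever its measure.\<close>

lemma (in gap_test) gap_integral_eq_components:
 assumes Z: "closed Z" "0 : Z" "unbounded_above Z"
 shows "(LINT u|lborel. indicator {0..t} u * h (gap Z t u)) =
  (\<Sum>C\<in>{C : components ({0..t} - Z). et < measure lborel C}. f (measure lborel C))" (is "_ = sum _ ?B")
proof -
 note fin = finite_large_components[OF Z eta, of t]
 have "AE u in lborel. u \<notin> {u : Z. left_end Z u < u} \<union> {u : Z. u < right_end Z u}"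
  using countable_left_isolated[of Z] countable_right_isolated[of Z]
  by (intro AE_not_in countable_imp_null_set_lborel) auto
 then have ae: "AE u in lborel. indicator {0..t} u * h (gap Z t u) = (\<Sum>C\<in>?B. indicator C u * h (measure lborel C))"
 proof eventually_elim
  case (elim u)
  consider "u \<notin> {0..t}" | "u : {0..t} \<inter> Z" | "u : {0..t} - Z" by blast
  then show ?case
  proof cases
   case 1
   then have "!!C. C : ?B ==> u \<notin> C" using component_facts(2)[OF Z] by blast
   then show ?thesis using 1 by simp
  next
   case 2
   then have "!!C. C : ?B ==> u \<notin> C" using component_facts(2)[OF Z] by blast
   moreover have "gap Z t u <= et"
    using elim 2 eta by (auto simp: gap_def)
   ultimately show ?thesis by (simp add: h0)
  next
   case 3
   define C where "C = connected_component_set ({0..t} - Z) u"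
   have C: "C : components ({0..t} - Z)" "u : C"
    using 3 by (auto simp: C_def components_def)
   have other: "u \<notin> C'" if "C' : ?B" "C' ~= C" for C'
    using components_nonoverlap[of C "{0..t} - Z" C'] C that by auto
   have g: "gap Z t u = measure lborel C" using component_facts(3)[OF Z C] .
   show ?thesis
   proof (cases "et < measure lborel C")
    case True
    then have "C : ?B" using C by auto
    moreover have "(\<Sum>C'\<in>?B - {C}. indicator C' u * h (measure lborel C')) = 0"
     using other by (intro sum.neutral) auto
    ultimately show ?thesis using 3 C g by (simp add: sum.remove[OF fin])
   next
    case False
    then have "!!C'. C' : ?B ==> u \<notin> C'" using other by auto
    then show ?thesis using False g by (simp add: h0)
   qed
  qed
 qed
 have int: "integrable lborel (%u. indicator C u * h (measure lborel C))" if "C : ?B" for C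
  using component_facts(1,4)[OF Z, of C t] that by (intro integrable_mult_left integrable_real_indicator) auto
 have "(LINT u|lborel. indicator {0..t} u * h (gap Z t u)) = (LINT u|lborel. (\<Sum>C\<in>?B. indicator C u * h (measure lborel C)))"
 proof (rule integral_cong_AE[OF _ _ ae])
  show "(%u. indicator {0..t} u * h (gap Z t u)) : borel_measurable lborel"
   by (rule borel_measurable_integrable[OF gap_integrable[OF Z(3)]])
  show "(%u. \<Sum>C\<in>?B. indicator C u * h (measure lborel C)) : borel_measurable lborel"
   by (rule borel_measurable_sum[OF borel_measurable_integrable[OF int]])
 qed
 also have "... = (\<Sum>C\<in>?B. \<integral>u. indicator C u * h (measure lborel C) \<partial>lborel)"
  by (rule Bochner_Integration.integral_sum[OF int])
 also have "... = (\<Sum>C\<in>?B. f (measure lborel C))"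
  using component_facts(1,4)[OF Z] by (intro sum.cong) (auto simp: f_def)
 finally show ?thesis .
qed


section \<open>Increasing right-continuous paths and their jumps\<close>

definition nice_path :: "(real => real) => bool" where
 "nice_path sg \<longleftrightarrow> mono_on {0..} sg & sg 0 = 0 & (\<forall>s\<ge>0. continuous (at_right s) sg) & (\<forall>K. \<exists>s\<ge>0. K < sg s)"

definition path_inverse :: "(real => real) => real => real" where
 "path_inverse sg u = Inf {v. 0 <= v & u < sg v}"

definition left_value :: "(real => real) => real => real" where
 "left_value sg s = Sup (sg ` {0..<s})"

context
 fixes sg :: "real => real"
 assumes nice: "nice_path sg"
begin

lemma nice_mono: "0 <= s ==> s <= r ==> sg s <= sg r"
 using nice by (auto simp: nice_path_def mono_on_def)

lemma nice_zero: "sg 0 = 0"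
 using nice by (auto simp: nice_path_def)

lemma nice_nonneg: "0 <= s ==> 0 <= sg s"
 using nice_mono[of 0 s] nice_zero by simp

lemma nice_right: "0 <= s ==> (sg \<longlongrightarrow> sg s) (at_right s)"
 using nice by (auto simp: nice_path_def continuous_within)

lemma nice_unbounded: "\<exists>s\<ge>0. K < sg s"
 using nice by (auto simp: nice_path_def)

lemma left_value_bdd: "0 < s ==> bdd_above (sg ` {0..<s})"
 by (rule bdd_aboveI[of _ "sg s"]) (auto intro: nice_mono)

lemma left_value_upper: "0 <= v ==> v < s ==> sg v <= left_value sg s"
 unfolding left_value_def by (rule cSup_upper[OF _ left_value_bdd]) auto

lemma left_value_le: "0 < s ==> (!!v. 0 <= v ==> v < s ==> sg v <= b) ==> left_value sg s <= b"
 unfolding left_value_def by (rule cSup_least) auto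

lemma left_value_nonneg: "0 < s ==> 0 <= left_value sg s"
 using left_value_upper[of 0 s] nice_zero by simp

lemma left_value_le_value: "0 < s ==> left_value sg s <= sg s"
 by (rule left_value_le) (auto intro: nice_mono)

lemma nice_left: "0 < s ==> (sg \<longlongrightarrow> left_value sg s) (at_left s)"
proof (rule order_tendstoI)
 fix a assume s: "0 < s" and "a < left_value sg s"
 then obtain v where v: "0 <= v" "v < s" "a < sg v"
  using less_cSup_iff[of "sg ` {0..<s}" a] left_value_bdd[OF s] by (auto simp: left_value_def)
 show "\<forall>\<^sub>F x in at_left s. a < sg x"
  unfolding eventually_at_left_field
 proof (intro exI[of _ v] conjI allI impI)
  fix y assume "v < y" "y < s"
  then show "a < sg y" using nice_mono[of v y] v by simp
 qed (use v in auto)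
next
 fix a assume s: "0 < s" and a: "left_value sg s < a"
 show "\<forall>\<^sub>F x in at_left s. sg x < a"
  unfolding eventually_at_left_field
 proof (intro exI[of _ 0] conjI allI impI)
  fix y assume "0 < y" "y < s"
  then show "sg y < a" using left_value_upper[of y s] a by simp
 qed (use s in auto)
qed

lemma Lim_left: "0 < s ==> Lim (at_left s) sg = left_value sg s"
 by (rule tendsto_Lim[OF _ nice_left]) auto

lemma inverse_bdd: "bdd_below {v. 0 <= v & u < sg v}"
 by (auto intro!: bdd_belowI[of _ 0])

lemma inverse_nonempty: "{v. 0 <= v & u < sg v} ~= {}"
 using nice_unbounded[of u] by auto

lemma path_inverse_nonneg: "0 <= path_inverse sg u"
 unfolding path_inverse_def by (rule cInf_greatest[OF inverse_nonempty]) auto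

lemma path_inverse_le: "0 <= v ==> u < sg v ==> path_inverse sg u <= v"
 unfolding path_inverse_def by (rule cInf_lower[OF _ inverse_bdd]) auto

lemma path_inverse_below: "0 <= v ==> v < path_inverse sg u ==> sg v <= u"
 using path_inverse_le[of v u] by (cases "u < sg v") auto

lemma path_inverse_above: "path_inverse sg u < v ==> u < sg v"
proof -
 assume "path_inverse sg u < v"
 then obtain w where "0 <= w" "u < sg w" "w < v"
  using cInf_less_iff[OF inverse_nonempty[of u] inverse_bdd[of u], of v] by (auto simp: path_inverse_def)
 then show ?thesis using nice_mono[of w v] by simp
qed

lemma path_inverse_value: "u <= sg (path_inverse sg u)"
proof (rule tendsto_lowerbound[OF nice_right[OF path_inverse_nonneg]])
 show "\<forall>\<^sub>F v in at_right (path_inverse sg u). u <= sg v"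
  unfolding eventually_at_right_field
  by (intro exI[of _ "path_inverse sg u + 1"]) (auto intro: less_imp_le path_inverse_above)
qed simp

lemma path_inverse_left_value: "0 < path_inverse sg u ==> left_value sg (path_inverse sg u) <= u"
 by (rule left_value_le) (auto intro: path_inverse_below)

lemma path_inverse_pos: "0 < u ==> 0 < path_inverse sg u"
 using path_inverse_value[of u] path_inverse_nonneg[of u] nice_zero
 by (cases "path_inverse sg u = 0") auto

lemma path_inverse_jump: "0 < s ==> left_value sg s < u ==> u < sg s ==> path_inverse sg u = s"
proof (rule antisym)
 assume s: "0 < s" and u: "left_value sg s < u" "u < sg s"
 show "path_inverse sg u <= s" using s u by (intro path_inverse_le) auto
 show "s <= path_inverse sg u"
  unfolding path_inverse_def
 proof (rule cInf_greatest[OF inverse_nonempty])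
  fix v assume "v : {v. 0 <= v & u < sg v}"
  then show "s <= v" using left_value_upper[of v s] u by (cases "v < s") auto
 qed
qed

lemma unbounded_grid: "0 < d ==> unbounded_above (range (%k. sg (real k * d)))"
 unfolding unbounded_above_def
proof
 fix u assume d: "0 < d"
 obtain s where s: "0 <= s" "u < sg s" using nice_unbounded by blast
 obtain k :: nat where "s / d < real k" using reals_Archimedean2 by blast
 then have "s <= real k * d" using d by (simp add: field_simps)
 then have "u < sg (real k * d)" using nice_mono[OF s(1)] s(2) by (meson less_le_trans)
 then show "\<exists>z\<in>range (%k. sg (real k * d)). u < z" by auto
qed

text \<open>Different jumps skip disjoint intervals of \<open>{0..sg 1}\<close>.\<close>

lemma finite_large_jumps: "0 < c ==> finite {s\<in>{0<..1}. c < sg s - left_value sg s}"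
proof (rule finite_disjoint_large[where A="%s. {left_value sg s<..<sg s}" and t="sg 1" and c=c])
 show "disjoint_family_on (%s. {left_value sg s<..<sg s}) {s : {0<..1}. c < sg s - left_value sg s}"
  unfolding disjoint_family_on_def
 proof (intro ballI impI)
  fix s r assume "s : {s : {0<..1}. c < sg s - left_value sg s}" "r : {s : {0<..1}. c < sg s - left_value sg s}" "s ~= r"
  then show "{left_value sg s<..<sg s} \<inter> {left_value sg r<..<sg r} = {}"
   using path_inverse_jump[of s] path_inverse_jump[of r] by fastforce
 qed
next
 fix s assume s: "s : {s : {0<..1}. c < sg s - left_value sg s}"
 then show "{left_value sg s<..<sg s} \<subseteq> {0..sg 1}"
  using left_value_nonneg[of s] nice_mono[of s 1] by auto
 show "0 < c ==> c < measure lborel {left_value sg s<..<sg s}" using s by simp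
qed auto

end

text \<open>The jumps of an increasing path are the gaps of its range, and the gap around a level
  \<open>u\<close> is the jump made at the passage time of \<open>u\<close>. This brings jumps under
  the same gap integrals as the intervals of a zero set.\<close>

lemma gap_range:
 assumes nice: "nice_path sg" and strict: "!!s r. 0 <= s ==> s < r ==> sg s < sg r" and u: "0 < u" "u < sg 1"
 shows "gap (sg ` {0..}) (sg 1) u = sg (path_inverse sg u) - left_value sg (path_inverse sg u)"
proof -
 let ?E = "path_inverse sg u" and ?R = "sg ` {0..}"
 have E: "0 < ?E" "?E <= 1" using u by (auto intro!: path_inverse_pos[OF nice] path_inverse_le[OF nice])
 have unb: "unbounded_above ?R" using nice_unbounded[OF nice] by (force simp: unbounded_above_def)
 have "right_end ?R u = sg ?E"
 proof (rule antisym)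
  show "sg ?E <= right_end ?R u"
  proof (rule right_end_greatest[OF unb])
   fix z assume "z : ?R" "u < z"
   then obtain v where v: "0 <= v" "z = sg v" "u < sg v" by auto
   then show "sg ?E <= z" using path_inverse_below[OF nice v(1), of u] E by (cases "v < ?E") (auto intro!: nice_mono[OF nice])
  qed
  have "\<forall>\<^sub>F v in at_right ?E. right_end ?R u <= sg v"
   unfolding eventually_at_right_field
   using path_inverse_above[OF nice, of u] E by (intro exI[of _ "?E + 1"]) (auto intro!: right_end_lower)
  then show "right_end ?R u <= sg ?E" using E by (intro tendsto_lowerbound[OF nice_right[OF nice]]) auto
 qed
 moreover have "left_end ?R u = left_value sg ?E"
 proof (rule antisym)
  show "left_end ?R u <= left_value sg ?E"
  proof (rule left_end_least[OF left_value_nonneg[OF nice E(1)]])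
   fix z assume "z : ?R" "z < u"
   then obtain v where v: "0 <= v" "z = sg v" "sg v < u" by auto
   have "v < ?E" using v nice_mono[OF nice, of ?E v] path_inverse_value[OF nice, of u] E by (cases "v < ?E") auto
   then show "z <= left_value sg ?E" using v left_value_upper[OF nice] by simp
  qed
  show "left_value sg ?E <= left_end ?R u"
  proof (rule left_value_le[OF nice E(1)])
   fix v assume v: "0 <= v" "v < ?E"
   \<comment> \<open>Strict growth up to the midpoint of v and the passage time turns a weak
     inequality into a strict one, so that \<open>sg v\<close> counts as a point of the range below
     \<open>u\<close>.\<close>
   then have "sg v < u" using strict[of v "(v + ?E) / 2"] path_inverse_below[OF nice, of "(v + ?E) / 2" u] by simp
   then show "sg v <= left_end ?R u" using v by (intro left_end_upper) auto
  qed
 qed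
 ultimately show ?thesis using nice_mono[OF nice, of ?E 1] E by (simp add: gap_def min_def)
qed

text \<open>The values at grid times cut the range into cells and become dense in it by
  right-continuity. The sums are therefore gap integrals that converge to the gap integral of the
  range, and this splits into the jumps.\<close>

lemma (in gap_test) jump_sum_limit:
 assumes nice: "nice_path sg" and strict: "!!s r. 0 <= s ==> s < r ==> sg s < sg r"
 shows "(%n. \<Sum>k<Suc n. f (sg (real (Suc k) * (1 / real (Suc n))) - sg (real k * (1 / real (Suc n))))) ---->
  (\<Sum>s\<in>{s\<in>{0<..1}. et < sg s - left_value sg s}. f (sg s - left_value sg s))"
proof -
 let ?A = "%nat v real n. nat \<lfloor>v * real (Suc n)\<rfloor>"
 define J where "J s = sg s - left_value sg s" for s
 let ?E = "path_inverse sg" and ?R = "sg ` {0..}"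
 define q where "q n k = sg (real k * (1 / real (Suc n)))" for n k :: nat
 let ?B = "{s\<in>{0<..1}. et < J s}" and ?g = "%u. \<Sum>s\<in>{s\<in>{0<..1}. et < J s}. indicator {left_value sg s<..<sg s} u * h (J s)"
 note fin = finite_large_jumps[OF nice eta, folded J_def]
 have q: "mono (q n)" "q n 0 = 0" "unbounded_above (range (q n))" for n
  using unbounded_grid[OF nice, of "1 / real (Suc n)"]
  by (auto simp: q_def[abs_def] nice_zero[OF nice] divide_right_mono intro!: monoI nice_mono[OF nice])
 have q1: "q n (Suc n) = sg 1" for n by (simp add: q_def)
 have sum_eq: "(\<Sum>k<Suc n. f (q n (Suc k) - q n k)) = (LINT u|lborel. indicator {0..sg 1} u * h (gap (range (q n)) (sg 1) u))" for n
 proof -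
  have "(\<Sum>k<Suc n. f (q n (Suc k) - q n k)) = (\<Sum>k<Suc n. f (min (sg 1) (q n (Suc k)) - min (sg 1) (q n k)))"
  proof (rule sum.cong)
   fix k assume "k : {..<Suc n}"
   then have "q n k <= q n (Suc n)" "q n (Suc k) <= q n (Suc n)" by (auto intro!: monoD[OF q(1)])
   then show "f (q n (Suc k) - q n k) = f (min (sg 1) (q n (Suc k)) - min (sg 1) (q n k))"
    by (simp add: q1 min_def)
  qed simp
  then show ?thesis unfolding cell_sum_eq_integral[OF q nice_nonneg[OF nice zero_le_one]] by (simp add: q1)
 qed
 have "(%n. \<integral>u. indicator {0..sg 1} u * h (gap (range (q n)) (sg 1) u) \<partial>lborel) ---->
  (LINT u|lborel. indicator {0..sg 1} u * h (gap ?R (sg 1) u))"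
 proof (rule gap_integral_limit[OF q])
  show "q n k : ?R" for n k by (simp add: q_def)
  fix z e :: real assume "z : ?R" and e: "0 < e"
  then obtain v where v: "0 <= v" "z = sg v" by auto
  have "\<forall>\<^sub>F x in at_right v. dist (sg x) (sg v) < e" by (rule tendstoD[OF nice_right[OF nice v(1)] e])
  then obtain b where b: "v < b" "!!x. v < x ==> x < b ==> dist (sg x) (sg v) < e"
   unfolding eventually_at_right_field by auto
  have "(%n. 1 / real (Suc n)) ----> 0" by real_asymp
  then have "\<forall>\<^sub>F n in sequentially. 1 / real (Suc n) < b - v" using b(1) by (intro order_tendstoD(2)) auto
  then show "\<forall>\<^sub>F n in sequentially. \<exists>k. \<bar>q n k - z\<bar> < e"
  proof eventually_elim
   case (elim n)
   \<comment> \<open>The first grid time strictly after v. It lies within one mesh of v, on the side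
     where the path is continuous.\<close>
   define x where "x = real (Suc (?A nat v real n)) * (1 / real (Suc n))"
   have "0 <= \<lfloor>v * real (Suc n)\<rfloor>" using v by simp
   then have "real (Suc (?A nat v real n)) = of_int \<lfloor>v * real (Suc n)\<rfloor> + 1" by simp
   then have r: "v * real (Suc n) < real (Suc (?A nat v real n))" "real (Suc (?A nat v real n)) <= v * real (Suc n) + 1"
    by linarith+
   have "v < x" unfolding x_def using r(1) by (simp add: pos_less_divide_eq del: of_nat_Suc)
   moreover have "x <= v + 1 / real (Suc n)" unfolding x_def using r(2) by (simp add: pos_divide_le_eq distrib_right del: of_nat_Suc)
   ultimately have "dist (sg x) (sg v) < e" using elim by (intro b(2)) auto
   then show ?case by (intro exI[of _ "Suc (?A nat v real n)"]) (simp add: q_def x_def v dist_real_def)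
  qed
 qed
 moreover have "(LINT u|lborel. indicator {0..sg 1} u * h (gap ?R (sg 1) u)) = (LINT u|lborel. ?g u)"
 proof (rule integral_cong_AE)
  have unb: "unbounded_above ?R" using nice_unbounded[OF nice] by (force simp: unbounded_above_def)
  show "(%u. indicator {0..sg 1} u * h (gap ?R (sg 1) u)) : borel_measurable lborel" using gap_measurable[OF unb] by measurable
  have "AE u in lborel. u \<notin> {0, sg 1} \<union> sg ` ?B \<union> left_value sg ` ?B"
   using fin by (intro AE_not_in countable_imp_null_set_lborel countable_finite) auto
  then show "AE u in lborel. indicator {0..sg 1} u * h (gap ?R (sg 1) u) = ?g u"
  proof eventually_elim
   case (elim u)
   have inside: "0 < u & u < sg 1 & ?E u = s" if "s : ?B" "left_value sg s < u" "u < sg s" for s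
    using that left_value_nonneg[OF nice, of s] nice_mono[OF nice, of s 1] path_inverse_jump[OF nice, of s u] by auto
   have z: "(\<Sum>s\<in>A. indicator {left_value sg s<..<sg s} u * h (J s)) = 0" if "A \<subseteq> ?B" "0 < u & u < sg 1 --> ?E u \<notin> A" for A
   proof (rule sum.neutral, rule ballI)
    fix s assume "s : A"
    then have "\<not> (left_value sg s < u & u < sg s)" using inside[of s] that by blast
    then show "indicator {left_value sg s<..<sg s} u * h (J s) = 0" by (simp add: indicator_def)
   qed
   show ?case
   proof (cases "0 < u & u < sg 1")
    case False
    then show ?thesis using elim z[of ?B] by (auto simp: indicator_def less_le)
   next
    case u: True
    have E: "0 < ?E u" "?E u <= 1" using u by (auto intro!: path_inverse_pos[OF nice] path_inverse_le[OF nice])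
    have g: "gap ?R (sg 1) u = J (?E u)" using gap_range[OF nice strict, of u] u by (simp add: J_def)
    show ?thesis
    proof (cases "?E u : ?B")
     case True
     then have "u ~= left_value sg (?E u)" "u ~= sg (?E u)" using elim by blast+
     then have "u : {left_value sg (?E u)<..<sg (?E u)}"
      using path_inverse_left_value[OF nice E(1)] path_inverse_value[OF nice, of u] by (simp add: less_le)
     then show ?thesis using z[of "?B - {?E u}"] u unfolding g sum.remove[OF fin True] by simp
    next
     case False
     then have "h (J (?E u)) = 0" using E by (simp add: h0)
     then show ?thesis using z[of ?B] False unfolding g by simp
    qed
   qed
  qed
 qed simp
 moreover have "(LINT u|lborel. ?g u) = (\<Sum>s\<in>?B. \<integral>u. indicator {left_value sg s<..<sg s} u * h (J s) \<partial>lborel)"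
  by (intro Bochner_Integration.integral_sum integrable_mult_left integrable_real_indicator)
    (auto simp: emeasure_lborel_Ioo left_value_le_value[OF nice])
 moreover have "... = (\<Sum>s\<in>?B. f (J s))"
  using left_value_le_value[OF nice] by (intro sum.cong) (auto simp: f_def J_def)
 ultimately show ?thesis unfolding sum_eq[symmetric] q_def J_def by simp
qed

section \<open>Ranked sequences and their laws\<close>

context
 fixes len :: "'i => real" and I :: "'i set"
 assumes fin: "!!x. 0 < x ==> finite {i\<in>I. x < len i}"
begin

lemma ranked_bounds_nonempty: "{x. 0 <= x & finite {i\<in>I. x < len i} & card {i\<in>I. x < len i} <= n} ~= {}"
proof -
 define x where "x = Max (insert 1 (len ` {i\<in>I. 1 < len i}))"
 have x: "1 <= x" "!!i. i : I ==> 1 < len i ==> len i <= x"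
  unfolding x_def using fin[of 1] by (auto intro!: Max_ge)
 have "len i <= x" if "i : I" for i using x that by (cases "1 < len i") auto
 then have e: "{i\<in>I. x < len i} = {}" by (auto simp: not_less)
 have "0 <= x & finite {i\<in>I. x < len i} & card {i\<in>I. x < len i} <= n" unfolding e using x(1) by simp
 then show ?thesis by blast
qed

lemma ranked_nonneg: "0 <= ranked len I n"
 unfolding ranked_def using ranked_bounds_nonempty by (intro cInf_greatest) auto

text \<open>Ranks and counts are inverse to each other. This reduces measurability and laws of
  ranked sequences to counts above positive levels.\<close>

lemma ranked_le_iff:
 assumes y: "0 < y"
 shows "ranked len I n <= y \<longleftrightarrow> card {i\<in>I. y < len i} <= n"
proof
 assume "card {i\<in>I. y < len i} <= n"
 then show "ranked len I n <= y"
  unfolding ranked_def using y fin[OF y] by (intro cInf_lower) (auto intro!: bdd_belowI[of _ 0])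
next
 let ?B = "{i\<in>I. y < len i}"
 assume r: "ranked len I n <= y"
 show "card ?B <= n"
 proof (rule ccontr)
  assume c: "\<not> card ?B <= n"
  \<comment> \<open>If more than n values exceed y, every admissible bound is at least their minimum
    m, which would put the rank above y.\<close>
  define m where "m = Min (len ` ?B)"
  have ne: "?B ~= {}" using c by (metis card.empty le0)
  have m: "y < m" "!!i. i : ?B ==> m <= len i"
   unfolding m_def using fin[OF y] ne by auto
  have "m <= ranked len I n"
   unfolding ranked_def
  proof (rule cInf_greatest[OF ranked_bounds_nonempty], rule ccontr)
   fix x assume x: "x : {x. 0 <= x & finite {i\<in>I. x < len i} & card {i\<in>I. x < len i} <= n}" and "\<not> m <= x"
   then have "?B \<subseteq> {i\<in>I. x < len i}" using m(2) by (smt (verit) mem_Collect_eq subsetI)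
   then have "card ?B <= n" using x card_mono[of "{i\<in>I. x < len i}" ?B] by auto
   then show False using c by simp
  qed
  then show False using r m by simp
 qed
qed

lemma ranked_pos:
 assumes "infinite {i\<in>I. 0 < len i}"
 shows "0 < ranked len I n"
proof -
 obtain G where G: "G \<subseteq> {i\<in>I. 0 < len i}" "finite G" "card G = Suc n"
  using infinite_arbitrarily_large[OF assms] by blast
 define m where "m = Min (len ` G)"
 have ne: "G ~= {}" using G(3) by auto
 have m: "0 < m" "!!i. i : G ==> m <= len i"
  unfolding m_def using G ne by (auto simp: subset_iff)
 have "G \<subseteq> {i\<in>I. m / 2 < len i}" using G(1) m by force
 then have "Suc n <= card {i\<in>I. m / 2 < len i}"
  using card_mono[OF fin[of "m / 2"]] G(3) m(1) by (metis half_gt_zero)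
 then show ?thesis using ranked_le_iff[of "m / 2" n] m(1) by linarith
qed

end

lemma ranked_scale:
 assumes fin: "!!x. 0 < x ==> finite {i\<in>I. x < len i}" and a: "0 < a"
 shows "ranked (%i. a * len i) I n = a * ranked len I n"
proof -
 have eq: "{i\<in>I. x < a * len i} = {i\<in>I. x / a < len i}" for x
  using a by (auto simp: field_simps)
 have fin': "finite {i\<in>I. x < a * len i}" if "0 < x" for x
  unfolding eq using that a by (intro fin) simp
 have iff: "ranked (%i. a * len i) I n <= y \<longleftrightarrow> a * ranked len I n <= y" if "0 < y" for y
 proof -
  have "ranked (%i. a * len i) I n <= y \<longleftrightarrow> ranked len I n <= y / a"
   using ranked_le_iff[OF fin' that, of n] ranked_le_iff[OF fin, of "y / a" n] that a unfolding eq by simp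
  then show ?thesis using a by (simp add: pos_le_divide_eq mult.commute)
 qed
 have "p <= q" if "0 <= q" "!!y. 0 < y ==> q <= y ==> p <= y" for p q :: real
  by (rule dense_ge) (use that in simp)
 note key = this
 have nn: "0 <= ranked (%i. a * len i) I n" "0 <= a * ranked len I n"
  using ranked_nonneg[OF fin', of n] ranked_nonneg[OF fin, of n] a by simp_all
 show ?thesis
  by (rule antisym[OF key[OF nn(2)] key[OF nn(1)]]) (simp_all add: iff)
qed

text \<open>Counts are finite only above positive levels, hence the restriction to positive x. The
  distribution function at 0 is recovered by right-continuity.\<close>

lemma determining_half_lines: "determining {indicator {..x} | x::real. 0 < x} {0..}"
 unfolding determining_def
proof (intro conjI ballI allI impI)
 show "{indicator {..x} | x::real. 0 < x} ~= ({} :: (real => real) set)" using zero_less_one by blast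
 fix mu nu :: "real measure"
 assume fm: "finite_measure mu" "finite_measure nu" and s: "sets mu = sets borel" "sets nu = sets borel"
  and pos: "AE x in mu. x : {0..}" "AE x in nu. x : {0..}"
  and eq: "\<forall>ph\<in>{indicator {..x} | x::real. 0 < x} :: (real => real) set. (LINT x|mu. ph x) = (LINT x|nu. ph x)"
 have fb: "finite_borel_measure mu" "finite_borel_measure nu"
  using fm s by (simp_all add: finite_borel_measure_def finite_borel_measure_axioms_def)
 have sp: "space mu = UNIV" "space nu = UNIV" using s[THEN sets_eq_imp_space_eq] by auto
 have gt: "cdf mu x = cdf nu x" if "0 < x" for x
 proof -
  have "(indicator {..x} :: real => real) : {indicator {..x} | x::real. 0 < x}" using that by blast
  note bspec[OF eq this]
  then show ?thesis by (simp add: sp cdf_def)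
 qed
 have lt: "cdf rh x = 0" if "AE y in rh. y : {0..}" "x < 0" "sets rh = sets borel" for rh x
 proof -
  have "AE y in rh. y \<notin> {..x}" using that(1) by eventually_elim (use that(2) in auto)
  then have "{..x} : null_sets rh" using that(3) by (subst AE_iff_null_sets) auto
  then show ?thesis unfolding cdf_def by (rule measure_eq_0_null_sets)
 qed
 have r0: "(cdf rh \<longlongrightarrow> cdf rh 0) (at_right 0)" if "finite_borel_measure rh" for rh
  using finite_borel_measure.cdf_is_right_cont[OF that, of 0] by (simp add: continuous_within)
 have "\<forall>\<^sub>F x in at_right 0. cdf mu x = cdf nu x" unfolding eventually_at_right_field using gt zero_less_one by blast
 from tendsto_cong[OF this] r0[OF fb(1)] have "(cdf nu \<longlongrightarrow> cdf mu 0) (at_right 0)" by simp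
 then have "cdf mu 0 = cdf nu 0" using r0[OF fb(2)] by (intro tendsto_unique[of "at_right 0"]) auto
 then have "cdf mu x = cdf nu x" for x
  using gt[of x] lt[OF pos(1) _ s(1), of x] lt[OF pos(2) _ s(2), of x] by (cases x "0::real" rule: linorder_cases) auto
 then show "mu = nu" by (intro cdf_unique' fb) auto
qed auto

definition family_sum :: "real => (real => real) => ('i => real) => 'i set => real" where
 "family_sum et f len I = (\<Sum>i\<in>{i\<in>I. et < len i}. f (len i))"

text \<open>Summed over the lengths, these functions approximate a combination of counts with the
  integer weights \<open>k j\<close>, so that exponentials of the sums lead to joint Laplace
  transforms of counts at integer points.\<close>

definition ramps :: "('j => nat) => ('j => real) => 'j set => nat => real => real" where
 "ramps k x J n y = (\<Sum>j\<in>J. real (k j) * ramp (x j) n y)"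

text \<open>A common positive threshold below all levels; the inserted 1 covers empty
  \<open>J\<close>.\<close>

definition cut :: "('j => real) => 'j set => real" where
 "cut x J = Min (insert 1 (x ` J))"

context
 fixes x :: "'j => real" and J :: "'j set"
 assumes J: "finite J" and x: "!!j. 0 < x j"
begin

lemma cut: "0 < cut x J" "j : J ==> cut x J <= x j"
 unfolding cut_def using x J by (auto simp: Min_gr_iff intro!: Min_le)

text \<open>Division by \<open>max (cut x J) y\<close> in place of y keeps the quotient bounded and
  continuous. Below the cut the numerator is 0, so the product with y is unaffected.\<close>

lemma gap_test_ramps: "gap_test (%y. ramps k x J n y / max (cut x J) y) (ramps k x J n) (cut x J) ((\<Sum>j\<in>J. real (k j)) / cut x J)"
proof
 have f: "0 <= ramps k x J n y" "ramps k x J n y <= (\<Sum>j\<in>J. real (k j))" for y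
  unfolding ramps_def by (auto intro!: sum_nonneg sum_mono mult_left_le simp: ramp_bounds)
 show z: "ramps k x J n y / max (cut x J) y = 0" if "y <= cut x J" for y
 proof -
  have "ramp (x j) n y = 0" if "j : J" for j
   by (rule ramp_zero) (use cut(2)[OF that] \<open>y <= cut x J\<close> in linarith)
  then show ?thesis by (simp add: ramps_def)
 qed
 show "0 <= ramps k x J n y / max (cut x J) y & ramps k x J n y / max (cut x J) y <= (\<Sum>j\<in>J. real (k j)) / cut x J" for y
  using f[of y] cut(1) by (auto intro!: divide_nonneg_pos frac_le sum_nonneg)
 show "continuous_on UNIV (%y. ramps k x J n y / max (cut x J) y)"
  unfolding ramps_def using cut(1) by (intro continuous_intros) (auto simp: max_def)
 show "ramps k x J n y = y * (ramps k x J n y / max (cut x J) y)" for y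
  using z[of y] cut(1) by (cases "y <= cut x J") auto
qed (rule cut)

lemma family_sum_ramps_limit:
 assumes fin: "!!x. 0 < x ==> finite {i\<in>I. x < len i}"
 shows "(%n. family_sum (cut x J) (ramps k x J n) len I) ----> (\<Sum>j\<in>J. real (k j) * real (card {i\<in>I. x j < len i}))"
proof -
 let ?A = "{i\<in>I. cut x J < len i}"
 have "(\<Sum>i\<in>?A. \<Sum>j\<in>J. real (k j) * (if x j < len i then 1 else 0)) = (\<Sum>j\<in>J. real (k j) * real (card {i\<in>I. x j < len i}))"
 proof (subst sum.swap, rule sum.cong)
  fix j assume "j : J"
  then have e: "?A \<inter> {i. x j < len i} = {i\<in>I. x j < len i}" using cut(2)[of j] by auto
  have "(\<Sum>i\<in>?A. (if x j < len i then 1 else 0 :: real)) = real (card {i\<in>I. x j < len i})"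
   using fin[OF cut(1)] by (simp add: sum.If_cases e)
  then show "(\<Sum>i\<in>?A. real (k j) * (if x j < len i then 1 else 0)) = real (k j) * real (card {i\<in>I. x j < len i})"
   by (simp add: sum_distrib_left[symmetric])
 qed simp
 moreover have "(%n. family_sum (cut x J) (ramps k x J n) len I) ----> (\<Sum>i\<in>?A. \<Sum>j\<in>J. real (k j) * (if x j < len i then 1 else 0))"
  unfolding family_sum_def ramps_def by (intro tendsto_sum tendsto_mult_left ramp_tendsto)
 ultimately show ?thesis by simp
qed

end

text \<open>Measurability is assumed for the functionals of continuous test functions; counts and
  ranks inherit it as limits.\<close>

locale ranked_family = prob_space M for M :: "'a measure" +
 fixes len :: "'a => 'i => real" and I :: "'a => 'i set"
 assumes fin: "!!om x. om : space M ==> 0 < x ==> finite {i\<in>I om. x < len om i}"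
  and meas: "!!h f et B. gap_test h f et B ==> (%om. family_sum et f (len om) (I om)) : borel_measurable M"
begin

abbreviation "cnt x om \<equiv> real (card {i\<in>I om. x < len om i})"
abbreviation "rnk om \<equiv> ranked (len om) (I om)"

lemma count_measurable:
 assumes "0 < x"
 shows "cnt x : borel_measurable M"
proof (rule borel_measurable_LIMSEQ_real)
 show "(%n. family_sum (cut (%_. x) {()}) (ramps (%_. 1) (%_. x) {()} n) (len om) (I om)) ----> cnt x om" if "om : space M" for om
  using family_sum_ramps_limit[of "{()}" "%_. x", OF _ assms fin[OF that], of "%_. 1"] by simp
 show "(%om. family_sum (cut (%_. x) {()}) (ramps (%_. 1) (%_. x) {()} n) (len om) (I om)) : borel_measurable M" for n
  by (rule meas[OF gap_test_ramps]) (simp_all add: assms)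
qed

lemma rank_le_iff: "om : space M ==> 0 < y ==> rnk om n <= y \<longleftrightarrow> cnt y om <= real n"
 using ranked_le_iff[OF fin, of om y n] by simp

lemma rank_measurable [measurable]: "(%om. rnk om n) : borel_measurable M"
proof (rule borel_measurable_iff_le[THEN iffD2], rule allI)
 have pos: "{om\<in>space M. rnk om n <= y} : sets M" if "0 < y" for y
 proof -
  have "{om\<in>space M. rnk om n <= y} = {om\<in>space M. cnt y om <= real n}" using rank_le_iff that by blast
  also have "... : sets M" using count_measurable[OF that] by measurable
  finally show ?thesis .
 qed
 fix y
 \<comment> \<open>Counts decide this inequality for positive levels only, so the level 0 is
   approached from above.\<close>
 have "rnk om n <= y \<longleftrightarrow> 0 <= y & (\<forall>k. rnk om n <= y + 1 / real (Suc k))" if "om : space M" for om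
 proof safe
  assume y: "0 <= y" and k: "\<forall>k. rnk om n <= y + 1 / real (Suc k)"
  have "rnk om n - y <= 0"
  proof (rule ccontr)
   assume "\<not> rnk om n - y <= 0"
   then obtain j where "1 / real (Suc j) < rnk om n - y" using nat_approx_posE[of "rnk om n - y"] by auto
   then show False using spec[OF k, of j] by simp
  qed
  then show "rnk om n <= y" by simp
 qed (use ranked_nonneg[OF fin[OF that], of n] in \<open>auto intro: order_trans add_increasing2\<close>)
 then have "{om\<in>space M. rnk om n <= y} = {om\<in>space M. 0 <= y & (\<forall>k. rnk om n <= y + 1 / real (Suc k))}" by blast
 also have "... : sets M"
  by (cases "0 <= y") (auto intro!: sets.sets_Collect_countable_All pos add_nonneg_pos)
 finally show "{om\<in>space M. rnk om n <= y} : sets M" .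
qed

lemma rank_path_measurable: "rnk : M \<rightarrow>\<^sub>M (\<Pi>\<^sub>M n\<in>UNIV. borel)"
 by (rule measurable_PiM_single') auto

lemma count_laplace_limit:
 assumes J: "finite J" and x: "!!j. 0 < x j"
 shows "(%n. expectation (%om. exp (- family_sum (cut x J) (ramps k x J n) (len om) (I om)))) ---->
  expectation (%om. exp (- (\<Sum>j\<in>J. real (k j) * cnt (x j) om)))"
proof (rule integral_dominated_convergence[where w="%_. 1"])
 let ?A = "%n om. - family_sum (cut x J) (ramps k x J n) (len om) (I om)"
 show "AE om in M. (%n. exp (?A n om)) ----> exp (- (\<Sum>j\<in>J. real (k j) * cnt (x j) om))"
  by (intro AE_I2 tendsto_intros family_sum_ramps_limit J x fin)
 show "AE om in M. norm (exp (?A n om)) <= 1" for n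
  by (auto simp: family_sum_def ramps_def ramp_bounds intro!: sum_nonneg)
 show "(%om. exp (- (\<Sum>j\<in>J. real (k j) * cnt (x j) om))) : borel_measurable M"
  by (intro measurable_compose[OF _ borel_measurable_exp] borel_measurable_uminus borel_measurable_sum borel_measurable_times count_measurable x) auto
 show "(%om. exp (?A n om)) : borel_measurable M" for n
  using meas[OF gap_test_ramps[OF J x, where k=k and n=n]] by measurable
qed simp

end

text \<open>The counts \<open>card {i. len i > x}\<close> are limits of sums of continuous test functions vanishing near
 \<open>0\<close>, and they determine the ranked sequence.\<close>

lemma ranked_law_unique:
 assumes "ranked_family M len I" and "ranked_family N len' I'"
  and eq: "!!h f et B. gap_test h f et B ==> (LINT om|M. exp (- family_sum et f (len om) (I om))) = (LINT om|N. exp (- family_sum et f (len' om) (I' om)))"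
 shows "distr M (\<Pi>\<^sub>M n\<in>UNIV. borel) (%om. ranked (len om) (I om)) = distr N (\<Pi>\<^sub>M n\<in>UNIV. borel) (%om. ranked (len' om) (I' om))"
proof -
 let ?A = "\<Pi>\<^sub>M n\<in>UNIV. borel"
 interpret M: ranked_family M len I by fact
 interpret N: ranked_family N len' I' by fact
 note P = M.prob_space_axioms N.prob_space_axioms
 have counts: "M.prob {om\<in>space M. \<forall>j\<in>J. M.cnt (x j) om : {..real j}} = N.prob {om\<in>space N. \<forall>j\<in>J. N.cnt (x j) om : {..real j}}"
  if x: "!!j. 0 < x j" and J: "finite J" for x :: "nat => real" and J
 proof (rule determining_joint[OF determining_laplace _ P M.count_measurable[OF x] N.count_measurable[OF x]])
  fix ph :: "nat => real => real" assume "!!i. ph i : range (%k x. exp (- real k * x))"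
  then have "\<forall>i. \<exists>k. ph i = (%x. exp (- real k * x))" by blast
  then obtain k where k: "!!i. ph i = (%x. exp (- real (k i) * x))" by metis
  have "(\<Prod>i\<in>J. ph i (z i)) = exp (- (\<Sum>i\<in>J. real (k i) * z i))" for z
   using J by (simp add: k exp_sum sum_negf[symmetric])
  then show "M.expectation (%om. \<Prod>i\<in>J. ph i (M.cnt (x i) om)) = N.expectation (%om. \<Prod>i\<in>J. ph i (N.cnt (x i) om))"
   using LIMSEQ_unique[OF M.count_laplace_limit[OF J x, where k=k]] N.count_laplace_limit[OF J x, where k=k]
   by (simp only: eq[OF gap_test_ramps[OF J x]])
 qed (use J in auto)
 have "distr M ?A (%om. \<lambda>n\<in>UNIV. M.rnk om n) = distr N ?A (%om. \<lambda>n\<in>UNIV. N.rnk om n)"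
 proof (rule determining_law[OF determining_half_lines _ P M.rank_measurable N.rank_measurable])
  fix J :: "nat set" and ph :: "nat => real => real" assume J: "finite J" and "!!i. ph i : {indicator {..x} |x. 0 < x}"
  then have "\<forall>i. \<exists>x>0. ph i = indicator {..x}" by blast
  then obtain x where x: "!!i. 0 < x i" and ph: "!!i. ph i = indicator {..x i}" by metis
  have "{om\<in>space M. \<forall>j\<in>J. M.rnk om j : {..x j}} = {om\<in>space M. \<forall>j\<in>J. M.cnt (x j) om : {..real j}}"
   "{om\<in>space N. \<forall>j\<in>J. N.rnk om j : {..x j}} = {om\<in>space N. \<forall>j\<in>J. N.cnt (x j) om : {..real j}}"
   using M.rank_le_iff N.rank_le_iff x by auto
  then show "M.expectation (%om. \<Prod>i\<in>J. ph i (M.rnk om i)) = N.expectation (%om. \<Prod>i\<in>J. ph i (N.rnk om i))"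
   using measure_all_in[OF J, of M "%j om. M.rnk om j" "%j. {..x j}"] measure_all_in[OF J, of N "%j om. N.rnk om j" "%j. {..x j}"] counts[OF x J]
   by (simp add: ph)
 qed (use ranked_nonneg[OF M.fin] ranked_nonneg[OF N.fin] in auto)
 then show ?thesis by (simp add: restrict_def)
qed

text \<open>The map \<open>r\<close> sends a null set containing all bad points to one good point
  and fixes everything else. It preserves \<open>M\<close>, so composing a process with
  \<open>r\<close> makes an almost sure path property hold everywhere without changing any
  law.\<close>

lemma (in prob_space) good_version:
 assumes "AE om in M. P om"
 obtains r where "r : M \<rightarrow>\<^sub>M M" "!!om. om : space M ==> P (r om)" "AE om in M. r om = om" "distr M M r = M"
proof -
 obtain N where N: "{om\<in>space M. \<not> P om} \<subseteq> N" "N : null_sets M" using assms by (rule AE_E3) blast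
 have "\<not> space M \<subseteq> N"
 proof
  assume "space M \<subseteq> N"
  from emeasure_mono[OF this, of M] N(2) show False by (simp add: null_sets_def emeasure_space_1)
 qed
 then obtain o' where o: "o' : space M" "o' \<notin> N" by blast
 define r where "r om = (if om : N then o' else om)" for om
 have N': "N : sets M" using N(2) by auto
 have rm: "r : M \<rightarrow>\<^sub>M M"
  unfolding r_def[abs_def] using N' o(1) by measurable
 have ae: "AE om in M. r om = om" using AE_not_in[OF N(2)] by eventually_elim (simp add: r_def)
 have "distr M M r = distr M M (%om. om)" by (rule distr_cong_AE[OF refl refl ae rm]) simp
 then have d: "distr M M r = M" by simp
 have "P (r om)" if "om : space M" for om using N(1) o that by (auto simp: r_def)
 then show ?thesis by (rule that[OF rm _ ae d])
qed

text \<open>The weight exp (- t) makes both densities finite, and l = 1 + k then gives their integer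
  Laplace transforms. This yields equality almost everywhere, and continuity extends it to every
  positive time.\<close>

lemma laplace_time_unique:
 fixes F G :: "real => real"
 assumes Fm [measurable]: "F : borel_measurable borel" and Gm [measurable]: "G : borel_measurable borel"
  and b: "!!t. 0 <= F t & F t <= 1" "!!t. 0 <= G t & G t <= 1"
  and c: "continuous_on {0<..} F" "continuous_on {0<..} G"
  and eq: "!!l. 0 < l ==> (\<integral>\<^sup>+t. ennreal (indicator {0<..} t * exp (- l * t) * F t) \<partial>lborel) = (\<integral>\<^sup>+t. ennreal (indicator {0<..} t * exp (- l * t) * G t) \<partial>lborel)"
  and t: "0 < t"
 shows "F t = G t"
proof -
 let ?A = "%t H. indicator {0<..} t * exp (- t) * H t"
 let ?B = "%k H. \<integral>\<^sup>+t. ennreal (indicator {0<..} t * exp (- (1 + real k) * t) * H t) \<partial>lborel"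
 let ?C = "%k D H. \<integral>x. exp (- real k * x) \<partial>D H"
 define D where "D H = density lborel (%t. ennreal (?A t H))" for H :: "real => real"
 have D: "finite_measure (D H)" "sets (D H) = sets borel" "AE x in D H. 0 <= x"
  "!!k::nat. ?C k D H = enn2real (?B k H)"
  if [measurable]: "H : borel_measurable borel" and H: "!!t. 0 <= H t & H t <= 1" for H
 proof -
  have "emeasure (D H) (space (D H)) = (\<integral>\<^sup>+t. ennreal (?A t H) \<partial>lborel)"
   by (simp add: D_def emeasure_density)
  also have "... <= (\<integral>\<^sup>+t. ennreal (indicator {0..} t * exp (- t)) \<partial>lborel)"
   using H by (intro nn_integral_mono ennreal_leI) (auto simp: indicator_def mult_left_le)
  also have "... = (\<integral>\<^sup>+t. ennreal (exp (- t)) * indicator {0..} t \<partial>lborel)"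
   by (intro nn_integral_cong) (auto simp: indicator_def)
  also have "... = ennreal (0 - (- exp (- 0)))"
  proof (rule nn_integral_FTC_atLeast)
   show "((%t::real. - exp (- t)) \<longlongrightarrow> 0) at_top" by real_asymp
  qed (auto intro!: derivative_eq_intros)
  finally have "emeasure (D H) (space (D H)) <= ennreal 1" by simp
  then show "finite_measure (D H)" by (intro finite_measureI) (auto simp: top_unique)
  show "sets (D H) = sets borel" by (simp add: D_def)
  show "AE x in D H. 0 <= x" unfolding D_def by (subst AE_density) (auto simp: indicator_def)
  show "?C k D H = enn2real (?B k H)" for k
  proof -
   have "?C k D H = (LINT t|lborel. ?A t H * exp (- real k * t))"
    unfolding D_def using H by (subst integral_density) (auto simp: mult_ac)
   also have "... = enn2real (\<integral>\<^sup>+t. ennreal (?A t H * exp (- real k * t)) \<partial>lborel)"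
    using H by (intro integral_eq_nn_integral) auto
   also have "(%t. ?A t H * exp (- real k * t)) = (%t. indicator {0<..} t * exp (- (1 + real k) * t) * H t)"
    by (simp add: fun_eq_iff algebra_simps exp_add[symmetric])
   finally show ?thesis .
  qed
 qed
 have "D F = D G"
 proof (rule laplace_unique[OF D(1-3)[OF Fm b(1)] D(1-3)[OF Gm b(2)]])
  show "(LINT x|D F. exp (- real k * x)) = (LINT x|D G. exp (- real k * x))" for k
   unfolding D(4)[OF Fm b(1)] D(4)[OF Gm b(2)] by (simp only: eq[of "1 + real k"]) 
 qed
 then have "AE t in lborel. ennreal (indicator {0<..} t * exp (- t) * F t) = ennreal (indicator {0<..} t * exp (- t) * G t)"
  unfolding D_def by (intro sigma_finite_measure.density_unique[OF lborel.sigma_finite_measure_axioms]) auto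
 then have ae: "AE t in lborel. 0 < t --> F t = G t"
  by eventually_elim (auto simp: indicator_def b ennreal_inj)
 show ?thesis
 proof (rule ccontr)
  assume ne: "F t ~= G t"
  have "isCont (%t. F t - G t) t"
   using c t by (intro isCont_diff) (auto simp: continuous_on_eq_continuous_at)
  then have "eventually (%s. F s - G s ~= 0) (at t)"
   using ne by (intro tendsto_imp_eventually_ne[of _ "F t - G t"]) (auto simp: isCont_def)
  then obtain d where d: "0 < d" "!!s. s ~= t ==> dist s t < d ==> F s ~= G s"
   by (auto simp: eventually_at)
  have "AE s in lborel. s \<notin> {t<..<t + d}"
   using ae by eventually_elim (use d t in \<open>auto simp: dist_real_def\<close>)
  then have "{t<..<t + d} : null_sets lborel" by (subst AE_iff_null_sets) auto
  then show False using d by (auto simp: null_sets_def)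
 qed
qed

section \<open>Versions of stable subordinators with regular paths\<close>

text \<open>The path properties hold at every sample point. Independence and stationarity are
  recorded as one product formula for functions with values in [0,1], a form that passes to versions
  directly.\<close>

locale nice_stable = prob_space M for M :: "'a measure" and \<alpha> c :: real and sg :: "real => 'a => real" +
 assumes index: "0 < \<alpha>" "\<alpha> < 1" and scale: "0 < c"
  and rv: "!!s. 0 <= s ==> sg s : borel_measurable M"
  and path: "!!om. om : space M ==> nice_path (%s. sg s om)"
  and strict: "!!om s r. om : space M ==> 0 <= s ==> s < r ==> sg s om < sg r om"
  and increments: "!!(u::nat => real) (ph::nat => real => real) n. 0 <= u 0 ==> mono u ==> (!!i. ph i : borel_measurable borel) ==>
   (!!i x. 0 <= x ==> 0 <= ph i x & ph i x <= 1) ==>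
   expectation (%om. \<Prod>i<n. ph i (sg (u (Suc i)) om - sg (u i) om)) = (\<Prod>i<n. expectation (%om. ph i (sg (u (Suc i) - u i) om)))"
  and laplace: "!!s th. 0 <= s ==> 0 <= th ==> expectation (%om. exp (- th * sg s om)) = exp (- c * s * th powr \<alpha>)"

context stable_subordinator
begin

lemma AE_nonneg: "0 <= s ==> AE om in M. 0 <= S s om"
proof -
 assume s: "0 <= s"
 show ?thesis using starts_at_0 nondecreasing_paths
 proof eventually_elim
  case (elim om)
  show ?case using mono_onD[OF elim(2), of 0 s] s elim(1) by simp
 qed
qed

lemma laplace0:
 assumes "0 <= s" "0 <= th"
 shows "expectation (%om. exp (- th * S s om)) = exp (- c * s * th powr \<alpha>)"
proof (cases "s = 0 \<or> th = 0")
 case True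
 have "expectation (%om. exp (- th * S s om)) = expectation (%om. 1)"
 proof (rule integral_cong_AE)
  show "AE om in M. exp (- th * S s om) = 1"
   using starts_at_0 by eventually_elim (use True in auto)
 qed (use random_variable[OF assms(1)] in auto)
 then show ?thesis using True index by (auto simp: prob_space)
qed (use laplace_transform[of s th] assms in auto)

lemma exp_neg_integrable: "0 <= s ==> 0 <= th ==> integrable M (%om. exp (- th * S s om))"
 using AE_nonneg[of s] random_variable[of s]
 by (intro integrable_const_bound[where B=1]) (auto elim!: eventually_mono)

text \<open>The indicator of a nonpositive increment is at most exp of -k times the increment, whose
  expectation tends to 0 as k grows. Stationarity reduces the increment to
  \<open>S (r - s)\<close>.\<close>

lemma AE_increment_pos:
 assumes "0 <= s" "s < r"
 shows "AE om in M. S s om < S r om"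
proof -
 let ?A = "%k. - c * (r - s) * real k powr \<alpha>"
 note [measurable] = random_variable[OF assms(1)] random_variable[of r] random_variable[of "r - s"]
 have m: "S (r - s) : borel_measurable M" "S r : borel_measurable M" "S s : borel_measurable M"
  using assms random_variable by auto
 define p where "p = prob {om\<in>space M. S (r - s) om <= 0}"
 have le: "p <= exp (?A k)" for k :: nat
 proof -
  have "p = expectation (indicator {om\<in>space M. S (r - s) om <= 0})" using m by (simp add: p_def)
  also have "... <= expectation (%om. exp (- real k * S (r - s) om))"
  proof (rule integral_mono_AE)
   show "AE om in M. indicator {om\<in>space M. S (r - s) om <= 0} om <= exp (- real k * S (r - s) om)"
    by (intro AE_I2) (auto simp: indicator_def mult_nonneg_nonpos)
  qed (use m assms exp_neg_integrable[of "r - s" "real k"] in \<open>auto intro!: integrable_real_indicator simp: less_top[symmetric] emeasure_eq_measure\<close>)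
  also have "... = exp (?A k)" using assms by (intro laplace0) auto
  finally show ?thesis .
 qed
 have "(%k::nat. exp (?A k)) ----> 0"
 proof -
  have "filterlim (%k::nat. real k powr \<alpha>) at_top sequentially" using index by real_asymp
  then have "filterlim (%k::nat. (c * (r - s)) * real k powr \<alpha>) at_top sequentially"
   using assms scale_pos by (intro filterlim_tendsto_pos_mult_at_top[OF tendsto_const]) auto
  then have "filterlim (%k::nat. - ((c * (r - s)) * real k powr \<alpha>)) at_bot sequentially"
   by (simp add: filterlim_uminus_at_bot)
  from filterlim_compose[OF exp_at_bot this] show ?thesis by simp
 qed
 then have "p <= 0" using le by (intro LIMSEQ_le_const) auto
 then have p0: "p = 0" unfolding p_def by (simp add: measure_le_0_iff)
 have "measure (distr M borel (%om. S (s + (r - s)) om - S s om)) {..0} = measure (distr M borel (S (r - s))) {..0}"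
  using stationary_increments[of s "r - s"] assms by simp
 then have "prob {om\<in>space M. S r om - S s om <= 0} = p"
  using m by (simp add: measure_distr p_def vimage_def Int_def conj_commute)
 then have "AE om in M. \<not> (S r om - S s om <= 0)"
  using p0 m by (intro AE_I'[of "{om\<in>space M. S r om - S s om <= 0}"]) (auto simp: null_sets_def emeasure_eq_measure)
 then show ?thesis by eventually_elim auto
qed

text \<open>Markov's inequality for exp (- S n) bounds the probability of S n being at most K by exp
  (K - c n).\<close>

lemma AE_unbounded: "AE om in M. \<exists>s\<ge>0. K < S s om"
proof -
 let ?A = "%n. %om. exp K * exp (- 1 * S (real n) om)"
 note m = random_variable
 define A where "A n = {om\<in>space M. S (real n) om <= K}" for n :: nat
 have A: "A n : sets M" for n unfolding A_def using m[of "real n"] by measurable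
 have le: "prob (A n) <= exp K * exp (- c * real n)" for n
 proof -
  have "prob (A n) = expectation (indicator (A n))" using A sets.sets_into_space[OF A] by (simp add: Int_absorb2)
  also have "... <= expectation (?A n)"
  proof (rule integral_mono_AE)
   show "AE om in M. indicator (A n) om <= exp K * exp (- 1 * S (real n) om)"
    by (intro AE_I2) (auto simp: indicator_def A_def exp_add[symmetric])
   show "integrable M (?A n)"
    using exp_neg_integrable[of "real n" 1] by (intro integrable_mult_right) auto
  qed (use A in \<open>auto intro!: integrable_real_indicator simp: less_top[symmetric] emeasure_eq_measure\<close>)
  also have "... = exp K * exp (- c * real n)" using laplace0[of "real n" 1] by simp
  finally show ?thesis .
 qed
 have "(%n::nat. exp K * exp (- c * real n)) ----> 0" using scale_pos by real_asymp
 moreover have "prob (\<Inter>n. A n) <= exp K * exp (- c * real n)" for n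
  using A by (intro order_trans[OF finite_measure_mono le[of n]]) auto
 ultimately have "prob (\<Inter>n. A n) <= 0" by (intro LIMSEQ_le_const) blast+
 then have "(\<Inter>n. A n) : null_sets M"
  using A by (auto simp: null_sets_def emeasure_eq_measure measure_le_0_iff)
 then have "AE om in M. om \<notin> (\<Inter>n. A n)" by (rule AE_not_in)
 then show ?thesis using AE_space
 proof eventually_elim
  case (elim om)
  then obtain n where "K < S (real n) om" by (auto simp: A_def not_le)
  then show ?case by (intro exI[of _ "real n"]) simp
 qed
qed

lemma AE_nice: "AE om in M. nice_path (%s. S s om) & (\<forall>s r. 0 <= s --> s < r --> S s om < S r om)"
proof -
 have "AE om in M. \<forall>q\<in>\<rat>. \<forall>r\<in>\<rat>. 0 <= q & q < r --> S q om < S r om"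
  using AE_increment_pos by (intro AE_ball_countable[OF countable_rat, THEN iffD2] ballI) auto
 moreover have "AE om in M. \<forall>n::nat. \<exists>s\<ge>0. real n < S s om"
  using AE_unbounded by (simp add: AE_all_countable)
 ultimately show ?thesis
  using starts_at_0 nondecreasing_paths right_continuous_paths
 proof eventually_elim
  case (elim om)
  have "\<exists>s\<ge>0. K < S s om" for K
  proof -
   obtain n :: nat where "K < real n" using reals_Archimedean2 by blast
   then show ?thesis using elim(2) by (meson less_trans)
  qed
  then have "nice_path (%s. S s om)" using elim by (auto simp: nice_path_def)
  moreover have "S s om < S r om" if sr: "0 <= s" "s < r" for s r
  proof -
   \<comment> \<open>Two rationals between s and r reduce strict growth to the countably many
     rational pairs; monotonicity covers the outer pieces.\<close>
   obtain q where q: "q : \<rat>" "s < q" "q < r" using Rats_dense_in_real[OF sr(2)] by blast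
   obtain q' where q': "q' : \<rat>" "q < q'" "q' < r" using Rats_dense_in_real[OF q(3)] by blast
   have "S s om <= S q om" "S q om < S q' om" "S q' om <= S r om"
    using elim sr q q' by (auto simp: mono_on_def)
   then show ?thesis by linarith
  qed
  ultimately show ?case by blast
 qed
qed

lemma increments_product:
 fixes u :: "nat => real"
 assumes u: "0 <= u 0" "mono u" and ph: "!!i. ph i : borel_measurable borel" "!!i x. 0 <= x ==> 0 <= ph i x & ph i x <= (1::real)"
 shows "expectation (%om. \<Prod>i<n. ph i (S (u (Suc i)) om - S (u i) om)) = (\<Prod>i<n. expectation (%om. ph i (S (u (Suc i) - u i) om)))"
proof -
 let ?A = "%i u. %om. ph i (S (u (Suc i)) om - S (u i) om)"
 let ?B = "%u i. %om. S (u (Suc i)) om - S (u i) om"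
 have u0: "0 <= u i" "u i <= u (Suc i)" for i using u monoD[OF u(2), of 0 i] monoD[OF u(2), of i "Suc i"] by auto
 note m = random_variable[OF u0(1)]
 have ind: "indep_vars (%_. borel) (%i om. ph i (S (u (Suc i)) om - S (u i) om)) {..<n}"
  using indep_vars_compose2[OF indep_increments[OF u, of n], where Y=ph and N="%_. borel"] ph(1) by auto
 have int: "integrable M (?A i u)" for i
 proof (rule integrable_const_bound[where B=1])
  show "AE om in M. norm (ph i (S (u (Suc i)) om - S (u i) om)) <= 1"
   using nondecreasing_paths
  proof eventually_elim
   case (elim om)
   then have "0 <= S (u (Suc i)) om - S (u i) om" using u0[of i] u0[of "Suc i"] by (auto simp: mono_on_def)
   from ph(2)[OF this] show ?case by simp
  qed
  show "(?A i u) : borel_measurable M"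
   by (rule measurable_compose[OF _ ph(1)]) (use m in simp)
 qed
 have "expectation (?A i u) = expectation (%om. ph i (S (u (Suc i) - u i) om))" for i
 proof -
  have "distr M borel (?B u i) = distr M borel (S (u (Suc i) - u i))"
   using stationary_increments[of "u i" "u (Suc i) - u i"] u0[of i] by simp
  then have "(\<integral>x. ph i x \<partial>distr M borel (?B u i)) = (\<integral>x. ph i x \<partial>distr M borel (S (u (Suc i) - u i)))" by simp
  then show ?thesis using m u0[of i] ph(1) random_variable[of "u (Suc i) - u i"] by (simp add: integral_distr)
 qed
 then show ?thesis using indep_vars_lebesgue_integral[OF _ ind int] by simp
qed

lemma nice_version:
 obtains S' where "nice_stable M \<alpha> c S'" "AE om in M. \<forall>s. S' s om = S s om"
proof -
 let ?A = "%n ph u r. %om. \<Prod>i<n. ph i (S (u (Suc i)) (r om) - S (u i) (r om))"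
 let ?B = "%n ph u r. \<Prod>i<n. expectation (%om. ph i (S (u (Suc i) - u i) (r om)))"
 obtain r where r: "r : M \<rightarrow>\<^sub>M M" "!!om. om : space M ==> nice_path (%s. S s (r om)) & (\<forall>s t. 0 <= s --> s < t --> S s (r om) < S t (r om))"
  "AE om in M. r om = om" "distr M M r = M" by (rule good_version[OF AE_nice]) blast
 have E: "expectation (%om. F (r om)) = expectation F" if "F : borel_measurable M" for F :: "'a => real"
  using integral_distr[OF r(1) that] r(4) by simp
 have "nice_stable M \<alpha> c (%s om. S s (r om))"
 proof
  show "expectation (%om. exp (- th * S s (r om))) = exp (- c * s * th powr \<alpha>)" if "0 <= s" "0 <= th" for s th
   using laplace0[OF that] random_variable[OF that(1)] by (subst E) auto
  fix u :: "nat => real" and ph :: "nat => real => real" and n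
  assume u: "0 <= u 0" "mono u" and ph: "!!i. ph i : borel_measurable borel" "!!i x. 0 <= x ==> 0 <= ph i x & ph i x <= 1"
  have u0: "0 <= u i" "0 <= u (Suc i) - u i" for i using u monoD[OF u(2), of 0 i] monoD[OF u(2), of i "Suc i"] by auto
  note m = random_variable[OF u0(1)] random_variable[OF u0(2)]
  have "expectation (?A n ph u r) = expectation (%om. \<Prod>i<n. ph i (S (u (Suc i)) om - S (u i) om))"
   by (rule E[of "%om. \<Prod>i<n. ph i (S (u (Suc i)) om - S (u i) om)"])
     (intro borel_measurable_prod measurable_compose[OF _ ph(1)] borel_measurable_diff m)
  also have "... = (\<Prod>i<n. expectation (%om. ph i (S (u (Suc i) - u i) om)))" by (rule increments_product[OF u ph])
  also have "... = ?B n ph u r"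
   by (intro prod.cong refl E[symmetric] measurable_compose[OF m(2) ph(1)])
  finally show "expectation (?A n ph u r) =
   (?B n ph u r)" .
 qed (use index scale_pos r(2) in \<open>auto intro!: measurable_compose[OF r(1) random_variable]\<close>)
 moreover have "AE om in M. \<forall>s. S s (r om) = S s om" using r(3) by eventually_elim simp
 ultimately show ?thesis by (rule that)
qed

end

text \<open>Compared with the powers of 1 - L / (n + 1), using that n-th powers on the unit interval
  differ by at most n times the difference of the bases.\<close>

lemma one_minus_power_limit:
 fixes x :: "nat => real"
 assumes x: "(%n. real (Suc n) * x n) ----> L" and b: "!!n. 0 <= x n & x n <= 1" and L: "0 <= L"
 shows "(%n. (1 - x n) ^ n) ----> exp (- L)"
proof -
 have y: "(%n. (1 - L / real (Suc n)) ^ n) ----> exp (- L)"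
  by real_asymp
 have "(%n. \<bar>real (Suc n) * x n - L\<bar>) ----> 0"
  using tendsto_rabs[OF tendsto_diff[OF x tendsto_const[of L]]] by simp
 then have "(%n. (1 - x n) ^ n - (1 - L / real (Suc n)) ^ n) ----> 0"
 proof (rule Lim_null_comparison[rotated])
  have "\<forall>\<^sub>F n in sequentially. L < real (Suc n)"
   by real_asymp
  then show "\<forall>\<^sub>F n in sequentially. norm ((1 - x n) ^ n - (1 - L / real (Suc n)) ^ n) <= \<bar>real (Suc n) * x n - L\<bar>"
  proof eventually_elim
   case (elim n)
   then have l: "0 <= L / real (Suc n)" "L / real (Suc n) <= 1" using L by (auto simp: divide_le_eq)
   have "norm ((1 - x n) ^ n - (1 - L / real (Suc n)) ^ n) <= real n * norm ((1 - x n) - (1 - L / real (Suc n)))"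
    by (rule norm_power_diff) (use b[of n] l in auto)
   also have "... <= real (Suc n) * \<bar>x n - L / real (Suc n)\<bar>"
    by (intro mult_mono) auto
   also have "... = \<bar>real (Suc n) * (x n - L / real (Suc n))\<bar>" by (simp add: abs_mult)
   also have "real (Suc n) * (x n - L / real (Suc n)) = real (Suc n) * x n - L" by (simp add: field_simps)
   finally show ?case .
  qed
 qed
 from tendsto_add[OF this y] show ?thesis by simp
qed

section \<open>The Poisson-Dirichlet law\<close>

lemma mult_exp_neg_le: "x * exp (- x) <= 1" for x :: real
proof -
 have "x * exp (- x) <= exp x * exp (- x)"
 proof (rule mult_right_mono)
  show "x <= exp x" using exp_ge_add_one_self[of x] by linarith
 qed simp
 then show ?thesis by (simp only: exp_minus_inverse)
qed

lemma mult_exp_neg_bound: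
 fixes s a j :: real
 assumes "0 <= s" "0 < a" "0 <= j"
 shows "0 <= s * exp (- a * s - j)" "s * exp (- a * s - j) <= 1 / a"
proof -
 show "0 <= s * exp (- a * s - j)" using assms by simp
 have "s * exp (- a * s - j) <= s * exp (- (a * s))" using assms by (intro mult_left_mono) auto
 also have "... <= 1 / a" using mult_exp_neg_le[of "a * s"] assms(2) by (simp add: pos_le_divide_eq mult_ac)
 finally show "s * exp (- a * s - j) <= 1 / a" .
qed

text \<open>The endpoint limits that \<open>vague_limit\<close> requires of the two integrands in
  the exponential formula. Near 0 the term g vanishes, at infinity exp (- a * x) dominates.\<close>

lemma ratio_limits:
 fixes g :: "real => real"
 assumes a: "0 < a" and et: "0 < et" and g0: "!!x. x <= et ==> g x = 0" and gn: "!!x. 0 <= g x"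
 shows "((%x. (1 - exp (- a * x - g x)) / (1 - exp (- x))) \<longlongrightarrow> a) (at_right 0)"
  and "((%x. (1 - exp (- a * x - g x)) / (1 - exp (- x))) \<longlongrightarrow> 1) at_top"
  and "((%x. (x * exp (- a * x - g x)) / (1 - exp (- x))) \<longlongrightarrow> 1) (at_right 0)"
  and "((%x. (x * exp (- a * x - g x)) / (1 - exp (- x))) \<longlongrightarrow> 0) at_top"
proof -
 let ?A = "%x. (1 - exp (- a * x - g x)) / (1 - exp (- x))"
 let ?B = "%x. (x * exp (- a * x - g x)) / (1 - exp (- x))"
 have ev: "eventually (%x. g x = 0) (at_right 0)"
  using et g0 by (auto simp: eventually_at_right_field intro!: exI[of _ et])
 have "((%x. (1 - exp (- a * x)) / (1 - exp (- x))) \<longlongrightarrow> a) (at_right 0)"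
  using a by real_asymp
 then show "(?A \<longlongrightarrow> a) (at_right 0)"
  by (rule Lim_transform_eventually) (use ev in eventually_elim, simp)
 have "((%x. (x * exp (- a * x)) / (1 - exp (- x))) \<longlongrightarrow> 1) (at_right 0)"
  using a by real_asymp
 then show "(?B \<longlongrightarrow> 1) (at_right 0)"
  by (rule Lim_transform_eventually) (use ev in eventually_elim, simp)
 have le: "exp (- a * x - g x) <= exp (- a * x)" for x using gn[of x] by simp
 have e0: "((%x. exp (- a * x - g x)) \<longlongrightarrow> 0) at_top"
 proof (rule tendsto_sandwich[OF _ _ tendsto_const])
  show "((%x. exp (- a * x)) \<longlongrightarrow> 0) at_top" using a by real_asymp
 qed (auto intro!: always_eventually gn)
 have d: "((%x::real. 1 - exp (- x)) \<longlongrightarrow> 1) at_top" by real_asymp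
 have "(?A \<longlongrightarrow> (1 - 0) / 1) at_top"
  by (intro tendsto_divide tendsto_diff tendsto_const e0 d) simp
 then show "(?A \<longlongrightarrow> 1) at_top" by simp
 have xe: "((%x. x * exp (- a * x - g x)) \<longlongrightarrow> 0) at_top"
 proof (rule tendsto_sandwich[OF _ _ tendsto_const])
  show "((%x. x * exp (- a * x)) \<longlongrightarrow> 0) at_top" using a by real_asymp
  show "\<forall>\<^sub>F x in at_top. x * exp (- a * x - g x) <= x * exp (- a * x)"
   using eventually_ge_at_top[of 0] by eventually_elim (intro mult_left_mono le)
  show "\<forall>\<^sub>F x in at_top. 0 <= x * exp (- a * x - g x)"
   using eventually_ge_at_top[of 0] by eventually_elim simp
 qed
 have "(?B \<longlongrightarrow> 0 / 1) at_top"
  by (intro tendsto_divide xe d) simp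
 then show "(?B \<longlongrightarrow> 0) at_top" by simp
qed

context gap_test
begin

text \<open>With \<open>levy \<alpha>\<close> as jump measure this is the exponent obtained when
  every jump y is weighted by exp (- l * y - f y). The function \<open>age_rate\<close> is its
  derivative in l and enters through size biasing.\<close>

definition jump_rate :: "real => real => real" where
 "jump_rate \<alpha> l = (LINT y|levy \<alpha>. 1 - exp (- l * y - f y))"

definition age_rate :: "real => real => real" where
 "age_rate \<alpha> l = (LINT y|levy \<alpha>. y * exp (- l * y - f y))"

lemma integral_levy_scale:
 assumes [measurable]: "F : borel_measurable borel" and F: "!!x. 0 < x ==> 0 <= F x" and r: "0 < r"
 shows "(LINT x|levy \<alpha>. F (r * x)) = r powr \<alpha> * (LINT x|levy \<alpha>. F x)"
proof -
 let ?A = "\<integral>\<^sup>+x. ennreal (F x) \<partial>levy \<alpha>"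
 let ?B = "\<integral>\<^sup>+x. ennreal (F (r * x)) \<partial>levy \<alpha>"
 have nn: "AE x in levy \<alpha>. 0 <= F x" "AE x in levy \<alpha>. 0 <= F (r * x)"
  using AE_levy_pos[of \<alpha>] by (eventually_elim, simp add: F r)+
 have "(LINT x|levy \<alpha>. F (r * x)) = enn2real ?B"
  by (rule integral_eq_nn_integral) (use nn in auto)
 also have "?B = ennreal (r powr \<alpha>) * ?A"
  by (rule nn_integral_levy_scale) (use r in auto)
 also have "enn2real ... = r powr \<alpha> * enn2real ?A"
  by (simp add: enn2real_mult)
 also have "enn2real ?A = (LINT x|levy \<alpha>. F x)"
  by (rule integral_eq_nn_integral[symmetric]) (use nn in auto)
 finally show ?thesis .
qed

lemma test_continuous: "continuous_on S (%x. exp (- l * x - f (r * x)))"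
 by (intro continuous_intros continuous_on_compose2[OF f_cont]) auto

lemma rates_integrable:
 assumes \<alpha>: "0 < \<alpha>" "\<alpha> < 1" and l: "0 < l"
 shows "integrable (levy \<alpha>) (%y. 1 - exp (- l * y - f y))" "integrable (levy \<alpha>) (%y. y * exp (- l * y - f y))"
proof -
 have k: "(%y. exp (- l * y - f y)) : borel_measurable borel" by measurable
 have c: "continuous_on S (%y. exp (- l * y - f y))" for S using test_continuous[of S l 1] by simp
 note R = ratio_limits[OF l eta f_zero f_nonneg]
 show "integrable (levy \<alpha>) (%y. 1 - exp (- l * y - f y))"
  by (rule ratio_integrable[OF \<alpha> _ _ _ R(1,2)]) (use eta in \<open>auto intro!: continuous_intros c continuous_on_subset[OF f_cont] simp: f_zero\<close>)
 show "integrable (levy \<alpha>) (%y. y * exp (- l * y - f y))"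
  by (rule ratio_integrable[OF \<alpha> _ _ _ R(3,4)]) (auto intro!: continuous_intros c continuous_on_subset[OF f_cont])
qed

lemma jump_rate_pos:
 assumes \<alpha>: "0 < \<alpha>" "\<alpha> < 1" and l: "0 < l"
 shows "0 < jump_rate \<alpha> l"
proof -
 have "0 < l powr \<alpha> * levy_const \<alpha>" using levy_const_pos[OF \<alpha>] l by simp
 also have "... = (LINT x|levy \<alpha>. 1 - exp (- l * x))" using integral_levy_exp(2)[OF \<alpha>, of l] l by simp
 also have "... <= jump_rate \<alpha> l"
  unfolding jump_rate_def using integral_levy_exp(1)[OF \<alpha>, of l] l rates_integrable(1)[OF \<alpha> l] f_nonneg
  by (intro integral_mono) auto
 finally show ?thesis .
qed

lemma age_rate_nonneg: "0 <= age_rate \<alpha> l"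
 unfolding age_rate_def by (rule integral_nonneg_AE) (use AE_levy_pos in eventually_elim, simp)

text \<open>Both follow from the scaling of \<open>levy\<close>; the second integrand carries one
  factor x unscaled, which costs a factor 1 / r.\<close>

lemma rates_scale:
 assumes r: "0 < r" and l: "0 < l"
 shows "(LINT x|levy \<alpha>. 1 - exp (- (l * r) * x - f (r * x))) = r powr \<alpha> * jump_rate \<alpha> l"
  "(LINT x|levy \<alpha>. x * exp (- (l * r) * x - f (r * x))) = r powr (\<alpha> - 1) * age_rate \<alpha> l"
proof -
 let ?A = "\<integral>x. x * exp (- (l * r) * x - f (r * x)) \<partial>levy \<alpha>"
 have nn: "exp (- (l * x) - f x) <= 1" if "0 < x" for x
  using mult_pos_pos[OF l that] f_nonneg[of x] by simp
 show "(LINT x|levy \<alpha>. 1 - exp (- (l * r) * x - f (r * x))) = r powr \<alpha> * jump_rate \<alpha> l"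
  using integral_levy_scale[of "%x. 1 - exp (- (l * x) - f x)" r \<alpha>] r nn by (simp add: jump_rate_def mult_ac)
 have "?A = (LINT x|levy \<alpha>. inverse r * ((r * x) * exp (- (l * (r * x)) - f (r * x))))"
  using r by (intro Bochner_Integration.integral_cong) (auto simp: mult_ac)
 also have "... = inverse r * (LINT x|levy \<alpha>. (r * x) * exp (- (l * (r * x)) - f (r * x)))"
  by simp
 also have "... = inverse r * (r powr \<alpha> * age_rate \<alpha> l)"
  using integral_levy_scale[of "%x. x * exp (- (l * x) - f x)" r \<alpha>] r by (simp add: age_rate_def)
 also have "... = r powr (\<alpha> - 1) * age_rate \<alpha> l"
  using r by (simp add: powr_diff field_simps)
 finally show "?A = r powr (\<alpha> - 1) * age_rate \<alpha> l" .
qed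

end

locale stable_test = nice_stable M \<alpha> c sg + gap_test h f et B
 for M :: "'a measure" and \<alpha> c sg h f et B
begin

definition cell :: "nat => nat => 'a => real" where
 "cell n k om = sg (real (Suc k) * (1 / real (Suc n))) om - sg (real k * (1 / real (Suc n))) om"

definition jump_functional :: "real => 'a => real" where
 "jump_functional r om = family_sum et f (%s. r * (sg s om - left_value (%s. sg s om) s)) {0<..1}"

lemma cell_measurable [measurable]: "cell n k : borel_measurable M"
 unfolding cell_def[abs_def] by (intro borel_measurable_diff rv) auto

lemma sigma1_measurable [measurable]: "sg 1 : borel_measurable M"
 by (rule rv) simp

lemma sigma1_pos: "om : space M ==> 0 < sg 1 om"
 using strict[of om 0 1] nice_zero[OF path, of om] by simp

lemma cell_nonneg: "om : space M ==> 0 <= cell n k om"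
 using nice_mono[OF path, of om "real k * (1 / real (Suc n))" "real (Suc k) * (1 / real (Suc n))"]
 by (simp add: cell_def divide_right_mono)

lemma sum_cells: "om : space M ==> (\<Sum>k<Suc n. cell n k om) = sg 1 om"
 using sum_lessThan_telescope[of "%k. sg (real k * (1 / real (Suc n))) om" "Suc n"] nice_zero[OF path, of om]
 by (simp add: cell_def del: of_nat_Suc sum.lessThan_Suc)

lemma nice_path_scale: "om : space M ==> 0 < r ==> nice_path (%s. r * sg s om)"
proof -
 assume om: "om : space M" and r: "0 < r"
 have p: "nice_path (%s. sg s om)" using path[OF om] .
 have "\<exists>s\<ge>0. K < r * sg s om" for K
  using nice_unbounded[OF p, of "K / r"] r by (auto simp: field_simps)
 then show ?thesis using p r by (auto simp: nice_path_def mono_on_def intro!: continuous_intros)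
qed

lemma left_value_scale:
 assumes om: "om : space M" and r: "0 < r" and s: "0 < s"
 shows "left_value (%s. r * sg s om) s = r * left_value (%s. sg s om) s"
 using tendsto_unique[OF _ nice_left[OF nice_path_scale[OF om r] s] tendsto_mult_left[OF nice_left[OF path[OF om] s]]]
 by simp

lemma jump_functional_limit:
 assumes om: "om : space M" and r: "0 < r"
 shows "(%n. \<Sum>k<Suc n. f (r * cell n k om)) ----> jump_functional r om"
proof -
 let ?A = "%s. r * sg s om"
 have "jump_functional r om = (\<Sum>s\<in>{s\<in>{0<..1}. et < r * sg s om - left_value ?A s}. f (r * sg s om - left_value ?A s))"
  unfolding jump_functional_def family_sum_def
  by (rule sum.cong) (auto simp: left_value_scale[OF om r] right_diff_distrib)
 then show ?thesis
  using jump_sum_limit[OF nice_path_scale[OF om r]] strict[OF om] r by (simp add: cell_def right_diff_distrib del: of_nat_Suc sum.lessThan_Suc)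
qed

lemma jump_functional_nonneg: "0 <= jump_functional r om"
 unfolding jump_functional_def family_sum_def by (intro sum_nonneg f_nonneg)

text \<open>The law of one short increment, multiplied by the number of cells, meets the hypothesis
  of \<open>vague_limit\<close> with constant \<open>c\<close>, since n + 1 times 1 - exp (- L / (n
  + 1)) tends to L.\<close>

lemma law_cell:
 defines "nu \<equiv> %n. distr M borel (sg (1 / real (Suc n)))"
 shows "finite_measure (nu n)" "sets (nu n) = sets borel" "AE x in nu n. 0 <= x"
  "!!F. F : borel_measurable borel ==> (LINT x|nu n. F x) = (expectation (%om. F (sg (1 / real (Suc n)) om)) :: real)"
  "(%n. real (Suc n) * (LINT x|nu n. 1 - exp (- real k * x))) ----> c * real k powr \<alpha>"
proof -
 let ?A = "%real n. \<integral>x. 1 - exp (- real k * x) \<partial>nu n"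
 let ?B = "%real n om. - real k * sg (1 / real (Suc n)) om"
 have m: "sg (1 / real (Suc n)) : borel_measurable M" for n by (rule rv) simp
 show "finite_measure (nu n)" unfolding nu_def by (intro prob_space.finite_measure prob_space_distr m)
 show "sets (nu n) = sets borel" by (simp add: nu_def)
 have "AE om in M. 0 <= sg (1 / real (Suc n)) om"
  using AE_space by eventually_elim (auto intro!: nice_nonneg[OF path])
 then show "AE x in nu n. 0 <= x" unfolding nu_def using m by (subst AE_distr_iff) auto
 show I: "(LINT x|nu n. F x) = expectation (%om. F (sg (1 / real (Suc n)) om))" if "F : borel_measurable borel" for F :: "real => real" and n
  unfolding nu_def using m that by (rule integral_distr)
 have "?A real n = 1 - exp (- ((c * real k powr \<alpha>) / real (Suc n)))" for n
 proof -
  have i: "integrable M (%om. exp (?B real n om))"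
  proof (rule integrable_const_bound[where B=1])
   show "AE om in M. norm (exp (?B real n om)) <= 1"
    using AE_space by eventually_elim (auto intro!: mult_nonneg_nonneg nice_nonneg[OF path])
  qed (use m in measurable)
  have "?A real n = expectation (%om. 1 - exp (?B real n om))"
   by (rule I) simp
  also have "... = 1 - expectation (%om. exp (?B real n om))"
   using i by (simp add: prob_space)
  also have "... = 1 - exp (- c * (1 / real (Suc n)) * real k powr \<alpha>)"
   by (subst laplace) auto
  finally show ?thesis by (simp add: field_simps)
 qed
 moreover have "(%n. real (Suc n) * (1 - exp (- (L / real (Suc n))))) ----> L" for L :: real
  by real_asymp
 ultimately show "(%n. real (Suc n) * ?A real n) ----> c * real k powr \<alpha>"
  by (simp only:)
qed

lemma cells_product:
 fixes ph :: "nat => real => real"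
 assumes "!!i. ph i : borel_measurable borel" "!!i x. 0 <= x ==> 0 <= ph i x & ph i x <= 1"
 shows "expectation (%om. \<Prod>k<m. ph k (cell n k om)) = (\<Prod>k<m. expectation (%om. ph k (sg (1 / real (Suc n)) om)))"
proof -
 have "mono (%k. real k * (1 / real (Suc n)))" by (intro monoI mult_right_mono) auto
 moreover have "real (Suc i) * (1 / real (Suc n)) - real i * (1 / real (Suc n)) = 1 / real (Suc n)" for i
  by (simp add: field_simps)
 ultimately show ?thesis
  using increments[of "%k. real k * (1 / real (Suc n))" ph m] assms
  unfolding cell_def by (simp del: of_nat_Suc times_divide_eq_right mult_1_right)
qed

text \<open>The factor \<open>sg 1\<close> is the sum of the cells. By independence each summand
  splits into one size-weighted cell and n unweighted ones, and by stationarity all summands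
  agree.\<close>

lemma weighted_cells:
 assumes a: "0 < a" and r: "0 < r"
 defines "ph \<equiv> %x. exp (- a * x - f (r * x))"
 shows "expectation (%om. sg 1 om * (\<Prod>k<Suc n. ph (cell n k om))) =
  real (Suc n) * (expectation (%om. sg (1 / real (Suc n)) om * ph (sg (1 / real (Suc n)) om)) *
   expectation (%om. ph (sg (1 / real (Suc n)) om)) ^ n)"
proof -
 let ?A = "%j ps. %om. \<Prod>k<Suc n. (if k = j then ps else ph) (cell n k om)"
 let ?B = "%om. \<Prod>k<Suc n. ph (cell n k om)"
 let ?C = "%k j ps. if k = j then ps else ph"
 let ?E = "%om. sg 1 om * ?B om"
 let ?D = "sg (1 / real (Suc n))"
 have Dm: "?D : borel_measurable M" by (rule rv) simp
 have phm [measurable]: "ph : borel_measurable borel" unfolding ph_def by measurable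
 have phb: "0 <= ph x & ph x <= 1" if "0 <= x" for x
 proof -
  have "- a * x - f (r * x) <= 0" using mult_nonneg_nonneg[of a x] that a f_nonneg[of "r * x"] by linarith
  then show ?thesis by (simp only: ph_def exp_ge_zero exp_le_one_iff simp_thms)
 qed
 \<comment> \<open>The factor \<open>a\<close> keeps the size-weighted test function in [0,1],
   because s * exp (- a * s) is at most 1 / a. It is cancelled at the end.\<close>
 define ps where "ps x = a * x * ph x" for x
 have psm [measurable]: "ps : borel_measurable borel" unfolding ps_def[abs_def] by measurable
 have psb: "0 <= ps x & ps x <= 1" if "0 <= x" for x
 proof -
  note mult_exp_neg_bound[OF that a f_nonneg[of "r * x"]]
  then show ?thesis using a unfolding ps_def ph_def by (simp add: pos_le_divide_eq mult_ac)
 qed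
 have piece: "expectation (?A j ps) = expectation (%om. ps (?D om)) * expectation (%om. ph (?D om)) ^ n"
  if j: "j < Suc n" for j
 proof -
  have "expectation (?A j ps) = (\<Prod>k<Suc n. expectation (%om. (?C k j ps) (?D om)))"
   by (rule cells_product[of "%k. if k = j then ps else ph"]) (use psb phb psm phm in auto)
  also have "... = expectation (%om. ps (?D om)) * (\<Prod>k\<in>{..<Suc n} - {j}. expectation (%om. ph (?D om)))"
   using j by (subst prod.remove[of _ j]) auto
  also have "(\<Prod>k\<in>{..<Suc n} - {j}. expectation (%om. ph (?D om))) = expectation (%om. ph (?D om)) ^ n"
   using j by simp
  finally show ?thesis .
 qed
 have int: "integrable M (?A j ps)" for j
 proof (rule integrable_const_bound[where B=1])
  show "AE om in M. norm (\<Prod>k<Suc n. (?C k j ps) (cell n k om)) <= 1"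
   using AE_space
  proof eventually_elim
   case (elim om)
   have "0 <= (?C k j ps) (cell n k om) & (?C k j ps) (cell n k om) <= 1" for k
    using psb[OF cell_nonneg[OF elim]] phb[OF cell_nonneg[OF elim]] by simp
   then show ?case by (auto simp: prod_nonneg simp del: prod.lessThan_Suc intro!: prod_le_1)
  qed
  have "(%om. (?C k j ps) (cell n k om)) : borel_measurable M" for k
   by (cases "k = j") simp_all
  then show "(?A j ps) : borel_measurable M"
   by (intro borel_measurable_prod)
 qed
 have split: "a * (sg 1 om * ?B om) = (\<Sum>j<Suc n. \<Prod>k<Suc n. (?C k j ps) (cell n k om))"
  if "om : space M" for om
 proof -
  have "(\<Prod>k<Suc n. (?C k j ps) (cell n k om)) = a * cell n j om * ?B om" if j: "j < Suc n" for j
  proof -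
   have "(\<Prod>k<Suc n. (?C k j ps) (cell n k om)) = ps (cell n j om) * (\<Prod>k\<in>{..<Suc n} - {j}. ph (cell n k om))"
    using j by (subst prod.remove[of _ j]) auto
   moreover have "?B om = ph (cell n j om) * (\<Prod>k\<in>{..<Suc n} - {j}. ph (cell n k om))"
    using j by (subst prod.remove[of _ j]) auto
   ultimately show ?thesis by (simp add: ps_def)
  qed
  then have "(\<Sum>j<Suc n. \<Prod>k<Suc n. (?C k j ps) (cell n k om)) = (\<Sum>j<Suc n. a * cell n j om * ?B om)"
   by (intro sum.cong) auto
  also have "... = a * ((\<Sum>j<Suc n. cell n j om) * ?B om)"
   by (simp only: sum_distrib_left sum_distrib_right mult.assoc)
  finally show ?thesis unfolding sum_cells[OF that] ..
 qed
 have "a * expectation ?E = expectation (%om. a * (sg 1 om * ?B om))"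
  by (simp del: prod.lessThan_Suc)
 also have "... = expectation (%om. \<Sum>j<Suc n. \<Prod>k<Suc n. (?C k j ps) (cell n k om))"
  by (intro Bochner_Integration.integral_cong refl split)
 also have "... = (\<Sum>j<Suc n. expectation (?A j ps))"
  by (rule Bochner_Integration.integral_sum[OF int])
 also have "... = (\<Sum>j<Suc n. expectation (%om. ps (?D om)) * expectation (%om. ph (?D om)) ^ n)"
  by (intro sum.cong refl piece) auto
 also have "... = real (Suc n) * (expectation (%om. ps (?D om)) * expectation (%om. ph (?D om)) ^ n)"
  by (simp del: sum.lessThan_Suc)
 also have "expectation (%om. ps (?D om)) = a * expectation (%om. ?D om * ph (?D om))"
  by (simp add: ps_def mult.assoc)
 finally have "a * expectation ?E =
  a * (real (Suc n) * (expectation (%om. ?D om * ph (?D om)) * expectation (%om. ph (?D om)) ^ n))"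
  by (simp only: mult_ac)
 then show ?thesis using a by (simp only: mult_left_cancel[OF less_imp_neq[OF a, symmetric]])
qed

text \<open>The Palm formula for the jumps, as the limit of the identity for cells: the
  size-weighted cell produces the age rate, and the power of the unweighted ones tends to the
  exponential of minus the jump rate. \<open>C\<close> is the intensity of jumps relative to
  \<open>levy \<alpha>\<close>.\<close>

lemma size_biased_functional:
 assumes r: "0 < r" and l: "0 < l"
 defines "C \<equiv> c / levy_const \<alpha>"
 shows "expectation (%om. sg 1 om * exp (- (l * r) * sg 1 om - jump_functional r om)) =
  C * (r powr (\<alpha> - 1) * age_rate \<alpha> l) * exp (- (C * (r powr \<alpha> * jump_rate \<alpha> l)))"
  and "(%om. jump_functional r om) : borel_measurable M"
proof -
 let ?A = "%n ph om. \<Prod>k<Suc n. ph (cell n k om)"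
 let ?B = "r powr \<alpha> * jump_rate \<alpha> l"
 let ?C = "%a om. - a * sg 1 om - jump_functional r om"
 let ?E = "r powr (\<alpha> - 1) * age_rate \<alpha> l"
 let ?F = "%n ph. %om. sg 1 om * ?A n ph om"
 let ?G = "%a. %om. sg 1 om * exp (?C a om)"
 define a where "a = l * r"
 have a: "0 < a" using r l by (simp add: a_def)
 define ph where "ph x = exp (- a * x - f (r * x))" for x
 have phm [measurable]: "ph : borel_measurable borel" unfolding ph_def[abs_def] by measurable
 have phb: "0 <= ph x & ph x <= 1" if "0 <= x" for x
 proof -
  have "- a * x - f (r * x) <= 0" using mult_nonneg_nonneg[of a x] that a f_nonneg[of "r * x"] by linarith
  then show ?thesis by (simp only: ph_def exp_ge_zero exp_le_one_iff simp_thms)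
 qed
 have phc: "continuous_on S ph" for S unfolding ph_def[abs_def] by (rule test_continuous)
 have er: "0 < et / r" using eta r by simp
 have fz: "f (r * x) = 0" if "x <= et / r" for x
  by (rule f_zero) (use that r in \<open>simp add: field_simps\<close>)
 note R = ratio_limits[where g="%x. f (r * x)", OF a er fz f_nonneg, folded ph_def]
 let ?D = "%n. sg (1 / real (Suc n))"
 have C0: "0 < C" unfolding C_def using scale levy_const_pos[OF index] by simp
 have H1: "(%n. real (Suc n) * expectation (%om. 1 - ph (?D n om))) ----> C * ?B"
 proof -
  have ph0: "ph 0 = 1" using eta by (simp add: ph_def f_zero)
  have "(%n. real (Suc n) * (\<integral>x. 1 - ph x \<partial>distr M borel (?D n))) ----> C * (LINT x|levy \<alpha>. 1 - ph x)"
   unfolding C_def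
   by (rule vague_limit[where H="%x. 1 - ph x" and nu="%n. distr M borel (sg (1 / real (Suc n)))" and a="%n. real (Suc n)", OF index law_cell(1,2,3) _ scale law_cell(5) _ _ _ R(1,2)])
    (auto intro!: continuous_intros phc simp: ph0)
  moreover have "(LINT x|levy \<alpha>. 1 - ph x) = r powr \<alpha> * jump_rate \<alpha> l"
   unfolding ph_def a_def by (rule rates_scale(1)[OF r l])
  moreover have "(\<integral>x. 1 - ph x \<partial>distr M borel (?D n)) = expectation (%om. 1 - ph (?D n om))" for n
   by (rule law_cell(4)) simp
  ultimately show ?thesis by (simp only:)
 qed
 have H2: "(%n. real (Suc n) * expectation (%om. ?D n om * ph (?D n om))) ----> C * ?E"
 proof -
  have "(%n. real (Suc n) * (\<integral>x. x * ph x \<partial>distr M borel (?D n))) ----> C * (LINT x|levy \<alpha>. x * ph x)"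
   unfolding C_def
   by (rule vague_limit[where H="%x. x * ph x" and nu="%n. distr M borel (sg (1 / real (Suc n)))" and a="%n. real (Suc n)", OF index law_cell(1,2,3) _ scale law_cell(5) _ _ _ R(3,4)])
    (auto intro!: continuous_intros phc)
  moreover have "(LINT x|levy \<alpha>. x * ph x) = r powr (\<alpha> - 1) * age_rate \<alpha> l"
   unfolding ph_def a_def by (rule rates_scale(2)[OF r l])
  moreover have "(\<integral>x. x * ph x \<partial>distr M borel (?D n)) = expectation (%om. ?D n om * ph (?D n om))" for n
   by (rule law_cell(4)) simp
  ultimately show ?thesis by (simp only:)
 qed
 have Db: "AE om in M. 0 <= ph (?D n om) & ph (?D n om) <= 1" for n
  using AE_space by eventually_elim (intro phb nice_nonneg[OF path], auto)
 have Dm: "(%om. ph (?D n om)) : borel_measurable M" for n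
  by (rule measurable_compose[OF rv phm]) simp
 have Di: "integrable M (%om. ph (?D n om))" for n
  by (rule integrable_const_bound[where B=1, OF _ Dm]) (use Db[of n] in eventually_elim, simp)
 have "(%n. (1 - expectation (%om. 1 - ph (?D n om))) ^ n) ----> exp (- (C * ?B))"
 proof (rule one_minus_power_limit[OF H1])
  fix n
  have "0 <= expectation (%om. ph (?D n om))" by (rule integral_nonneg_AE) (use Db[of n] in eventually_elim, simp)
  moreover have "expectation (%om. ph (?D n om)) <= expectation (%om. 1)"
   by (rule integral_mono_AE[OF Di]) (use Db[of n] in \<open>auto elim!: eventually_mono\<close>)
  ultimately show "0 <= expectation (%om. 1 - ph (?D n om)) & expectation (%om. 1 - ph (?D n om)) <= 1"
   using Di by (simp add: prob_space)
 qed (use C0 jump_rate_pos[OF index l] in \<open>simp add: less_imp_le\<close>)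
 from tendsto_mult[OF H2 this]
 have "(%n. expectation (?F n ph)) ----> C * ?E * exp (- (C * ?B))"
  unfolding weighted_cells[OF a r, folded ph_def] using Di by (simp add: prob_space mult.assoc del: of_nat_Suc)
 moreover have prod_eq: "?A n ph om = exp (- a * sg 1 om - (\<Sum>k<Suc n. f (r * cell n k om)))" if "om : space M" for n om
 proof -
  have "?A n ph om = exp (\<Sum>k<Suc n. - a * cell n k om - f (r * cell n k om))"
   unfolding ph_def by (rule exp_sum[symmetric]) simp
  also have "(\<Sum>k<Suc n. - a * cell n k om - f (r * cell n k om)) = - a * sg 1 om - (\<Sum>k<Suc n. f (r * cell n k om))"
   unfolding sum_cells[OF that, of n, symmetric] by (simp only: sum_subtractf sum_distrib_left)
  finally show ?thesis .
 qed
 show jm: "(%om. jump_functional r om) : borel_measurable M"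
  by (rule borel_measurable_LIMSEQ_real[OF jump_functional_limit[OF _ r]]) auto
 have "(%n. expectation (?F n ph)) ---->
  expectation (?G a)"
 proof (rule integral_dominated_convergence[where w="%_. 1 / a"])
  show "(?G a) : borel_measurable M"
   using jm by measurable
  show "(?F n ph) : borel_measurable M" for n by measurable
  show "AE om in M. (%n. sg 1 om * ?A n ph om) ----> sg 1 om * exp (?C a om)"
  proof (rule AE_I2)
   fix om assume om: "om : space M"
   show "(%n. sg 1 om * ?A n ph om) ----> sg 1 om * exp (?C a om)"
    unfolding prod_eq[OF om] by (intro tendsto_intros jump_functional_limit om r)
  qed
  show "AE om in M. norm (sg 1 om * ?A n ph om) <= 1 / a" for n
  proof (rule AE_I2)
   fix om assume om: "om : space M"
   have "0 <= (\<Sum>k<Suc n. f (r * cell n k om))" by (intro sum_nonneg f_nonneg)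
   then show "norm (sg 1 om * ?A n ph om) <= 1 / a"
    unfolding prod_eq[OF om] using mult_exp_neg_bound[OF less_imp_le[OF sigma1_pos[OF om]] a] by (simp del: sum.lessThan_Suc)
  qed
 qed simp
 ultimately show "expectation (%om. sg 1 om * exp (- (l * r) * sg 1 om - jump_functional r om)) =
  C * ?E * exp (- (C * ?B))"
  unfolding a_def by (rule LIMSEQ_unique[rotated])
qed


text \<open>A form that is jointly measurable in \<open>r\<close> and the sample point, as Fubini
  demands; for positive \<open>r\<close> it is \<open>jump_functional\<close>.\<close>

definition limit_functional :: "real => 'a => real" where
 "limit_functional r om = lim (%n. \<Sum>k<Suc n. f (r * cell n k om))"

lemma limit_functional_eq: "om : space M ==> 0 < r ==> limit_functional r om = jump_functional r om"
 unfolding limit_functional_def by (rule limI[OF jump_functional_limit])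

lemma limit_functional_measurable [measurable]:
 "(%x. limit_functional (fst x) (snd x)) : borel_measurable (borel \<Otimes>\<^sub>M M)"
 unfolding limit_functional_def
proof (rule borel_measurable_lim_metric)
 fix n
 show "(%x. \<Sum>k<Suc n. f (fst x * cell n k (snd x))) : borel_measurable (borel \<Otimes>\<^sub>M M)"
  by (intro borel_measurable_sum measurable_compose[OF _ f_measurable] borel_measurable_times
   measurable_compose[OF measurable_snd cell_measurable] measurable_fst)
qed

text \<open>For scales below 2 * r only the finitely many jumps above et / (2 * r) contribute, so
  the functional is locally a finite sum of continuous functions.\<close>

lemma jump_functional_isCont:
 assumes om: "om : space M" and r: "0 < r"
 shows "isCont (%r. jump_functional r om) r"
proof -
 define J where "J s = sg s om - left_value (%s. sg s om) s" for s
 define S where "S = {s\<in>{0<..1}. et / (2 * r) < J s}"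
 have fin: "finite S" unfolding S_def J_def using r eta by (intro finite_large_jumps[OF path[OF om]]) simp
 have eq: "jump_functional u om = (\<Sum>s\<in>S. f (u * J s))" if "u : {0<..<2 * r}" for u
  unfolding jump_functional_def family_sum_def J_def[symmetric]
 proof (rule sum.mono_neutral_left[OF fin])
  show "{s : {0<..1}. et < u * J s} \<subseteq> S"
  proof
   fix s assume s: "s : {s : {0<..1}. et < u * J s}"
   then have "0 < u * J s" using eta by auto
   then have "0 < J s" using that by (simp add: zero_less_mult_iff)
   then have "u * J s <= 2 * r * J s" using that by (intro mult_right_mono) auto
   then show "s : S" using s r by (auto simp: S_def field_simps)
  qed
  show "\<forall>i\<in>S - {s : {0<..1}. et < u * J s}. f (u * J i) = 0"
   by (intro ballI f_zero) (auto simp: S_def not_less)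
 qed
 have "continuous_on {0<..<2 * r} (%u. \<Sum>s\<in>S. f (u * J s))"
  by (intro continuous_intros continuous_on_compose2[OF f_cont]) auto
 then have "continuous_on {0<..<2 * r} (%r. jump_functional r om)"
  by (rule continuous_on_eq) (simp add: eq)
 then show ?thesis using r by (simp add: continuous_on_eq_continuous_at)
qed

definition PD_laplace :: "real => real" where
 "PD_laplace t = (LINT om|M. indicator {0<..} t * exp (- limit_functional (t / sg 1 om) om) * indicator (space M) om)"

lemma limit_functional_scaled [measurable]:
 "(%x. limit_functional (fst x / sg 1 (snd x)) (snd x)) : borel_measurable (borel \<Otimes>\<^sub>M M)"
proof -
 have "(%x. (fst x / sg 1 (snd x), snd x)) : (borel \<Otimes>\<^sub>M M) \<rightarrow>\<^sub>M (borel \<Otimes>\<^sub>M M)" by measurable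
 from measurable_compose[OF this limit_functional_measurable] show ?thesis by simp
qed

lemma PD_laplace_eq:
 assumes t: "0 < t"
 shows "PD_laplace t = expectation (%om. exp (- jump_functional (t / sg 1 om) om))"
 unfolding PD_laplace_def
 by (rule Bochner_Integration.integral_cong) (use t in \<open>auto simp: limit_functional_eq sigma1_pos\<close>)

lemma PD_laplace_zero: "t <= 0 ==> PD_laplace t = 0"
 by (simp add: PD_laplace_def)

lemma jump_functional_scaled_measurable:
 assumes t: "0 < t"
 shows "(%om. jump_functional (t / sg 1 om) om) : borel_measurable M"
proof -
 have "(%om. (t, om)) : M \<rightarrow>\<^sub>M (borel \<Otimes>\<^sub>M M)" by measurable
 from measurable_compose[OF this limit_functional_scaled]
 have "(%om. limit_functional (t / sg 1 om) om) : borel_measurable M" by simp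
 moreover have "limit_functional (t / sg 1 om) om = jump_functional (t / sg 1 om) om" if "om : space M" for om
  using t sigma1_pos[OF that] by (intro limit_functional_eq that) simp
 ultimately show ?thesis by (simp cong: measurable_cong)
qed

lemma exp_functional_integrable:
 assumes t: "0 < t"
 shows "integrable M (%om. exp (- jump_functional (t / sg 1 om) om))"
 by (rule integrable_const_bound[where B=1])
   (use jump_functional_scaled_measurable[OF t] jump_functional_nonneg in auto)

lemma PD_laplace_bounds: "0 <= PD_laplace t & PD_laplace t <= 1"
proof (cases "0 < t")
 case True
 have "expectation (%om. exp (- jump_functional (t / sg 1 om) om)) <= expectation (%om. 1)"
  using exp_functional_integrable[OF True] jump_functional_nonneg by (intro integral_mono) auto
 then show ?thesis unfolding PD_laplace_eq[OF True] by (auto simp: prob_space)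
qed (simp add: PD_laplace_zero)

lemma PD_laplace_measurable: "PD_laplace : borel_measurable borel"
proof -
 have *: "(%x. indicator {0<..} (fst x) * exp (- limit_functional (fst x / sg 1 (snd x)) (snd x)) * indicator (space M) (snd x) :: real)
  : borel_measurable (borel \<Otimes>\<^sub>M M)" by measurable
 show ?thesis unfolding PD_laplace_def[abs_def]
  by (rule borel_measurable_lebesgue_integral) (use * in \<open>simp add: split_beta'\<close>)
qed

lemma PD_laplace_continuous: "continuous_on {0<..} PD_laplace"
proof (rule continuous_on_sequentiallyI)
 let ?A = "%t om. - jump_functional (t / sg 1 om) om"
 let ?B = "%s n om. - jump_functional (s n / sg 1 om) om"
 fix s :: "nat => real" and t assume s: "\<forall>n. s n : {0<..}" and t: "t : {0<..}" and lim: "s ----> t"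
 have "(%n. expectation (%om. exp (?B s n om))) ----> expectation (%om. exp (?A t om))"
 proof (rule integral_dominated_convergence[where w="%_. 1"])
  show "AE om in M. (%n. exp (?B s n om)) ----> exp (?A t om)"
  proof (rule AE_I2)
   fix om assume om: "om : space M"
   have "0 < t / sg 1 om" using t sigma1_pos[OF om] by simp
   note c = jump_functional_isCont[OF om this]
   have "(%n. s n / sg 1 om) ----> t / sg 1 om"
    using sigma1_pos[OF om] lim by (intro tendsto_divide tendsto_const) auto
   from isCont_tendsto_compose[OF c this] show "(%n. exp (?B s n om)) ----> exp (?A t om)"
    by (intro tendsto_exp tendsto_minus)
  qed
 qed (use s t jump_functional_scaled_measurable jump_functional_nonneg in auto)
 then show "(%n. PD_laplace (s n)) ----> PD_laplace t"
  using s t by (simp add: PD_laplace_eq)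
qed

text \<open>The integrand is the derivative of - (p / (\<alpha> q)) exp (- C q r^\<alpha>). The
  value is free of C: this is why the normalised jumps do not depend on the scale of the
  subordinator.\<close>

lemma radial_integral:
 assumes C: "0 < C" and p: "0 <= p" and q: "0 < (q::real)"
 shows "(\<integral>\<^sup>+r. ennreal (indicator {0<..} r * (C * (r powr (\<alpha> - 1) * p) * exp (- (C * (r powr \<alpha> * q))))) \<partial>lborel) = ennreal (p / (\<alpha> * q))"
proof -
 let ?A = "%g. \<integral>r. indicator {0<..} r * g r \<partial>lborel"
 define F where "F r = - (p / (\<alpha> * q)) * exp (- (C * (r powr \<alpha> * q)))" for r
 define g where "g r = C * (r powr (\<alpha> - 1) * p) * exp (- (C * (r powr \<alpha> * q)))" for r
 have ein: "einterval 0 \<infinity> = {0<..}" by (auto simp: einterval_def)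
 have D: "DERIV F r :> g r" if "0 < ereal r" for r
 proof -
  have "0 < r" using that by simp
  then show ?thesis unfolding F_def g_def using index q
   by (auto intro!: derivative_eq_intros simp: powr_diff field_simps)
 qed
 have cont: "isCont g r" if "0 < ereal r" for r
  unfolding g_def using that by (intro continuous_intros) auto
 have nn: "0 <= g r" if "0 < r" for r unfolding g_def using that C p by simp
 have F0: "((F \<circ> real_of_ereal) \<longlongrightarrow> - (p / (\<alpha> * q))) (at_right 0)"
 proof -
  have "((%r. r powr \<alpha>) \<longlongrightarrow> 0) (at_right 0)" using index by real_asymp
  then have "(F \<longlongrightarrow> - (p / (\<alpha> * q)) * exp (- (C * (0 * q)))) (at_right 0)"
   unfolding F_def by (intro tendsto_intros)
  then show ?thesis unfolding zero_ereal_def by (simp add: ereal_tendsto_simps)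
 qed
 have F1: "((F \<circ> real_of_ereal) \<longlongrightarrow> 0) (at_left \<infinity>)"
 proof -
  have "filterlim (%r. r powr \<alpha>) at_top at_top" using index by real_asymp
  then have "filterlim (%r. (C * q) * r powr \<alpha>) at_top at_top"
   using C q by (intro filterlim_tendsto_pos_mult_at_top[OF tendsto_const]) auto
  then have "filterlim (%r. - ((C * q) * r powr \<alpha>)) at_bot at_top"
   by (simp add: filterlim_uminus_at_bot)
  from filterlim_compose[OF exp_at_bot this]
  have "((%r. - (p / (\<alpha> * q)) * exp (- ((C * q) * r powr \<alpha>))) \<longlongrightarrow> - (p / (\<alpha> * q)) * 0) at_top"
   by (intro tendsto_intros)
  then have "(F \<longlongrightarrow> 0) at_top" unfolding F_def by (simp add: mult_ac)
  then show ?thesis by (simp add: ereal_tendsto_simps)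
 qed
 note FTC = interval_integral_FTC_nonneg[of 0 \<infinity> F g "- (p / (\<alpha> * q))" 0, OF _ D cont _ F0 F1]
 have int: "set_integrable lborel {0<..} g" and val: "(LBINT r=0..\<infinity>. g r) = p / (\<alpha> * q)"
  using FTC nn by (auto simp: ein)
 have "(\<integral>\<^sup>+r. ennreal (indicator {0<..} r * g r) \<partial>lborel) = ennreal (?A g)"
  using int nn by (intro nn_integral_eq_integral) (auto simp: set_integrable_def indicator_def)
 also have "?A g = p / (\<alpha> * q)"
  using val by (simp add: interval_lebesgue_integral_def ein set_lebesgue_integral_def)
 finally show ?thesis by (simp add: g_def)
qed

text \<open>Substituting \<open>t = r * sg 1\<close> turns the normalised jumps at scale \<open>t\<close> into the size-biased
 unnormalised ones.\<close>

lemma PD_laplace_transform: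
 assumes l: "0 < l"
 shows "(\<integral>\<^sup>+t. ennreal (indicator {0<..} t * exp (- l * t) * PD_laplace t) \<partial>lborel) = ennreal (age_rate \<alpha> l / (\<alpha> * jump_rate \<alpha> l))"
proof -
 let ?A = "%r om. indicator {0<..} r * (sg 1 om * exp (- (l * r) * sg 1 om - limit_functional r om))"
 let ?B = "%t om. indicator {0<..} t * exp (- l * t) * exp (- limit_functional (t / sg 1 om) om)"
 let ?D = "%om r. indicator {0<..} (0 + sg 1 om * r) * exp (- l * (0 + sg 1 om * r)) * exp (- limit_functional ((0 + sg 1 om * r) / sg 1 om) om)"
 let ?E = "%r om. - (l * r) * sg 1 om - jump_functional r om"
 let ?F = "%t. \<integral>\<^sup>+om. ennreal (?B t om) \<partial>M"
 let ?G = "%r. \<integral>\<^sup>+om. ennreal (?A r om) \<partial>M"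
 let ?H = "%t. \<integral>\<^sup>+om. ennreal (exp (- jump_functional (t / sg 1 om) om)) \<partial>M"
 let ?I = "%om. \<integral>\<^sup>+t. ennreal (?B t om) \<partial>lborel"
 let ?J = "%om. \<integral>\<^sup>+r. ennreal (?A r om) \<partial>lborel"
 let ?K = "%r. \<integral>\<^sup>+om. ennreal (sg 1 om * exp (?E r om)) \<partial>M"
 let ?L = "%r. %om. sg 1 om * exp (?E r om)"
 let ?N = "%t. indicator {0<..} t * exp (- l * t) * PD_laplace t"
 interpret P: pair_sigma_finite lborel M ..
 let ?C = "c / levy_const \<alpha>"
 have m1: "(%x. ennreal (indicator {0<..} (fst x) * exp (- l * fst x) * exp (- limit_functional (fst x / sg 1 (snd x)) (snd x)))) : borel_measurable (lborel \<Otimes>\<^sub>M M)"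
  using limit_functional_scaled by (simp add: measurable_cong_sets[OF sets_pair_measure_cong[OF sets_lborel refl] refl]) measurable
 have m2: "(%x. ennreal (indicator {0<..} (fst x) * (sg 1 (snd x) * exp (- (l * fst x) * sg 1 (snd x) - limit_functional (fst x) (snd x))))) : borel_measurable (lborel \<Otimes>\<^sub>M M)"
  using limit_functional_measurable by (simp add: measurable_cong_sets[OF sets_pair_measure_cong[OF sets_lborel refl] refl]) measurable
 have "(\<integral>\<^sup>+t. ennreal (?N t) \<partial>lborel) =
  (\<integral>\<^sup>+t. ?F t \<partial>lborel)"
 proof (rule nn_integral_cong)
  fix t :: real
  show "ennreal (?N t) = ?F t"
  proof (cases "0 < t")
   case True
   have "?F t =
    (\<integral>\<^sup>+om. ennreal (exp (- l * t)) * ennreal (exp (- jump_functional (t / sg 1 om) om)) \<partial>M)"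
    using True by (intro nn_integral_cong) (simp add: limit_functional_eq sigma1_pos ennreal_mult')
   also have "... = ennreal (exp (- l * t)) * ?H t"
    using jump_functional_scaled_measurable[OF True] by (intro nn_integral_cmult) measurable
   also have "?H t = ennreal (PD_laplace t)"
    unfolding PD_laplace_eq[OF True] by (rule nn_integral_eq_integral[OF exp_functional_integrable[OF True]]) simp
   finally show ?thesis using True by (simp add: ennreal_mult')
  qed simp
 qed
 also have "... = (\<integral>\<^sup>+om. ?I om \<partial>M)"
  by (rule P.Fubini'[symmetric]) (use m1 in \<open>simp add: split_beta'\<close>)
 also have "... = (\<integral>\<^sup>+om. ?J om \<partial>M)"
 proof (rule nn_integral_cong)
  fix om assume om: "om : space M"
  have s: "0 < sg 1 om" by (rule sigma1_pos[OF om])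
  have lm: "(%r. limit_functional r om) : borel_measurable borel"
   using measurable_compose[OF measurable_Pair2'[OF om] limit_functional_measurable] by simp
  have "?I om =
   ennreal (sg 1 om) * (\<integral>\<^sup>+r. ennreal (?D om r) \<partial>lborel)"
   using s lm by (subst nn_integral_real_affine[where c="sg 1 om" and t=0]) auto
  also have "... = (\<integral>\<^sup>+r. ennreal (sg 1 om) * ennreal (?D om r) \<partial>lborel)"
   using s lm by (intro nn_integral_cmult[symmetric]) simp
  also have "... = ?J om"
  proof (rule nn_integral_cong)
   fix r :: real
   show "ennreal (sg 1 om) * ennreal (?D om r) =
    ennreal (?A r om)"
    using s by (cases "0 < r") (simp_all add: ennreal_mult'[symmetric] exp_diff exp_minus mult_ac zero_less_mult_iff divide_inverse)
  qed
  finally show "?I om = ?J om" .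
 qed
 also have "... = (\<integral>\<^sup>+r. ?G r \<partial>lborel)"
  by (rule P.Fubini') (use m2 in \<open>simp add: split_beta'\<close>)
 also have "... = (\<integral>\<^sup>+r. ennreal (indicator {0<..} r * (?C * (r powr (\<alpha> - 1) * age_rate \<alpha> l) * exp (- (?C * (r powr \<alpha> * jump_rate \<alpha> l))))) \<partial>lborel)"
 proof (rule nn_integral_cong)
  fix r :: real
  show "?G r =
   ennreal (indicator {0<..} r * (?C * (r powr (\<alpha> - 1) * age_rate \<alpha> l) * exp (- (?C * (r powr \<alpha> * jump_rate \<alpha> l)))))"
  proof (cases "0 < r")
   case True
   note sb = size_biased_functional[OF True l]
   have "integrable M (?L r)"
   proof (rule integrable_const_bound[where B="1 / (l * r)"])
    show "AE om in M. norm (sg 1 om * exp (?E r om)) <= 1 / (l * r)"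
    proof (rule AE_I2)
     fix om assume om: "om : space M"
     show "norm (sg 1 om * exp (?E r om)) <= 1 / (l * r)"
      using mult_exp_neg_bound[OF less_imp_le[OF sigma1_pos[OF om]] mult_pos_pos[OF l True] jump_functional_nonneg[of r om]] by simp
    qed
   qed (use sb(2) in measurable)
   then have "?K r =
    ennreal (expectation (?L r))"
    using AE_space by (intro nn_integral_eq_integral) (auto elim!: eventually_mono simp: less_imp_le[OF sigma1_pos])
   moreover have "?G r =
    (?K r)"
    using True by (intro nn_integral_cong) (simp add: limit_functional_eq)
   ultimately show ?thesis using True sb(1) by simp
  qed simp
 qed
 also have "... = ennreal (age_rate \<alpha> l / (\<alpha> * jump_rate \<alpha> l))"
  using scale levy_const_pos[OF index] by (intro radial_integral age_rate_nonneg jump_rate_pos index l) simp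
 finally show ?thesis .
qed

end

section \<open>Brownian motion\<close>

text \<open>The point mass at v = 0 allows repeated times in the product formula for
  increments.\<close>

definition gauss :: "real => real measure" where
 "gauss v = (if v = 0 then return borel 0 else density lborel (%x. ennreal (normal_density 0 (sqrt v) x)))"

lemma sets_gauss [simp, measurable_cong]: "sets (gauss v) = sets borel"
 by (simp add: gauss_def)

lemma space_gauss [simp]: "space (gauss v) = UNIV"
 by (simp add: gauss_def)

lemma prob_space_gauss: "0 <= v ==> prob_space (gauss v)"
 by (auto simp: gauss_def intro!: prob_space_return prob_space_normal_density)

lemma gauss_scale:
 assumes v: "0 <= v" and r: "r ~= 0"
 shows "distr (gauss v) borel (%x. r * x) = gauss (r\<^sup>2 * v)"
proof (cases "v = 0")
 case True
 then show ?thesis by (simp add: gauss_def distr_return)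
next
 case False
 then have sv: "0 < sqrt v" using v by simp
 interpret prob_space "gauss v" by (rule prob_space_gauss[OF v])
 have "distributed (gauss v) lborel (%x. x) (%x. ennreal (normal_density 0 (sqrt v) x))"
  using False by (auto simp: distributed_def gauss_def distr_id2)
 from normal_density_affine[OF this sv r, of 0]
 have "distributed (gauss v) lborel (%x. r * x) (%x. ennreal (normal_density 0 (\<bar>r\<bar> * sqrt v) x))" by simp
 then have "distr (gauss v) lborel (%x. r * x) = density lborel (%x. ennreal (normal_density 0 (\<bar>r\<bar> * sqrt v) x))"
  by (rule distributed_distr_eq_density)
 moreover have "distr (gauss v) lborel (%x. r * x) = distr (gauss v) borel (%x. r * x)"
  by (rule distr_cong) auto
 ultimately show ?thesis using False r v by (simp add: gauss_def real_sqrt_mult)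
qed

lemma gauss_scale_integral:
 fixes ph :: "real => real"
 assumes "0 <= v" "r ~= 0" "ph : borel_measurable borel"
 shows "(LINT x|gauss v. ph (r * x)) = (\<integral>x. ph x \<partial>gauss (r\<^sup>2 * v))"
 unfolding gauss_scale[OF assms(1,2), symmetric] using assms(3) by (subst integral_distr) auto

locale cbm = prob_space M for M :: "'a measure" and B :: "real => 'a => real" +
 assumes rv: "!!s. 0 <= s ==> B s : borel_measurable M"
  and cont: "!!om. om : space M ==> continuous_on {0..} (%s. B s om)"
  and zero: "!!om. om : space M ==> B 0 om = 0"
  and increments: "!!(u::nat => real) (ph::nat => real => real) n. 0 <= u 0 ==> mono u ==> (!!i. ph i : borel_measurable borel) ==>
   (!!i x. 0 <= ph i x & ph i x <= 1) ==>
   expectation (%om. \<Prod>i<n. ph i (B (u (Suc i)) om - B (u i) om)) = (\<Prod>i<n. \<integral>x. ph i x \<partial>gauss (u (Suc i) - u i))"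

lemma (in brownian_motion) continuous_version:
 obtains B' where "cbm M B'" "AE om in M. \<forall>s. B' s om = B s om"
proof -
 have ae: "AE om in M. continuous_on {0..} (%s. B s om) & B 0 om = 0"
  using continuous_paths starts_at_0 by eventually_elim simp
 obtain r where r: "r : M \<rightarrow>\<^sub>M M" "!!om. om : space M ==> continuous_on {0..} (%s. B s (r om)) & B 0 (r om) = 0"
  "AE om in M. r om = om" "distr M M r = M" by (rule good_version[OF ae]) blast
 have "cbm M (%s om. B s (r om))"
 proof
  fix u :: "nat => real" and ph :: "nat => real => real" and n
  assume u: "0 <= u 0" "mono u" and ph: "!!i. ph i : borel_measurable borel" "!!i x. 0 <= ph i x & ph i x <= 1"
  let ?d = "%i om. B (u (Suc i)) om - B (u i) om"
  have u0: "0 <= u i" "u i <= u (Suc i)" for i using u monoD[OF u(2), of 0 i] monoD[OF u(2), of i "Suc i"] by auto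
  have m: "(%om. ph i (?d i om)) : borel_measurable M" for i
   by (intro measurable_compose[OF _ ph(1)] borel_measurable_diff random_variable u0)
  have ind: "indep_vars (%_. borel) (%i om. ph i (?d i om)) {..<n}"
   using indep_vars_compose2[OF indep_increments[OF u, of n], where Y=ph and N="%_. borel"] ph(1) by auto
  have int: "integrable M (%om. ph i (?d i om))" for i
   using ph(2) by (intro integrable_const_bound[where B=1, OF _ m]) auto
  have law: "expectation (%om. ph i (?d i om)) = (\<integral>x. ph i x \<partial>gauss (u (Suc i) - u i))" for i
  proof (cases "u i = u (Suc i)")
   case True
   then show ?thesis using ph(1) by (simp add: gauss_def integral_return prob_space)
  next
   case False
   then have lt: "u i < u (Suc i)" using u0(2)[of i] by simp
   have "distr M lborel (%om. ?d i om) = gauss (u (Suc i) - u i)"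
    using distributed_distr_eq_density[OF normal_increments[OF u0(1) lt]] lt by (simp add: gauss_def)
   then have "(\<integral>x. ph i x \<partial>gauss (u (Suc i) - u i)) = (\<integral>x. ph i x \<partial>distr M lborel (%om. ?d i om))" by simp
   also have "... = expectation (%om. ph i (?d i om))"
    using random_variable[OF u0(1)] ph(1) by (intro integral_distr) auto
   finally show ?thesis ..
  qed
  have "expectation (%om. \<Prod>i<n. ph i (?d i (r om))) = expectation (%om. \<Prod>i<n. ph i (?d i om))"
   using integral_distr[OF r(1) borel_measurable_prod[of "{..<n}" "%i om. ph i (?d i om)", OF m]] r(4) by simp
  then show "expectation (%om. \<Prod>i<n. ph i (?d i (r om))) = (\<Prod>i<n. \<integral>x. ph i x \<partial>gauss (u (Suc i) - u i))"
   using indep_vars_lebesgue_integral[OF _ ind int] law by simp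
 qed (use r(2) in \<open>auto intro: measurable_compose[OF r(1) random_variable]\<close>)
 moreover have "AE om in M. \<forall>s. B s (r om) = B s om" using r(3) by eventually_elim simp
 ultimately show ?thesis by (rule that)
qed

context cbm
begin

text \<open>Negative \<open>r\<close> is included: r = - 1 later turns unboundedness above into
  unboundedness below.\<close>

lemma cbm_scale:
 assumes r: "r ~= 0"
 shows "cbm M (%s om. r * B (s / r\<^sup>2) om)"
proof
 let ?A = "%n ph u. %om. \<Prod>i<n. ph i (r * B (u (Suc i) / r\<^sup>2) om - r * B (u i / r\<^sup>2) om)"
 show "(%om. r * B (s / r\<^sup>2) om) : borel_measurable M" if "0 <= s" for s
  using rv that by (intro borel_measurable_times) auto
 show "continuous_on {0..} (%s. r * B (s / r\<^sup>2) om)" if "om : space M" for om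
  using r by (intro continuous_intros continuous_on_compose2[OF cont[OF that]]) auto
 show "r * B (0 / r\<^sup>2) om = 0" if "om : space M" for om using zero[OF that] by simp
 fix u :: "nat => real" and ph :: "nat => real => real" and n
 assume u: "0 <= u 0" "mono u" and ph: "!!i. ph i : borel_measurable borel" "!!i x. 0 <= ph i x & ph i x <= 1"
 have "expectation (?A n ph u) =
  expectation (%om. \<Prod>i<n. (%x. ph i (r * x)) (B (u (Suc i) / r\<^sup>2) om - B (u i / r\<^sup>2) om))"
  by (simp add: right_diff_distrib)
 also have "... = (\<Prod>i<n. \<integral>x. ph i (r * x) \<partial>gauss (u (Suc i) / r\<^sup>2 - u i / r\<^sup>2))"
  using u ph by (intro increments) (auto simp: mono_def divide_right_mono intro!: measurable_compose[OF _ ph(1)])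
 also have "... = (\<Prod>i<n. \<integral>x. ph i x \<partial>gauss (u (Suc i) - u i))"
 proof (rule prod.cong)
  fix i
  have "u i / r\<^sup>2 <= u (Suc i) / r\<^sup>2" using monoD[OF u(2), of i "Suc i"] by (intro divide_right_mono) auto
  then show "(\<integral>x. ph i (r * x) \<partial>gauss (u (Suc i) / r\<^sup>2 - u i / r\<^sup>2)) = (\<integral>x. ph i x \<partial>gauss (u (Suc i) - u i))"
   using r by (subst gauss_scale_integral) (auto simp: ph right_diff_distrib)
 qed simp
 finally show "expectation (?A n ph u) = (\<Prod>i<n. \<integral>x. ph i x \<partial>gauss (u (Suc i) - u i))" .
qed

end

section \<open>Path laws at dyadic times and the Markov property\<close>

text \<open>A countable dense time set with nested levels: finitely many of its points lie on one
  grid, where Brownian values are sums of independent increments.\<close>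

definition dyadics :: "real set" where
 "dyadics = (\<Union>n::nat. range (%k::nat. real k / 2 ^ n))"

abbreviation dyadic_paths :: "(real => real) measure" where
 "dyadic_paths \<equiv> \<Pi>\<^sub>M q\<in>dyadics. borel"

lemma dyadics_nonneg: "q : dyadics ==> 0 <= q"
 by (auto simp: dyadics_def)

lemma dyadicI: "real k / 2 ^ n : dyadics"
 by (auto simp: dyadics_def)

lemma zero_dyadic: "0 : dyadics"
 using dyadicI[of 0 0] by simp

lemma countable_dyadics: "countable dyadics"
 by (simp add: dyadics_def)

lemma dyadic_refine: "n <= m ==> real k / 2 ^ n = real (k * 2 ^ (m - n)) / 2 ^ m"
 by (simp add: field_simps flip: power_add)

lemma finite_dyadics_level:
 assumes "finite J" "J \<subseteq> dyadics"
 obtains n k where "!!q. q : J ==> q = real (k q) / 2 ^ n"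
proof -
 have "\<exists>n. \<forall>q\<in>J. \<exists>k. q = real k / 2 ^ n"
  using assms
 proof (induction J rule: finite_induct)
  case (insert q J)
  then obtain n where n: "\<forall>q\<in>J. \<exists>k. q = real k / 2 ^ n" by auto
  obtain m k where q: "q = real k / 2 ^ m" using insert.prems by (auto simp: dyadics_def)
  show ?case
  proof (rule exI[of _ "max n m"], rule ballI)
   fix p assume "p : insert q J"
   then show "\<exists>k'. p = real k' / 2 ^ max n m"
    using n q dyadic_refine[of m "max n m"] dyadic_refine[of n "max n m"] by (metis insertE max.cobounded1 max.cobounded2)
  qed
 qed auto
 then show ?thesis using that by metis
qed

lemma dyadic_add:
 assumes "q : dyadics" "r : dyadics"
 shows "q + r : dyadics"
proof -
 have "finite {q, r}" "{q, r} \<subseteq> dyadics" using assms by auto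
 then obtain n k where *: "!!p. p : {q, r} ==> p = real (k p) / 2 ^ n" by (rule finite_dyadics_level) blast
 have "q + r = real (k q + k r) / 2 ^ n" using *[of q] *[of r] by (simp only: of_nat_add add_divide_distrib insertI1 insertI2)
 then show ?thesis using dyadicI by metis
qed

definition dyadic_up :: "nat => real => real" where
 "dyadic_up n t = real (nat \<lceil>t * 2 ^ n\<rceil>) / 2 ^ n"

lemma dyadic_up_bounds:
 assumes "0 <= t"
 shows "t <= dyadic_up n t" "dyadic_up n t < t + 1 / 2 ^ n" "dyadic_up n t : dyadics"
proof -
 have "0 <= \<lceil>t * 2 ^ n\<rceil>" using assms by (simp add: zero_le_ceiling less_le_trans[of _ 0])
 then have r: "real (nat \<lceil>t * 2 ^ n\<rceil>) = of_int \<lceil>t * 2 ^ n\<rceil>" by simp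
 have c: "t * 2 ^ n <= of_int \<lceil>t * 2 ^ n\<rceil>" "of_int \<lceil>t * 2 ^ n\<rceil> < t * 2 ^ n + 1" by linarith+
 show "t <= dyadic_up n t" unfolding dyadic_up_def r using c(1) by (simp add: field_simps)
 show "dyadic_up n t < t + 1 / 2 ^ n" unfolding dyadic_up_def r using c(2) by (simp add: field_simps)
 show "dyadic_up n t : dyadics" unfolding dyadic_up_def by (rule dyadicI)
qed

lemma dyadic_up_tendsto: "0 <= t ==> (%n. dyadic_up n t) ----> t"
proof (rule tendsto_sandwich[of "%_. t" _ _ "%n. t + 1 / 2 ^ n"])
 assume t: "0 <= t"
 have "(%n. t + 1 / 2 ^ n) ----> t + 0" by (intro tendsto_intros) real_asymp
 then show "(%n. t + 1 / 2 ^ n) ----> t" by simp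
 show "\<forall>\<^sub>F n in sequentially. t <= dyadic_up n t" "\<forall>\<^sub>F n in sequentially. dyadic_up n t <= t + 1 / 2 ^ n"
  using dyadic_up_bounds(1,2)[OF t] by (auto intro!: always_eventually less_imp_le)
qed simp

lemma dyadic_dense: "0 <= s ==> s < t ==> \<exists>q\<in>dyadics. s <= q & q < t"
proof -
 assume s: "0 <= s" "s < t"
 have "\<forall>\<^sub>F n in sequentially. dyadic_up n s < t" using order_tendstoD(2)[OF dyadic_up_tendsto[OF s(1)] s(2)] .
 then obtain n where "dyadic_up n s < t" by (auto simp: eventually_sequentially)
 then show ?thesis using dyadic_up_bounds[OF s(1), of n] by auto
qed

lemma integral_law_eq:
 assumes "distr M K X = distr N K Y" "X : M \<rightarrow>\<^sub>M K" "Y : N \<rightarrow>\<^sub>M K" "H : borel_measurable K"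
 shows "(LINT x|M. H (X x)) = (\<integral>x. H (Y x) \<partial>N :: real)"
 using integral_distr[OF assms(2,4)] integral_distr[OF assms(3,4)] by (simp add: assms(1))

lemma pair_product_expectation:
 fixes f :: "'a => real" and g :: "'b => real"
 assumes M: "prob_space M" and N: "prob_space N" and fm [measurable]: "f : borel_measurable M" and gm [measurable]: "g : borel_measurable N"
  and b: "!!x. x : space M ==> \<bar>f x\<bar> <= 1" "!!y. y : space N ==> \<bar>g y\<bar> <= 1"
 shows "(\<integral>z. f (fst z) * g (snd z) \<partial>(M \<Otimes>\<^sub>M N)) = (LINT x|M. f x) * (LINT y|N. g y)"
proof -
 interpret M: prob_space M by fact
 interpret N: prob_space N by fact
 interpret P: pair_prob_space M N ..
 have "integrable (M \<Otimes>\<^sub>M N) (%z. f (fst z) * g (snd z))"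
 proof (rule P.integrable_const_bound[where B=1])
  show "AE z in M \<Otimes>\<^sub>M N. norm (f (fst z) * g (snd z)) <= 1"
   using b by (intro AE_I2) (auto simp: space_pair_measure abs_mult intro!: mult_le_one)
 qed simp
 then show ?thesis
  by (subst P.integral_fst'[symmetric]) (simp_all add: split_beta')
qed

lemma prod_lessThan_add: "(\<Prod>i<k + (m::nat). g i) = (\<Prod>i<k. g i) * (\<Prod>i<m. g (k + i))" for g :: "nat => real"
 by (induction m) (simp_all add: mult.assoc)

lemma sums_functional_measurable:
 fixes ph :: "'i => real => real"
 assumes "!!z. ph z : borel_measurable borel"
 shows "(%v. \<Prod>z\<in>J. ph z (\<Sum>i\<in>F z. v i)) : borel_measurable (\<Pi>\<^sub>M i\<in>(UNIV::nat set). borel)"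
proof (rule borel_measurable_prod)
 fix z
 have "(%v. \<Sum>i\<in>F z. v i) : borel_measurable (\<Pi>\<^sub>M i\<in>(UNIV::nat set). borel :: real measure)"
  by (intro borel_measurable_sum measurable_component_singleton) simp
 then show "(%v. ph z (\<Sum>i\<in>F z. v i)) : borel_measurable (\<Pi>\<^sub>M i\<in>(UNIV::nat set). borel)"
  by (rule measurable_compose[OF _ assms])
qed

text \<open>Finitely many test functions are padded by the constant 1 to an initial segment, whose
  length may be taken at least \<open>k\<close>.\<close>

lemma sequence_law_eqI:
 fixes X :: "nat => 'a => real" and Y :: "nat => 'b => real"
 assumes M: "prob_space M" and N: "prob_space N" and X: "!!i. X i : borel_measurable M" and Y: "!!i. Y i : borel_measurable N"
  and eq: "!!m (ph :: nat => real => real). k <= m ==> (!!i. ph i : borel_measurable borel) ==> (!!i x. 0 <= ph i x & ph i x <= 1) ==>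
   (LINT x|M. (\<Prod>i<m. ph i (X i x))) = (LINT x|N. (\<Prod>i<m. ph i (Y i x)))"
 shows "distr M (\<Pi>\<^sub>M i\<in>UNIV. borel) (%x i. X i x) = distr N (\<Pi>\<^sub>M i\<in>UNIV. borel) (%x i. Y i x)"
proof -
 let ?A = "\<Pi>\<^sub>M i\<in>UNIV. borel"
 have "distr M ?A (%x. \<lambda>i\<in>UNIV. X i x) = distr N ?A (%x. \<lambda>i\<in>UNIV. Y i x)"
 proof (rule determining_law[OF determining_continuous _ M N X Y])
  fix J :: "nat set" and ph :: "nat => real => real"
  assume J: "finite J" and ph: "!!i. ph i : {g. continuous_on UNIV g & (\<forall>x. 0 <= g x & g x <= 1)}"
  define m where "m = max k (Suc (Max (insert 0 J)))"
  have m: "J \<subseteq> {..<m}" using J by (auto simp: m_def less_Suc_eq_le less_max_iff_disj)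
  let ?ph = "%i. if i : J then ph i else (%_. 1 :: real)"
  have e: "(\<Prod>i\<in>J. ph i (z i)) = (\<Prod>i<m. ?ph i (z i))" for z
   using m by (intro prod.mono_neutral_cong_left) auto
  have "?ph i : borel_measurable borel" for i
   using ph[of i] by (auto intro: borel_measurable_continuous_onI)
  then show "(LINT x|M. (\<Prod>i\<in>J. ph i (X i x))) = (LINT x|N. (\<Prod>i\<in>J. ph i (Y i x)))"
   unfolding e by (intro eq[where ph="?ph"]) (use ph in \<open>auto simp: m_def\<close>)
 qed auto
 then show ?thesis by (simp add: restrict_def)
qed

context cbm
begin

definition incr :: "nat => nat => 'a => real" where
 "incr n i om = B (real (Suc i) / 2 ^ n) om - B (real i / 2 ^ n) om"

lemma incr_measurable [measurable]: "incr n i : borel_measurable M"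
 unfolding incr_def[abs_def] by (intro borel_measurable_diff rv) auto

lemma incr_product:
 fixes ph :: "nat => real => real"
 assumes "!!i. ph i : borel_measurable borel" "!!i x. 0 <= ph i x & ph i x <= 1"
 shows "expectation (%om. \<Prod>i<m. ph i (incr n i om)) = (\<Prod>i<m. \<integral>x. ph i x \<partial>gauss (1 / 2 ^ n))"
proof -
 have "mono (%i. real i / 2 ^ n)" by (intro monoI divide_right_mono) auto
 moreover have "real (Suc i) / 2 ^ n - real i / 2 ^ n = 1 / 2 ^ n" for i by (simp add: field_simps)
 ultimately show ?thesis
  using increments[of "%i. real i / 2 ^ n" ph m] assms by (simp add: incr_def del: of_nat_Suc)
qed

lemma grid_value: "om : space M ==> B (real k / 2 ^ n) om = (\<Sum>i<k. incr n i om)"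
 using sum_lessThan_telescope[of "%i. B (real i / 2 ^ n) om" k] zero by (simp add: incr_def del: of_nat_Suc)

text \<open>The discrete Markov property: from index k on the increments may be read from an
  independent copy.\<close>

lemma incr_split_law:
 "distr M (\<Pi>\<^sub>M i\<in>UNIV. borel) (%om i. incr n i om) =
  distr (M \<Otimes>\<^sub>M M) (\<Pi>\<^sub>M i\<in>UNIV. borel) (%z i. if i < k then incr n i (fst z) else incr n (i - k) (snd z))"
proof -
 interpret P: pair_prob_space M M ..
 let ?Y = "%i z. if i < k then incr n i (fst z) else incr n (i - k) (snd z)"
 show ?thesis
 proof (rule sequence_law_eqI[OF prob_space_axioms P.prob_space_axioms incr_measurable])
  show "?Y i : borel_measurable (M \<Otimes>\<^sub>M M)" for i by (cases "i < k") simp_all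
  fix m and ph :: "nat => real => real"
  assume "k <= m" and ph: "!!i. ph i : borel_measurable borel" "!!i x. 0 <= ph i x & ph i x <= 1"
  then obtain l where m: "m = k + l" using le_Suc_ex by blast
  have pm: "(%om. \<Prod>i\<in>I. ph (c i) (incr n i om)) : borel_measurable M" for I and c :: "nat => nat"
   by (intro borel_measurable_prod measurable_compose[OF incr_measurable ph(1)])
  have "(\<integral>z. (\<Prod>i<m. ph i (?Y i z)) \<partial>(M \<Otimes>\<^sub>M M)) =
   (\<integral>z. (\<Prod>i<k. ph i (incr n i (fst z))) * (\<Prod>i<l. ph (k + i) (incr n i (snd z))) \<partial>(M \<Otimes>\<^sub>M M))"
   by (simp add: m prod_lessThan_add)
  also have "... = expectation (%om. \<Prod>i<k. ph i (incr n i om)) * expectation (%om. \<Prod>i<l. ph (k + i) (incr n i om))"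
   using ph(2) by (intro pair_product_expectation prob_space_axioms pm[of "%i. i"] pm[of "%i. k + i"])
    (auto simp: abs_prod intro!: prod_le_1)
  also have "... = (\<Prod>i<m. \<integral>x. ph i x \<partial>gauss (1 / 2 ^ n))"
   using incr_product[where ph=ph and m=k and n=n, OF ph] incr_product[where ph="%i. ph (k + i)" and m=l and n=n, OF ph]
   by (simp add: m prod_lessThan_add)
  also have "... = expectation (%om. \<Prod>i<m. ph i (incr n i om))" by (rule incr_product[OF ph, symmetric])
  finally show "expectation (%om. \<Prod>i<m. ph i (incr n i om)) = (\<integral>z. (\<Prod>i<m. ph i (?Y i z)) \<partial>(M \<Otimes>\<^sub>M M))" ..
 qed
qed

definition dyadic_path :: "'a => real => real" where
 "dyadic_path om = (\<lambda>q\<in>dyadics. B q om)"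

lemma dyadic_path_measurable [measurable]: "dyadic_path : M \<rightarrow>\<^sub>M dyadic_paths"
 unfolding dyadic_path_def[abs_def] by (intro measurable_restrict rv dyadics_nonneg)

end

lemma dyadic_law_unique:
 assumes "cbm M B" "cbm N B'"
 shows "distr M dyadic_paths (cbm.dyadic_path B) = distr N dyadic_paths (cbm.dyadic_path B')"
proof -
 let ?A = "%J ph. \<integral>om. (\<Prod>q\<in>J. ph q (B q om)) \<partial>M"
 let ?B = "%J ph. \<integral>om. (\<Prod>q\<in>J. ph q (B' q om)) \<partial>N"
 interpret M: cbm M B by fact
 interpret N: cbm N B' by fact
 note P = M.prob_space_axioms N.prob_space_axioms
 have "distr M dyadic_paths (%om. \<lambda>q\<in>dyadics. B q om) = distr N dyadic_paths (%om. \<lambda>q\<in>dyadics. B' q om)"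
 proof (rule determining_law[OF determining_continuous _ P M.rv[OF dyadics_nonneg] N.rv[OF dyadics_nonneg]])
  fix J and ph :: "real => real => real"
  assume J: "finite J" "J \<subseteq> dyadics" and ph: "!!i. ph i : {g. continuous_on UNIV g & (\<forall>x. 0 <= g x & g x <= 1)}"
  obtain n k where k: "!!q. q : J ==> q = real (k q) / 2 ^ n" using finite_dyadics_level[OF J] by blast
  let ?H = "%v. \<Prod>q\<in>J. ph q (\<Sum>i<k q. v i)"
  have "ph q : borel_measurable borel" for q using ph[of q] by (auto intro: borel_measurable_continuous_onI)
  note H = sums_functional_measurable[where ph=ph and J=J and F="%q. {..<k q}", OF this]
  have "B q om = (\<Sum>i<k q. M.incr n i om)" if "om : space M" "q : J" for om q
   using M.grid_value[OF that(1), of "k q" n] arg_cong[OF k[OF that(2)], of "%q. B q om"] by (rule trans[rotated])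
  then have "?A J ph = (LINT om|M. ?H (%i. M.incr n i om))"
   by (intro Bochner_Integration.integral_cong prod.cong refl) simp
  also have "... = (LINT om|N. ?H (%i. N.incr n i om))"
  proof (rule integral_law_eq[OF sequence_law_eqI[where k=0, OF P M.incr_measurable N.incr_measurable] _ _ H])
   show "M.expectation (%om. \<Prod>i<m. ph i (M.incr n i om)) = N.expectation (%om. \<Prod>i<m. ph i (N.incr n i om))"
    if "!!i. ph i : borel_measurable borel" "!!i x. 0 <= ph i x & ph i x <= 1" for m and ph :: "nat => real => real"
    by (simp only: M.incr_product[OF that] N.incr_product[OF that])
  qed (auto intro!: measurable_PiM_single')
  finally have 1: "?A J ph = (LINT om|N. ?H (%i. N.incr n i om))" .
  have "B' q om = (\<Sum>i<k q. N.incr n i om)" if "om : space N" "q : J" for om q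
   using N.grid_value[OF that(1), of "k q" n] arg_cong[OF k[OF that(2)], of "%q. B' q om"] by (rule trans[rotated])
  then have "(LINT om|N. ?H (%i. N.incr n i om)) = ?B J ph"
   by (intro Bochner_Integration.integral_cong prod.cong refl) simp
  then show "?A J ph = ?B J ph" using 1 by simp
 qed auto
 then show ?thesis by (simp add: M.dyadic_path_def[abs_def] N.dyadic_path_def[abs_def])
qed

lemma dyadic_up_nonneg: "0 <= dyadic_up n t"
 unfolding dyadic_up_def by (rule divide_nonneg_nonneg) simp_all

lemma dyadic_set_countable: "countable (dyadics \<inter> S)"
 using countable_dyadics by (rule countable_subset[rotated]) auto

lemma nn_integral_pair_product:
 assumes P: "sigma_finite_measure Q" and f: "f : borel_measurable P" and g: "g : borel_measurable Q"
 shows "(\<integral>\<^sup>+z. f (fst z) * g (snd z) \<partial>(P \<Otimes>\<^sub>M Q)) = (\<integral>\<^sup>+x. f x \<partial>P) * (\<integral>\<^sup>+y. g y \<partial>Q)"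
proof -
 let ?A = "\<integral>\<^sup>+y. g y \<partial>Q"
 interpret sigma_finite_measure Q by fact
 note [measurable] = f g
 have "(\<integral>\<^sup>+z. f (fst z) * g (snd z) \<partial>(P \<Otimes>\<^sub>M Q)) = (\<integral>\<^sup>+x. (\<integral>\<^sup>+y. f x * g y \<partial>Q) \<partial>P)"
  by (subst nn_integral_fst[symmetric]) simp_all
 also have "... = (\<integral>\<^sup>+x. f x * ?A \<partial>P)" by (simp add: nn_integral_cmult)
 also have "... = (\<integral>\<^sup>+x. f x \<partial>P) * ?A" by (simp add: nn_integral_multc)
 finally show ?thesis .
qed

context cbm
begin

definition past :: "real => 'a => real => real" where
 "past s om = (\<lambda>q\<in>dyadics \<inter> {..s}. B q om)"

definition future :: "real => 'a => real => real" where
 "future t om = (\<lambda>q\<in>dyadics. B (t + q) om - B t om)"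

definition wiener :: "(real => real) measure" where
 "wiener = distr M dyadic_paths dyadic_path"

lemma sets_wiener [measurable_cong]: "sets wiener = sets dyadic_paths"
 by (simp add: wiener_def)

lemma prob_space_wiener: "prob_space wiener"
 unfolding wiener_def by (rule prob_space_distr) measurable

lemma past_measurable [measurable]: "past s : M \<rightarrow>\<^sub>M (\<Pi>\<^sub>M q\<in>dyadics \<inter> {..s}. borel)"
 unfolding past_def[abs_def] by (intro measurable_restrict rv dyadics_nonneg) auto

lemma future_measurable_const: "0 <= t ==> future t : M \<rightarrow>\<^sub>M dyadic_paths"
 unfolding future_def[abs_def] by (intro measurable_restrict borel_measurable_diff rv add_nonneg_nonneg) (auto dest: dyadics_nonneg)

text \<open>Past and future are put into one family indexed by pairs whose flag \<open>True\<close>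
  marks the future. Finitely many members live on one grid containing \<open>s\<close>, where
  \<open>incr_split_law\<close> replaces the future by an independent copy.\<close>

lemma markov_dyadic:
 assumes s: "s : dyadics"
 shows "distr M ((\<Pi>\<^sub>M q\<in>dyadics \<inter> {..s}. borel) \<Otimes>\<^sub>M dyadic_paths) (%om. (past s om, future s om)) =
  distr M (\<Pi>\<^sub>M q\<in>dyadics \<inter> {..s}. borel) (past s) \<Otimes>\<^sub>M wiener"
proof -
 let ?A = "%J ph V. \<integral>x. (\<Prod>z\<in>J. ph z (V z x)) \<partial>(M \<Otimes>\<^sub>M M)"
 let ?P = "\<Pi>\<^sub>M q\<in>dyadics \<inter> {..s}. borel :: real measure" and ?D = dyadic_paths
 interpret P: pair_prob_space M M ..
 define C where "C = {False} \<times> (dyadics \<inter> {..s}) \<union> {True} \<times> dyadics"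
 define W where "W z om = (if fst z then B (s + snd z) om - B s om else B (snd z) om)" for z om
 define V where "V z x = B (snd z) (if fst z then snd x else fst x)" for z and x :: "'a \<times> 'a"
 have C: "snd z : dyadics" "0 <= snd z" "\<not> fst z ==> snd z <= s" if "z : C" for z
  using that dyadics_nonneg by (auto simp: C_def)
 have Wm: "W z : borel_measurable M" if "z : C" for z
  unfolding W_def[abs_def] using C(2)[OF that] dyadics_nonneg[OF s] rv by (cases "fst z") auto
 have Vm: "V z : borel_measurable (M \<Otimes>\<^sub>M M)" if "z : C" for z
  unfolding V_def[abs_def] using measurable_compose[OF measurable_fst rv[OF C(2)[OF that]]] measurable_compose[OF measurable_snd rv[OF C(2)[OF that]]]
  by (cases "fst z") auto
 let ?C = "\<Pi>\<^sub>M z\<in>C. borel :: real measure" and ?S = "\<Pi>\<^sub>M i\<in>(UNIV::nat set). borel :: real measure"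
 have law: "distr M ?C (%om. \<lambda>z\<in>C. W z om) = distr (M \<Otimes>\<^sub>M M) ?C (%x. \<lambda>z\<in>C. V z x)"
 proof (rule determining_law[OF determining_continuous _ prob_space_axioms P.prob_space_axioms Wm Vm])
  fix J and ph :: "bool \<times> real => real => real"
  assume J: "finite J" "J \<subseteq> C" and ph: "!!i. ph i : {g. continuous_on UNIV g & (\<forall>x. 0 <= g x & g x <= 1)}"
  have "finite (insert s (snd ` J))" "insert s (snd ` J) \<subseteq> dyadics" using J s C(1) by auto
  then obtain n k' where k': "!!q. q : insert s (snd ` J) ==> q = real (k' q) / 2 ^ n" by (rule finite_dyadics_level) blast
  obtain j where j: "s = real j / 2 ^ n" using k'[of s] by blast
  have "\<forall>z\<in>J. \<exists>k. snd z = real k / 2 ^ n" using k' by blast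
  then obtain k where k: "!!z. z : J ==> snd z = real (k z) / 2 ^ n" by metis
  \<comment> \<open>The block of increments that adds up to the coordinate z. For the past it starts
    at 0, for the future at the index j of the time s.\<close>
  define F where "F z = (if fst z then {j..<j + k z} else {..<k z})" for z
  let ?Y = "%i x. if i < j then incr n i (fst x) else incr n (i - j) (snd x)"
  have W: "W z om = (\<Sum>i\<in>F z. incr n i om)" if z: "z : J" and om: "om : space M" for z om
  proof (cases "fst z")
   case True
   have "W z om = B (real (j + k z) / 2 ^ n) om - B (real j / 2 ^ n) om"
    using True by (simp add: W_def k[OF z] j add_divide_distrib)
   also have "... = (\<Sum>i<j + k z. incr n i om) - (\<Sum>i<j. incr n i om)" by (simp only: grid_value[OF om])
   also have "... = (\<Sum>i\<in>{j..<j + k z}. incr n i om)"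
    using sum_diff_nat_ivl[of 0 j "j + k z" "%i. incr n i om"] by (simp add: atLeast0LessThan)
   finally show ?thesis using True by (simp add: F_def)
  qed (simp add: W_def F_def k[OF z] grid_value[OF om])
  have V: "V z x = (\<Sum>i\<in>F z. ?Y i x)" if z: "z : J" and x: "x : space (M \<Otimes>\<^sub>M M)" for z x
  proof -
   have x: "fst x : space M" "snd x : space M" using x by (auto simp: space_pair_measure)
   show ?thesis
   proof (cases "fst z")
    case True
    then have "V z x = (\<Sum>i<k z. incr n i (snd x))" by (simp add: V_def k[OF z] grid_value[OF x(2)])
    also have "... = (\<Sum>i\<in>{0 + j..<k z + j}. incr n (i - j) (snd x))"
     by (subst sum.shift_bounds_nat_ivl) (simp add: atLeast0LessThan)
    also have "... = (\<Sum>i\<in>F z. ?Y i x)" using True by (intro sum.cong) (auto simp: F_def)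
    finally show ?thesis .
   next
    case False
    have "real (k z) / 2 ^ n <= real j / 2 ^ n" using C(3)[of z] J(2) z False k[OF z] j by auto
    then have "k z <= j" by (simp add: divide_le_cancel)
    then have "(\<Sum>i<k z. incr n i (fst x)) = (\<Sum>i<k z. ?Y i x)" by (intro sum.cong) auto
    then show ?thesis using False by (simp add: V_def F_def k[OF z] grid_value[OF x(1)])
   qed
  qed
  let ?H = "%v. \<Prod>z\<in>J. ph z (\<Sum>i\<in>F z. v i)"
  have "ph z : borel_measurable borel" for z using ph[of z] by (auto intro: borel_measurable_continuous_onI)
  note H = sums_functional_measurable[where ph=ph and J=J and F=F, OF this]
  have m1: "(%om i. incr n i om) : M \<rightarrow>\<^sub>M ?S" by (rule measurable_PiM_single') auto
  have Ym: "?Y i : borel_measurable (M \<Otimes>\<^sub>M M)" for i by (cases "i < j") simp_all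
  have m2: "(%x i. ?Y i x) : (M \<Otimes>\<^sub>M M) \<rightarrow>\<^sub>M ?S" using Ym by (intro measurable_PiM_single') auto
  have "expectation (%om. \<Prod>z\<in>J. ph z (W z om)) = expectation (%om. ?H (%i. incr n i om))"
   by (intro Bochner_Integration.integral_cong prod.cong refl) (simp add: W)
  also have "... = (\<integral>x. ?H (%i. ?Y i x) \<partial>(M \<Otimes>\<^sub>M M))" by (rule integral_law_eq[OF incr_split_law m1 m2 H])
  also have "... = ?A J ph V"
   by (intro Bochner_Integration.integral_cong prod.cong refl) (simp add: V)
  finally show "expectation (%om. \<Prod>z\<in>J. ph z (W z om)) = ?A J ph V" .
 qed auto
 define Ph where "Ph w = (\<lambda>q\<in>dyadics \<inter> {..s}. w (False, q), \<lambda>r\<in>dyadics. w (True, r))" for w :: "bool \<times> real => real"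
 have Phm: "Ph : ?C \<rightarrow>\<^sub>M (?P \<Otimes>\<^sub>M ?D)"
  unfolding Ph_def[abs_def] by (intro measurable_Pair measurable_restrict measurable_component_singleton) (auto simp: C_def)
 have c: "Ph (\<lambda>z\<in>C. W z om) = (past s om, future s om)" "Ph (\<lambda>z\<in>C. V z x) = (past s (fst x), dyadic_path (snd x))" for om x
  by (auto simp: Ph_def past_def future_def dyadic_path_def C_def W_def V_def fun_eq_iff restrict_def)
 have "distr M (?P \<Otimes>\<^sub>M ?D) (%om. (past s om, future s om)) = distr (distr M ?C (%om. \<lambda>z\<in>C. W z om)) (?P \<Otimes>\<^sub>M ?D) Ph"
  using distr_distr[OF Phm measurable_restrict[of C W M, OF Wm]] by (simp add: comp_def c)
 also have "... = distr (M \<Otimes>\<^sub>M M) (?P \<Otimes>\<^sub>M ?D) (%x. (past s (fst x), dyadic_path (snd x)))"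
  unfolding law using distr_distr[OF Phm measurable_restrict[of C V "M \<Otimes>\<^sub>M M", OF Vm]] by (simp add: comp_def c)
 also have "... = distr M ?P (past s) \<Otimes>\<^sub>M wiener"
  unfolding wiener_def
  by (subst pair_measure_distr) (auto intro!: prob_space_imp_sigma_finite prob_space_distr simp: split_beta')
 finally show ?thesis .
qed

lemma past_future:
 assumes s: "s : dyadics" and A: "A : sets (\<Pi>\<^sub>M q\<in>dyadics \<inter> {..s}. borel)" and h: "h : borel_measurable dyadic_paths"
 shows "(\<integral>\<^sup>+om. indicator A (past s om) * h (future s om) \<partial>M) = (\<integral>\<^sup>+om. indicator A (past s om) \<partial>M) * (\<integral>\<^sup>+om. h (dyadic_path om) \<partial>M)"
proof -
 let ?A = "\<integral>\<^sup>+y. h y \<partial>wiener"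
 note [measurable] = A h future_measurable_const[OF dyadics_nonneg[OF s]]
 let ?P = "\<Pi>\<^sub>M q\<in>dyadics \<inter> {..s}. borel :: real measure" and ?D = dyadic_paths
 have "(\<integral>\<^sup>+om. indicator A (past s om) * h (future s om) \<partial>M) =
  (\<integral>\<^sup>+z. indicator A (fst z) * h (snd z) \<partial>distr M (?P \<Otimes>\<^sub>M ?D) (%om. (past s om, future s om)))"
  by (subst nn_integral_distr) simp_all
 also have "... = (\<integral>\<^sup>+z. indicator A (fst z) * h (snd z) \<partial>(distr M ?P (past s) \<Otimes>\<^sub>M wiener))"
  by (simp only: markov_dyadic[OF s])
 also have "... = (\<integral>\<^sup>+x. indicator A x \<partial>distr M ?P (past s)) * ?A"
  by (rule nn_integral_pair_product) (use prob_space_wiener prob_space_imp_sigma_finite in auto)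
 also have "(\<integral>\<^sup>+x. indicator A x \<partial>distr M ?P (past s)) = (\<integral>\<^sup>+om. indicator A (past s om) \<partial>M)"
  by (rule nn_integral_distr) simp_all
 also have "?A = (\<integral>\<^sup>+om. h (dyadic_path om) \<partial>M)"
  unfolding wiener_def by (rule nn_integral_distr) simp_all
 finally show ?thesis .
qed

lemma random_time_measurable:
 assumes T: "T : borel_measurable M" and T0: "!!om. om : space M ==> 0 <= T om"
 shows "(%om. B (T om) om) : borel_measurable M"
proof (rule borel_measurable_LIMSEQ_real)
 show "(%n. B (dyadic_up n (T om)) om) ----> B (T om) om" if "om : space M" for om
  by (rule continuous_on_tendsto_compose[OF cont[OF that] dyadic_up_tendsto[OF T0[OF that]]])
    (use T0[OF that] in \<open>auto simp: dyadic_up_nonneg\<close>)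
 show "(%om. B (dyadic_up n (T om)) om) : borel_measurable M" for n
  unfolding dyadic_up_def
 proof (rule measurable_compose_countable[where f="%k om. B (real k / 2 ^ n) om"])
  show "(%om. nat \<lceil>T om * 2 ^ n\<rceil>) : M \<rightarrow>\<^sub>M count_space UNIV" using T by measurable
 qed (intro rv, simp)
qed

lemma future_measurable:
 assumes T: "T : borel_measurable M" and T0: "!!om. om : space M ==> 0 <= T om"
 shows "(%om. future (T om) om) : M \<rightarrow>\<^sub>M dyadic_paths"
 unfolding future_def
 by (intro measurable_restrict borel_measurable_diff random_time_measurable borel_measurable_add T borel_measurable_const add_nonneg_nonneg T0)
   (auto dest: dyadics_nonneg)

text \<open>Stopping times for the dyadic past, up to null sets. Testing dyadic s is what is needed
  when T is rounded up to dyadic values.\<close>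

definition adapted :: "('a => real) => bool" where
 "adapted T \<longleftrightarrow> (\<forall>s\<in>dyadics. \<exists>A\<in>sets (\<Pi>\<^sub>M q\<in>dyadics \<inter> {..s}. borel). AE om in M. T om <= s \<longleftrightarrow> past s om : A)"

text \<open>The rounded time has index k when T lies in the k-th half-open cell. Both ends of the
  cell are decided by the past at its right end, because the earlier past is a restriction of the
  later one; for k = 0 the event is that T is at most 0.\<close>

lemma adapted_ceiling:
 assumes T: "adapted T" and T0: "!!om. om : space M ==> 0 <= T om"
 shows "\<exists>A\<in>sets (\<Pi>\<^sub>M q\<in>dyadics \<inter> {..real k / 2 ^ n}. borel). AE om in M. nat \<lceil>T om * 2 ^ n\<rceil> = k \<longleftrightarrow> past (real k / 2 ^ n) om : A"
proof -
 let ?s = "real k / 2 ^ n"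
 obtain A where A: "A : sets (\<Pi>\<^sub>M q\<in>dyadics \<inter> {..?s}. borel)" "AE om in M. T om <= ?s \<longleftrightarrow> past ?s om : A"
  using T dyadicI[of k n] unfolding adapted_def by blast
 show ?thesis
 proof (cases k)
  case 0
  have "AE om in M. nat \<lceil>T om * 2 ^ n\<rceil> = k \<longleftrightarrow> past ?s om : A"
   using A(2) AE_space
  proof eventually_elim
   case (elim om)
   have "nat \<lceil>T om * 2 ^ n\<rceil> = 0 \<longleftrightarrow> T om * 2 ^ n <= 0" by (simp add: ceiling_le_zero)
   also have "... \<longleftrightarrow> T om <= 0" using mult_le_cancel_right_pos[of "2 ^ n" "T om" 0] by simp
   finally show ?case using elim 0 by simp
  qed
  then show ?thesis using A(1) by blast
 next
  case (Suc j)
  let ?r = "real j / 2 ^ n"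
  have rs: "?r <= ?s" using Suc by (simp add: divide_right_mono)
  obtain A' where A': "A' : sets (\<Pi>\<^sub>M q\<in>dyadics \<inter> {..?r}. borel)" "AE om in M. T om <= ?r \<longleftrightarrow> past ?r om : A'"
   using T dyadicI[of j n] unfolding adapted_def by blast
  let ?P = "\<Pi>\<^sub>M q\<in>dyadics \<inter> {..?s}. borel :: real measure"
  define R where "R w = restrict w (dyadics \<inter> {..?r})" for w :: "real => real"
  have R: "R : ?P \<rightarrow>\<^sub>M (\<Pi>\<^sub>M q\<in>dyadics \<inter> {..?r}. borel)"
   unfolding R_def[abs_def] using rs by (intro measurable_restrict_subset) auto
  have Rp: "R (past ?s om) = past ?r om" for om
   using rs by (auto simp: R_def past_def restrict_def fun_eq_iff)
  have S: "A - (R -` A' \<inter> space ?P) : sets ?P" using A(1) measurable_sets[OF R A'(1)] by blast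
  have "AE om in M. nat \<lceil>T om * 2 ^ n\<rceil> = k \<longleftrightarrow> past ?s om : A - (R -` A' \<inter> space ?P)"
   using A(2) A'(2) AE_space
  proof eventually_elim
   case (elim om)
   have "past ?s om : space ?P" using measurable_space[OF past_measurable elim(3)] .
   then have "past ?s om : A - (R -` A' \<inter> space ?P) \<longleftrightarrow> T om <= ?s & \<not> T om <= ?r" using elim Rp by auto
   also have "... \<longleftrightarrow> T om * 2 ^ n <= real k & real j < T om * 2 ^ n"
    by (simp add: pos_le_divide_eq pos_divide_less_eq not_le)
   also have "... \<longleftrightarrow> \<lceil>T om * 2 ^ n\<rceil> = int k" using Suc by (simp add: ceiling_eq_iff conj_commute)
   also have "... \<longleftrightarrow> nat \<lceil>T om * 2 ^ n\<rceil> = k" using Suc by auto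
   finally show ?case by blast
  qed
  then show ?thesis using S by blast
 qed
qed

text \<open>A rounded time has countably many values; on each of them past and future at a fixed
  time are independent.\<close>

lemma strong_markov_grid:
 assumes T: "adapted T" and T0: "!!om. om : space M ==> 0 <= T om" and Tm: "T : borel_measurable M"
  and h: "h : borel_measurable dyadic_paths" and g: "g : borel_measurable borel"
 shows "(\<integral>\<^sup>+om. g (dyadic_up n (T om)) * h (future (dyadic_up n (T om)) om) \<partial>M) =
  (\<integral>\<^sup>+om. g (dyadic_up n (T om)) \<partial>M) * (\<integral>\<^sup>+om. h (dyadic_path om) \<partial>M)"
proof -
 let ?A = "\<integral>\<^sup>+om. h (dyadic_path om) \<partial>M"
 let ?B = "%ka F. \<Sum>k. \<integral>\<^sup>+om. indicator {k} (ka om) * F k om \<partial>M"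
 let ?C = "%k ka. \<integral>\<^sup>+om. indicator {k} (ka om) \<partial>M"
 define ka where "ka om = nat \<lceil>T om * 2 ^ n\<rceil>" for om
 have kam [measurable]: "ka : M \<rightarrow>\<^sub>M count_space UNIV" unfolding ka_def[abs_def] using Tm by measurable
 note [measurable] = h g future_measurable_const
 let ?s = "%k::nat. real k / 2 ^ n"
 have s0: "0 <= ?s k" for k by simp
 have kai [measurable]: "(%om. indicator {k} (ka om) :: ennreal) : borel_measurable M" for k
  by (rule measurable_compose[OF kam]) simp
 have part: "(\<integral>\<^sup>+om. F (ka om) om \<partial>M) = ?B ka F"
  if F: "!!k. F k : borel_measurable M" for F :: "nat => 'a => ennreal"
 proof -
  have "F (ka om) om = (\<Sum>k. indicator {k} (ka om) * F k om)" for om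
  proof -
   have "(\<Sum>k. indicator {k} (ka om) * F k om) = (\<Sum>k\<in>{ka om}. indicator {k} (ka om) * F k om)"
    by (rule suminf_finite) auto
   then show ?thesis by simp
  qed
  then have "(\<integral>\<^sup>+om. F (ka om) om \<partial>M) = (\<integral>\<^sup>+om. (\<Sum>k. indicator {k} (ka om) * F k om) \<partial>M)" by simp
  also have "... = ?B ka F"
   using F by (intro nn_integral_suminf) measurable
  finally show ?thesis .
 qed
 have hf: "(%om. h (future (?s k) om)) : borel_measurable M" for k
  by (rule measurable_compose[OF future_measurable_const[OF s0] h])
 have piece: "(\<integral>\<^sup>+om. indicator {k} (ka om) * (g (?s k) * h (future (?s k) om)) \<partial>M) =
  (\<integral>\<^sup>+om. indicator {k} (ka om) * g (?s k) \<partial>M) * ?A" for k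
 proof -
  obtain A where A: "A : sets (\<Pi>\<^sub>M q\<in>dyadics \<inter> {..?s k}. borel)" "AE om in M. ka om = k \<longleftrightarrow> past (?s k) om : A"
   using adapted_ceiling[OF T T0, of k n] unfolding ka_def by blast
  have ae: "AE om in M. indicator {k} (ka om) = (indicator A (past (?s k) om) :: ennreal)"
   using A(2) by eventually_elim (simp add: indicator_def)
  have Ap: "(%om. indicator A (past (?s k) om) :: ennreal) : borel_measurable M"
   using A(1) by measurable
  have "(\<integral>\<^sup>+om. indicator {k} (ka om) * (g (?s k) * h (future (?s k) om)) \<partial>M) =
   (\<integral>\<^sup>+om. g (?s k) * (indicator A (past (?s k) om) * h (future (?s k) om)) \<partial>M)"
   by (rule nn_integral_cong_AE) (use ae in \<open>eventually_elim, simp add: mult_ac\<close>)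
  also have "... = g (?s k) * ((\<integral>\<^sup>+om. indicator A (past (?s k) om) \<partial>M) * ?A)"
   using Ap hf by (subst nn_integral_cmult) (simp_all add: past_future[OF dyadicI A(1) h])
  also have "(\<integral>\<^sup>+om. indicator A (past (?s k) om) \<partial>M) = ?C k ka"
   by (rule nn_integral_cong_AE) (use ae in \<open>eventually_elim, simp\<close>)
  also have "g (?s k) * (?C k ka * ?A) =
   (\<integral>\<^sup>+om. indicator {k} (ka om) * g (?s k) \<partial>M) * ?A"
   by (subst nn_integral_multc) (simp_all add: mult_ac)
  finally show ?thesis .
 qed
 have up: "dyadic_up n (T om) = ?s (ka om)" for om by (simp add: dyadic_up_def ka_def)
 have "(\<integral>\<^sup>+om. g (dyadic_up n (T om)) * h (future (dyadic_up n (T om)) om) \<partial>M) =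
  (\<Sum>k. \<integral>\<^sup>+om. indicator {k} (ka om) * (g (?s k) * h (future (?s k) om)) \<partial>M)"
  unfolding up using hf by (intro part[of "%k om. g (?s k) * h (future (?s k) om)"]) simp
 also have "... = (\<Sum>k. (\<integral>\<^sup>+om. indicator {k} (ka om) * g (?s k) \<partial>M) * ?A)"
  by (simp only: piece)
 also have "... = (\<Sum>k. \<integral>\<^sup>+om. indicator {k} (ka om) * g (?s k) \<partial>M) * ?A"
  by simp
 also have "(\<Sum>k. \<integral>\<^sup>+om. indicator {k} (ka om) * g (?s k) \<partial>M) = (\<integral>\<^sup>+om. g (dyadic_up n (T om)) \<partial>M)"
  unfolding up by (rule part[of "%k om. g (?s k)", symmetric]) simp
 finally show ?thesis .
qed

text \<open>Rounded times tend to \<open>T\<close> from above, and path continuity carries the grid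
  version over for continuous test functions. The index \<open>None\<close> stands for
  \<open>T\<close> itself and \<open>Some q\<close> for the future increment over
  \<open>q\<close>.\<close>

lemma strong_markov:
 assumes T: "adapted T" and T0: "!!om. om : space M ==> 0 <= T om" and Tm: "T : borel_measurable M"
 shows "distr M (borel \<Otimes>\<^sub>M dyadic_paths) (%om. (T om, future (T om) om)) = distr M borel T \<Otimes>\<^sub>M wiener"
proof -
 let ?A = "%g H. %om. g (T om) * H (future (T om) om)"
 let ?B = "%H. %om. H (dyadic_path om)"
 let ?D = dyadic_paths
 interpret P: pair_prob_space M M ..
 define C where "C = insert None (Some ` dyadics)"
 define X where "X z om = (case z of None => T om | Some q => B (T om + q) om - B (T om) om)" for z om
 define Y where "Y z x = (case z of None => T (fst x) | Some q => B q (snd x))" for z and x :: "'a \<times> 'a"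
 have Xm: "X z : borel_measurable M" if "z : C" for z
  using that T0 Tm dyadics_nonneg
  by (auto simp: X_def[abs_def] C_def intro!: borel_measurable_diff random_time_measurable)
 have Ym: "Y z : borel_measurable (M \<Otimes>\<^sub>M M)" if "z : C" for z
  using that measurable_compose[OF measurable_fst Tm] measurable_compose[OF measurable_snd rv[OF dyadics_nonneg]]
  by (auto simp: Y_def[abs_def] C_def)
 let ?C = "\<Pi>\<^sub>M z\<in>C. borel :: real measure" and ?u = "%n om. dyadic_up n (T om)"
 have law: "distr M ?C (%om. \<lambda>z\<in>C. X z om) = distr (M \<Otimes>\<^sub>M M) ?C (%x. \<lambda>z\<in>C. Y z x)"
 proof (rule determining_law[OF determining_continuous _ prob_space_axioms P.prob_space_axioms Xm Ym])
  fix J and ph :: "real option => real => real"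
  assume J: "finite J" "J \<subseteq> C" and ph: "!!i. ph i : {g. continuous_on UNIV g & (\<forall>x. 0 <= g x & g x <= 1)}"
  have phm: "ph i : borel_measurable borel" for i using ph[of i] by (auto intro: borel_measurable_continuous_onI)
  define g where "g = (if None : J then ph None else (%_. 1))"
  have gm: "g : borel_measurable borel" and gc: "continuous_on UNIV g" and gb: "0 <= g x & g x <= 1" for x
   using phm ph[of None] by (auto simp: g_def)
  define H where "H w = (\<Prod>z\<in>J - {None}. ph z (w (the z)))" for w :: "real => real"
  have J0: "the z : dyadics" if "z : J - {None}" for z using that J(2) by (auto simp: C_def)
  have Hm: "H : borel_measurable ?D"
   unfolding H_def[abs_def] using J0 by (intro borel_measurable_prod measurable_compose[OF measurable_component_singleton, where g="ph _"] phm) auto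
  have Hb: "0 <= H w & H w <= 1" for w
   unfolding H_def using ph by (auto intro!: prod_nonneg prod_le_1)
  have split: "(\<Prod>z\<in>J. ph z (f z)) = g (f None) * (\<Prod>z\<in>J - {None}. ph z (f z))" for f
   using J(1) by (cases "None : J") (simp_all add: g_def prod.remove)
  have splitX: "(\<Prod>z\<in>J. ph z (X z om)) = g (T om) * H (future (T om) om)" for om
   unfolding split H_def using J0 by (intro arg_cong2[where f="(*)"] prod.cong) (auto simp: X_def future_def)
  have splitY: "(\<Prod>z\<in>J. ph z (Y z x)) = g (T (fst x)) * H (dyadic_path (snd x))" for x
   unfolding split H_def using J0 by (intro arg_cong2[where f="(*)"] prod.cong) (auto simp: Y_def dyadic_path_def)
  have HDm: "(?B H) : borel_measurable M" by (rule measurable_compose[OF dyadic_path_measurable Hm])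
  have upm: "?u n : borel_measurable M" for n unfolding dyadic_up_def using Tm by measurable
  have gTm: "(%om. g (?u n om)) : borel_measurable M" for n by (rule measurable_compose[OF upm gm])
  have HFm: "(%om. H (future (?u n om) om)) : borel_measurable M" for n
   by (rule measurable_compose[OF future_measurable[OF upm dyadic_up_nonneg] Hm])
  have grid: "expectation (%om. g (?u n om) * H (future (?u n om) om)) = expectation (%om. g (?u n om)) * expectation (?B H)" for n
  proof -
   have conv: "expectation F = enn2real (\<integral>\<^sup>+om. ennreal (F om) \<partial>M)" if "F : borel_measurable M" "!!om. 0 <= F om" for F
    using that by (intro integral_eq_nn_integral) auto
   have "(\<integral>\<^sup>+om. ennreal (g (?u n om) * H (future (?u n om) om)) \<partial>M) = (\<integral>\<^sup>+om. ennreal (g (?u n om)) \<partial>M) * (\<integral>\<^sup>+om. ennreal (H (dyadic_path om)) \<partial>M)"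
    using strong_markov_grid[OF T T0 Tm measurable_compose[OF Hm measurable_ennreal] measurable_compose[OF gm measurable_ennreal], of n] gb Hb
    by (simp add: ennreal_mult)
   then show ?thesis using gb Hb gTm HFm HDm by (simp add: conv enn2real_mult)
  qed
  have gL: "(%n. g (?u n om)) ----> g (T om)" if "om : space M" for om
   by (rule continuous_on_tendsto_compose[OF gc dyadic_up_tendsto[OF T0[OF that]]]) auto
  have HL: "(%n. H (future (?u n om) om)) ----> H (future (T om) om)" if om: "om : space M" for om
   unfolding H_def
  proof (rule tendsto_prod)
   fix z assume "z : J - {None}"
   then have q: "the z : dyadics" "0 <= the z" using J0 dyadics_nonneg by auto
   have "(%n. B (?u n om + the z) om - B (?u n om) om) ----> B (T om + the z) om - B (T om) om"
    using T0[OF om] q dyadic_up_nonneg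
    by (intro tendsto_diff continuous_on_tendsto_compose[OF cont[OF om]] tendsto_add tendsto_const dyadic_up_tendsto) auto
   then show "(%n. ph z (future (?u n om) om (the z))) ----> ph z (future (T om) om (the z))"
    using q ph[of z] by (intro continuous_on_tendsto_compose[of UNIV "ph z"]) (auto simp: future_def)
  qed
  have L1: "(%n. expectation (%om. g (?u n om) * H (future (?u n om) om))) ----> expectation (?A g H)"
  proof (rule integral_dominated_convergence[where w="%_. 1"])
   show "(?A g H) : borel_measurable M"
    by (intro borel_measurable_times measurable_compose[OF Tm gm] measurable_compose[OF future_measurable[OF Tm T0] Hm])
   show "AE om in M. (%n. g (?u n om) * H (future (?u n om) om)) ----> g (T om) * H (future (T om) om)"
    by (intro AE_I2 tendsto_mult gL HL)
   show "AE om in M. norm (g (?u n om) * H (future (?u n om) om)) <= 1" for n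
    using gb Hb by (intro AE_I2) (simp add: abs_mult mult_le_one)
  qed (use gTm HFm in \<open>auto intro!: borel_measurable_times\<close>)
  have L2: "(%n. expectation (%om. g (?u n om))) ----> expectation (%om. g (T om))"
   by (rule integral_dominated_convergence[where w="%_. 1"])
     (use gL gb gTm measurable_compose[OF Tm gm] in auto)
  have "expectation (?A g H) = expectation (%om. g (T om)) * expectation (?B H)"
   using LIMSEQ_unique[OF L1] tendsto_mult_right[OF L2, of "expectation (?B H)"] by (simp add: grid)
  also have "... = (\<integral>x. g (T (fst x)) * H (dyadic_path (snd x)) \<partial>(M \<Otimes>\<^sub>M M))"
   using gb Hb by (intro pair_product_expectation[symmetric] prob_space_axioms measurable_compose[OF Tm gm] HDm) auto
  finally show "expectation (%om. \<Prod>z\<in>J. ph z (X z om)) = (\<integral>x. (\<Prod>z\<in>J. ph z (Y z x)) \<partial>(M \<Otimes>\<^sub>M M))"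
   unfolding splitX splitY .
 qed auto
 define Ph where "Ph w = (w None, \<lambda>r\<in>dyadics. w (Some r))" for w :: "real option => real"
 have Phm: "Ph : ?C \<rightarrow>\<^sub>M (borel \<Otimes>\<^sub>M ?D)"
  unfolding Ph_def[abs_def] by (intro measurable_Pair measurable_restrict measurable_component_singleton) (auto simp: C_def)
 have c: "Ph (\<lambda>z\<in>C. X z om) = (T om, future (T om) om)" "Ph (\<lambda>z\<in>C. Y z x) = (T (fst x), dyadic_path (snd x))" for om x
  by (auto simp: Ph_def future_def dyadic_path_def C_def X_def Y_def fun_eq_iff restrict_def)
 have "distr M (borel \<Otimes>\<^sub>M ?D) (%om. (T om, future (T om) om)) = distr (distr M ?C (%om. \<lambda>z\<in>C. X z om)) (borel \<Otimes>\<^sub>M ?D) Ph"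
  using distr_distr[OF Phm measurable_restrict[of C X M, OF Xm]] by (simp add: comp_def c)
 also have "... = distr (M \<Otimes>\<^sub>M M) (borel \<Otimes>\<^sub>M ?D) (%x. (T (fst x), dyadic_path (snd x)))"
  unfolding law using distr_distr[OF Phm measurable_restrict[of C Y "M \<Otimes>\<^sub>M M", OF Ym]] by (simp add: comp_def c)
 also have "... = distr M borel T \<Otimes>\<^sub>M wiener"
  unfolding wiener_def using Tm
  by (subst pair_measure_distr) (auto intro!: prob_space_imp_sigma_finite prob_space_distr simp: split_beta')
 finally show ?thesis .
qed

end

section \<open>Recurrence of Brownian paths\<close>

lemma sets_Collect_Bex_countable:
 assumes "countable C" "!!q. q : C ==> {x\<in>space M. P q x} : sets M"
 shows "{x\<in>space M. \<exists>q\<in>C. P q x} : sets M"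
proof -
 have "(\<Union>q\<in>C. {x\<in>space M. P q x}) : sets M" using assms by (intro sets.countable_UN'') auto
 also have "(\<Union>q\<in>C. {x\<in>space M. P q x}) = {x\<in>space M. \<exists>q\<in>C. P q x}" by blast
 finally show ?thesis .
qed

text \<open>By symmetry the two closed half-lines have equal mass, and 0 carries none.\<close>

lemma gauss_half: "measure (gauss 1) {..0} = 1 / 2"
proof -
 interpret prob_space "gauss 1" by (rule prob_space_gauss) simp
 have "measure (gauss 1) {..0} = measure (distr (gauss 1) borel (%x. - 1 * x)) {..0}"
  by (subst gauss_scale) simp_all
 also have "... = measure (gauss 1) ((%x. - 1 * x) -` {..0} \<inter> space (gauss 1))"
  by (rule measure_distr) simp_all
 also have "(%x::real. - 1 * x) -` {..0} \<inter> space (gauss 1) = {0..}" by auto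
 finally have sym: "measure (gauss 1) {..0} = measure (gauss 1) {0..}" .
 have "emeasure (gauss 1) {0} = 0"
  unfolding gauss_def by (simp add: emeasure_density nn_integral_indicator_singleton)
 then have z: "measure (gauss 1) {0} = 0" by (simp add: measure_def)
 have "measure (gauss 1) ({..0} \<union> {0..}) = measure (gauss 1) {..0} + measure (gauss 1) ({0..} - {0})"
  by (subst finite_measure_Union[symmetric]) (auto intro!: arg_cong[where f="measure (gauss 1)"])
 also have "measure (gauss 1) ({0..} - {0}) = measure (gauss 1) {0..} - measure (gauss 1) {0}"
  by (rule finite_measure_Diff) auto
 also have "{..0} \<union> {0..} = space (gauss 1)" by auto
 finally show ?thesis using sym z prob_space by simp
qed

definition recurrent_path :: "(real => real) => bool" where
 "recurrent_path w \<longleftrightarrow> continuous_on {0..} w & w 0 = 0 & (\<forall>a r. 0 <= r --> (\<exists>s\<ge>r. w s = a))"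

lemma recurrent_pathD:
 assumes "recurrent_path w"
 shows "continuous_on {0..} w" "w 0 = 0" "0 <= r ==> \<exists>s\<ge>r. w s = a"
 using assms by (auto simp: recurrent_path_def)

lemma recurrent_pathI:
 assumes c: "continuous_on {0..} w" and z: "w 0 = 0"
  and up: "!!n::nat. \<exists>s\<ge>0. real n < w s" and down: "!!n::nat. \<exists>s\<ge>0. w s < - real n"
 shows "recurrent_path w"
 unfolding recurrent_path_def
proof (intro conjI allI impI c z)
 fix a r :: real assume r: "0 <= r"
 have "compact (w ` {0..r})" by (rule compact_continuous_image[OF continuous_on_subset[OF c]]) auto
 then obtain K where K: "!!s. s : {0..r} ==> \<bar>w s\<bar> <= K"
  by (metis (no_types, lifting) bounded_iff compact_imp_bounded image_eqI real_norm_def)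
 \<comment> \<open>Beyond this bound in either direction the path takes values only after time r,
   and these values enclose a.\<close>
 obtain n :: nat where n: "max K \<bar>a\<bar> < real n" using reals_Archimedean2 by blast
 obtain s1 where s1: "0 <= s1" "real n < w s1" using up by blast
 obtain s2 where s2: "0 <= s2" "w s2 < - real n" using down by blast
 have ge: "r <= s1" "r <= s2" using K[of s1] K[of s2] s1 s2 n by (force simp: not_le[symmetric])+
 have a: "w s2 <= a" "a <= w s1" using n s1 s2 by auto
 have ic: "connected (w ` {r..})"
  using r by (intro connected_continuous_image continuous_on_subset[OF c]) auto
 have "w s2 : w ` {r..}" "w s1 : w ` {r..}" using ge by auto
 then have "a : w ` {r..}" using ic a unfolding connected_iff_interval by blast
 then show "\<exists>s\<ge>r. w s = a" by auto
qed

lemma recurrent_path_shift: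
 assumes w: "recurrent_path w" and t: "0 <= t"
 shows "recurrent_path (%s. w (t + s) - w t)"
 unfolding recurrent_path_def
proof (intro conjI allI impI)
 show "continuous_on {0..} (%s. w (t + s) - w t)"
  using t by (intro continuous_intros continuous_on_compose2[OF recurrent_pathD(1)[OF w]]) auto
 fix a r :: real assume "0 <= r"
 then obtain s where "t + r <= s" "w s = a + w t" using recurrent_pathD(3)[OF w, of "t + r" "a + w t"] t by auto
 then show "\<exists>s\<ge>r. w (t + s) - w t = a" by (intro exI[of _ "s - t"]) auto
qed simp

context cbm
begin

lemma exceeds_iff:
 assumes "om : space M"
 shows "(\<exists>q\<in>dyadics. a < B q om) \<longleftrightarrow> (\<exists>s\<ge>0. a < B s om)"
proof
 assume "\<exists>s\<ge>0. a < B s om"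
 then obtain s where s: "0 <= s" "a < B s om" by blast
 have "(%n. B (dyadic_up n s) om) ----> B s om"
  by (rule continuous_on_tendsto_compose[OF cont[OF assms] dyadic_up_tendsto[OF s(1)]]) (use s in \<open>auto simp: dyadic_up_nonneg\<close>)
 from order_tendstoD(1)[OF this s(2)] obtain n where "a < B (dyadic_up n s) om" by (auto simp: eventually_sequentially)
 then show "\<exists>q\<in>dyadics. a < B q om" using dyadic_up_bounds(3)[OF s(1)] by blast
qed (auto dest: dyadics_nonneg)

abbreviation exceeding :: "real => 'a set" where
 "exceeding a \<equiv> {om\<in>space M. \<exists>q\<in>dyadics. a < B q om}"

lemma exceeding_sets [measurable]: "exceeding a : sets M"
proof -
 have "{om\<in>space M. a < B q om} : sets M" if "q : dyadics" for q
  using rv[OF dyadics_nonneg[OF that]] by measurable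
 then show ?thesis by (rule sets_Collect_Bex_countable[OF countable_dyadics])
qed

text \<open>Brownian scaling by a turns exceeding level 1 into exceeding level a.\<close>

lemma exceeding_scale:
 assumes a: "0 < a"
 shows "prob (exceeding a) = prob (exceeding 1)"
proof -
 interpret S: cbm M "%s om. a * B (s / a\<^sup>2) om" by (rule cbm_scale) (use a in simp)
 let ?D = dyadic_paths and ?E = "{v\<in>space (dyadic_paths). \<exists>q\<in>dyadics. a < v q}"
 have E: "?E : sets ?D" by (rule sets_Collect_Bex_countable[OF countable_dyadics]) measurable
 have "(\<exists>s\<ge>0. a < a * B (s / a\<^sup>2) om) \<longleftrightarrow> (\<exists>s\<ge>0. 1 < B s om)" for om
 proof
  assume "\<exists>s\<ge>0. 1 < B s om"
  then obtain s where "0 <= s" "1 < B s om" by blast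
  then show "\<exists>s\<ge>0. a < a * B (s / a\<^sup>2) om" using a by (intro exI[of _ "a\<^sup>2 * s"]) simp
 next
  assume "\<exists>s\<ge>0. a < a * B (s / a\<^sup>2) om"
  then obtain s where "0 <= s" "a < a * B (s / a\<^sup>2) om" by blast
  then show "\<exists>s\<ge>0. 1 < B s om" using a by (intro exI[of _ "s / a\<^sup>2"]) simp
 qed
 then have eq: "S.exceeding a = exceeding 1"
  by (intro Collect_cong conj_cong refl) (simp only: S.exceeds_iff exceeds_iff)
 have "prob (exceeding a) = measure (distr M ?D dyadic_path) ?E"
  using E by (subst measure_distr) (auto intro!: arg_cong[where f=prob] simp: dyadic_path_def space_PiM)
 also have "... = measure (distr M ?D S.dyadic_path) ?E"
  by (simp only: dyadic_law_unique[OF cbm_axioms S.cbm_axioms])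
 also have "... = prob (S.exceeding a)"
  using E by (subst measure_distr) (auto intro!: arg_cong[where f=prob] simp: S.dyadic_path_def space_PiM)
 finally show ?thesis by (simp only: eq)
qed

lemma prob_nonpositive: "prob {om\<in>space M. B 1 om <= 0} = 1 / 2"
proof -
 have B1 [measurable]: "B 1 : borel_measurable M" by (rule rv) simp
 let ?u = "%i::nat. if i = 0 then 0 else 1 :: real"
 have "prob {om\<in>space M. B 1 om <= 0} = expectation (%om. indicator {om\<in>space M. B 1 om <= 0} om)"
  by simp
 also have "... = expectation (%om. \<Prod>i<(1::nat). indicator {..0} (B (?u (Suc i)) om - B (?u i) om))"
  by (intro Bochner_Integration.integral_cong refl) (auto simp: zero indicator_def)
 also have "... = (\<Prod>i<(1::nat). \<integral>x. indicator {..0} x \<partial>gauss (?u (Suc i) - ?u i))"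
  by (rule increments) (auto simp: mono_def indicator_def)
 also have "... = 1 / 2" using gauss_half by simp
 finally show ?thesis .
qed

text \<open>Let p be the probability of exceeding 1. By scaling p is also the probability of
  exceeding every level and of being positive somewhere. A path that is never positive has B 1 at
  most 0 and a future after time 1 that is bounded above. These two events are independent with
  probabilities 1/2 and 1 - p, so 1 - p is at most half of itself.\<close>

lemma exceeds_one: "prob (exceeding 1) = 1"
proof -
 let ?A = "\<Union>n. exceeding (1 / real (Suc n))"
 let ?B = "\<Inter>n. exceeding (real (Suc n))"
 let ?C = "%F. \<integral>\<^sup>+om. indicator F (dyadic_path om) \<partial>M"
 let ?E = "%A. \<integral>\<^sup>+om. indicator A (past 1 om) \<partial>M"
 let ?D = dyadic_paths
 define F where "F = {v\<in>space ?D. \<exists>n::nat. \<not> (\<exists>q\<in>dyadics. real (Suc n) < v q)}"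
 have F [measurable]: "F : sets ?D"
  unfolding F_def
  by (rule sets.sets_Collect_countable_Ex, rule sets.sets_Collect_neg, rule sets_Collect_Bex_countable[OF countable_dyadics]) measurable
 let ?p = "prob (exceeding 1)"
 have "(%n. prob (exceeding (real (Suc n)))) ----> prob ?B"
 proof (rule finite_Lim_measure_decseq)
  show "decseq (%n. exceeding (real (Suc n)))" by (force simp: decseq_def)
 qed (use exceeding_sets in blast)
 moreover have "prob (exceeding (real (Suc n))) = ?p" for n by (rule exceeding_scale) simp
 ultimately have all: "prob ?B = ?p" using LIMSEQ_unique[OF _ tendsto_const] by simp
 have "(%n. prob (exceeding (1 / real (Suc n)))) ----> prob ?A"
 proof (rule finite_Lim_measure_incseq)
  show "incseq (%n. exceeding (1 / real (Suc n)))"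
  proof (rule incseq_SucI)
   show "exceeding (1 / real (Suc n)) \<subseteq> exceeding (1 / real (Suc (Suc n)))" for n
    using order.strict_trans1[of "1 / real (Suc (Suc n))" "1 / real (Suc n)"] by (auto simp: frac_le)
  qed
 qed (use exceeding_sets in blast)
 moreover have "prob (exceeding (1 / real (Suc n))) = ?p" for n by (rule exceeding_scale) simp
 ultimately have some: "prob ?A = ?p" using LIMSEQ_unique[OF _ tendsto_const] by simp
 have un: "?A = exceeding 0"
 proof -
  have "(\<exists>n. \<exists>q\<in>dyadics. 1 / real (Suc n) < B q om) \<longleftrightarrow> (\<exists>q\<in>dyadics. 0 < B q om)" for om
  proof
   assume "\<exists>n. \<exists>q\<in>dyadics. 1 / real (Suc n) < B q om"
   then obtain n q where q: "q : dyadics" "1 / real (Suc n) < B q om" by blast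
   have "0 < B q om" using q(2) divide_pos_pos[of 1 "real (Suc n)"] by linarith
   then show "\<exists>q\<in>dyadics. 0 < B q om" using q(1) by blast
  next
   assume "\<exists>q\<in>dyadics. 0 < B q om"
   then obtain q where q: "q : dyadics" "0 < B q om" by blast
   obtain n where "1 / real (Suc n) < B q om" using nat_approx_posE[OF q(2)] by metis
   then show "\<exists>n. \<exists>q\<in>dyadics. 1 / real (Suc n) < B q om" using q(1) by blast
  qed
  then show ?thesis by (simp only: set_eq_iff UN_iff mem_Collect_eq) simp
 qed
 have F1: "prob {om\<in>space M. dyadic_path om : F} = 1 - ?p"
 proof -
  have "{om\<in>space M. dyadic_path om : F} = space M - ?B"
   by (auto simp: F_def dyadic_path_def space_PiM)
  then show ?thesis using all prob_compl[of "\<Inter>n. exceeding (real (Suc n))"] exceeding_sets by (simp add: sets.countable_INT'')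
 qed
 define A where "A = {x\<in>space (\<Pi>\<^sub>M q\<in>dyadics \<inter> {..1}. borel :: real measure). x 1 <= 0}"
 have one: "1 : dyadics" using dyadicI[of 1 0] by simp
 have A: "A : sets (\<Pi>\<^sub>M q\<in>dyadics \<inter> {..1}. borel)"
  unfolding A_def by (rule measurable_sets_Collect) (use one in \<open>auto intro!: measurable_component_singleton\<close>)
 have "1 - ?p = prob (space M - exceeding 0)" using some un prob_compl[OF exceeding_sets] by simp
 also have "... <= prob {om\<in>space M. past 1 om : A & future 1 om : F}"
 proof (rule finite_measure_mono)
  have "past 1 om : A & future 1 om : F" if om: "om : space M - exceeding 0" for om
  proof -
   have le: "B s om <= 0" if "0 <= s" for s using om that exceeds_iff[of om 0] by (auto simp: not_less)
   obtain n :: nat where n: "- B 1 om < real n" using reals_Archimedean2 by blast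
   have "\<not> real (Suc n) < B (1 + q) om - B 1 om" if "q : dyadics" for q
    using le[of "1 + q"] dyadics_nonneg[OF that] n by simp
   then have "future 1 om : F" by (auto simp: F_def future_def space_PiM)
   moreover have "past 1 om : A" using le[of 1] one by (auto simp: A_def past_def space_PiM)
   ultimately show ?thesis by blast
  qed
  then show "space M - exceeding 0 \<subseteq> {om\<in>space M. past 1 om : A & future 1 om : F}" by blast
  show "{om\<in>space M. past 1 om : A & future 1 om : F} : sets M"
   using A F past_measurable[of 1] future_measurable_const[of 1] by measurable
 qed
 also have "... = prob {om\<in>space M. past 1 om : A} * prob {om\<in>space M. dyadic_path om : F}"
 proof -
  have [measurable]: "future 1 : M \<rightarrow>\<^sub>M ?D" by (rule future_measurable_const) simp
  note [measurable] = A
  have "ennreal (prob {om\<in>space M. past 1 om : A & future 1 om : F}) = (\<integral>\<^sup>+om. indicator {om\<in>space M. past 1 om : A & future 1 om : F} om \<partial>M)"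
   by (simp add: emeasure_eq_measure)
  also have "... = (\<integral>\<^sup>+om. indicator A (past 1 om) * indicator F (future 1 om) \<partial>M)"
   by (intro nn_integral_cong) (simp add: indicator_def)
  also have "... = ?E A * ?C F"
   by (rule past_future[OF one A]) measurable
  also have "?E A = (\<integral>\<^sup>+om. indicator {om\<in>space M. past 1 om : A} om \<partial>M)"
   by (intro nn_integral_cong) (simp add: indicator_def)
  also have "... = prob {om\<in>space M. past 1 om : A}" by (simp add: emeasure_eq_measure)
  also have "?C F = (\<integral>\<^sup>+om. indicator {om\<in>space M. dyadic_path om : F} om \<partial>M)"
   by (intro nn_integral_cong) (simp add: indicator_def)
  also have "... = prob {om\<in>space M. dyadic_path om : F}" by (simp add: emeasure_eq_measure)
  finally show ?thesis by (simp flip: ennreal_mult)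
 qed
 also have "{om\<in>space M. past 1 om : A} = {om\<in>space M. B 1 om <= 0}"
  using one by (auto simp: A_def past_def space_PiM)
 finally have "1 - ?p <= (1 / 2) * (1 - ?p)" by (simp only: F1 prob_nonpositive)
 then have "1 <= ?p" by (simp add: field_simps)
 then show ?thesis using prob_le_1[of "exceeding 1"] by (rule order_antisym[rotated])
qed

lemma AE_unbounded: "AE om in M. \<forall>n::nat. \<exists>s\<ge>0. real n < B s om"
proof -
 have "AE om in M. \<exists>s\<ge>0. real n < B s om" for n
 proof -
  have "prob (exceeding (real (Suc n))) = 1" using exceeding_scale[of "real (Suc n)"] exceeds_one by simp
  then have "AE om in M. om : exceeding (real (Suc n))" by (rule AE_prob_1)
  then show ?thesis
  proof eventually_elim
   case (elim om)
   then obtain q where "q : dyadics" "real (Suc n) < B q om" by blast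
   then show ?case using dyadics_nonneg by (intro exI[of _ q]) auto
  qed
 qed
 then show ?thesis by (simp add: AE_all_countable)
qed

lemma AE_recurrent: "AE om in M. recurrent_path (%s. B s om)"
proof -
 interpret N: cbm M "%s om. - 1 * B (s / (- 1)\<^sup>2) om" by (rule cbm_scale) simp
 show ?thesis using AE_unbounded N.AE_unbounded AE_space
 proof eventually_elim
  case (elim om)
  have "\<exists>s\<ge>0. B s om < - real n" for n
  proof -
   obtain s where "0 <= s" "real n < - B s om" using elim(2) by auto
   then show ?thesis by (intro exI[of _ s]) auto
  qed
  then show ?case using elim(1) by (intro recurrent_pathI cont[OF elim(3)] zero[OF elim(3)]) auto
 qed
qed

end

locale recurrent_cbm = cbm +
 assumes recurrent: "!!om. om : space M ==> recurrent_path (%s. B s om)"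

lemma (in brownian_motion) recurrent_version:
 obtains B' where "recurrent_cbm M B'" "AE om in M. \<forall>s. B' s om = B s om"
proof -
 obtain B1 where B1: "cbm M B1" "AE om in M. \<forall>s. B1 s om = B s om" by (rule continuous_version)
 interpret B1: cbm M B1 by (rule B1)
 obtain r where r: "r : M \<rightarrow>\<^sub>M M" "!!om. om : space M ==> recurrent_path (%s. B1 s (r om))" "AE om in M. r om = om" "distr M M r = M"
  by (rule good_version[OF B1.AE_recurrent]) blast
 have "recurrent_cbm M (%s om. B1 s (r om))"
 proof
  fix u :: "nat => real" and ph :: "nat => real => real" and n
  assume u: "0 <= u 0" "mono u" and ph: "!!i. ph i : borel_measurable borel" "!!i x. 0 <= ph i x & ph i x <= 1"
  have u0: "0 <= u i" for i using u monoD[OF u(2), of 0 i] by auto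
  have "(%om. \<Prod>i<n. ph i (B1 (u (Suc i)) om - B1 (u i) om)) : borel_measurable M"
   by (intro borel_measurable_prod measurable_compose[OF _ ph(1)] borel_measurable_diff B1.rv u0)
  from integral_distr[OF r(1) this] B1.increments[OF u ph, where n=n] r(4)
  show "expectation (%om. \<Prod>i<n. ph i (B1 (u (Suc i)) (r om) - B1 (u i) (r om))) = (\<Prod>i<n. \<integral>x. ph i x \<partial>gauss (u (Suc i) - u i))"
   by simp
 qed (use r(2) recurrent_pathD(1,2)[OF r(2)] in \<open>auto intro: measurable_compose[OF r(1) B1.rv]\<close>)
 moreover have "AE om in M. \<forall>s. B1 s (r om) = B s om" using r(3) B1(2) by eventually_elim simp
 ultimately show ?thesis by (rule that)
qed

section \<open>Hitting times\<close>

lemma dyadic_near_zero: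
 fixes w :: "real => real"
 assumes c: "continuous_on {0..} w" and z: "0 <= z" "w z = 0" and e: "0 < e" and y: "z < y"
 shows "\<exists>q\<in>dyadics. z <= q & q < y & \<bar>w q\<bar> < e"
proof -
 have "continuous (at z within {0..}) w" using c z by (auto simp: continuous_on_eq_continuous_within)
 then obtain d where d: "0 < d" "!!x. 0 <= x ==> dist x z < d ==> dist (w x) (w z) < e"
  unfolding continuous_within_eps_delta using e by (metis atLeast_iff)
 obtain q where q: "q : dyadics" "z <= q" "q < min y (z + d)" using dyadic_dense[of z "min y (z + d)"] d(1) y z by auto
 moreover have "\<bar>w q\<bar> < e" using d(2)[of q] q z by (simp add: dist_real_def)
 ultimately show ?thesis by auto
qed

lemma zero_free_bound:
 fixes w :: "real => real"
 assumes c: "continuous_on {0..} w" and r: "0 <= r" and ne: "!!t. r <= t ==> t <= x ==> w t ~= 0"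
 obtains m :: nat where "!!t. r <= t ==> t <= x ==> 1 / real (Suc m) < \<bar>w t\<bar>"
proof -
 have "compact (w ` {r..x})" using r by (intro compact_continuous_image continuous_on_subset[OF c]) auto
 then have cl: "closed (w ` {r..x})" by (rule compact_imp_closed)
 have "0 \<notin> w ` {r..x}" using ne by force
 then obtain e where e: "0 < e" "!!u. u : w ` {r..x} ==> e <= dist 0 u"
  using separate_point_closed[OF cl] by metis
 obtain m where m: "1 / real (Suc m) < e" using nat_approx_posE[OF e(1)] by metis
 have "1 / real (Suc m) < \<bar>w t\<bar>" if "r <= t" "t <= x" for t
  using e(2)[of "w t"] that m by auto
 then show ?thesis by (rule that)
qed

text \<open>Built by countable operations from dyadic values, so it is measurable in the dyadic
  restriction. It uses only absolute values and hence agrees for a path and its reflection. For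
  continuous paths the first dyadic times of near-zeros increase, as the precision grows, to the
  first zero.\<close>

definition first_zero :: "(real => real) => real => real" where
 "first_zero w r = real_of_ereal
   (SUP m::nat. INF q\<in>dyadics. if r <= q & \<bar>w q\<bar> < 1 / real (Suc m) then ereal q else \<infinity>)"

lemma first_zero_cong:
 assumes "!!q. q : dyadics ==> \<bar>w q\<bar> = \<bar>v q\<bar>"
 shows "first_zero w r = first_zero v r"
 unfolding first_zero_def using assms by (simp cong: INF_cong)

text \<open>Just after z there are dyadic times with arbitrarily small values, which bounds every
  infimum by z. On a compact interval from r that ends before z the path stays away from 0, so a
  fine enough precision pushes the infimum past that interval.\<close>

lemma first_zero_eqI:
 assumes c: "continuous_on {0..} w" and r: "0 <= r" "r <= z" and z: "w z = 0"
  and ne: "!!t. r <= t ==> t < z ==> w t ~= 0"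
 shows "first_zero w r = z"
proof -
 let ?I = "%m::nat. INF q\<in>dyadics. if r <= q & \<bar>w q\<bar> < 1 / real (Suc m) then ereal q else \<infinity>"
 have "(SUP m. ?I m) = ereal z"
 proof (rule antisym)
  show "(SUP m. ?I m) <= ereal z"
  proof (rule SUP_least, rule ereal_le_epsilon2)
   fix m :: nat and e :: real assume e: "0 < e"
   have "0 <= z" "z < z + e" "0 < 1 / real (Suc m)" using r e by auto
   from dyadic_near_zero[OF c this(1) z this(3,2)]
   obtain q where q: "q : dyadics" "z <= q" "q < z + e" "\<bar>w q\<bar> < 1 / real (Suc m)" by blast
   then have "?I m <= ereal q" using q r by (intro INF_lower2[of q]) auto
   also have "... <= ereal z + ereal e" using q by simp
   finally show "?I m <= ereal z + ereal e" .
  qed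
  show "ereal z <= (SUP m. ?I m)"
  proof (rule dense_le)
   fix y :: ereal assume y: "y < ereal z"
   show "y <= (SUP m. ?I m)"
   proof (cases "y <= ereal r")
    case True
    have "y <= ?I 0" using True by (intro INF_greatest) (auto intro: order_trans)
    then show ?thesis by (rule order_trans) (rule SUP_upper, simp)
   next
    case False
    then obtain x where x: "y = ereal x" "r < x" "x < z" using y by (cases y) auto
    have "w t ~= 0" if "r <= t" "t <= x" for t using ne[of t] that x(3) by simp
    then obtain m :: nat where m: "!!t. r <= t ==> t <= x ==> 1 / real (Suc m) < \<bar>w t\<bar>"
     using zero_free_bound[OF c r(1)] by metis
    have "ereal x <= ?I m"
    proof (rule INF_greatest)
     fix q assume "q : dyadics"
     show "ereal x <= (if r <= q & \<bar>w q\<bar> < 1 / real (Suc m) then ereal q else \<infinity>)"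
      using m[of q] by (cases "q <= x") auto
    qed
    then show ?thesis unfolding x(1) by (rule order_trans) (rule SUP_upper, simp)
   qed
  qed
 qed
 then show ?thesis by (simp add: first_zero_def)
qed

lemma first_zero:
 assumes c: "continuous_on {0..} w" and r: "0 <= r" and ex: "\<exists>s\<ge>r. w s = 0"
 shows "r <= first_zero w r" "w (first_zero w r) = 0" "!!t. r <= t ==> w t = 0 ==> first_zero w r <= t"
proof -
 let ?Z = "{s\<in>{r..}. w s = 0}"
 have cl: "closed ?Z" using r by (intro continuous_closed_preimage_constant continuous_on_subset[OF c]) auto
 have ne: "?Z ~= {}" using ex by auto
 have bd: "bdd_below ?Z" by (rule bdd_belowI[of _ r]) auto
 have inZ: "Inf ?Z : ?Z" by (rule closed_contains_Inf[OF ne bd cl])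
 have least: "Inf ?Z <= t" if "r <= t" "w t = 0" for t using that bd by (intro cInf_lower) auto
 have "w t ~= 0" if "r <= t" "t < Inf ?Z" for t using least[OF that(1)] that(2) by (auto simp: not_le)
 moreover have "r <= Inf ?Z" "w (Inf ?Z) = 0" using inZ by simp_all
 ultimately have "first_zero w r = Inf ?Z" by (intro first_zero_eqI[OF c r])
 then show "r <= first_zero w r" "w (first_zero w r) = 0" "!!t. r <= t ==> w t = 0 ==> first_zero w r <= t"
  using inZ least by auto
qed

text \<open>The event is read from dyadic values up to \<open>s\<close> alone, which makes first
  zeros adapted.\<close>

lemma first_zero_le_iff:
 assumes c: "continuous_on {0..} w" and r: "0 <= r" and ex: "\<exists>s\<ge>r. w s = 0" and s: "r <= s" "s : dyadics"
 shows "first_zero w r <= s \<longleftrightarrow> (\<forall>m::nat. \<exists>q\<in>dyadics \<inter> {r..s}. \<bar>w q\<bar> < 1 / real (Suc m))"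
proof
 let ?z = "first_zero w r"
 note fz = first_zero[OF c r ex]
 assume zs: "?z <= s"
 show "\<forall>m::nat. \<exists>q\<in>dyadics \<inter> {r..s}. \<bar>w q\<bar> < 1 / real (Suc m)"
 proof
  fix m :: nat
  show "\<exists>q\<in>dyadics \<inter> {r..s}. \<bar>w q\<bar> < 1 / real (Suc m)"
  proof (cases "?z = s")
   case True
   then show ?thesis using fz s by (intro bexI[of _ s]) auto
  next
   case False
   have "0 <= ?z" "?z < s" "0 < 1 / real (Suc m)" using r fz(1) zs False by auto
   from dyadic_near_zero[OF c this(1) fz(2) this(3,2)]
   obtain q where q: "q : dyadics" "?z <= q" "q < s" "\<bar>w q\<bar> < 1 / real (Suc m)" by blast
   then show ?thesis using q fz by (intro bexI[of _ q]) auto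
  qed
 qed
next
 assume A: "\<forall>m::nat. \<exists>q\<in>dyadics \<inter> {r..s}. \<bar>w q\<bar> < 1 / real (Suc m)"
 show "first_zero w r <= s"
 proof (rule ccontr)
  assume "\<not> first_zero w r <= s"
  then have "w t ~= 0" if "r <= t" "t <= s" for t using first_zero(3)[OF c r ex] that by force
  then obtain m :: nat where m: "!!t. r <= t ==> t <= s ==> 1 / real (Suc m) < \<bar>w t\<bar>"
   using zero_free_bound[OF c r] by metis
  obtain q where "q : {r..s}" "\<bar>w q\<bar> < 1 / real (Suc m)" using A by blast
  then show False using m[of q] by auto
 qed
qed

lemma first_zero_measurable:
 assumes f: "!!q. q : dyadics ==> (%x. f x q) : borel_measurable N" and g: "g : borel_measurable N"
 shows "(%x. first_zero (f x) (g x)) : borel_measurable N"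
proof -
 have "(%x. if g x <= q & \<bar>f x q\<bar> < 1 / real (Suc m) then ereal q else \<infinity>) : borel_measurable N" if "q : dyadics" for q m
  using f[OF that] g by measurable
 then show ?thesis unfolding first_zero_def
  by (intro borel_measurable_real_of_ereal borel_measurable_SUP borel_measurable_INF countable_dyadics) auto
qed

lemma first_zero_shift:
 assumes w: "recurrent_path w" and t: "0 <= t" "w t = 0" and r: "0 <= r"
 shows "first_zero w (t + r) = t + first_zero (%s. w (t + s) - w t) r"
proof -
 let ?w = "%s. w (t + s) - w t"
 note w' = recurrent_path_shift[OF w t(1)]
 note fz = first_zero[OF recurrent_pathD(1)[OF w'] r recurrent_pathD(3)[OF w' r]]
 show ?thesis
 proof (rule first_zero_eqI[OF recurrent_pathD(1)[OF w]])
  show "w (t + first_zero ?w r) = 0" "0 <= t + r" "t + r <= t + first_zero ?w r" using fz(1,2) t r by auto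
  show "w u ~= 0" if "t + r <= u" "u < t + first_zero ?w r" for u
   using fz(3)[of "u - t"] that t by force
 qed
qed

definition hit :: "(real => real) => real => real" where
 "hit w a = first_zero (%s. w s - a) 0"

lemma hit_cong: "(!!q. q : dyadics ==> w q = v q) ==> hit w a = hit v a"
 unfolding hit_def by (rule first_zero_cong) simp

lemma hit_eqI:
 assumes "continuous_on {0..} w" "0 <= z" "w z = a" "!!t. 0 <= t ==> t < z ==> w t ~= a"
 shows "hit w a = z"
 unfolding hit_def using assms by (intro first_zero_eqI continuous_intros) auto

lemma hit:
 assumes w: "recurrent_path w"
 shows "0 <= hit w a" "w (hit w a) = a" "!!t. 0 <= t ==> w t = a ==> hit w a <= t"
proof -
 have "continuous_on {0..} (%s. w s - a)" "\<exists>s\<ge>0. w s - a = 0"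
  using recurrent_pathD(1)[OF w] recurrent_pathD(3)[OF w, of 0 a] by (auto intro!: continuous_intros)
 from first_zero[OF this(1) order_refl this(2)]
 show "0 <= hit w a" "w (hit w a) = a" "!!t. 0 <= t ==> w t = a ==> hit w a <= t"
  by (simp_all add: hit_def)
qed

lemma hit_0: "recurrent_path w ==> hit w 0 = 0"
 by (rule hit_eqI) (auto dest: recurrent_pathD)

text \<open>On its way from 0 to a + b the path passes a, by the intermediate value theorem. Hitting
  times of growing levels are therefore renewals.\<close>

lemma hit_add:
 assumes w: "recurrent_path w" and ab: "0 <= a" "0 <= b"
 shows "hit w (a + b) = hit w a + hit (%s. w (hit w a + s) - w (hit w a)) b"
proof (rule hit_eqI[OF recurrent_pathD(1)[OF w]])
 let ?T = "hit w a" let ?w = "%s. w (?T + s) - w ?T"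
 note h = hit[OF w, where a=a]
 note h' = hit[OF recurrent_path_shift[OF w h(1)], where a=b]
 show "0 <= ?T + hit ?w b" "w (?T + hit ?w b) = a + b" using h(1,2) h'(1,2) by auto
 fix t assume t: "0 <= t" "t < ?T + hit ?w b"
 show "w t ~= a + b"
 proof
  assume wt: "w t = a + b"
  show False
  proof (cases "?T <= t")
   case True
   then show False using h'(3)[of "t - ?T"] t wt h(2) by simp
  next
   case False
   obtain x where "0 <= x" "x <= t" "w x = a"
    using IVT'[of w 0 a t] recurrent_pathD(2)[OF w] wt ab t continuous_on_subset[OF recurrent_pathD(1)[OF w], of "{0..t}"] by auto
   then show False using h(3)[of x] False by simp
  qed
 qed
qed

lemma hit_scale:
 assumes w: "recurrent_path w" and r: "r ~= 0"
 shows "hit (%s. r * w (s / r\<^sup>2)) a = r\<^sup>2 * hit w (a / r)"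
proof (rule hit_eqI)
 show "continuous_on {0..} (%s. r * w (s / r\<^sup>2))"
  using r by (intro continuous_intros continuous_on_compose2[OF recurrent_pathD(1)[OF w]]) auto
 show "0 <= r\<^sup>2 * hit w (a / r)" "r * w (r\<^sup>2 * hit w (a / r) / r\<^sup>2) = a"
  using hit(1,2)[OF w, of "a / r"] r by auto
 fix t assume t: "0 <= t" "t < r\<^sup>2 * hit w (a / r)"
 show "r * w (t / r\<^sup>2) ~= a"
 proof
  assume "r * w (t / r\<^sup>2) = a"
  then have "w (t / r\<^sup>2) = a / r" using r by (simp add: field_simps)
  then have "hit w (a / r) <= t / r\<^sup>2" using t by (intro hit(3)[OF w]) auto
  then show False using t r by (simp add: field_simps)
 qed
qed

text \<open>Recovers a right-continuous path from its dyadic values, so that its values at random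
  times are measurable on \<open>dyadic_paths\<close>.\<close>

definition extension :: "(real => real) => real => real" where
 "extension v t = lim (%n. v (dyadic_up n t))"

lemma extension_restrict:
 assumes "continuous_on {0..} w" "0 <= t"
 shows "extension (restrict w dyadics) t = w t"
proof -
 have "(%n. w (dyadic_up n t)) ----> w t"
  using assms by (intro continuous_on_tendsto_compose[OF assms(1) dyadic_up_tendsto]) (auto simp: dyadic_up_nonneg)
 then show ?thesis using dyadic_up_bounds(3)[OF assms(2)] by (simp add: extension_def limI)
qed

lemma extension_measurable:
 assumes f: "f : N \<rightarrow>\<^sub>M dyadic_paths" and g: "g : borel_measurable N"
 shows "(%x. extension (f x) (g x)) : borel_measurable N"
 unfolding extension_def
proof (rule borel_measurable_lim_metric)
 show "(%x. f x (dyadic_up n (g x))) : borel_measurable N" for n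
  unfolding dyadic_up_def
 proof (rule measurable_compose_countable[where f="%k x. f x (real k / 2 ^ n)"])
  show "(%x. f x (real k / 2 ^ n)) : borel_measurable N" for k
   by (rule measurable_compose[OF f measurable_component_singleton[OF dyadicI]])
  show "(%x. nat \<lceil>g x * 2 ^ n\<rceil>) : N \<rightarrow>\<^sub>M count_space UNIV" using g by measurable
 qed
qed

definition shift :: "(real => real) => real => real => real" where
 "shift v t = (\<lambda>q\<in>dyadics. extension v (t + q) - extension v t)"

lemma shift_restrict:
 assumes "continuous_on {0..} w" "0 <= t"
 shows "shift (restrict w dyadics) t = restrict (%s. w (t + s) - w t) dyadics"
 unfolding shift_def using assms by (intro restrict_ext) (simp add: extension_restrict dyadics_nonneg)

lemma shift_measurable:
 assumes f: "f : N \<rightarrow>\<^sub>M dyadic_paths" and g: "g : borel_measurable N"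
 shows "(%x. shift (f x) (g x)) : N \<rightarrow>\<^sub>M dyadic_paths"
 unfolding shift_def by (intro measurable_restrict borel_measurable_diff extension_measurable f borel_measurable_add g borel_measurable_const)

text \<open>The i-th waiting time: \<open>R 0\<close> is read from the path, \<open>R 1\<close> from
  the path restarted at that time, and so on.\<close>

primrec renewal :: "(nat => (real => real) => real) => nat => (real => real) => real" where
 "renewal R 0 v = R 0 v"
| "renewal R (Suc i) v = renewal (%j. R (Suc j)) i (shift v (R 0 v))"

lemma renewal_measurable:
 assumes "!!i. R i : borel_measurable dyadic_paths"
 shows "renewal R i : borel_measurable dyadic_paths"
 using assms
proof (induction i arbitrary: R)
 let ?A = "%R i. %v. renewal (%j. R (Suc j)) i (shift v (R 0 v))"
 case (Suc i)
 have "renewal (%j. R (Suc j)) i : borel_measurable dyadic_paths" by (rule Suc)+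
 then have "(?A R i) : borel_measurable dyadic_paths"
  by (rule measurable_compose[rotated]) (intro shift_measurable Suc.prems measurable_ident_sets refl)
 moreover have "renewal R (Suc i) = ?A R i" by (rule ext) simp
 ultimately show ?case by simp
qed (simp add: fun_eq_iff cong: measurable_cong)

lemma sum_renewal_hit:
 assumes "recurrent_path w" "!!i. 0 <= b i"
 shows "(\<Sum>i<k. renewal (%i v. hit v (b i)) i (restrict w dyadics)) = hit w (\<Sum>i<k. b i)"
 using assms
proof (induction k arbitrary: w b)
 case (Suc k)
 let ?T = "hit w (b 0)"
 have T: "hit (restrict w dyadics) (b 0) = ?T" by (rule hit_cong) simp
 note h = hit[OF Suc.prems(1), where a="b 0"]
 note sh = shift_restrict[OF recurrent_pathD(1)[OF Suc.prems(1)] h(1)]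
 have "(\<Sum>i<Suc k. renewal (%i v. hit v (b i)) i (restrict w dyadics)) =
  ?T + (\<Sum>i<k. renewal (%i v. hit v (b (Suc i))) i (restrict (%s. w (?T + s) - w ?T) dyadics))"
  unfolding sum.lessThan_Suc_shift by (simp add: T sh)
 also have "... = ?T + hit (%s. w (?T + s) - w ?T) (\<Sum>i<k. b (Suc i))"
  by (rule arg_cong2[where f="(+)", OF refl Suc.IH[OF recurrent_path_shift[OF Suc.prems(1) h(1)]]]) (rule Suc.prems)
 also have "... = hit w (b 0 + (\<Sum>i<k. b (Suc i)))"
  by (rule hit_add[OF Suc.prems(1,2) sum_nonneg, symmetric]) (rule Suc.prems)
 finally show ?case unfolding sum.lessThan_Suc_shift .
qed (simp add: hit_0)

text \<open>The times T_k, with \<open>dl\<close> for \<delta>.\<close>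

primrec return_time :: "real => nat => (real => real) => real" where
 "return_time dl 0 v = 0"
| "return_time dl (Suc k) v = first_zero v (return_time dl k v + dl)"

lemma return_time_cong:
 assumes "!!q. q : dyadics ==> \<bar>w q\<bar> = \<bar>v q\<bar>"
 shows "return_time dl k w = return_time dl k v"
 by (induction k) (simp_all add: first_zero_cong[of w v, OF assms])

lemma return_time_measurable:
 assumes f: "!!q. q : dyadics ==> (%x. f x q) : borel_measurable N"
 shows "(%x. return_time dl k (f x)) : borel_measurable N"
proof (induction k)
 case (Suc k)
 show ?case unfolding return_time.simps by (intro first_zero_measurable f borel_measurable_add Suc borel_measurable_const)
qed simp

lemma return_time:
 assumes c: "continuous_on {0..} w" "w 0 = 0" and ex: "!!r. 0 <= r ==> \<exists>s\<ge>r. w s = 0" and dl: "0 <= dl"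
 shows "0 <= return_time dl k w" "w (return_time dl k w) = 0" "return_time dl k w + dl <= return_time dl (Suc k) w"
  "!!t. return_time dl k w + dl <= t ==> w t = 0 ==> return_time dl (Suc k) w <= t"
proof -
 have *: "0 <= return_time dl k w & w (return_time dl k w) = 0" for k
 proof (induction k)
  case (Suc k)
  then have "0 <= return_time dl k w + dl" using dl by simp
  from first_zero(1,2)[OF c(1) this ex[OF this]] this show ?case by simp
 qed (simp add: c)
 then have "0 <= return_time dl k w + dl" using dl by (simp add: add_nonneg_nonneg)
 from first_zero[OF c(1) this ex[OF this]] * show "0 <= return_time dl k w" "w (return_time dl k w) = 0" "return_time dl k w + dl <= return_time dl (Suc k) w"
  "!!t. return_time dl k w + dl <= t ==> w t = 0 ==> return_time dl (Suc k) w <= t" by auto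
qed

lemma return_time_Suc_shift:
 assumes w: "recurrent_path w" and dl: "0 <= dl"
 defines "T \<equiv> first_zero w dl"
 shows "return_time dl (Suc k) w = T + return_time dl k (%s. w (T + s) - w T)"
proof -
 let ?A = "%k. return_time dl k (%s. w (T + s) - w T) + dl"
 note fz = first_zero[OF recurrent_pathD(1)[OF w] dl recurrent_pathD(3)[OF w dl], folded T_def]
 have T0: "0 <= T" using fz(1) dl by simp
 note w' = recurrent_path_shift[OF w T0]
 have nn: "0 <= return_time dl k (%s. w (T + s) - w T)" for k
  by (rule return_time(1)[OF recurrent_pathD(1,2)[OF w'] recurrent_pathD(3)[OF w'] dl])
 show ?thesis
 proof (induction k)
  case (Suc k)
  have "return_time dl (Suc (Suc k)) w = first_zero w (T + ?A k)"
   by (simp only: return_time.simps(2)[of _ "Suc k"] Suc add.assoc)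
  also have "... = T + first_zero (%s. w (T + s) - w T) (?A k)"
   using nn[of k] dl by (intro first_zero_shift[OF w T0 fz(2)]) auto
  finally show ?case by (simp only: return_time.simps(2)[of _ k])
 qed (simp add: T_def)
qed

lemma sum_renewal_return:
 assumes "recurrent_path w" and dl: "0 <= dl"
 shows "(\<Sum>i<k. renewal (%_ v. first_zero v dl) i (restrict w dyadics)) = return_time dl k w"
 using assms(1)
proof (induction k arbitrary: w)
 case (Suc k)
 let ?T = "first_zero w dl"
 have T: "first_zero (restrict w dyadics) dl = ?T" by (rule first_zero_cong) simp
 note fz = first_zero[OF recurrent_pathD(1)[OF Suc.prems] dl recurrent_pathD(3)[OF Suc.prems dl]]
 have T0: "0 <= ?T" using fz(1) dl by simp
 note sh = shift_restrict[OF recurrent_pathD(1)[OF Suc.prems] T0]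
 have "(\<Sum>i<Suc k. renewal (%_ v. first_zero v dl) i (restrict w dyadics)) =
  ?T + (\<Sum>i<k. renewal (%_ v. first_zero v dl) i (restrict (%s. w (?T + s) - w ?T) dyadics))"
  unfolding sum.lessThan_Suc_shift by (simp add: T sh)
 also have "... = ?T + return_time dl k (%s. w (?T + s) - w ?T)"
  by (rule arg_cong2[where f="(+)", OF refl Suc.IH[OF recurrent_path_shift[OF Suc.prems T0]]])
 also have "... = return_time dl (Suc k) w" by (rule return_time_Suc_shift[OF Suc.prems dl, symmetric])
 finally show ?case .
qed simp

context cbm
begin

text \<open>The strong Markov property at the first waiting time separates it from the restarted
  path, which is again Brownian; induction makes all waiting times independent.\<close>

lemma renewal_product:
 fixes R :: "nat => (real => real) => real" and ph :: "nat => real => ennreal"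
 assumes "!!i. R i : borel_measurable dyadic_paths"
  and "!!i om. om : space M ==> 0 <= R i (dyadic_path om)"
  and "!!i. adapted (%om. R i (dyadic_path om))"
  and "!!i. ph i : borel_measurable borel"
 shows "(\<integral>\<^sup>+om. (\<Prod>i<n. ph i (renewal R i (dyadic_path om))) \<partial>M) = (\<Prod>i<n. \<integral>\<^sup>+om. ph i (R i (dyadic_path om)) \<partial>M)"
 using assms
proof (induction n arbitrary: R ph)
 case (Suc n)
 note [measurable] = Suc.prems(1,4)
 let ?D = dyadic_paths
 define T where "T om = R 0 (dyadic_path om)" for om
 define H where "H v = (\<Prod>i<n. ph (Suc i) (renewal (%j. R (Suc j)) i v))" for v
 have Tm [measurable]: "T : borel_measurable M" unfolding T_def[abs_def] by measurable
 have [measurable]: "renewal (%j. R (Suc j)) i : borel_measurable ?D" for i by (rule renewal_measurable) measurable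
 have Hm [measurable]: "H : borel_measurable ?D" unfolding H_def[abs_def] by measurable
 have T0: "0 <= T om" if "om : space M" for om unfolding T_def by (rule Suc.prems(2)[OF that])
 have [measurable]: "(%om. future (T om) om) : M \<rightarrow>\<^sub>M ?D" using Tm T0 by (rule future_measurable)
 have sh: "shift (dyadic_path om) (T om) = future (T om) om" if "om : space M" for om
  using shift_restrict[OF cont[OF that] T0[OF that]] by (simp add: dyadic_path_def future_def)
 have "(\<integral>\<^sup>+om. (\<Prod>i<Suc n. ph i (renewal R i (dyadic_path om))) \<partial>M) = (\<integral>\<^sup>+om. ph 0 (T om) * H (future (T om) om) \<partial>M)"
  by (intro nn_integral_cong) (simp add: prod.lessThan_Suc_shift H_def sh[unfolded T_def] T_def del: prod.lessThan_Suc)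
 also have "... = (\<integral>\<^sup>+z. ph 0 (fst z) * H (snd z) \<partial>distr M (borel \<Otimes>\<^sub>M ?D) (%om. (T om, future (T om) om)))"
  by (subst nn_integral_distr) simp_all
 also have "... = (\<integral>\<^sup>+z. ph 0 (fst z) * H (snd z) \<partial>(distr M borel T \<Otimes>\<^sub>M wiener))"
  by (subst strong_markov) (use Suc.prems(3)[of 0] T0 Tm in \<open>simp_all add: T_def[abs_def]\<close>)
 also have "... = (\<integral>\<^sup>+x. ph 0 x \<partial>distr M borel T) * (\<integral>\<^sup>+v. H v \<partial>wiener)"
  by (rule nn_integral_pair_product) (use prob_space_wiener prob_space_imp_sigma_finite in auto)
 also have "(\<integral>\<^sup>+x. ph 0 x \<partial>distr M borel T) = (\<integral>\<^sup>+om. ph 0 (R 0 (dyadic_path om)) \<partial>M)"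
  by (subst nn_integral_distr) (simp_all add: T_def)
 also have "(\<integral>\<^sup>+v. H v \<partial>wiener) = (\<integral>\<^sup>+om. H (dyadic_path om) \<partial>M)"
  unfolding wiener_def by (rule nn_integral_distr) simp_all
 also have "... = (\<Prod>i<n. \<integral>\<^sup>+om. ph (Suc i) (R (Suc i) (dyadic_path om)) \<partial>M)"
  unfolding H_def by (rule Suc.IH) (rule Suc.prems; assumption)+
 finally show ?case unfolding prod.lessThan_Suc_shift .
qed (simp add: emeasure_space_1)

end

lemma hit_measurable:
 assumes f: "f : N \<rightarrow>\<^sub>M dyadic_paths" and g: "g : borel_measurable N"
 shows "(%x. hit (f x) (g x)) : borel_measurable N"
 unfolding hit_def
 by (intro first_zero_measurable borel_measurable_diff g borel_measurable_const measurable_compose[OF f measurable_component_singleton])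

text \<open>Nonnegativity gives monotonicity, which traps n * g x between multiples of g 1 by
  consecutive integers. The deviation from linearity is then at most g 1 / n for every n.\<close>

lemma additive_nonneg_linear:
 fixes g :: "real => real"
 assumes add: "!!x y. 0 <= x ==> 0 <= y ==> g (x + y) = g x + g y" and nn: "!!x. 0 <= x ==> 0 <= g x" and x: "0 <= x"
 shows "g x = x * g 1"
proof -
 have mult: "g (real n * y) = real n * g y" if "0 <= y" for n y
 proof (induction n)
  case 0
  show ?case using add[of 0 0] by simp
 next
  case (Suc n)
  then show ?case using add[of "real n * y" y] that by (simp add: algebra_simps)
 qed
 have mono: "g y <= g z" if "0 <= y" "y <= z" for y z
  using add[of y "z - y"] nn[of "z - y"] that by simp
 have bound: "real n * \<bar>g x - x * g 1\<bar> <= g 1" for n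
 proof -
  define k where "k = nat \<lfloor>real n * x\<rfloor>"
  have k: "real k <= real n * x" "real n * x <= real k + 1" using x by (auto simp: k_def)
  have "real k * g 1 <= real n * g x"
   using mono[of "real k" "real n * x"] mult[of 1 k] mult[OF x, of n] k x by simp
  moreover have "real n * g x <= (real k + 1) * g 1"
   using mono[of "real n * x" "real (Suc k)"] mult[of 1 "Suc k"] mult[OF x, of n] k x by (simp add: add.commute)
  moreover have "real k * g 1 <= (real n * x) * g 1" "(real n * x) * g 1 <= (real k + 1) * g 1"
   using k nn[of 1] by (intro mult_right_mono; simp)+
  ultimately have "\<bar>real n * g x - (real n * x) * g 1\<bar> <= g 1" by (simp add: abs_le_iff algebra_simps)
  also have "\<bar>real n * g x - (real n * x) * g 1\<bar> = real n * \<bar>g x - x * g 1\<bar>"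
   using abs_mult[of "real n" "g x - x * g 1"] by (simp add: right_diff_distrib mult.assoc)
  finally show ?thesis .
 qed
 show ?thesis
 proof (rule ccontr)
  assume "g x ~= x * g 1"
  then have "0 < \<bar>g x - x * g 1\<bar>" by simp
  from ex_less_of_nat_mult[OF this, of "g 1"] bound show False by (metis not_le)
 qed
qed

context recurrent_cbm
begin

lemma first_zero_dyadic_path: "first_zero (%q. dyadic_path om q - a) r = first_zero (%s. B s om - a) r"
 by (rule first_zero_cong) (simp add: dyadic_path_def)

lemma hit_dyadic_path: "hit (dyadic_path om) a = hit (%s. B s om) a"
 by (rule hit_cong) (simp add: dyadic_path_def)

lemma adapted_first_zero:
 assumes r: "r : dyadics"
 shows "adapted (%om. first_zero (%q. dyadic_path om q - a) r)"
 unfolding adapted_def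
proof
 fix s assume s: "s : dyadics"
 have r0: "0 <= r" by (rule dyadics_nonneg[OF r])
 let ?P = "\<Pi>\<^sub>M q\<in>dyadics \<inter> {..s}. borel :: real measure"
 define A where "A = {x\<in>space ?P. r <= s & (\<forall>m::nat. \<exists>q\<in>dyadics \<inter> {r..s}. \<bar>x q - a\<bar> < 1 / real (Suc m))}"
 have "A : sets ?P"
  unfolding A_def
 proof (intro sets.sets_Collect_conj sets.sets_Collect_const sets.sets_Collect_countable_All sets_Collect_Bex_countable dyadic_set_countable)
  fix q m assume "q : dyadics \<inter> {r..s}"
  then have [measurable]: "(%x. x q) : borel_measurable ?P" by (intro measurable_component_singleton) auto
  show "{x\<in>space ?P. \<bar>x q - a\<bar> < 1 / real (Suc m)} : sets ?P" by measurable
 qed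
 moreover have "first_zero (%q. dyadic_path om q - a) r <= s \<longleftrightarrow> past s om : A" if om: "om : space M" for om
 proof -
  note w = recurrent[OF om]
  have c: "continuous_on {0..} (%s. B s om - a)" by (intro continuous_intros cont[OF om])
  have ex: "\<exists>s\<ge>r. B s om - a = 0" using recurrent_pathD(3)[OF w r0, of a] by auto
  have "past s om : space ?P" using om past_measurable by (rule measurable_space[rotated])
  moreover have "past s om q = B q om" if "q : dyadics \<inter> {r..s}" for q using that by (simp add: past_def)
  then have "(\<exists>q\<in>dyadics \<inter> {r..s}. \<bar>past s om q - a\<bar> < 1 / real (Suc m)) \<longleftrightarrow> (\<exists>q\<in>dyadics \<inter> {r..s}. \<bar>B q om - a\<bar> < 1 / real (Suc m))" for m
   by (intro bex_cong refl) (simp only:)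
  ultimately have "past s om : A \<longleftrightarrow> r <= s & (\<forall>m::nat. \<exists>q\<in>dyadics \<inter> {r..s}. \<bar>B q om - a\<bar> < 1 / real (Suc m))"
   unfolding A_def by (simp only: mem_Collect_eq simp_thms)
  moreover have "\<not> first_zero (%s. B s om - a) r <= s" if "\<not> r <= s"
   using first_zero(1)[OF c r0 ex] that by linarith
  ultimately show ?thesis unfolding first_zero_dyadic_path using first_zero_le_iff[OF c r0 ex _ s] by blast
 qed
 ultimately show "\<exists>A\<in>sets ?P. AE om in M. first_zero (%q. dyadic_path om q - a) r <= s \<longleftrightarrow> past s om : A"
  by (intro bexI[of _ A] AE_I2)
qed

lemma hit_nonneg: "om : space M ==> 0 <= hit (dyadic_path om) a"
 unfolding hit_dyadic_path by (rule hit(1)[OF recurrent])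

lemma hit_product:
 fixes ph :: "nat => real => ennreal" and b :: "nat => real"
 assumes b: "!!i. 0 <= b i" and ph: "!!i. ph i : borel_measurable borel"
 shows "(\<integral>\<^sup>+om. (\<Prod>i<n. ph i (hit (dyadic_path om) (\<Sum>j<Suc i. b j) - hit (dyadic_path om) (\<Sum>j<i. b j))) \<partial>M) =
  (\<Prod>i<n. \<integral>\<^sup>+om. ph i (hit (dyadic_path om) (b i)) \<partial>M)"
proof -
 let ?R = "%i v. hit v (b i)"
 have "hit (dyadic_path om) (\<Sum>j<Suc i. b j) - hit (dyadic_path om) (\<Sum>j<i. b j) = renewal ?R i (dyadic_path om)" if om: "om : space M" for om i
 proof -
  have e: "hit (dyadic_path om) (\<Sum>j<k. b j) = (\<Sum>j<k. renewal ?R j (dyadic_path om))" for k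
   unfolding hit_dyadic_path using sum_renewal_hit[OF recurrent[OF om] b, where k=k] by (simp add: dyadic_path_def)
  show ?thesis unfolding e[of "Suc i"] e[of i] by simp
 qed
 then have "(\<integral>\<^sup>+om. (\<Prod>i<n. ph i (hit (dyadic_path om) (\<Sum>j<Suc i. b j) - hit (dyadic_path om) (\<Sum>j<i. b j))) \<partial>M) =
  (\<integral>\<^sup>+om. (\<Prod>i<n. ph i (renewal ?R i (dyadic_path om))) \<partial>M)" by (intro nn_integral_cong prod.cong refl arg_cong[where f="ph _"])
 also have "... = (\<Prod>i<n. \<integral>\<^sup>+om. ph i (hit (dyadic_path om) (b i)) \<partial>M)"
  using adapted_first_zero[OF zero_dyadic]
  by (intro renewal_product ph hit_measurable measurable_ident_sets refl borel_measurable_const hit_nonneg) (simp_all add: hit_def)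
 finally show ?thesis .
qed

lemma hit_bounds: "om : space M ==> 0 <= th ==> 0 <= exp (- th * hit (dyadic_path om) a) & exp (- th * hit (dyadic_path om) a) <= 1"
 using hit_nonneg by simp

lemma hit_path_measurable [measurable]: "(%om. hit (dyadic_path om) a) : borel_measurable M"
 by (intro hit_measurable dyadic_path_measurable borel_measurable_const)

lemma hit_integrable: "0 <= th ==> integrable M (%om. exp (- th * hit (dyadic_path om) a))"
 by (rule integrable_const_bound[where B=1]) (use hit_bounds in auto)

lemma hit_nn_laplace:
 "0 <= th ==> (\<integral>\<^sup>+om. ennreal (exp (- th * hit (dyadic_path om) a)) \<partial>M) = ennreal (expectation (%om. exp (- th * hit (dyadic_path om) a)))"
 by (rule nn_integral_eq_integral[OF hit_integrable]) auto

lemma hit_laplace_scale: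
 assumes r: "r ~= 0"
 shows "expectation (%om. exp (- th * hit (dyadic_path om) a)) = expectation (%om. exp (- (th * r\<^sup>2) * hit (dyadic_path om) (a / r)))"
proof -
 interpret S: cbm M "%s om. r * B (s / r\<^sup>2) om" by (rule cbm_scale[OF r])
 let ?D = dyadic_paths and ?f = "%v. exp (- th * hit v a)"
 have hm: "(%v. hit v a) : borel_measurable ?D" by (intro hit_measurable measurable_ident_sets refl borel_measurable_const)
 have f: "?f : borel_measurable ?D" using hm by measurable
 have "expectation (%om. ?f (dyadic_path om)) = (LINT v|distr M ?D dyadic_path. ?f v)"
  by (rule integral_distr[symmetric]) (use f in measurable)
 also have "... = (\<integral>v. ?f v \<partial>distr M ?D S.dyadic_path)"
  by (simp only: dyadic_law_unique[OF cbm_axioms S.cbm_axioms])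
 also have "... = expectation (%om. ?f (S.dyadic_path om))"
  by (rule integral_distr) (use f in measurable)
 also have "... = expectation (%om. exp (- (th * r\<^sup>2) * hit (dyadic_path om) (a / r)))"
 proof (rule Bochner_Integration.integral_cong[OF refl])
  fix om assume om: "om : space M"
  have "hit (S.dyadic_path om) a = hit (%s. r * B (s / r\<^sup>2) om) a" by (rule hit_cong) (simp add: S.dyadic_path_def)
  also have "... = r\<^sup>2 * hit (%s. B s om) (a / r)" by (rule hit_scale[OF recurrent[OF om] r])
  finally show "?f (S.dyadic_path om) = exp (- (th * r\<^sup>2) * hit (dyadic_path om) (a / r))"
   by (simp add: hit_dyadic_path mult.assoc)
 qed
 finally show ?thesis .
qed

text \<open>By independence of successive passages the transform at th = 1 is multiplicative in the
  level, hence exponential. Scaling supplies the square root of \<open>th\<close> and, with a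
  negative factor, the absolute value of \<open>a\<close>. The constant is sqrt 2, but it cancels
  later.\<close>

lemma hit_laplace:
 obtains ka where "0 < ka" "!!a th. 0 <= th ==> expectation (%om. exp (- th * hit (dyadic_path om) a)) = exp (- ka * \<bar>a\<bar> * sqrt th)"
proof -
 let ?A = "%th a. %om. exp (- th * hit (dyadic_path om) a)"
 define ps where "ps a = expectation (%om. exp (- 1 * hit (dyadic_path om) a))" for a
 have pos: "0 < ps a" for a
 proof -
  have "ps a ~= 0"
  proof
   assume "ps a = 0"
   then have "AE om in M. exp (- 1 * hit (dyadic_path om) a) = 0"
    unfolding ps_def by (subst (asm) integral_nonneg_eq_0_iff_AE) (use hit_integrable[of 1 a] in auto)
   then show False using AE_False by simp
  qed
  moreover have "0 <= ps a" unfolding ps_def by (intro integral_nonneg_AE) auto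
  ultimately show ?thesis by simp
 qed
 have le1: "ps a <= 1" for a
  unfolding ps_def using hit_bounds[of _ 1 a] hit_integrable[of 1 a] by (intro integral_le_const AE_I2) auto
 have mult: "ps (x + y) = ps x * ps y" if xy: "0 <= x" "0 <= y" for x y
 proof -
  let ?b = "%i::nat. if i = 0 then x else y"
  have "ennreal (ps (x + y)) = (\<integral>\<^sup>+om. ennreal (exp (- 1 * hit (dyadic_path om) (x + y))) \<partial>M)"
   unfolding ps_def by (rule hit_nn_laplace[symmetric]) simp
  also have "... = (\<integral>\<^sup>+om. (\<Prod>i<2. ennreal (exp (- 1 * (hit (dyadic_path om) (\<Sum>j<Suc i. ?b j) - hit (dyadic_path om) (\<Sum>j<i. ?b j))))) \<partial>M)"
   using recurrent by (intro nn_integral_cong)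
    (simp add: numeral_2_eq_2 hit_dyadic_path hit_0 flip: ennreal_mult exp_add)
  also have "... = (\<Prod>i<2. \<integral>\<^sup>+om. ennreal (exp (- 1 * hit (dyadic_path om) (?b i))) \<partial>M)"
   using xy by (intro hit_product[of ?b "%_ z. ennreal (exp (- 1 * z))"]) auto
  also have "... = ennreal (ps x) * ennreal (ps y)"
   using hit_nn_laplace[of 1 x] hit_nn_laplace[of 1 y] by (simp add: numeral_2_eq_2 ps_def)
  also have "... = ennreal (ps x * ps y)" using pos[of x] pos[of y] by (simp add: ennreal_mult)
  finally show ?thesis using pos[of x] pos[of y] pos[of "x + y"] by (subst (asm) ennreal_inj) auto
 qed
 define ka where "ka = - ln (ps 1)"
 have lin: "- ln (ps x) = x * ka" if "0 <= x" for x
  unfolding ka_def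
  by (rule additive_nonneg_linear[of "%x. - ln (ps x)", OF _ _ that]) (simp_all add: mult ln_mult_pos pos le1 less_imp_neq[OF pos, symmetric])
 \<comment> \<open>Otherwise level 1 would almost surely be hit at time 0, where the path is
   0.\<close>
 have "ps 1 ~= 1"
 proof
  assume "ps 1 = 1"
  then have "expectation (%om. 1 - exp (- 1 * hit (dyadic_path om) 1)) = 0"
   using hit_integrable[of 1 1] by (simp add: ps_def prob_space)
  then have "AE om in M. 1 - exp (- 1 * hit (dyadic_path om) 1) = 0"
   by (subst (asm) integral_nonneg_eq_0_iff_AE) (use hit_integrable[of 1 1] hit_bounds[of _ 1 1] in auto)
  then have "AE om in M. False"
   using AE_space
  proof eventually_elim
   case (elim om)
   then have "hit (%s. B s om) 1 = 0" by (simp add: hit_dyadic_path)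
   then show False using hit(2)[OF recurrent[OF elim(2)], of 1] zero[OF elim(2)] by simp
  qed
  then show False using AE_False by simp
 qed
 then have ka: "0 < ka" using le1[of 1] pos[of 1] by (simp add: ka_def)
 have ps: "ps x = exp (- ka * x)" if "0 <= x" for x
  using lin[OF that] exp_ln[OF pos[of x]] by (metis minus_minus mult.commute mult_minus_left)
 show ?thesis
 proof (rule that[OF ka])
  fix a th :: real assume th: "0 <= th"
  show "expectation (?A th a) = exp (- ka * \<bar>a\<bar> * sqrt th)"
  proof (cases "th = 0 \<or> a = 0")
   case True
   have "expectation (?A th a) = expectation (%_. 1)"
    using True recurrent by (intro Bochner_Integration.integral_cong) (auto simp: hit_dyadic_path hit_0)
   then show ?thesis using True by (auto simp: prob_space)
  next
   case False
   \<comment> \<open>This scaling factor brings \<open>th\<close> to 1 and the level to the absolute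
     value of a times sqrt th.\<close>
   let ?r = "sgn a / sqrt th"
   have r: "?r ~= 0" "th * ?r\<^sup>2 = 1" "a / ?r = \<bar>a\<bar> * sqrt th"
    using False th by (auto simp: power_divide sgn_if)
   have "expectation (?A th a) = ps (\<bar>a\<bar> * sqrt th)"
    using hit_laplace_scale[OF r(1), of th a] unfolding r(2,3) ps_def .
   then show ?thesis using ps[of "\<bar>a\<bar> * sqrt th"] th by (simp add: mult.assoc)
  qed
 qed
qed

end

section \<open>Renewal cycles of the time change\<close>

lemma first_zero_after:
 assumes w: "recurrent_path w" and dl: "0 <= dl"
 shows "first_zero w dl = dl + hit (%s. w (dl + s) - w dl) (- w dl)"
proof (rule first_zero_eqI[OF recurrent_pathD(1)[OF w] dl])
 let ?A = "%s. w (dl + s) - w dl"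
 note h = hit[OF recurrent_path_shift[OF w dl], where a="- w dl"]
 show "dl <= dl + hit ?A (- w dl)" "w (dl + hit ?A (- w dl)) = 0"
  using h(1,2) by simp_all
 show "w t ~= 0" if "dl <= t" "t < dl + hit ?A (- w dl)" for t
  using h(3)[of "t - dl"] that by auto
qed

context recurrent_cbm
begin

lemma return_product:
 fixes ph :: "nat => real => ennreal"
 assumes dl: "dl : dyadics" and ph: "!!i. ph i : borel_measurable borel"
 shows "(\<integral>\<^sup>+om. (\<Prod>i<n. ph i (return_time dl (Suc i) (dyadic_path om) - return_time dl i (dyadic_path om))) \<partial>M) =
  (\<Prod>i<n. \<integral>\<^sup>+om. ph i (return_time dl 1 (dyadic_path om)) \<partial>M)"
proof -
 let ?R = "%(_::nat) v. first_zero v dl"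
 have dl0: "0 <= dl" by (rule dyadics_nonneg[OF dl])
 have "return_time dl (Suc i) (dyadic_path om) - return_time dl i (dyadic_path om) = renewal ?R i (dyadic_path om)" if om: "om : space M" for om i
 proof -
  have e: "return_time dl k (dyadic_path om) = (\<Sum>j<k. renewal ?R j (dyadic_path om))" for k
   using sum_renewal_return[OF recurrent[OF om] dl0, of k] return_time_cong[of "dyadic_path om" "%s. B s om" dl k]
   by (simp add: dyadic_path_def)
  show ?thesis unfolding e[of "Suc i"] e[of i] by simp
 qed
 then have "(\<integral>\<^sup>+om. (\<Prod>i<n. ph i (return_time dl (Suc i) (dyadic_path om) - return_time dl i (dyadic_path om))) \<partial>M) =
  (\<integral>\<^sup>+om. (\<Prod>i<n. ph i (renewal ?R i (dyadic_path om))) \<partial>M)"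
  by (intro nn_integral_cong prod.cong refl arg_cong[where f="ph _"])
 also have "... = (\<Prod>i<n. \<integral>\<^sup>+om. ph i (?R i (dyadic_path om)) \<partial>M)"
 proof (rule renewal_product)
  show "?R i : borel_measurable dyadic_paths" for i
   by (intro first_zero_measurable borel_measurable_const measurable_component_singleton)
  show "0 <= ?R i (dyadic_path om)" if om: "om : space M" for i om
   using first_zero(1)[OF cont[OF om] dl0 recurrent_pathD(3)[OF recurrent[OF om] dl0]] dl0 first_zero_dyadic_path[of om 0 dl] by simp
  show "adapted (%om. ?R i (dyadic_path om))" for i
   using adapted_first_zero[OF dl, of 0] by simp
 qed (rule ph)
 finally show ?thesis by simp
qed

lemma law_at_time:
 fixes ph :: "real => real"
 assumes s: "0 <= s" and ph: "ph : borel_measurable borel" "!!x. 0 <= ph x & ph x <= 1"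
 shows "expectation (%om. ph (B s om)) = (LINT x|gauss s. ph x)"
proof -
 let ?u = "%i::nat. if i = 0 then 0 else s"
 have "expectation (%om. ph (B s om)) = expectation (%om. \<Prod>i<(1::nat). ph (B (?u (Suc i)) om - B (?u i) om))"
  by (intro Bochner_Integration.integral_cong refl) (simp add: zero)
 also have "... = (\<Prod>i<(1::nat). \<integral>x. ph x \<partial>gauss (?u (Suc i) - ?u i))"
  using s ph by (intro increments) (auto simp: mono_def)
 finally show ?thesis by simp
qed

text \<open>The first return happens at \<open>dl\<close> plus the time that the future path needs
  to reach - B dl. Integrating out the future by the Markov property at \<open>dl\<close> leaves an
  exponential of the absolute value of B dl.\<close>

lemma return_laplace:
 assumes dl: "dl : dyadics" and th: "0 <= th" and ka: "0 < ka"
  and hl: "!!a. expectation (%om. exp (- th * hit (dyadic_path om) a)) = exp (- ka * \<bar>a\<bar> * sqrt th)"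
 shows "(\<integral>\<^sup>+om. ennreal (exp (- th * return_time dl 1 (dyadic_path om))) \<partial>M) =
  ennreal (exp (- th * dl) * (LINT x|gauss dl. exp (- ka * sqrt th * \<bar>x\<bar>)))"
proof -
 let ?A = "%om. - ka * sqrt th * \<bar>B dl om\<bar>"
 let ?B = "\<integral>\<^sup>+om. ennreal (exp (?A om)) \<partial>M"
 let ?C = "%x. exp (- ka * sqrt th * \<bar>x dl\<bar>)"
 let ?E = "%om. exp (?A om)"
 let ?D = dyadic_paths and ?P = "\<Pi>\<^sub>M q\<in>dyadics \<inter> {..dl}. borel :: real measure"
 have dl0: "0 <= dl" by (rule dyadics_nonneg[OF dl])
 note [measurable] = future_measurable_const[OF dl0]
 have xm [measurable]: "(%x. x dl) : borel_measurable ?P" using dl by (intro measurable_component_singleton) auto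
 let ?F = "%x y. ennreal (exp (- th * dl)) * ennreal (exp (- th * hit y (- x dl)))"
 have hm [measurable]: "(%z. hit (snd z) (- fst z dl)) : borel_measurable (?P \<Otimes>\<^sub>M ?D)"
  by (intro hit_measurable measurable_snd) measurable
 interpret W: prob_space wiener by (rule prob_space_wiener)
 have "(\<integral>\<^sup>+om. ennreal (exp (- th * return_time dl 1 (dyadic_path om))) \<partial>M) = (\<integral>\<^sup>+om. ?F (past dl om) (future dl om) \<partial>M)"
 proof (rule nn_integral_cong)
  fix om assume om: "om : space M"
  have "hit (future dl om) a = hit (%s. B (dl + s) om - B dl om) a" for a by (rule hit_cong) (simp add: future_def)
  moreover have "past dl om dl = B dl om" using dl by (simp add: past_def)
  moreover have "return_time dl 1 (dyadic_path om) = first_zero (%s. B s om) dl"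
   using first_zero_dyadic_path[of om 0 dl] by simp
  ultimately show "ennreal (exp (- th * return_time dl 1 (dyadic_path om))) = ?F (past dl om) (future dl om)"
   using first_zero_after[OF recurrent[OF om] dl0] by (simp add: ring_distribs flip: ennreal_mult exp_add)
 qed
 also have "... = (\<integral>\<^sup>+z. ?F (fst z) (snd z) \<partial>distr M (?P \<Otimes>\<^sub>M ?D) (%om. (past dl om, future dl om)))"
  by (subst nn_integral_distr) simp_all
 also have "... = (\<integral>\<^sup>+x. (\<integral>\<^sup>+y. ?F x y \<partial>wiener) \<partial>distr M ?P (past dl))"
  unfolding markov_dyadic[OF dl] by (subst W.nn_integral_fst[symmetric]) simp_all
 also have "... = (\<integral>\<^sup>+x. ennreal (exp (- th * dl)) * ennreal (?C x) \<partial>distr M ?P (past dl))"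
 proof (rule nn_integral_cong)
  fix x
  have h1 [measurable]: "(%y. hit y (- x dl)) : borel_measurable ?D" by (intro hit_measurable measurable_ident_sets refl borel_measurable_const)
  have "(\<integral>\<^sup>+y. ?F x y \<partial>wiener) = ennreal (exp (- th * dl)) * (\<integral>\<^sup>+om. ennreal (exp (- th * hit (dyadic_path om) (- x dl))) \<partial>M)"
   unfolding wiener_def by (subst nn_integral_distr) (simp_all add: nn_integral_cmult)
  then show "(\<integral>\<^sup>+y. ?F x y \<partial>wiener) = ennreal (exp (- th * dl)) * ennreal (?C x)"
   using hit_nn_laplace[OF th, of "- x dl"] hl[of "- x dl"] by (simp add: mult.assoc mult.commute[of "sqrt th"])
 qed
 also have "... = ennreal (exp (- th * dl)) * ?B"
  using dl rv[OF dl0] by (subst nn_integral_distr) (simp_all add: nn_integral_cmult past_def)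
 also have "?B = ennreal (expectation ?E)"
  using rv[OF dl0] ka th by (intro nn_integral_eq_integral integrable_const_bound[where B=1]) auto
 also have "expectation ?E = (LINT x|gauss dl. exp (- ka * sqrt th * \<bar>x\<bar>))"
  using ka th by (intro law_at_time[OF dl0, of "%x. exp (- ka * sqrt th * \<bar>x\<bar>)"]) auto
 finally show ?thesis by (simp add: ennreal_mult integral_nonneg_AE)
qed

end

text \<open>Properties of a reflected path in terms of dyadic values, so that they pass to
  \<open>X\<close> through its law. Near-zeros of every precision in one bounded window beyond n
  become a zero there by compactness.\<close>

definition recurring_zeros :: "(real => real) => bool" where
 "recurring_zeros v \<longleftrightarrow> (\<forall>q\<in>dyadics. 0 <= v q) & v 0 = 0 \<and>
   (\<forall>n::nat. \<exists>m::nat. \<forall>k::nat. \<exists>q\<in>dyadics \<inter> {real n..real m}. \<bar>v q\<bar> < 1 / real (Suc k))"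

lemma recurring_zeros_cong:
 assumes "!!q. q : dyadics ==> v q = w q"
 shows "recurring_zeros v \<longleftrightarrow> recurring_zeros w"
 using assms zero_dyadic by (simp add: recurring_zeros_def)

lemma recurring_zeros_abs:
 assumes w: "recurrent_path w"
 shows "recurring_zeros (%s. \<bar>w s\<bar>)"
 unfolding recurring_zeros_def
proof (intro conjI allI)
 fix n :: nat
 obtain z where z: "real n <= z" "w z = 0" using recurrent_pathD(3)[OF w, of "real n" 0] by auto
 obtain m :: nat where m: "z < real m" using reals_Archimedean2 by blast
 have "\<exists>q\<in>dyadics \<inter> {real n..real m}. \<bar>\<bar>w q\<bar>\<bar> < 1 / real (Suc k)" for k
  using dyadic_near_zero[OF recurrent_pathD(1)[OF w] _ z(2) _ m, of "1 / real (Suc k)"] z(1) by fastforce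
 then show "\<exists>m::nat. \<forall>k::nat. \<exists>q\<in>dyadics \<inter> {real n..real m}. \<bar>\<bar>w q\<bar>\<bar> < 1 / real (Suc k)" by blast
qed (use recurrent_pathD(2)[OF w] in auto)

lemma recurring_zerosD:
 assumes c: "continuous_on {0..} w" and w: "recurring_zeros w"
 shows "w 0 = 0" "0 <= s ==> 0 <= w s" "0 <= r ==> \<exists>s\<ge>r. w s = 0"
proof -
 show "w 0 = 0" using w by (simp add: recurring_zeros_def)
 show "0 <= w s" if s: "0 <= s"
 proof (rule LIMSEQ_le_const)
  show "(%n. w (dyadic_up n s)) ----> w s"
   using s by (intro continuous_on_tendsto_compose[OF c dyadic_up_tendsto]) (auto simp: dyadic_up_nonneg)
  show "\<exists>N. \<forall>n\<ge>N. 0 <= w (dyadic_up n s)"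
   using w dyadic_up_bounds(3)[OF s] by (auto simp: recurring_zeros_def)
 qed
 show "\<exists>s\<ge>r. w s = 0" if r: "0 <= r"
 proof (rule ccontr)
  assume no: "\<not> (\<exists>s\<ge>r. w s = 0)"
  obtain n :: nat where n: "r <= real n" using real_arch_simple by blast
  obtain m :: nat where m: "!!k::nat. \<exists>q\<in>dyadics \<inter> {real n..real m}. \<bar>w q\<bar> < 1 / real (Suc k)"
   using w unfolding recurring_zeros_def by blast
  have "w t ~= 0" if "real n <= t" "t <= real m" for t using no n that by force
  then obtain k :: nat where k: "!!t. real n <= t ==> t <= real m ==> 1 / real (Suc k) < \<bar>w t\<bar>"
   using zero_free_bound[OF c, of "real n" "real m"] by auto
  obtain q where "q : {real n..real m}" "\<bar>w q\<bar> < 1 / real (Suc k)" using m[of k] by blast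
  then show False using k[of q] by auto
 qed
qed

lemma recurring_zeros_sets: "{v\<in>space dyadic_paths. recurring_zeros v} : sets dyadic_paths"
proof -
 let ?D = dyadic_paths
 have "(\<forall>q\<in>dyadics. 0 <= v q) \<longleftrightarrow> \<not> (\<exists>q\<in>dyadics. v q < 0)" for v :: "real => real" by (auto simp: not_less)
 then have "{v\<in>space ?D. recurring_zeros v} = {v\<in>space ?D. \<not> (\<exists>q\<in>dyadics. v q < 0) & v 0 = 0 \<and>
   (\<forall>n::nat. \<exists>m::nat. \<forall>k::nat. \<exists>q\<in>dyadics \<inter> {real n..real m}. \<bar>v q\<bar> < 1 / real (Suc k))}"
  by (simp only: recurring_zeros_def)
 also have "... : sets ?D"
 proof (intro sets.sets_Collect_conj sets.sets_Collect_neg sets.sets_Collect_countable_All sets.sets_Collect_countable_Ex sets_Collect_Bex_countable dyadic_set_countable countable_dyadics)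
  show "{x\<in>space ?D. x 0 = 0} : sets ?D" using zero_dyadic by measurable
  show "{x\<in>space ?D. x q < 0} : sets ?D" if "q : dyadics" for q using that by measurable
  fix q and k n m :: nat assume "q : dyadics \<inter> {real n..real m}"
  then have [measurable]: "(%x. x q) : borel_measurable ?D" by (intro measurable_component_singleton) auto
  show "{x\<in>space ?D. \<bar>x q\<bar> < 1 / real (Suc k)} : sets ?D" by measurable
 qed
 finally show ?thesis .
qed

text \<open>What is used of a reflected Brownian motion. The strong Markov property is available for
  the Brownian motion behind it, so only those consequences appear that can be expressed by zeros of
  \<open>X\<close>.\<close>

locale reflected_path = prob_space M for M :: "'a measure" and ka :: real and X :: "real => 'a => real" +
 assumes X_measurable: "!!s. 0 <= s ==> X s : borel_measurable M"
  and X_cont: "!!om. om : space M ==> continuous_on {0..} (%s. X s om)"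
  and X_zeros: "!!om. om : space M ==> recurring_zeros (%s. X s om)"
  and X_nonzero: "!!s. 0 < s ==> AE om in M. X s om ~= 0"
  and exponent_pos: "0 < ka"
  and returns: "!!dl n (ph :: nat => real => ennreal). dl : dyadics ==> (!!i. ph i : borel_measurable borel) ==>
   (\<integral>\<^sup>+om. (\<Prod>i<n. ph i (return_time dl (Suc i) (%s. X s om) - return_time dl i (%s. X s om))) \<partial>M) =
   (\<Prod>i<n. \<integral>\<^sup>+om. ph i (return_time dl 1 (%s. X s om)) \<partial>M)"
  and first_return: "!!dl th. dl : dyadics ==> 0 <= th ==>
   (\<integral>\<^sup>+om. ennreal (exp (- th * return_time dl 1 (%s. X s om))) \<partial>M) =
   ennreal (exp (- th * dl) * (LINT x|gauss dl. exp (- ka * sqrt th * \<bar>x\<bar>)))"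

definition dyadic_values :: "(real => 'a => real) => 'a => real => real" where
 "dyadic_values Z om = (\<lambda>q\<in>dyadics. Z q om)"

lemma dyadic_values_measurable:
 "(!!s. 0 <= s ==> Z s : borel_measurable M) ==> dyadic_values Z : M \<rightarrow>\<^sub>M dyadic_paths"
 unfolding dyadic_values_def[abs_def] by (intro measurable_restrict) (auto dest: dyadics_nonneg)

lemma sample_path_measurable:
 "(!!s. 0 <= s ==> Z s : borel_measurable M) ==> sample_path Z : M \<rightarrow>\<^sub>M path_space"
 unfolding sample_path_def[abs_def] path_space_def by (intro measurable_restrict) auto

lemma restrict_dyadics_measurable: "(%w. restrict w dyadics) : path_space \<rightarrow>\<^sub>M dyadic_paths"
 unfolding path_space_def by (intro measurable_restrict measurable_component_singleton) (auto dest: dyadics_nonneg)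

lemma restrict_sample_path: "restrict (sample_path Z om) dyadics = dyadic_values Z om"
 unfolding sample_path_def dyadic_values_def by (rule restrict_ext) (simp add: dyadics_nonneg)

lemma dyadic_values_law:
 assumes "!!s. 0 <= s ==> Z s : borel_measurable M"
 shows "distr M dyadic_paths (dyadic_values Z) = distr (distr M path_space (sample_path Z)) dyadic_paths (%w. restrict w dyadics)"
 using distr_distr[OF restrict_dyadics_measurable sample_path_measurable[of Z M, OF assms]] by (simp add: comp_def restrict_sample_path)

text \<open>The return times of a path depend on its absolute values at dyadic times only. The cycle
  formulas therefore move from the Brownian motion to its absolute value, and through the equality
  of dyadic laws to \<open>X\<close>.\<close>

lemma reflected_version:
 assumes "reflected_brownian_motion M X"
 obtains ka X' where "reflected_path M ka X'" "AE om in M. \<forall>s. X' s om = X s om"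
proof -
 let ?B = "%B0. %s om. \<bar>B0 s om\<bar>"
 let ?D = dyadic_paths
 have M: "prob_space M" and Xm: "!!s. 0 <= s ==> X s : borel_measurable M" and Xc: "AE om in M. continuous_on {0..} (%s. X s om)"
  using assms by (auto simp: reflected_brownian_motion_def)
 obtain N :: "(real => real) measure" and B0 where B0: "brownian_motion N B0"
  and law0: "distr M path_space (sample_path X) = distr N path_space (sample_path (?B B0))"
  using assms unfolding reflected_brownian_motion_def by blast
 interpret M: prob_space M by (rule M)
 interpret B0: brownian_motion N B0 by (rule B0)
 obtain B where B: "recurrent_cbm N B" "AE om in N. \<forall>s. B s om = B0 s om" by (rule B0.recurrent_version)
 interpret B: recurrent_cbm N B by (rule B(1))
 let ?A = "dyadic_values (%s om. \<bar>B s om\<bar>)"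
 have B0m: "(%om. \<bar>B0 s om\<bar>) : borel_measurable N" if "0 <= s" for s using B0.random_variable[OF that] by measurable
 have Am: "?A : N \<rightarrow>\<^sub>M ?D" by (rule dyadic_values_measurable) (use B.rv in measurable)
 have A0m: "dyadic_values (?B B0) : N \<rightarrow>\<^sub>M ?D" by (rule dyadic_values_measurable) (rule B0m)
 have Xd: "dyadic_values X : M \<rightarrow>\<^sub>M ?D" by (rule dyadic_values_measurable) (rule Xm)
 have "distr M ?D (dyadic_values X) = distr N ?D (dyadic_values (?B B0))"
  by (simp only: dyadic_values_law[of X M, OF Xm] dyadic_values_law[of "%s om. \<bar>B0 s om\<bar>" N, OF B0m] law0)
 also have "... = distr N ?D ?A"
  by (rule distr_cong_AE[OF refl refl _ A0m Am]) (use B(2) in \<open>eventually_elim, simp add: dyadic_values_def\<close>)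
 finally have law: "distr M ?D (dyadic_values X) = distr N ?D ?A" .
 have "recurring_zeros (?A om)" if "om : space N" for om
  using recurring_zeros_abs[OF B.recurrent[OF that]] recurring_zeros_cong[of "?A om" "%s. \<bar>B s om\<bar>"] by (simp add: dyadic_values_def)
 then have "AE v in distr M ?D (dyadic_values X). recurring_zeros v"
  unfolding law by (subst AE_distr_iff[OF Am recurring_zeros_sets]) (rule AE_I2)
 then have "AE om in M. recurring_zeros (dyadic_values X om)" by (subst (asm) AE_distr_iff[OF Xd recurring_zeros_sets])
 then have good: "AE om in M. continuous_on {0..} (%s. X s om) & recurring_zeros (%s. X s om)"
  using Xc by eventually_elim (simp add: dyadic_values_def recurring_zeros_cong[of "\<lambda>q\<in>dyadics. X q _" "%q. X q _"])
 obtain r where r: "r : M \<rightarrow>\<^sub>M M" "AE om in M. r om = om"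
  "!!om. om : space M ==> continuous_on {0..} (%s. X s (r om)) & recurring_zeros (%s. X s (r om))"
  by (rule M.good_version[OF good]) blast
 define X' where "X' s om = X s (r om)" for s om
 have ae: "AE om in M. \<forall>s. X' s om = X s om" using r(2) by eventually_elim (simp add: X'_def)
 have X'm: "X' s : borel_measurable M" if "0 <= s" for s
  unfolding X'_def[abs_def] by (rule measurable_compose[OF r(1) Xm[OF that]])
 have X'c: "continuous_on {0..} (%s. X' s om)" if "om : space M" for om using r(3)[OF that] by (simp add: X'_def)
 have Xd': "dyadic_values X' : M \<rightarrow>\<^sub>M ?D" by (rule dyadic_values_measurable) (rule X'm)
 have law': "distr M ?D (dyadic_values X') = distr N ?D ?A"
  unfolding law[symmetric] by (rule distr_cong_AE[OF refl refl _ Xd' Xd]) (use ae in \<open>eventually_elim, simp add: dyadic_values_def\<close>)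
 have transfer: "(\<integral>\<^sup>+om. F (dyadic_values X' om) \<partial>M) = (\<integral>\<^sup>+om. F (?A om) \<partial>N)" if "F : borel_measurable ?D" for F
  using nn_integral_distr[OF Xd', of F] nn_integral_distr[OF Am, of F] that by (simp add: law')
 have rt: "return_time dl k (%s. X' s om) = return_time dl k (dyadic_values X' om)"
  "return_time dl k (?A om') = return_time dl k (B.dyadic_path om')" for dl k om om'
  by (rule return_time_cong, simp add: dyadic_values_def B.dyadic_path_def)+
 have [measurable]: "(%v. return_time dl k v) : borel_measurable ?D" for dl k
  by (intro return_time_measurable measurable_component_singleton)
 obtain ka where ka: "0 < ka" "!!a th. 0 <= th ==> B0.expectation (%om. exp (- th * hit (B.dyadic_path om) a)) = exp (- ka * \<bar>a\<bar> * sqrt th)"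
  by (rule B.hit_laplace) blast
 have "reflected_path M ka X'"
 proof
  show "recurring_zeros (%s. X' s om)" if "om : space M" for om using r(3)[OF that] by (simp add: X'_def)
  show "AE om in M. X' s om ~= 0" if s: "0 < s" for s
  proof -
   \<comment> \<open>The extension makes the value at a time that need not be dyadic a function of
     the dyadic path, so that this property can also be transferred.\<close>
   have em [measurable]: "(%v. extension v s) : borel_measurable ?D" by (intro extension_measurable) measurable
   have S: "{v\<in>space ?D. extension v s ~= 0} : sets ?D" by measurable
   let ?Z = "{om\<in>space N. B s om = 0}"
   have "B0.expectation (%om. indicator {0} (B s om)) = B0.expectation (indicator ?Z)"
    by (intro Bochner_Integration.integral_cong) (auto simp: indicator_def)
   also have "... = B0.prob (?Z \<inter> space N)" by (rule Bochner_Integration.integral_indicator)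
   also have "?Z \<inter> space N = ?Z" by blast
   also have "B0.expectation (%om. indicator {0} (B s om)) = (\<integral>x. indicator {0} x \<partial>gauss s :: real)"
    using s by (intro B.law_at_time[where ph="indicator {0}"]) (auto simp: indicator_def)
   also have "... = measure (gauss s) {0}" by simp
   also have "... = 0" using s unfolding gauss_def
    by (simp add: measure_def emeasure_density nn_integral_indicator_singleton)
   finally have "B0.prob ?Z = 0" ..
   then have "AE om in N. B s om ~= 0"
    using B.rv[of s] s by (intro AE_I'[of "{om\<in>space N. B s om = 0}"]) (auto simp: null_sets_def B0.emeasure_eq_measure)
   then have "AE om in N. extension (?A om) s ~= 0"
    using AE_space
   proof eventually_elim
    case (elim om)
    have "extension (?A om) s = \<bar>B s om\<bar>"
     unfolding dyadic_values_def using s B.cont[OF elim(2)] by (intro extension_restrict continuous_intros) auto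
    then show ?case using elim(1) by simp
   qed
   then have "AE v in distr M ?D (dyadic_values X'). extension v s ~= 0" unfolding law' by (subst AE_distr_iff[OF Am S])
   then have "AE om in M. extension (dyadic_values X' om) s ~= 0" by (subst (asm) AE_distr_iff[OF Xd' S])
   then show ?thesis using AE_space
    by eventually_elim (use s extension_restrict[OF X'c] in \<open>simp add: dyadic_values_def\<close>)
  qed
  fix dl :: real assume dl: "dl : dyadics"
  show "(\<integral>\<^sup>+om. (\<Prod>i<n. ph i (return_time dl (Suc i) (%s. X' s om) - return_time dl i (%s. X' s om))) \<partial>M) =
   (\<Prod>i<n. \<integral>\<^sup>+om. ph i (return_time dl 1 (%s. X' s om)) \<partial>M)"
   if [measurable]: "!!i. ph i : borel_measurable borel" for n and ph :: "nat => real => ennreal"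
  proof -
   have m: "(%v. \<Prod>i<n. ph i (return_time dl (Suc i) v - return_time dl i v)) : borel_measurable ?D"
    "!!i. (%v. ph i (return_time dl 1 v)) : borel_measurable ?D" by measurable
   show ?thesis unfolding rt(1) transfer[OF m(1)] transfer[OF m(2)] rt(2) by (rule B.return_product[OF dl that])
  qed
  show "(\<integral>\<^sup>+om. ennreal (exp (- th * return_time dl 1 (%s. X' s om))) \<partial>M) =
   ennreal (exp (- th * dl) * (LINT x|gauss dl. exp (- ka * sqrt th * \<bar>x\<bar>)))" if "0 <= th" for th
  proof -
   have m: "(%v. ennreal (exp (- th * return_time dl 1 v))) : borel_measurable ?D" by measurable
   show ?thesis unfolding rt(1) transfer[OF m] rt(2) by (rule B.return_laplace[OF dl that ka(1) ka(2)[OF that]])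
  qed
 qed (fact X'm X'c ka(1))+
 then show ?thesis using ae that by blast
qed

lemma abs_moment:
 shows "integrable (gauss 1) (%x. \<bar>x\<bar>)" "0 < (LINT x|gauss 1. \<bar>x\<bar>)"
proof -
 let ?A = "\<integral>x. \<bar>x\<bar> \<partial>gauss 1"
 interpret G: prob_space "gauss 1" by (rule prob_space_gauss) simp
 have g: "gauss 1 = density lborel (%x. ennreal (std_normal_density x))" by (simp add: gauss_def)
 show int: "integrable (gauss 1) (%x. \<bar>x\<bar>)"
  unfolding g using integrable_std_normal_moment_abs[of 1] by (subst integrable_density) simp_all
 have "?A ~= 0"
 proof
  assume "?A = 0"
  then have "AE x in gauss 1. x = 0" by (subst (asm) integral_nonneg_eq_0_iff_AE[OF int]) auto
  then have "AE x in gauss 1. x : {..0}" by eventually_elim simp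
  then have "measure (gauss 1) {..0} = 1" by (intro G.prob_eq_1[THEN iffD2]) auto
  then show False using gauss_half by simp
 qed
 moreover have "0 <= ?A" by (rule integral_nonneg_AE) simp
 ultimately show "0 < ?A" by linarith
qed

text \<open>At variance 1 / 4 ^ n the absolute value is 1 / 2 ^ n times that of a standard normal
  variable. After multiplication by 2 ^ n the term with a is of order 1 / 2 ^ n and disappears,
  while the term with b survives.\<close>

lemma return_rate_limit:
 fixes a b :: real
 assumes a: "0 <= a" and b: "0 <= b"
 shows "(%n. 2 ^ n * (1 - exp (- a * (1 / 4 ^ n)) * (\<integral>x. exp (- b * \<bar>x\<bar>) \<partial>gauss (1 / 4 ^ n)))) ----> b * (LINT x|gauss 1. \<bar>x\<bar>)"
proof -
 let ?A = "%n x. 1 - exp (- b * \<bar>1 / 2 ^ n * x\<bar>)"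
 let ?B = "%n. \<integral>x. exp (- b * \<bar>1 / 2 ^ n * x\<bar>) \<partial>gauss 1"
 let ?C = "\<integral>x. b * \<bar>x\<bar> \<partial>gauss 1"
 let ?D = "%n. \<integral>x. 2 ^ n * ?A n x \<partial>gauss 1"
 let ?E = "%x n. - (b * \<bar>x\<bar> / 2 ^ n)"
 interpret G: prob_space "gauss 1" by (rule prob_space_gauss) simp
 have e_int: "integrable (gauss 1) (%x. exp (- b * \<bar>r * x\<bar>))" for r
  using b by (intro G.integrable_const_bound[where B=1]) auto
 have scale: "(\<integral>x. exp (- b * \<bar>x\<bar>) \<partial>gauss (1 / 4 ^ n)) = ?B n" for n
  using gauss_scale_integral[of 1 "1 / 2 ^ n" "%x. exp (- b * \<bar>x\<bar>)"] by (simp add: power_divide power2_eq_square flip: power_mult_distrib)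
 have diff: "2 ^ n * (1 - (?B n)) = ?D n" for n
  using e_int[of "1 / 2 ^ n"] by (simp add: G.prob_space[simplified])
 have pt: "(%n. 2 ^ n * (1 - exp (- y / 2 ^ n))) ----> y" for y :: real by real_asymp
 have L: "(%n. \<integral>x. 2 ^ n * ?A n x \<partial>gauss 1) ----> ?C"
 proof (rule integral_dominated_convergence[where w="%x. b * \<bar>x\<bar>"])
  show "integrable (gauss 1) (%x. b * \<bar>x\<bar>)" using abs_moment(1) by simp
  show "AE x in gauss 1. (%n. 2 ^ n * ?A n x) ----> b * \<bar>x\<bar>"
  proof (rule AE_I2)
   show "(%n. 2 ^ n * ?A n x) ----> b * \<bar>x\<bar>" for x
    using pt[of "b * \<bar>x\<bar>"] by (simp add: abs_mult)
  qed
  show "AE x in gauss 1. norm (2 ^ n * ?A n x) <= b * \<bar>x\<bar>" for n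
  proof (rule AE_I2)
   fix x :: real
   have "1 - exp (?E x n) <= b * \<bar>x\<bar> / 2 ^ n" using exp_ge_add_one_self[of "- (b * \<bar>x\<bar> / 2 ^ n)"] by simp
   then have "2 ^ n * (1 - exp (?E x n)) <= b * \<bar>x\<bar>" by (simp add: field_simps)
   moreover have "0 <= 1 - exp (?E x n)" using b by simp
   ultimately show "norm (2 ^ n * ?A n x) <= b * \<bar>x\<bar>" by (simp add: abs_mult)
  qed
 qed auto
 have A: "(%n. 2 ^ n * (1 - exp (- a * (1 / 4 ^ n)))) ----> 0" "(%n. exp (- a * (1 / 4 ^ n))) ----> 1" by real_asymp+
 have "(%n. 2 ^ n * (1 - exp (- a * (1 / 4 ^ n))) + exp (- a * (1 / 4 ^ n)) * ?D n) ----> 0 + 1 * ?C"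
  by (intro tendsto_add tendsto_mult A L)
 then show ?thesis unfolding diff[symmetric] scale by (simp add: algebra_simps)
qed

lemma extension_right:
 assumes w: "!!s. 0 <= s ==> continuous (at_right s) w" and t: "0 <= t"
 shows "extension (restrict w dyadics) t = w t"
proof -
 have "continuous (at t within {t..}) w" using w[OF t] by (simp add: at_within_Ici_at_right)
 from continuous_within_tendsto_compose'[OF this _ dyadic_up_tendsto[OF t]]
 have "(%n. w (dyadic_up n t)) ----> w t" using dyadic_up_bounds(1)[OF t] by simp
 then show ?thesis using dyadic_up_bounds(3)[OF t] by (simp add: extension_def limI)
qed

context nice_stable
begin

lemma nn_increments:
 fixes u :: "nat => real" and ph :: "nat => real => real"
 assumes u: "0 <= u 0" "mono u" and ph: "!!i. ph i : borel_measurable borel" "!!i x. 0 <= x ==> 0 <= ph i x & ph i x <= 1"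
 shows "(\<integral>\<^sup>+om. (\<Prod>i<n. ennreal (ph i (sg (u (Suc i)) om - sg (u i) om))) \<partial>M) =
  (\<Prod>i<n. \<integral>\<^sup>+om. ennreal (ph i (sg (u (Suc i) - u i) om)) \<partial>M)"
proof -
 let ?A = "%u i om. sg (u (Suc i)) om - sg (u i) om"
 let ?B = "%i u. %om. ph i (sg (u (Suc i) - u i) om)"
 let ?C = "%u. %om. \<Prod>i<n. ph i (?A u i om)"
 have u0: "0 <= u i" "u i <= u (Suc i)" for i using u monoD[OF u(2), of 0 i] monoD[OF u(2), of i "Suc i"] by auto
 have m: "(%om. ph i (?A u i om)) : borel_measurable M" for i
  by (rule measurable_compose[OF borel_measurable_diff[OF rv[OF u0(1)] rv[OF u0(1)]] ph(1)])
 have m1: "(?B i u) : borel_measurable M" for i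
  using u0(2)[of i] by (intro measurable_compose[OF rv ph(1)]) simp
 have b: "0 <= ph i (?A u i om) & ph i (?A u i om) <= 1" if "om : space M" for om i
  using nice_mono[OF path[OF that] u0(1) u0(2)] by (intro ph(2)) simp
 have b1: "0 <= ph i (sg (u (Suc i) - u i) om) & ph i (sg (u (Suc i) - u i) om) <= 1" if "om : space M" for om i
  using nice_nonneg[OF path[OF that], of "u (Suc i) - u i"] u0(2)[of i] by (intro ph(2)) simp
 have i1: "(\<integral>\<^sup>+om. ennreal (ph i (sg (u (Suc i) - u i) om)) \<partial>M) = ennreal (expectation (?B i u))" for i
  by (rule nn_integral_eq_integral) (use b1 m1 in \<open>auto intro!: integrable_const_bound[where B=1] AE_I2\<close>)
 have "(\<integral>\<^sup>+om. (\<Prod>i<n. ennreal (ph i (?A u i om))) \<partial>M) =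
  (\<integral>\<^sup>+om. ennreal (\<Prod>i<n. ph i (?A u i om)) \<partial>M)"
  by (intro nn_integral_cong prod_ennreal) (use b in blast)
 also have "... = ennreal (expectation (?C u))"
 proof (rule nn_integral_eq_integral)
  show "integrable M (?C u)"
  proof (rule integrable_const_bound[where B=1])
   show "AE om in M. norm (\<Prod>i<n. ph i (?A u i om)) <= 1"
    using b by (intro AE_I2) (simp add: abs_prod prod_le_1)
  qed (intro borel_measurable_prod m)
  show "AE om in M. 0 <= (\<Prod>i<n. ph i (?A u i om))"
   using b by (intro AE_I2 prod_nonneg) blast
 qed
 also have "... = ennreal (\<Prod>i<n. expectation (?B i u))"
  by (simp only: increments[OF u ph])
 also have "... = (\<Prod>i<n. \<integral>\<^sup>+om. ennreal (ph i (sg (u (Suc i) - u i) om)) \<partial>M)"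
  unfolding i1 using b1 by (intro prod_ennreal[symmetric] integral_nonneg_AE AE_I2) blast
 finally show ?thesis .
qed

lemma sigma_right: "om : space M ==> 0 <= s ==> continuous (at_right s) (%s. sg s om)"
 using path[of om] by (simp add: nice_path_def)

end

section \<open>Cycles after the independent time change\<close>

text \<open>Independence is stated for dyadic restrictions; they determine \<open>X\<close> by
  continuity and \<open>S\<close> by right-continuity.\<close>

locale subordinated = reflected_path M ka X + nice_stable M be c S
 for M :: "'a measure" and ka X be c S +
 assumes indep: "distr M (dyadic_paths \<Otimes>\<^sub>M dyadic_paths) (%om. (dyadic_values X om, dyadic_values S om)) =
  distr M dyadic_paths (dyadic_values X) \<Otimes>\<^sub>M distr M dyadic_paths (dyadic_values S)"
begin

lemma X_values [measurable]: "dyadic_values X : M \<rightarrow>\<^sub>M dyadic_paths"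
 by (rule dyadic_values_measurable) (rule X_measurable)

lemma S_values [measurable]: "dyadic_values S : M \<rightarrow>\<^sub>M dyadic_paths"
 by (rule dyadic_values_measurable) (rule rv)

lemma extension_S: "om : space M ==> 0 <= t ==> extension (dyadic_values S om) t = S t om"
 unfolding dyadic_values_def by (rule extension_right) (rule sigma_right)

lemma extension_X: "om : space M ==> 0 <= t ==> extension (dyadic_values X om) t = X t om"
 unfolding dyadic_values_def by (rule extension_restrict[OF X_cont])

text \<open>One path is frozen while the other is integrated out. Freezing \<open>X\<close> serves
  the laws of the marks, freezing \<open>S\<close> the nonvanishing at a fixed time.\<close>

lemma independent_integral:
 assumes F: "F : borel_measurable (dyadic_paths \<Otimes>\<^sub>M dyadic_paths)"
 shows "(\<integral>\<^sup>+om. F (dyadic_values X om, dyadic_values S om) \<partial>M) = (\<integral>\<^sup>+x. (\<integral>\<^sup>+y. F (dyadic_values X x, dyadic_values S y) \<partial>M) \<partial>M)"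
  and "(\<integral>\<^sup>+om. F (dyadic_values X om, dyadic_values S om) \<partial>M) = (\<integral>\<^sup>+y. (\<integral>\<^sup>+x. F (dyadic_values X x, dyadic_values S y) \<partial>M) \<partial>M)"
proof -
 let ?D = dyadic_paths
 note [measurable] = F
 interpret PX: prob_space "distr M ?D (dyadic_values X)" by (rule prob_space_distr) measurable
 interpret PS: prob_space "distr M ?D (dyadic_values S)" by (rule prob_space_distr) measurable
 interpret P: pair_sigma_finite M M ..
 have "(\<integral>\<^sup>+om. F (dyadic_values X om, dyadic_values S om) \<partial>M) = (\<integral>\<^sup>+z. F z \<partial>distr M (?D \<Otimes>\<^sub>M ?D) (%om. (dyadic_values X om, dyadic_values S om)))"
  by (subst nn_integral_distr) simp_all
 also have "... = (\<integral>\<^sup>+v. (\<integral>\<^sup>+y. F (v, y) \<partial>distr M ?D (dyadic_values S)) \<partial>distr M ?D (dyadic_values X))"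
  unfolding indep by (subst PS.nn_integral_fst[symmetric]) simp_all
 also have "... = (\<integral>\<^sup>+v. (\<integral>\<^sup>+y. F (v, dyadic_values S y) \<partial>M) \<partial>distr M ?D (dyadic_values X))"
  by (intro nn_integral_cong nn_integral_distr) (simp_all add: space_PiM)
 also have "... = (\<integral>\<^sup>+x. (\<integral>\<^sup>+y. F (dyadic_values X x, dyadic_values S y) \<partial>M) \<partial>M)"
  by (subst nn_integral_distr) simp_all
 finally show 1: "(\<integral>\<^sup>+om. F (dyadic_values X om, dyadic_values S om) \<partial>M) = (\<integral>\<^sup>+x. (\<integral>\<^sup>+y. F (dyadic_values X x, dyadic_values S y) \<partial>M) \<partial>M)" .
 then show "(\<integral>\<^sup>+om. F (dyadic_values X om, dyadic_values S om) \<partial>M) = (\<integral>\<^sup>+y. (\<integral>\<^sup>+x. F (dyadic_values X x, dyadic_values S y) \<partial>M) \<partial>M)"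
  using P.Fubini'[of "%x y. F (dyadic_values X x, dyadic_values S y)"] by simp
qed

definition ret :: "real => nat => 'a => real" where
 "ret dl k om = return_time dl k (%s. X s om)"

definition mark :: "real => nat => 'a => real" where
 "mark dl k om = S (ret dl k om) om"

lemma ret_values: "return_time dl k (dyadic_values X om) = ret dl k om"
 unfolding ret_def by (rule return_time_cong) (simp add: dyadic_values_def)

lemma return_time_path: "(%v. return_time dl k v) : borel_measurable dyadic_paths"
 by (intro return_time_measurable measurable_component_singleton)

lemma ret_measurable [measurable]: "ret dl k : borel_measurable M"
 unfolding ret_def[abs_def] by (intro return_time_measurable X_measurable dyadics_nonneg)

lemma ret_facts:
 assumes om: "om : space M" and dl: "0 <= dl"
 shows "0 <= ret dl k om" "X (ret dl k om) om = 0" "ret dl k om + dl <= ret dl (Suc k) om"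
  "!!t. ret dl k om + dl <= t ==> X t om = 0 ==> ret dl (Suc k) om <= t"
proof -
 note z = recurring_zerosD[OF X_cont[OF om] X_zeros[OF om]]
 note r = return_time[OF X_cont[OF om] z(1,3) dl]
 show "0 <= ret dl k om" "X (ret dl k om) om = 0" "ret dl k om + dl <= ret dl (Suc k) om"
  "!!t. ret dl k om + dl <= t ==> X t om = 0 ==> ret dl (Suc k) om <= t"
  unfolding ret_def using r by auto
qed

lemma ret_mono: "om : space M ==> 0 <= dl ==> mono (%k. ret dl k om)"
proof -
 assume "om : space M" "0 <= dl"
 then have "ret dl k om <= ret dl (Suc k) om" for k using ret_facts(3)[of om dl k] by linarith
 then show ?thesis by (simp add: mono_iff_le_Suc)
qed

lemma ret_0 [simp]: "ret dl 0 om = 0"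
 by (simp add: ret_def)

lemma mark_0 [simp]: "om : space M ==> mark dl 0 om = 0"
 unfolding mark_def using nice_zero[OF path] by simp

lemma extension_mark: "om : space M ==> 0 <= dl ==> extension (dyadic_values S om) (return_time dl k (dyadic_values X om)) = mark dl k om"
 by (simp add: ret_values mark_def extension_S ret_facts(1))

lemma mark_measurable:
 assumes dl: "0 <= dl"
 shows "mark dl k : borel_measurable M"
proof -
 have "(%om. extension (dyadic_values S om) (return_time dl k (dyadic_values X om))) : borel_measurable M"
  by (intro extension_measurable S_values measurable_compose[OF X_values return_time_path])
 then show ?thesis by (rule measurable_cong[THEN iffD1, rotated]) (rule extension_mark[OF _ dl])
qed

text \<open>With \<open>X\<close> frozen, \<open>S\<close> has independent stationary increments
  over the cycles. What remains is a product of functions of the cycle lengths of \<open>X\<close>,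
  and these lengths are independent as well.\<close>

lemma mark_product:
 fixes ph :: "nat => real => real"
 assumes dl: "dl : dyadics" and ph: "!!i. ph i : borel_measurable borel" "!!i x. 0 <= x ==> 0 <= ph i x & ph i x <= 1"
 shows "(\<integral>\<^sup>+om. (\<Prod>i<n. ennreal (ph i (mark dl (Suc i) om - mark dl i om))) \<partial>M) = (\<Prod>i<n. \<integral>\<^sup>+om. ennreal (ph i (mark dl 1 om)) \<partial>M)"
proof -
 let ?A = "%x. \<integral>\<^sup>+y. (\<Prod>i<n. ennreal (ph i (S (ret dl (Suc i) x) y - S (ret dl i x) y))) \<partial>M"
 let ?B = "%i. \<integral>\<^sup>+om. ennreal (ph i (mark dl 1 om)) \<partial>M"
 let ?C = "%i. %z. ennreal (ph i (extension (snd z) (return_time dl 1 (fst z))))"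
 let ?D = dyadic_paths
 have dl0: "0 <= dl" by (rule dyadics_nonneg[OF dl])
 note [measurable] = ph(1)
 have xm [measurable]: "(%z. extension (snd z) (return_time dl k (fst z))) : borel_measurable (?D \<Otimes>\<^sub>M ?D)" for k
  by (intro extension_measurable measurable_snd measurable_compose[OF measurable_fst return_time_path])
 \<comment> \<open>The expectation for a cycle of length r once \<open>X\<close> is frozen. Using
   the extension makes it measurable in r.\<close>
 define ps where "ps i r = (\<integral>\<^sup>+y. ennreal (ph i (extension (dyadic_values S y) r)) \<partial>M)" for i r
 have em [measurable]: "(%z. extension (dyadic_values S (snd z)) (fst z)) : borel_measurable (borel \<Otimes>\<^sub>M M)"
  by (intro extension_measurable measurable_compose[OF measurable_snd S_values] measurable_fst)
 have psm: "ps i : borel_measurable borel" for i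
  unfolding ps_def[abs_def] by (rule borel_measurable_nn_integral) (simp add: split_beta')
 have psS: "ps i r = (\<integral>\<^sup>+y. ennreal (ph i (S r y)) \<partial>M)" if "0 <= r" for i r
  unfolding ps_def using that by (intro nn_integral_cong) (simp add: extension_S)
 have "(\<integral>\<^sup>+om. (\<Prod>i<n. ennreal (ph i (mark dl (Suc i) om - mark dl i om))) \<partial>M) =
  (\<integral>\<^sup>+om. (%z. \<Prod>i<n. ennreal (ph i (extension (snd z) (return_time dl (Suc i) (fst z)) - extension (snd z) (return_time dl i (fst z))))) (dyadic_values X om, dyadic_values S om) \<partial>M)"
  by (intro nn_integral_cong) (simp only: fst_conv snd_conv extension_mark dl0)
 also have "... = (\<integral>\<^sup>+x. ?A x \<partial>M)"
  by (subst independent_integral(1)) (simp_all add: ret_values extension_S ret_facts(1) dl0 del: return_time.simps cong: nn_integral_cong_simp)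
 also have "... = (\<integral>\<^sup>+x. (\<Prod>i<n. ps i (ret dl (Suc i) x - ret dl i x)) \<partial>M)"
 proof (rule nn_integral_cong)
  fix x assume x: "x : space M"
  have inc: "0 <= ret dl (Suc i) x - ret dl i x" for i using monoD[OF ret_mono[OF x dl0], of i "Suc i"] by simp
  show "?A x = (\<Prod>i<n. ps i (ret dl (Suc i) x - ret dl i x))"
   using nn_increments[OF ret_facts(1)[OF x dl0] ret_mono[OF x dl0] ph] by (simp only: psS[OF inc])
 qed
 also have "... = (\<Prod>i<n. \<integral>\<^sup>+x. ps i (ret dl 1 x) \<partial>M)"
  unfolding ret_def by (rule returns[OF dl psm])
 also have "... = (\<Prod>i<n. \<integral>\<^sup>+om. ennreal (ph i (mark dl 1 om)) \<partial>M)"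
 proof (rule prod.cong[OF refl])
  fix i
  have "(\<integral>\<^sup>+x. ps i (ret dl 1 x) \<partial>M) = (\<integral>\<^sup>+x. (\<integral>\<^sup>+y. (?C i) (dyadic_values X x, dyadic_values S y) \<partial>M) \<partial>M)"
   by (simp only: ps_def fst_conv snd_conv ret_values)
  also have "... = (\<integral>\<^sup>+om. (?C i) (dyadic_values X om, dyadic_values S om) \<partial>M)"
   by (rule independent_integral(1)[symmetric]) measurable
  also have "... = ?B i"
   by (intro nn_integral_cong) (simp only: fst_conv snd_conv extension_mark dl0)
  finally show "(\<integral>\<^sup>+x. ps i (ret dl 1 x) \<partial>M) = ?B i" .
 qed
 finally show ?thesis .
qed

text \<open>Evaluating \<open>S\<close> at the independent first return replaces \<open>th\<close>
  by \<open>c * th powr be\<close> in the transform of that return.\<close>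

lemma mark_laplace:
 assumes dl: "dl : dyadics" and th: "0 <= th"
 shows "expectation (%om. exp (- th * mark dl 1 om)) =
  exp (- (c * th powr be) * dl) * (LINT x|gauss dl. exp (- ka * sqrt (c * th powr be) * \<bar>x\<bar>))"
proof -
 let ?A = "exp (- (c * th powr be) * dl) * (LINT x|gauss dl. exp (- ka * sqrt (c * th powr be) * \<bar>x\<bar>))"
 let ?B = "\<integral>\<^sup>+om. ennreal (exp (- th * mark dl 1 om)) \<partial>M"
 let ?C = "%r. \<integral>\<^sup>+y. ennreal (exp (- th * S r y)) \<partial>M"
 let ?D = dyadic_paths
 have dl0: "0 <= dl" by (rule dyadics_nonneg[OF dl])
 have xm [measurable]: "(%z. extension (snd z) (return_time dl 1 (fst z))) : borel_measurable (?D \<Otimes>\<^sub>M ?D)"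
  by (intro extension_measurable measurable_snd measurable_compose[OF measurable_fst return_time_path])
 have Sl: "?C r = ennreal (exp (- (c * th powr be) * r))" if r: "0 <= r" for r
 proof -
  have "?C r = ennreal (expectation (%y. exp (- th * S r y)))"
   using rv[OF r] th nice_nonneg[OF path r] by (intro nn_integral_eq_integral integrable_const_bound[where B=1] AE_I2) auto
  then show ?thesis using laplace[OF r th] by (simp add: mult_ac)
 qed
 have "?B =
  (\<integral>\<^sup>+om. (%z. ennreal (exp (- th * extension (snd z) (return_time dl 1 (fst z))))) (dyadic_values X om, dyadic_values S om) \<partial>M)"
  by (intro nn_integral_cong) (simp only: fst_conv snd_conv extension_mark dl0)
 also have "... = (\<integral>\<^sup>+x. (\<integral>\<^sup>+y. ennreal (exp (- th * S (ret dl 1 x) y)) \<partial>M) \<partial>M)"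
  by (subst independent_integral(1)) (simp_all add: ret_values extension_S ret_facts(1) dl0 del: return_time.simps One_nat_def cong: nn_integral_cong_simp)
 also have "... = (\<integral>\<^sup>+x. ennreal (exp (- (c * th powr be) * return_time dl 1 (%s. X s x))) \<partial>M)"
  by (intro nn_integral_cong) (simp only: Sl ret_facts(1) dl0 ret_def[symmetric])
 also have "... = ennreal ?A"
  using scale by (intro first_return dl) simp
 finally have nn: "?B =
  ennreal ?A" .
 have "(%om. exp (- th * mark dl 1 om)) : borel_measurable M" using mark_measurable[OF dl0, of 1] by measurable
 from integral_eq_nn_integral[OF this] nn show ?thesis by (simp add: integral_nonneg_AE)
qed

text \<open>The origin of the index: the Brownian square root applied to
  \<open>c * th powr be\<close> leaves the power be / 2.\<close>

lemma mark_rate_limit: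
 assumes th: "0 <= th"
 shows "(%n. 2 ^ n * (1 - expectation (%om. exp (- th * mark (1 / 4 ^ n) 1 om)))) ---->
  ka * sqrt c * (LINT x|gauss 1. \<bar>x\<bar>) * th powr (be / 2)"
proof -
 let ?A = "ka * sqrt (c * th powr be)"
 have d: "1 / 4 ^ n : dyadics" for n :: nat
  using dyadicI[of 1 "2 * n"] by (simp add: power_mult)
 have "sqrt (c * th powr be) = sqrt c * th powr (be / 2)"
  using th by (simp add: real_sqrt_mult powr_half_sqrt[symmetric] powr_powr)
 moreover have "(%n. 2 ^ n * (1 - exp (- (c * th powr be) * (1 / 4 ^ n)) * (\<integral>x. exp (- ?A * \<bar>x\<bar>) \<partial>gauss (1 / 4 ^ n)))) ---->
  ?A * (LINT x|gauss 1. \<bar>x\<bar>)"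
  using scale exponent_pos th by (intro return_rate_limit) auto
 ultimately show ?thesis unfolding mark_laplace[OF d th] by (simp add: mult_ac)
qed

end

section \<open>The contribution of the unfinished cycle\<close>

context gap_test
begin

text \<open>The share of a cycle of length x in the Laplace integral over time, apart from the
  weight collected by earlier cycles; v is the age in the cycle.\<close>

definition primitive :: "real => real => real" where
 "primitive l x = (LINT v|lborel. indicator {0<..x} v * exp (- l * v - f v))"

lemma nn_exp_half_line:
 assumes l: "0 < l"
 shows "(\<integral>\<^sup>+v. ennreal (indicator {0<..} v * exp (- l * v)) \<partial>lborel) = ennreal (1 / l)"
proof -
 let ?A = "%v. - exp (- l * v) / l"
 have "(\<integral>\<^sup>+v. ennreal (indicator {0<..} v * exp (- l * v)) \<partial>lborel) = (\<integral>\<^sup>+v. ennreal (exp (- l * v)) * indicator {0..} v \<partial>lborel)"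
  by (intro nn_integral_cong_AE, rule AE_mp[OF AE_lborel_singleton[of 0]]) (auto simp: indicator_def)
 also have "... = ennreal (0 - (- exp (- l * 0) / l))"
 proof (rule nn_integral_FTC_atLeast)
  show "(?A has_real_derivative exp (- l * v)) (at v)" for v
   using l by (auto intro!: derivative_eq_intros)
  show "(?A \<longlongrightarrow> 0) at_top" using l by real_asymp
 qed auto
 finally show ?thesis by simp
qed

lemma primitive_integrable:
 assumes l: "0 < l"
 shows "integrable lborel (%v. indicator {0<..} v * exp (- l * v - f v))"
proof (rule integrableI_bounded)
 let ?A = "\<integral>\<^sup>+v. ennreal (norm (indicator {0<..} v * exp (- l * v - f v))) \<partial>lborel"
 have "?A <= (\<integral>\<^sup>+v. ennreal (indicator {0<..} v * exp (- l * v)) \<partial>lborel)"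
  using f_nonneg by (intro nn_integral_mono ennreal_leI) (auto simp: indicator_def)
 also have "... < \<infinity>" unfolding nn_exp_half_line[OF l] by simp
 finally show "?A < \<infinity>" .
qed measurable

lemma piece_integrable:
 assumes l: "0 < l" and a: "0 <= a"
 shows "integrable lborel (%v. indicator {a<..x} v * exp (- l * v - f v))"
 by (rule Bochner_Integration.integrable_bound[OF primitive_integrable[OF l]]) (use a in \<open>auto simp: indicator_def\<close>)

lemma nn_primitive:
 assumes l: "0 < l"
 shows "(\<integral>\<^sup>+v. indicator {0<..x} v * ennreal (exp (- l * v - f v)) \<partial>lborel) = ennreal (primitive l x)"
proof -
 have "(\<integral>\<^sup>+v. indicator {0<..x} v * ennreal (exp (- l * v - f v)) \<partial>lborel) = (\<integral>\<^sup>+v. ennreal (indicator {0<..x} v * exp (- l * v - f v)) \<partial>lborel)"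
  by (intro nn_integral_cong) (simp add: indicator_def)
 also have "... = ennreal (primitive l x)"
  unfolding primitive_def by (rule nn_integral_eq_integral[OF piece_integrable[OF l]]) auto
 finally show ?thesis .
qed

lemma primitive_nonneg: "0 <= primitive l x"
 unfolding primitive_def by (rule integral_nonneg_AE) simp

text \<open>Multiplied by l, the primitive takes values in [0,1] and is admissible in
  \<open>mark_product\<close>.\<close>

lemma primitive_le:
 assumes l: "0 < l"
 shows "l * primitive l x <= 1"
proof -
 have "ennreal (primitive l x) <= (\<integral>\<^sup>+v. ennreal (indicator {0<..} v * exp (- l * v)) \<partial>lborel)"
  unfolding nn_primitive[OF l, symmetric] using f_nonneg by (intro nn_integral_mono) (auto simp: indicator_def intro!: ennreal_leI)
 also have "... = ennreal (1 / l)" by (rule nn_exp_half_line[OF l])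
 finally have "primitive l x <= 1 / l" using l by (simp add: ennreal_le_iff)
 then show ?thesis using l by (simp add: field_simps)
qed

lemma primitive_zero: "x <= 0 ==> primitive l x = 0"
 by (simp add: primitive_def)

lemma primitive_diff:
 assumes l: "0 < l" and x: "0 <= x" "x <= y"
 shows "0 <= primitive l y - primitive l x" "primitive l y - primitive l x <= y - x"
proof -
 let ?A = "%x. \<integral>v. indicator {x<..y} v * exp (- l * v - f v) \<partial>lborel"
 have "primitive l y = (LINT v|lborel. indicator {0<..x} v * exp (- l * v - f v) + indicator {x<..y} v * exp (- l * v - f v))"
  unfolding primitive_def using x by (intro Bochner_Integration.integral_cong) (auto simp: indicator_def)
 also have "... = primitive l x + ?A x"
  unfolding primitive_def using piece_integrable[OF l] x by simp
 finally have d: "primitive l y - primitive l x = ?A x" by simp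
 show "0 <= primitive l y - primitive l x" unfolding d by (rule integral_nonneg_AE) simp
 have "?A x <= (LINT v|lborel. indicator {x<..y} v)"
 proof (rule integral_mono)
  show "integrable lborel (%v. indicator {x<..y} v :: real)" using x by (intro integrable_real_indicator) auto
  show "indicator {x<..y} v * exp (- l * v - f v) <= indicator {x<..y} v" for v
  proof (cases "v : {x<..y}")
   case True
   then have "0 <= l * v" using l x by simp
   then show ?thesis using f_nonneg[of v] True by simp
  qed simp
 qed (rule piece_integrable[OF l x(1)])
 then show "primitive l y - primitive l x <= y - x" unfolding d using x by simp
qed

lemma primitive_cont:
 assumes l: "0 < l"
 shows "continuous_on UNIV (primitive l)"
proof (rule continuous_onI)
 fix x e :: real assume e: "0 < e"
 have *: "\<bar>primitive l y - primitive l x\<bar> <= \<bar>y - x\<bar>" for x y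
 proof -
  have mx: "primitive l z = primitive l (max 0 z)" for z by (simp add: primitive_zero max_def)
  have "\<bar>primitive l b - primitive l a\<bar> <= \<bar>b - a\<bar>" if "0 <= a" "0 <= b" for a b
   using primitive_diff[OF l, of a b] primitive_diff[OF l, of b a] that by (cases "a <= b") auto
  from this[of "max 0 x" "max 0 y"] have "\<bar>primitive l y - primitive l x\<bar> <= \<bar>max 0 y - max 0 x\<bar>"
   unfolding mx[of x] mx[of y] by simp
  also have "... <= \<bar>y - x\<bar>" by (auto simp: max_def)
  finally show ?thesis .
 qed
 show "\<exists>d>0. \<forall>x'\<in>UNIV. dist x' x < d --> dist (primitive l x') (primitive l x) <= e"
  using e order_trans[OF *[of _ x] less_imp_le] by (intro exI[of _ e]) (auto simp: dist_real_def)
qed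

lemma primitive_measurable:
 assumes "0 < l"
 shows "primitive l : borel_measurable borel"
 using primitive_cont[OF assms] by (rule borel_measurable_continuous_onI)

text \<open>For 0 < x < et the function f vanishes up to x, so the primitive lies between x * exp (-
  l * x) and x. At infinity it tends to the full integral.\<close>

lemma primitive_ratio:
 assumes l: "0 < l"
 shows "((%x. primitive l x / (1 - exp (- x))) \<longlongrightarrow> 1) (at_right 0)"
  and "((%x. primitive l x / (1 - exp (- x))) \<longlongrightarrow> (LINT v|lborel. indicator {0<..} v * exp (- l * v - f v))) at_top"
proof -
 let ?A = "%x. primitive l x / (1 - exp (- x))"
 have lower: "x * exp (- l * x - f x) <= primitive l x" if x: "0 < x" "x < et" for x
 proof -
  have "(LINT v|lborel. indicator {0<..x} v * exp (- l * x)) <= primitive l x"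
   unfolding primitive_def
  proof (rule integral_mono)
   show "integrable lborel (%v. indicator {0<..x} v * exp (- l * x))"
    using x by (intro integrable_mult_left integrable_real_indicator) auto
   show "indicator {0<..x} v * exp (- l * x) <= indicator {0<..x} v * exp (- l * v - f v)" for v
    using f_zero[of v] x l by (auto simp: indicator_def)
  qed (rule piece_integrable[OF l order_refl])
  then show ?thesis using f_zero[of x] x by simp
 qed
 have ev: "\<forall>\<^sub>F x in at_right 0. 0 < x & x < et"
  using eta by (intro eventually_at_rightI[of 0 et]) auto
 show "(?A \<longlongrightarrow> 1) (at_right 0)"
 proof (rule tendsto_sandwich)
  show "((%x. (x * exp (- l * x - f x)) / (1 - exp (- x))) \<longlongrightarrow> 1) (at_right 0)"
   by (rule ratio_limits(3)[OF l eta f_zero f_nonneg])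
  show "((%x::real. x / (1 - exp (- x))) \<longlongrightarrow> 1) (at_right 0)" by real_asymp
  show "\<forall>\<^sub>F x in at_right 0. (x * exp (- l * x - f x)) / (1 - exp (- x)) <= primitive l x / (1 - exp (- x))"
   using ev by eventually_elim (intro divide_right_mono lower; simp)
  show "\<forall>\<^sub>F x in at_right 0. primitive l x / (1 - exp (- x)) <= x / (1 - exp (- x))"
   using ev by eventually_elim (use primitive_diff[OF l order_refl] in \<open>auto simp: primitive_zero intro!: divide_right_mono\<close>)
 qed
 let ?g = "%v. indicator {0<..} v * exp (- l * v - f v)"
 have "((%y. \<integral>v. indicator {..y} v *\<^sub>R ?g v \<partial>lborel) \<longlongrightarrow> (LINT v|lborel. ?g v)) at_top"
  by (rule tendsto_integral_at_top) (use primitive_integrable[OF l] in auto)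
 moreover have "(LINT v|lborel. indicator {..y} v *\<^sub>R ?g v) = primitive l y" for y
  unfolding primitive_def by (intro Bochner_Integration.integral_cong) (auto simp: indicator_def)
 ultimately have "(primitive l \<longlongrightarrow> (LINT v|lborel. ?g v)) at_top" by simp
 moreover have "((%x::real. 1 - exp (- x)) \<longlongrightarrow> 1) at_top" by real_asymp
 ultimately have "(?A \<longlongrightarrow> (LINT v|lborel. ?g v) / 1) at_top"
  by (rule tendsto_divide) simp
 then show "(?A \<longlongrightarrow> (LINT v|lborel. ?g v)) at_top" by simp
qed

text \<open>By \<open>nn_integral_levy_primitive\<close> the tail
  \<open>v powr (- \<alpha>) / \<alpha>\<close> appears, which is v / \<alpha> times the density of
  \<open>levy \<alpha>\<close>. This extra v makes the integral an age rate.\<close>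

lemma integral_primitive:
 assumes \<alpha>: "0 < \<alpha>" "\<alpha> < 1" and l: "0 < l"
 shows "(LINT x|levy \<alpha>. primitive l x) = age_rate \<alpha> l / \<alpha>"
proof -
 let ?A = "\<integral>\<^sup>+v. ennreal (indicator {0<..} v * v powr (- \<alpha>)) * ennreal (exp (- l * v - f v)) \<partial>lborel"
 let ?B = "\<integral>x. primitive l x \<partial>levy \<alpha>"
 note [measurable] = primitive_measurable[OF l]
 have int: "integrable (levy \<alpha>) (primitive l)"
  using primitive_ratio[OF l] primitive_cont[OF l]
  by (intro ratio_integrable[OF \<alpha>]) (auto intro: continuous_on_subset simp: primitive_zero)
 have "ennreal ?B = (\<integral>\<^sup>+x. ennreal (primitive l x) \<partial>levy \<alpha>)"
  by (rule nn_integral_eq_integral[OF int, symmetric]) (simp add: primitive_nonneg)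
 also have "... = (\<integral>\<^sup>+x. (\<integral>\<^sup>+v. indicator {0<..x} v * ennreal (exp (- l * v - f v)) \<partial>lborel) \<partial>levy \<alpha>)"
  by (simp only: nn_primitive[OF l])
 also have "... = ennreal (1 / \<alpha>) * ?A"
  by (rule nn_integral_levy_primitive) (use \<alpha> in measurable)
 also have "?A =
  (\<integral>\<^sup>+v. ennreal (v * exp (- l * v - f v)) \<partial>levy \<alpha>)"
 proof (subst nn_integral_levy)
  show "?A =
   (\<integral>\<^sup>+v. ennreal (indicator {0<..} v * v powr (- 1 - \<alpha>)) * ennreal (v * exp (- l * v - f v)) \<partial>lborel)"
  proof (rule nn_integral_cong)
   fix v :: real
   have "v powr (- \<alpha>) = v powr (- 1 - \<alpha>) * v" if "0 < v" using that powr_add[of v "- 1 - \<alpha>" 1] by simp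
   then show "ennreal (indicator {0<..} v * v powr (- \<alpha>)) * ennreal (exp (- l * v - f v)) =
    ennreal (indicator {0<..} v * v powr (- 1 - \<alpha>)) * ennreal (v * exp (- l * v - f v))"
    by (cases "0 < v") (simp_all add: mult.assoc flip: ennreal_mult)
  qed
 qed measurable
 also have "... = ennreal (age_rate \<alpha> l)"
  unfolding age_rate_def
 proof (rule nn_integral_eq_integral[OF rates_integrable(2)[OF \<alpha> l]])
  show "AE v in levy \<alpha>. 0 <= v * exp (- l * v - f v)" using AE_levy_pos by eventually_elim simp
 qed
 finally have "ennreal ?B = ennreal (age_rate \<alpha> l / \<alpha>)"
  using \<alpha> age_rate_nonneg by (simp flip: ennreal_mult)
 then show ?thesis using \<alpha> age_rate_nonneg primitive_nonneg
  by (subst (asm) ennreal_inj) (auto intro!: integral_nonneg_AE divide_nonneg_pos)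
qed

end

text \<open>Shows that passage times are measurable functions of dyadic values.\<close>

lemma path_inverse_dyadic:
 assumes n: "nice_path sg"
 shows "real_of_ereal (INF q\<in>dyadics. if u < sg q then ereal q else \<infinity>) = path_inverse sg u"
proof -
 let ?A = "INF q\<in>dyadics. if u < sg q then ereal q else \<infinity>"
 have "?A = ereal (path_inverse sg u)"
 proof (rule antisym)
  show "ereal (path_inverse sg u) <= ?A"
   using path_inverse_le[OF n] dyadics_nonneg by (intro INF_greatest) auto
  show "?A <= ereal (path_inverse sg u)"
  proof (rule ereal_le_epsilon2)
   fix e :: real assume e: "0 < e"
   obtain q where q: "q : dyadics" "path_inverse sg u + e / 2 <= q" "q < path_inverse sg u + e"
    using dyadic_dense[of "path_inverse sg u + e / 2" "path_inverse sg u + e"] e path_inverse_nonneg[OF n, of u] by auto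
   then have "u < sg q" using e by (intro path_inverse_above[OF n]) auto
   then have "?A <= ereal q" using q by (intro INF_lower2[of q]) auto
   also have "... <= ereal (path_inverse sg u) + ereal e" using q by simp
   finally show "?A <= ereal (path_inverse sg u) + ereal e" .
  qed
 qed
 then show ?thesis by simp
qed

lemma path_inverse_value_id:
 assumes n: "nice_path sg" and strict: "!!s r. 0 <= s ==> s < r ==> sg s < sg r" and t: "0 <= t"
 shows "path_inverse sg (sg t) = t"
proof (rule antisym)
 show "path_inverse sg (sg t) <= t"
  by (rule dense_ge) (use t strict in \<open>auto intro!: path_inverse_le[OF n]\<close>)
 show "t <= path_inverse sg (sg t)"
 proof (rule ccontr)
  assume "\<not> t <= path_inverse sg (sg t)"
  then show False using path_inverse_above[OF n, of "sg t" t] by simp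
 qed
qed

text \<open>A jump of the inverse would be a flat piece of the path, excluded by strict
  growth.\<close>

lemma continuous_path_inverse:
 assumes n: "nice_path sg" and strict: "!!s r. 0 <= s ==> s < r ==> sg s < sg r"
 shows "continuous_on {0..} (path_inverse sg)"
proof (rule continuous_onI)
 fix u e :: real assume u: "u : {0..}" and e: "0 < e"
 let ?E = "path_inverse sg"
 have up: "u < sg (?E u + e)" using e by (intro path_inverse_above[OF n]) simp
 have low: "\<exists>d>0. \<forall>x. 0 <= x --> u - d < x --> ?E u - e <= ?E x"
 proof (cases "?E u - e <= 0")
  case True
  then show ?thesis using order_trans[OF True path_inverse_nonneg[OF n]] by (intro exI[of _ 1]) simp
 next
  case False
  have "sg (?E u - e) < sg (?E u - e / 2)" using False e by (intro strict) auto
  also have "... <= u" using False e by (intro path_inverse_below[OF n]) auto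
  finally have lt: "sg (?E u - e) < u" .
  have "?E u - e <= ?E x" if "sg (?E u - e) < x" for x
  proof (rule ccontr)
   assume "\<not> ?E u - e <= ?E x"
   then have "x < sg (?E u - e)" by (intro path_inverse_above[OF n]) simp
   then show False using that by simp
  qed
  then show ?thesis using lt by (intro exI[of _ "u - sg (?E u - e)"]) auto
 qed
 then obtain d where d: "0 < d" "!!x. 0 <= x ==> u - d < x ==> ?E u - e <= ?E x" by blast
 have hi: "?E x <= ?E u + e" if "x < sg (?E u + e)" for x
  using that e path_inverse_nonneg[OF n, of u] by (intro path_inverse_le[OF n]) auto
 show "\<exists>d>0. \<forall>x'\<in>{0..}. dist x' u < d --> dist (?E x') (?E u) <= e"
 proof (intro exI[of _ "min d (sg (?E u + e) - u)"] conjI ballI impI)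
  show "0 < min d (sg (?E u + e) - u)" using d up by simp
  fix x assume x: "x : {0..}" "dist x u < min d (sg (?E u + e) - u)"
  then have "\<bar>x - u\<bar> < d" "\<bar>x - u\<bar> < sg (?E u + e) - u" by (auto simp: dist_real_def)
  then have "u - d < x" "x < sg (?E u + e)" by linarith+
  then show "dist (?E x) (?E u) <= e" using d(2)[of x] hi[of x] x by (auto simp: dist_real_def abs_le_iff)
 qed
qed

section \<open>The zero set of the time-changed process\<close>

context subordinated
begin

definition zero_set :: "'a => real set" where
 "zero_set om = {u. 0 <= u & X (path_inverse (%s. S s om) u) om = 0}"

lemma zero_set_closed:
 assumes om: "om : space M"
 shows "closed (zero_set om)"
proof -
 have "continuous_on {0..} (%u. X (path_inverse (%s. S s om) u) om)"
  by (rule continuous_on_compose2[OF X_cont[OF om] continuous_path_inverse[OF path[OF om] strict[OF om]]])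
   (use path_inverse_nonneg[OF path[OF om]] in auto)
 from continuous_closed_preimage_constant[OF this, of 0] show ?thesis by (simp add: zero_set_def)
qed

lemma mark_in_zero_set:
 assumes om: "om : space M" and dl: "0 <= dl"
 shows "mark dl k om : zero_set om"
 using ret_facts(1,2)[OF om dl] nice_nonneg[OF path[OF om]] path_inverse_value_id[OF path[OF om] strict[OF om]]
 by (simp add: zero_set_def mark_def)

lemma zero_in_zero_set: "om : space M ==> 0 : zero_set om"
 using mark_in_zero_set[of om 0 0] by simp

lemma ret_lower: "om : space M ==> 0 <= dl ==> real k * dl <= ret dl k om"
proof (induction k)
 case (Suc k)
 then show ?case using ret_facts(3)[of om dl k] by (simp add: algebra_simps)
qed simp

lemma ret_unbounded:
 assumes om: "om : space M" and dl: "0 < dl"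
 shows "\<exists>k. s < ret dl k om"
proof -
 obtain k :: nat where "s < real k * dl" using ex_less_of_nat_mult[OF dl] by blast
 then show ?thesis using ret_lower[OF om, of dl k] dl by (intro exI[of _ k]) simp
qed

lemma mark_mono:
 assumes om: "om : space M" and dl: "0 <= dl"
 shows "mono (%k. mark dl k om)"
 unfolding mark_def by (intro monoI nice_mono[OF path[OF om]] ret_facts(1)[OF om dl] monoD[OF ret_mono[OF om dl]])

lemma mark_unbounded:
 assumes om: "om : space M" and dl: "0 < dl"
 shows "unbounded_above (range (%k. mark dl k om))"
 unfolding unbounded_above_def
proof
 fix u
 obtain s where s: "0 <= s" "u < S s om" using nice_unbounded[OF path[OF om]] by blast
 obtain k where "s < ret dl k om" using ret_unbounded[OF om dl] by blast
 then have "S s om <= mark dl k om" unfolding mark_def using s by (intro nice_mono[OF path[OF om]]) auto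
 then show "\<exists>z\<in>range (%k. mark dl k om). u < z" using s by (intro bexI[of _ "mark dl k om"]) auto
qed

lemma zero_set_unbounded: "om : space M ==> unbounded_above (zero_set om)"
 using mark_unbounded[of om 1] mark_in_zero_set[of om 1] by (force simp: unbounded_above_def)

text \<open>With \<open>S\<close> frozen, the passage time of \<open>u\<close> is a fixed positive
  time, at which \<open>X\<close> is almost surely nonzero.\<close>

lemma AE_not_zero:
 assumes u: "0 < u"
 shows "AE om in M. X (path_inverse (%s. S s om) u) om ~= 0"
proof -
 let ?D = dyadic_paths
 define e where "e y = real_of_ereal (INF q\<in>dyadics. if u < y q then ereal q else \<infinity>)" for y :: "real => real"
 have em: "e : borel_measurable ?D"
  unfolding e_def[abs_def]
 proof (intro borel_measurable_real_of_ereal borel_measurable_INF countable_dyadics)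
  fix q assume "q : dyadics"
  then have [measurable]: "(%y. y q) : borel_measurable ?D" by (intro measurable_component_singleton)
  show "(%y. if u < y q then ereal q else \<infinity>) : borel_measurable ?D" by measurable
 qed
 have eS: "e (dyadic_values S om) = path_inverse (%s. S s om) u" if "om : space M" for om
  using path_inverse_dyadic[OF path[OF that], of u] unfolding e_def dyadic_values_def by (simp cong: INF_cong)
 have Epos: "0 < path_inverse (%s. S s om) u" if "om : space M" for om by (rule path_inverse_pos[OF path[OF that] u])
 let ?F = "%z. indicator {0} (extension (fst z) (e (snd z))) :: ennreal"
 have xm: "(%z. extension (fst z) (e (snd z))) : borel_measurable (?D \<Otimes>\<^sub>M ?D)"
  by (intro extension_measurable measurable_fst measurable_compose[OF measurable_snd em])
 have Fm: "?F : borel_measurable (?D \<Otimes>\<^sub>M ?D)" by (rule measurable_compose[OF xm]) simp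
 have FM: "(%om. ?F (dyadic_values X om, dyadic_values S om)) : borel_measurable M"
  by (rule measurable_compose[OF _ Fm]) measurable
 have z: "(\<integral>\<^sup>+om. ?F (dyadic_values X om, dyadic_values S om) \<partial>M) = (\<integral>\<^sup>+y. (\<integral>\<^sup>+x. ?F (dyadic_values X x, dyadic_values S y) \<partial>M) \<partial>M)"
  by (rule independent_integral(2)[OF Fm])
 also have "... = (\<integral>\<^sup>+y. 0 \<partial>M)"
 proof (rule nn_integral_cong)
  fix y assume y: "y : space M"
  have "(\<integral>\<^sup>+x. ?F (dyadic_values X x, dyadic_values S y) \<partial>M) = (\<integral>\<^sup>+x. 0 \<partial>M)"
  proof (rule nn_integral_cong_AE)
   show "AE x in M. ?F (dyadic_values X x, dyadic_values S y) = 0"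
    using X_nonzero[OF Epos[OF y]] AE_space
    by eventually_elim (use Epos[OF y] in \<open>simp add: eS[OF y] extension_X\<close>)
  qed
  then show "(\<integral>\<^sup>+x. ?F (dyadic_values X x, dyadic_values S y) \<partial>M) = 0" by simp
 qed
 finally have "AE om in M. ?F (dyadic_values X om, dyadic_values S om) = 0"
  using nn_integral_0_iff_AE[OF FM] by simp
 then show ?thesis using AE_space
  by eventually_elim (use Epos in \<open>auto simp: eS extension_X less_imp_le split: split_indicator_asm\<close>)
qed

text \<open>If \<open>S\<close> jumped at a zero s of \<open>X\<close>, its inverse would equal s at
  every level inside the jump, in particular at a positive rational. There the time-changed process
  would vanish, which \<open>AE_not_zero\<close> excludes for all positive rationals at
  once.\<close>

lemma AE_no_jump: "AE om in M. \<forall>s>0. X s om = 0 --> left_value (%s. S s om) s = S s om"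
proof -
 have "AE om in M. \<forall>u\<in>\<rat> \<inter> {0<..}. X (path_inverse (%s. S s om) u) om ~= 0"
  using AE_not_zero countable_rat by (intro AE_ball_countable[THEN iffD2]) auto
 then show ?thesis using AE_space
 proof eventually_elim
  case (elim om)
  note n = path[OF elim(2)]
  show ?case
  proof (intro allI impI, rule ccontr)
   fix s assume s: "0 < s" "X s om = 0" "left_value (%s. S s om) s ~= S s om"
   then have "left_value (%s. S s om) s < S s om" using left_value_le_value[OF n s(1)] by simp
   then obtain u where u: "u : \<rat>" "left_value (%s. S s om) s < u" "u < S s om" using Rats_dense_in_real by blast
   have "path_inverse (%s. S s om) u = s" by (rule path_inverse_jump[OF n s(1) u(2,3)])
   moreover have "0 < u" using u(2) left_value_nonneg[OF n s(1)] by simp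
   ultimately show False using elim(1) u(1) s(2) by auto
  qed
 qed
qed

text \<open>Let s be the passage time of z. Without a jump at s one has S s = z, and S is
  left-continuous at s. The last return not after s lies within one step of s, since otherwise the
  next return would also come no later than s. Its mark is therefore close to z.\<close>

lemma marks_dense:
 assumes om: "om : space M" and nj: "\<forall>s>0. X s om = 0 --> left_value (%s. S s om) s = S s om"
  and z: "z : zero_set om" and e: "0 < e"
 shows "\<forall>\<^sub>F n in sequentially. \<exists>k. \<bar>mark (1 / 4 ^ n) k om - z\<bar> < e"
proof -
 note n = path[OF om]
 let ?s = "path_inverse (%s. S s om) z"
 have z0: "0 <= z" "X ?s om = 0" using z by (auto simp: zero_set_def)
 have s0: "0 <= ?s" by (rule path_inverse_nonneg[OF n])
 have Sz: "S ?s om = z"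
 proof (cases "?s = 0")
  case True
  then show ?thesis using path_inverse_value[OF n, of z] nice_zero[OF n] z0 by simp
 next
  case False
  then have "0 < ?s" using s0 by simp
  then show ?thesis using path_inverse_value[OF n, of z] path_inverse_left_value[OF n, of z] nj z0 by fastforce
 qed
 have near: "\<exists>d>0. \<forall>r. 0 <= r --> ?s - d < r --> r <= ?s --> \<bar>S r om - z\<bar> < e"
 proof (cases "?s = 0")
  case True
  have "\<bar>S r om - z\<bar> < e" if "0 <= r" "r <= ?s" for r
  proof -
   have "r = ?s" using that True by simp
   then show ?thesis using Sz e by simp
  qed
  then show ?thesis by (intro exI[of _ 1]) auto
 next
  case False
  then have sp: "0 < ?s" using s0 by simp
  have "((%r. S r om) \<longlongrightarrow> z) (at_left ?s)" using nice_left[OF n sp] nj sp z0 Sz by simp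
  then have "\<forall>\<^sub>F r in at_left ?s. dist (S r om) z < e" using e by (rule tendstoD)
  then obtain b where b: "b < ?s" "!!r. b < r ==> r < ?s ==> dist (S r om) z < e"
   unfolding eventually_at_left_field by blast
  have "\<bar>S r om - z\<bar> < e" if "?s - (?s - b) < r" "r <= ?s" for r
   using b(2)[of r] that Sz e by (cases "r = ?s") (auto simp: dist_real_def)
  then show ?thesis using b(1) by (intro exI[of _ "?s - b"]) auto
 qed
 then obtain d where d: "0 < d" "!!r. 0 <= r ==> ?s - d < r ==> r <= ?s ==> \<bar>S r om - z\<bar> < e" by blast
 have "(%n. 1 / 4 ^ n :: real) ----> 0" by real_asymp
 then have "\<forall>\<^sub>F n in sequentially. 1 / 4 ^ n < d" by (rule order_tendstoD(2)) (rule d)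
 then show ?thesis
 proof eventually_elim
  case (elim m)
  let ?d = "1 / 4 ^ m :: real"
  have dp: "0 < ?d" by simp
  define k where "k = (LEAST k. ?s < ret ?d k om)"
  have k1: "?s < ret ?d k om" unfolding k_def by (rule LeastI_ex[OF ret_unbounded[OF om dp]])
  have "k ~= 0" using k1 s0 by (intro notI) simp
  then obtain j where j: "k = Suc j" using not0_implies_Suc by blast
  have j1: "ret ?d j om <= ?s" using not_less_Least[of j "%k. ?s < ret ?d k om"] j by (simp add: k_def)
  have "?s - ?d < ret ?d j om"
  proof (rule ccontr)
   assume "\<not> ?s - ?d < ret ?d j om"
   then have "ret ?d (Suc j) om <= ?s" using z0(2) by (intro ret_facts(4)[OF om]) auto
   then show False using k1 j by simp
  qed
  then have "\<bar>S (ret ?d j om) om - z\<bar> < e" using elim j1 ret_facts(1)[OF om, of ?d j] by (intro d(2)) auto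
  then show ?case unfolding mark_def by blast
 qed
qed

end

section \<open>The renewal equation in Laplace form\<close>

lemma half_open_partition:
 fixes p :: "nat => real" and g :: "real => ennreal"
 assumes p: "mono p" "p 0 = 0" "unbounded_above (range p)"
 shows "indicator {0<..} t * g t = (\<Sum>k. indicator {p k<..p (Suc k)} t * g t)"
proof (cases "0 < t")
 case True
 obtain m where m: "t <= p m" using p(3) by (auto simp: unbounded_above_def dest: less_imp_le)
 define i where "i = (LEAST m. t <= p m)"
 have i: "t <= p i" unfolding i_def by (rule LeastI[of _ m]) (rule m)
 have "i ~= 0" using i p(2) True by (intro notI) simp
 then obtain j where j: "i = Suc j" using not0_implies_Suc by blast
 have "p j < t" using not_less_Least[of j "%m. t <= p m"] j by (simp add: i_def)
 then have in_j: "t : {p j<..p (Suc j)}" using i j by simp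
 have out: "t \<notin> {p k<..p (Suc k)}" if "k ~= j" for k
 proof (cases "k < j")
  case True
  then have "p (Suc k) <= p j" by (intro monoD[OF p(1)]) simp
  then show ?thesis using \<open>p j < t\<close> by simp
 next
  case False
  then have "p (Suc j) <= p k" using that by (intro monoD[OF p(1)]) simp
  then show ?thesis using in_j by simp
 qed
 have "(\<Sum>k. indicator {p k<..p (Suc k)} t * g t) = (\<Sum>k\<in>{j}. indicator {p k<..p (Suc k)} t * g t)"
  by (rule suminf_finite) (use out in auto)
 also have "... = indicator {p j<..p (Suc j)} t * g t" by (simp only: sum.insert finite.emptyI sum.empty empty_iff not_False_eq_True add_0_right)
 finally have "(\<Sum>k. indicator {p k<..p (Suc k)} t * g t) = indicator {p j<..p (Suc j)} t * g t" .
 also have "... = indicator {0<..} t * g t" using in_j True by (simp only: indicator_simps greaterThan_iff)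
 finally show ?thesis ..
next
 case False
 have "t \<notin> {p k<..p (Suc k)}" for k using monoD[OF p(1), of 0 k] p(2) False by simp
 then show ?thesis using False by simp
qed

lemma geometric_ennreal:
 assumes "0 <= q" "q < 1" "0 <= r"
 shows "(\<Sum>k. ennreal (q ^ k * r)) = ennreal (r / (1 - q))"
proof -
 have "(%k. q ^ k * r) sums (1 / (1 - q) * r)" using assms by (intro sums_mult2 geometric_sums) simp
 then have "(\<Sum>k. ennreal (q ^ k * r)) = ennreal (1 / (1 - q) * r)"
  using assms by (subst suminf_ennreal2) (auto simp: sums_iff)
 then show ?thesis by simp
qed

locale subordinated_test = subordinated M ka X be c S + gap_test h f et B
 for M :: "'a measure" and ka X be c S h f et B
begin

definition step :: "real => nat => 'a => real" where
 "step dl j om = mark dl (Suc j) om - mark dl j om"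

text \<open>The functional with the zero set replaced by the marks of step \<open>dl\<close>. The
  series is finite: once the marks have passed t all increments vanish, and f 0 = 0.\<close>

definition partial :: "real => real => 'a => real" where
 "partial dl t om = (\<Sum>j. f (min t (mark dl (Suc j) om) - min t (mark dl j om)))"

lemma f0 [simp]: "f 0 = 0"
 using f_zero[of 0] eta by simp

lemma partial_eq_sum:
 assumes om: "om : space M" and dl: "0 < dl" and m: "t <= mark dl m om"
 shows "partial dl t om = (\<Sum>j<m. f (min t (mark dl (Suc j) om) - min t (mark dl j om)))"
 unfolding partial_def
proof (rule suminf_finite)
 fix j assume "j \<notin> {..<m}"
 then have "t <= mark dl j om" "t <= mark dl (Suc j) om"
  using monoD[OF mark_mono[OF om, of dl], of m j] monoD[OF mark_mono[OF om, of dl], of m "Suc j"] m dl by auto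
 then show "f (min t (mark dl (Suc j) om) - min t (mark dl j om)) = 0" by simp
qed simp

lemma mark_exceeds: "om : space M ==> 0 < dl ==> \<exists>m. t <= mark dl m om"
 using mark_unbounded[of om dl] by (auto simp: unbounded_above_def dest: less_imp_le)

lemma partial_eq_integral:
 assumes om: "om : space M" and dl: "0 < dl" and t: "0 <= t"
 shows "partial dl t om = (LINT u|lborel. indicator {0..t} u * h (gap (range (%k. mark dl k om)) t u))"
proof -
 obtain m where m: "t <= mark dl m om" using mark_exceeds[OF om dl] by blast
 show ?thesis
  unfolding partial_eq_sum[OF om dl m]
  using cell_sum_eq_integral[OF mark_mono[OF om less_imp_le[OF dl]] mark_0[OF om] mark_unbounded[OF om dl] t, of m] m
  by (simp add: min_absorb1)
qed

lemma partial_cell: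
 assumes om: "om : space M" and dl: "0 < dl" and t: "mark dl k om < t" "t <= mark dl (Suc k) om"
 shows "partial dl t om = (\<Sum>j<k. f (step dl j om)) + f (t - mark dl k om)"
proof -
 have "min t (mark dl j om) = mark dl j om" if "j <= k" for j
  using monoD[OF mark_mono[OF om, of dl], of j k] that t dl by simp
 then have "(\<Sum>j<k. f (min t (mark dl (Suc j) om) - min t (mark dl j om))) = (\<Sum>j<k. f (step dl j om))"
  unfolding step_def by (intro sum.cong refl) simp
 then show ?thesis unfolding partial_eq_sum[OF om dl t(2)] using t by simp
qed

lemma partial_nonneg:
 assumes om: "om : space M" and dl: "0 < dl"
 shows "0 <= partial dl t om"
proof -
 obtain m where m: "t <= mark dl m om" using mark_exceeds[OF om dl] by blast
 show ?thesis unfolding partial_eq_sum[OF om dl m] by (intro sum_nonneg f_nonneg)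
qed

lemma partial_measurable:
 assumes dl: "0 <= dl"
 shows "(%x. partial dl (fst x) (snd x)) : borel_measurable (borel \<Otimes>\<^sub>M M)"
proof -
 have [measurable]: "mark dl k : borel_measurable M" for k by (rule mark_measurable[OF dl])
 show ?thesis unfolding partial_def by measurable
qed

lemma step_sum: "om : space M ==> (\<Sum>j<k. step dl j om) = mark dl k om"
 using sum_lessThan_telescope[of "%j. mark dl j om" k] by (simp add: step_def)

text \<open>Between two consecutive marks the functional is the sum over the complete cycles plus f
  of the age. Writing t as the sum of the complete steps and the age factorises the exponential, and
  integration over the age gives the primitive.\<close>

lemma path_transform:
 assumes om: "om : space M" and dl: "0 < dl" and l: "0 < l"
 shows "(\<integral>\<^sup>+t. indicator {0<..} t * ennreal (exp (- l * t - partial dl t om)) \<partial>lborel) =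
  (\<Sum>k. ennreal ((\<Prod>j<k. exp (- l * step dl j om - f (step dl j om))) * primitive l (step dl k om)))"
proof -
 let ?A = "%t. - l * t - partial dl t om"
 let ?p = "%k. mark dl k om" and ?P = "%k. \<Prod>j<k. exp (- l * step dl j om - f (step dl j om))"
 have pm: "(%t. partial dl t om) : borel_measurable borel"
  unfolding partial_def by measurable
 have "(\<integral>\<^sup>+t. indicator {0<..} t * ennreal (exp (?A t)) \<partial>lborel) =
  (\<integral>\<^sup>+t. (\<Sum>k. indicator {?p k<..?p (Suc k)} t * ennreal (exp (?A t))) \<partial>lborel)"
  by (rule nn_integral_cong, rule half_open_partition[OF mark_mono[OF om less_imp_le[OF dl]] mark_0[OF om] mark_unbounded[OF om dl]])
 also have "... = (\<Sum>k. \<integral>\<^sup>+t. indicator {?p k<..?p (Suc k)} t * ennreal (exp (?A t)) \<partial>lborel)"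
  by (rule nn_integral_suminf) (use pm in measurable)
 also have "... = (\<Sum>k. ennreal (?P k * primitive l (step dl k om)))"
 proof (rule suminf_cong)
  fix k
  let ?k = "%v. indicator {0<..step dl k om} v * ennreal (exp (- l * v - f v))"
  have "(\<integral>\<^sup>+t. indicator {?p k<..?p (Suc k)} t * ennreal (exp (?A t)) \<partial>lborel) =
   (\<integral>\<^sup>+t. ennreal (?P k) * ?k (t - ?p k) \<partial>lborel)"
  proof (rule nn_integral_cong)
   fix t
   show "indicator {?p k<..?p (Suc k)} t * ennreal (exp (?A t)) = ennreal (?P k) * ?k (t - ?p k)"
   proof (cases "t : {?p k<..?p (Suc k)}")
    case True
    have "?P k = exp (- l * ?p k - (\<Sum>j<k. f (step dl j om)))"
     unfolding exp_sum[OF finite_lessThan, symmetric] step_sum[OF om, symmetric]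
     by (simp add: sum_subtractf sum_distrib_left sum_negf)
    then have "exp (?A t) = ?P k * exp (- l * (t - ?p k) - f (t - ?p k))"
     using partial_cell[OF om dl, of k t] True by (simp add: algebra_simps flip: exp_add)
    then show ?thesis using True by (simp add: step_def ennreal_mult' prod_nonneg)
   next
    case False
    then have "t - ?p k \<notin> {0<..step dl k om}" by (simp add: step_def)
    then show ?thesis using False by simp
   qed
  qed
  also have "... = ennreal (?P k) * (\<integral>\<^sup>+t. ?k (t - ?p k) \<partial>lborel)"
   by (rule nn_integral_cmult) measurable
  also have "(\<integral>\<^sup>+t. ?k (t - ?p k) \<partial>lborel) = (\<integral>\<^sup>+v. ?k v \<partial>lborel)"
   by (subst nn_integral_real_affine[where c=1 and t="?p k"]) simp_all
  also have "... = ennreal (primitive l (step dl k om))" by (rule nn_primitive[OF l])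
  finally show "(\<integral>\<^sup>+t. indicator {?p k<..?p (Suc k)} t * ennreal (exp (?A t)) \<partial>lborel) = ennreal (?P k * primitive l (step dl k om))"
   by (simp add: ennreal_mult' prod_nonneg)
 qed
 finally show ?thesis .
qed

text \<open>The ratio of the geometric series of complete cycles; \<open>cycle_prim\<close> is the
  factor of the unfinished one.\<close>

definition cycle_exp :: "real => real => real" where
 "cycle_exp l dl = expectation (%om. exp (- l * mark dl 1 om - f (mark dl 1 om)))"

definition cycle_prim :: "real => real => real" where
 "cycle_prim l dl = expectation (%om. primitive l (mark dl 1 om))"

lemma mark_nonneg: "om : space M ==> 0 <= dl ==> 0 <= mark dl k om"
 using monoD[OF mark_mono, of om dl 0 k] by simp

lemma test_bounds:
 assumes "0 < l" "0 <= x"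
 shows "0 <= exp (- l * x - f x) & exp (- l * x - f x) <= 1"
proof -
 have "0 <= l * x" using assms by simp
 then show ?thesis using f_nonneg[of x] by simp
qed

lemma test_measurable: "(%x. exp (- l * x - f x)) : borel_measurable borel"
 by measurable

lemma cycle_term:
 assumes dl: "dl : dyadics" and l: "0 < l"
 shows "(\<integral>\<^sup>+om. ennreal ((\<Prod>j<k. exp (- l * step dl j om - f (step dl j om))) * primitive l (step dl k om)) \<partial>M) =
  ennreal (cycle_exp l dl ^ k * cycle_prim l dl)"
proof -
 let ?A = "%ph. \<Prod>i<Suc k. \<integral>\<^sup>+om. ennreal (ph i (mark dl 1 om)) \<partial>M"
 let ?B = "%i om. mark dl (Suc i) om - mark dl i om"
 have dl0: "0 <= dl" by (rule dyadics_nonneg[OF dl])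
 let ?e = "%x. exp (- l * x - f x)"
 \<comment> \<open>The factor l brings the last function into [0,1]; it is compensated by 1 / l
   below.\<close>
 define ph where "ph i = (if i < k then ?e else (%x. l * primitive l x))" for i
 note [measurable] = mark_measurable[OF dl0] primitive_measurable[OF l]
 have sm [measurable]: "step dl j : borel_measurable M" for j unfolding step_def[abs_def] by measurable
 have phm: "ph i : borel_measurable borel" for i unfolding ph_def by simp
 have phb: "0 <= ph i x & ph i x <= 1" if "0 <= x" for i x
  using test_bounds[OF l that] primitive_nonneg[of l x] primitive_le[OF l, of x] l by (simp add: ph_def)
 have e1: "(\<integral>\<^sup>+om. ennreal (?e (mark dl 1 om)) \<partial>M) = ennreal (cycle_exp l dl)"
  unfolding cycle_exp_def using test_bounds[OF l mark_nonneg[OF _ dl0]]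
  by (intro nn_integral_eq_integral integrable_const_bound[where B=1] AE_I2) auto
 have e2: "(\<integral>\<^sup>+om. ennreal (l * primitive l (mark dl 1 om)) \<partial>M) = ennreal (l * cycle_prim l dl)"
 proof -
  have "integrable M (%om. l * primitive l (mark dl 1 om))"
   using primitive_nonneg[of l] primitive_le[OF l] l by (intro integrable_const_bound[where B=1] AE_I2) auto
  then show ?thesis
   unfolding cycle_prim_def using primitive_nonneg[of l] l
   by (subst nn_integral_eq_integral) (simp_all add: AE_I2)
 qed
 have "(\<integral>\<^sup>+om. ennreal ((\<Prod>j<k. ?e (step dl j om)) * primitive l (step dl k om)) \<partial>M) =
  (\<integral>\<^sup>+om. ennreal (1 / l) * (\<Prod>i<Suc k. ennreal (ph i (?B i om))) \<partial>M)"
 proof (rule nn_integral_cong)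
  fix om
  have "(\<Prod>i<Suc k. ph i (step dl i om)) = (\<Prod>j<k. ?e (step dl j om)) * (l * primitive l (step dl k om))"
   by (simp add: ph_def)
  then have "(\<Prod>j<k. ?e (step dl j om)) * primitive l (step dl k om) = 1 / l * (\<Prod>i<Suc k. ph i (step dl i om))"
   using l by simp
  moreover have "0 <= ph i (step dl i om)" for i
   using primitive_nonneg[of l] l by (simp add: ph_def)
  ultimately show "ennreal ((\<Prod>j<k. ?e (step dl j om)) * primitive l (step dl k om)) =
   ennreal (1 / l) * (\<Prod>i<Suc k. ennreal (ph i (?B i om)))"
   using l by (simp only: step_def[symmetric] prod_ennreal ennreal_mult' divide_nonneg_nonneg zero_le_one less_imp_le)
 qed
 also have "... = ennreal (1 / l) * ?A ph"
 proof -
  have "(%om. \<Prod>i<Suc k. ennreal (ph i (?B i om))) : borel_measurable M"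
   by (intro borel_measurable_prod_ennreal measurable_compose[OF _ measurable_compose[OF phm measurable_ennreal]]) measurable
  then show ?thesis by (subst nn_integral_cmult) (simp_all only: mark_product[OF dl phm phb])
 qed
 also have "?A ph = ennreal (cycle_exp l dl) ^ k * ennreal (l * cycle_prim l dl)"
  using e1 e2 by (simp add: ph_def)
 also have "ennreal (1 / l) * (ennreal (cycle_exp l dl) ^ k * ennreal (l * cycle_prim l dl)) = ennreal (cycle_exp l dl ^ k * cycle_prim l dl)"
 proof -
  have "0 <= cycle_exp l dl" "0 <= cycle_prim l dl"
   unfolding cycle_exp_def cycle_prim_def using primitive_nonneg[of l] by (auto intro!: integral_nonneg_AE)
  then show ?thesis using l by (simp add: ennreal_power flip: ennreal_mult)
 qed
 finally show ?thesis .
qed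

definition approx :: "real => real => real" where
 "approx dl t = expectation (%om. exp (- partial dl t om))"

lemma partial_at_measurable [measurable]: "0 <= dl ==> partial dl t : borel_measurable M"
 using measurable_compose[OF measurable_Pair1'[of t borel M] partial_measurable[of dl]] by simp

lemma approx_measurable:
 assumes dl: "0 <= dl"
 shows "approx dl : borel_measurable borel"
 unfolding approx_def[abs_def]
 by (rule borel_measurable_lebesgue_integral) (use partial_measurable[OF dl] in \<open>simp add: split_beta'\<close>)

lemma approx_bounds: "0 < dl ==> 0 <= approx dl t & approx dl t <= 1"
 unfolding approx_def using partial_nonneg[of _ dl t]
 by (auto intro!: integral_nonneg_AE integral_le_const AE_I2 integrable_const_bound[where B=1])

text \<open>The sum over the number of complete cycles before t is a geometric series.\<close>

lemma approx_transform:
 assumes dl: "dl : dyadics" "0 < dl" and l: "0 < l" and q: "cycle_exp l dl < 1"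
 shows "(\<integral>\<^sup>+t. ennreal (indicator {0<..} t * exp (- l * t) * approx dl t) \<partial>lborel) = ennreal (cycle_prim l dl / (1 - cycle_exp l dl))"
proof -
 let ?A = "%t. \<integral>\<^sup>+om. indicator {0<..} t * ennreal (exp (- l * t - partial dl t om)) \<partial>M"
 let ?B = "%k om. (\<Prod>j<k. exp (- l * step dl j om - f (step dl j om))) * primitive l (step dl k om)"
 let ?C = "%t. \<integral>\<^sup>+om. ennreal (exp (- partial dl t om)) \<partial>M"
 let ?D = "%t. indicator {0<..} t * exp (- l * t) * approx dl t"
 have dl0: "0 <= dl" using dl by simp
 interpret P: pair_sigma_finite lborel M ..
 note pm [measurable] = partial_measurable[OF dl0]
 have mm: "(%x. indicator {0<..} (fst x) * ennreal (exp (- l * fst x - partial dl (fst x) (snd x)))) : borel_measurable (lborel \<Otimes>\<^sub>M M)"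
  using pm by (simp add: measurable_cong_sets[OF sets_pair_measure_cong[OF sets_lborel refl] refl]) measurable
 have tm: "(%om. ennreal (?B k om)) : borel_measurable M" for k
  unfolding step_def using mark_measurable[OF dl0] primitive_measurable[OF l] by measurable
 have "(\<integral>\<^sup>+t. ennreal (?D t) \<partial>lborel) =
  (\<integral>\<^sup>+t. ?A t \<partial>lborel)"
 proof (rule nn_integral_cong)
  fix t :: real
  have "?A t =
   (\<integral>\<^sup>+om. ennreal (indicator {0<..} t * exp (- l * t)) * ennreal (exp (- partial dl t om)) \<partial>M)"
   by (intro nn_integral_cong) (simp add: exp_diff exp_minus divide_inverse indicator_def flip: ennreal_mult)
  also have "... = ennreal (indicator {0<..} t * exp (- l * t)) * ?C t"
   using dl0 by (intro nn_integral_cmult) measurable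
  also have "?C t = ennreal (approx dl t)"
   unfolding approx_def using partial_nonneg[OF _ dl(2)] dl0
   by (intro nn_integral_eq_integral integrable_const_bound[where B=1] AE_I2) auto
  finally show "ennreal (?D t) = ?A t"
   by (simp add: ennreal_mult')
 qed
 also have "... = (\<integral>\<^sup>+om. (\<integral>\<^sup>+t. indicator {0<..} t * ennreal (exp (- l * t - partial dl t om)) \<partial>lborel) \<partial>M)"
  by (rule P.Fubini'[symmetric]) (use mm in \<open>simp add: split_beta'\<close>)
 also have "... = (\<integral>\<^sup>+om. (\<Sum>k. ennreal (?B k om)) \<partial>M)"
  by (intro nn_integral_cong path_transform dl l)
 also have "... = (\<Sum>k. ennreal (cycle_exp l dl ^ k * cycle_prim l dl))"
  by (subst nn_integral_suminf[OF tm]) (simp only: cycle_term[OF dl(1) l])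
 also have "... = ennreal (cycle_prim l dl / (1 - cycle_exp l dl))"
  using q primitive_nonneg[of l] by (intro geometric_ennreal) (auto simp: cycle_exp_def cycle_prim_def intro!: integral_nonneg_AE)
 finally show ?thesis .
qed

lemma dyadic_step: "1 / 4 ^ n : dyadics"
 using dyadicI[of 1 "2 * n"] by (simp add: power_mult)

text \<open>Both limits come from \<open>vague_limit\<close> for the rescaled laws of the first
  mark, with index be / 2. They share the constant C, which drops out of the quotient in the renewal
  equation.\<close>

lemma cycle_limits:
 assumes l: "0 < l"
 defines "C \<equiv> ka * sqrt c * (LINT x|gauss 1. \<bar>x\<bar>) / levy_const (be / 2)"
 shows "0 < C"
  and "(%n. 2 ^ n * (1 - cycle_exp l (1 / 4 ^ n))) ----> C * jump_rate (be / 2) l"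
  and "(%n. 2 ^ n * cycle_prim l (1 / 4 ^ n)) ----> C * (age_rate (be / 2) l / (be / 2))"
proof -
 let ?A = "%x. (1 - exp (- l * x - f x)) / (1 - exp (- x))"
 let ?D = "ka * sqrt c * (LINT x|gauss 1. \<bar>x\<bar>)"
 have be: "0 < be / 2" "be / 2 < 1" using index by auto
 have D: "0 < ?D" using exponent_pos scale abs_moment(2) by (intro mult_pos_pos) auto
 then show "0 < C" unfolding C_def using levy_const_pos[OF be] by simp
 define nu where "nu n = distr M borel (mark (1 / 4 ^ n) 1)" for n :: nat
 have mm: "mark (1 / 4 ^ n) 1 : borel_measurable M" for n :: nat by (rule mark_measurable) simp
 have mn: "0 <= mark (1 / 4 ^ n) k om" if "om : space M" for n k :: nat and om by (rule mark_nonneg[OF that]) simp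
 have nu: "finite_measure (nu n)" "sets (nu n) = sets borel" "AE x in nu n. 0 <= x" for n
 proof -
  interpret nu: prob_space "nu n" unfolding nu_def by (rule prob_space_distr[OF mm])
  show "finite_measure (nu n)" by (rule nu.finite_measure_axioms)
  show "sets (nu n) = sets borel" by (simp add: nu_def)
  show "AE x in nu n. 0 <= x" unfolding nu_def by (subst AE_distr_iff[OF mm]) (auto intro!: AE_I2 mn)
 qed
 have nui: "(LINT x|nu n. H x) = expectation (%om. H (mark (1 / 4 ^ n) 1 om))" if "H : borel_measurable borel" for H :: "real => real" and n
  unfolding nu_def by (rule integral_distr[OF mm that])
 have int: "integrable M (%om. g (mark (1 / 4 ^ n) 1 om))"
  if "g : borel_measurable borel" "!!x. 0 <= x ==> 0 <= g x & g x <= 1" for g :: "real => real" and n :: nat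
  using that(2)[OF mn] measurable_compose[OF mm that(1)] by (intro integrable_const_bound[where B=1] AE_I2) auto
 have lim: "(%n. 2 ^ n * (LINT x|nu n. 1 - exp (- real k * x))) ----> ?D * real k powr (be / 2)" for k :: nat
 proof -
  have "(LINT x|nu n. 1 - exp (- real k * x)) = 1 - expectation (%om. exp (- real k * mark (1 / 4 ^ n) 1 om))" for n
   using int[of "%x. exp (- real k * x)" n] by (subst nui) (simp_all add: prob_space)
  then show ?thesis using mark_rate_limit[of "real k"] by simp
 qed
 note VL = vague_limit[OF be nu, where a="%n. 2 ^ n" and C="?D", OF _ D lim]
 have "(%n. 2 ^ n * (LINT x|nu n. 1 - exp (- l * x - f x))) ----> ?D / levy_const (be / 2) * (\<integral>x. 1 - exp (- l * x - f x) \<partial>levy (be / 2))"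
 proof (rule VL)
  show "continuous_on {0<..} (%x. 1 - exp (- l * x - f x))"
   using f_cont by (intro continuous_intros continuous_on_subset[OF f_cont]) auto
  show "(?A \<longlongrightarrow> l) (at_right 0)"
   by (rule ratio_limits(1)[OF l eta f_zero f_nonneg])
  show "(?A \<longlongrightarrow> 1) at_top"
   by (rule ratio_limits(2)[OF l eta f_zero f_nonneg])
 qed auto
 moreover have "(LINT x|nu n. 1 - exp (- l * x - f x)) = 1 - cycle_exp l (1 / 4 ^ n)" for n
  unfolding cycle_exp_def using int[OF test_measurable test_bounds[OF l], of n] by (subst nui) (simp_all add: prob_space)
 ultimately show "(%n. 2 ^ n * (1 - cycle_exp l (1 / 4 ^ n))) ----> C * jump_rate (be / 2) l"
  by (simp add: C_def jump_rate_def)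
 have "(%n. 2 ^ n * (LINT x|nu n. primitive l x)) ----> ?D / levy_const (be / 2) * (\<integral>x. primitive l x \<partial>levy (be / 2))"
  by (rule VL[OF _ primitive_measurable[OF l] continuous_on_subset[OF primitive_cont[OF l]] _ primitive_ratio[OF l]]) (auto simp: primitive_zero)
 moreover have "(LINT x|nu n. primitive l x) = cycle_prim l (1 / 4 ^ n)" for n
  unfolding cycle_prim_def by (rule nui[OF primitive_measurable[OF l]])
 ultimately show "(%n. 2 ^ n * cycle_prim l (1 / 4 ^ n)) ----> C * (age_rate (be / 2) l / (be / 2))"
  by (simp add: C_def integral_primitive[OF be l])
qed

lemma approx_transform_limit:
 assumes l: "0 < l"
 shows "(%n. \<integral>\<^sup>+t. ennreal (indicator {0<..} t * exp (- l * t) * approx (1 / 4 ^ n) t) \<partial>lborel) ---->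
  ennreal (age_rate (be / 2) l / (be / 2 * jump_rate (be / 2) l))"
proof -
 let ?A = "age_rate (be / 2) l / (be / 2)"
 let ?B = "be / 2 * jump_rate (be / 2) l"
 let ?C = "%n. cycle_prim l (1 / 4 ^ n) / (1 - cycle_exp l (1 / 4 ^ n))"
 have be: "0 < be / 2" "be / 2 < 1" using index by auto
 note jp = jump_rate_pos[OF be l]
 obtain C where C: "0 < C" "(%n. 2 ^ n * (1 - cycle_exp l (1 / 4 ^ n))) ----> C * jump_rate (be / 2) l"
  "(%n. 2 ^ n * cycle_prim l (1 / 4 ^ n)) ----> C * ?A"
  using cycle_limits[OF l] by blast
 have "(%n. (2 ^ n * cycle_prim l (1 / 4 ^ n)) / (2 ^ n * (1 - cycle_exp l (1 / 4 ^ n)))) ----> (C * ?A) / (C * jump_rate (be / 2) l)"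
  using C(1) jp by (intro tendsto_divide C(2,3)) simp
 then have "(%n. cycle_prim l (1 / 4 ^ n) / (1 - cycle_exp l (1 / 4 ^ n))) ----> age_rate (be / 2) l / ?B"
  using C(1) by simp
 then have L: "(%n. ennreal (?C n)) ----> ennreal (age_rate (be / 2) l / ?B)"
  by (rule tendsto_ennrealI)
 have "\<forall>\<^sub>F n in sequentially. 0 < 2 ^ n * (1 - cycle_exp l (1 / 4 ^ n))"
  using C(1) jp by (intro order_tendstoD(1)[OF C(2)]) simp
 then have "\<forall>\<^sub>F n in sequentially. ennreal (?C n) =
  (\<integral>\<^sup>+t. ennreal (indicator {0<..} t * exp (- l * t) * approx (1 / 4 ^ n) t) \<partial>lborel)"
 proof eventually_elim
  case (elim n)
  then have "cycle_exp l (1 / 4 ^ n) < 1" by (simp add: zero_less_mult_iff)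
  then show ?case using approx_transform[OF dyadic_step _ l, of n] by simp
 qed
 then show ?thesis using L by (rule Lim_transform_eventually[rotated])
qed

definition gap_functional :: "real => 'a => real" where
 "gap_functional t om = (LINT u|lborel. indicator {0..t} u * h (gap (zero_set om) t u))"

lemma gap_functional_components:
 "om : space M ==> gap_functional t om = family_sum et f (measure lborel) (components ({0..t} - zero_set om))"
 unfolding gap_functional_def family_sum_def
 by (rule gap_integral_eq_components[OF zero_set_closed zero_in_zero_set zero_set_unbounded])

lemma gap_functional_nonneg: "0 <= gap_functional t om"
 unfolding gap_functional_def using h_bound by (intro integral_nonneg_AE) auto

text \<open>One null set serves all times together, as continuity in t of the limiting transform
  requires.\<close>

lemma partial_tendsto:
 "AE om in M. \<forall>t\<ge>0. (%n. partial (1 / 4 ^ n) t om) ----> gap_functional t om"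
 using AE_no_jump AE_space
proof eventually_elim
 case (elim om)
 note om = elim(2)
 show ?case
 proof (intro allI impI)
  fix t :: real assume t: "0 <= t"
  have "(%n. \<integral>u. indicator {0..t} u * h (gap (range (%k. mark (1 / 4 ^ n) k om)) t u) \<partial>lborel) ----> gap_functional t om"
   unfolding gap_functional_def
   by (rule gap_integral_limit) (use mark_mono[OF om] mark_0[OF om] mark_unbounded[OF om] mark_in_zero_set[OF om] marks_dense[OF om elim(1)] in auto)
  then show "(%n. partial (1 / 4 ^ n) t om) ----> gap_functional t om"
   using partial_eq_integral[OF om _ t] by simp
 qed
qed

end

lemma completion_AE_eq:
 assumes f: "f : completion M \<rightarrow>\<^sub>M K" and ae: "AE x in M. f x = g x" and g: "!!x. x : space M ==> g x : space K"
 shows "g : completion M \<rightarrow>\<^sub>M K" "distr (completion M) K g = distr (completion M) K f"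
proof -
 have ae': "AE x in completion M. f x = g x" using ae by (rule AE_completion)
 show gm: "g : completion M \<rightarrow>\<^sub>M K"
 proof (rule measurableI)
  show "g x : space K" if "x : space (completion M)" for x using g that by simp
  fix A assume A: "A : sets K"
  show "g -` A \<inter> space (completion M) : sets (completion M)"
  proof (rule completion.in_sets_AE[OF _ measurable_sets[OF f A]])
   show "AE x in completion M. (x : f -` A \<inter> space (completion M)) = (x : g -` A \<inter> space (completion M))"
    using ae' by eventually_elim simp
  qed simp
 qed
 show "distr (completion M) K g = distr (completion M) K f"
 proof (rule distr_cong_AE[OF refl refl _ gm f])
  show "AE x in completion M. g x = f x" using ae' by eventually_elim simp
 qed
qed

context subordinated_test
begin

text \<open>The gap functional is known to be measurable only for the completion; this limit is a
  version measurable for \<open>M\<close>.\<close>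

definition limit_version :: "real => 'a => real" where
 "limit_version t om = lim (%n. partial (1 / 4 ^ n) t om)"

lemma limit_version_measurable [measurable]: "limit_version t : borel_measurable M"
 unfolding limit_version_def[abs_def] by (intro borel_measurable_lim_metric partial_at_measurable) simp

lemma limit_version_eq: "AE om in M. \<forall>t\<ge>0. limit_version t om = gap_functional t om"
 using partial_tendsto by eventually_elim (simp add: limit_version_def limI)

lemma gap_functional_measurable:
 assumes t: "0 <= t"
 shows "gap_functional t : borel_measurable (completion M)"
proof (rule completion_AE_eq(1)[OF measurable_completion[OF limit_version_measurable]])
 show "AE om in M. limit_version t om = gap_functional t om"
  using limit_version_eq by eventually_elim (use t in simp)
qed simp

text \<open>The maximum with 0 keeps the integrand at most 1 also on the null set where the limit is
  not the gap functional.\<close>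

definition gap_laplace :: "real => real" where
 "gap_laplace t = indicator {0<..} t * expectation (%om. exp (- max 0 (limit_version t om)))"

lemma max_version_eq: "AE om in M. \<forall>t\<ge>0. max 0 (limit_version t om) = gap_functional t om"
 using limit_version_eq by eventually_elim (simp add: gap_functional_nonneg max_absorb2)

lemma gap_laplace_eq:
 assumes t: "0 < t"
 shows "gap_laplace t = (LINT om|completion M. exp (- gap_functional t om))"
proof -
 have "gap_laplace t = (LINT om|completion M. exp (- max 0 (limit_version t om)))"
  using t by (subst integral_completion) (simp_all add: gap_laplace_def)
 also have "... = (LINT om|completion M. exp (- gap_functional t om))"
 proof (rule integral_cong_AE)
  show "AE om in completion M. exp (- max 0 (limit_version t om)) = exp (- gap_functional t om)"
   by (rule AE_completion) (use max_version_eq in \<open>eventually_elim, use t in simp\<close>)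
  show "(%om. exp (- max 0 (limit_version t om))) : borel_measurable (completion M)"
   by (rule measurable_completion) measurable
  show "(%om. exp (- gap_functional t om)) : borel_measurable (completion M)"
   using gap_functional_measurable[OF less_imp_le[OF t]] by measurable
 qed
 finally show ?thesis .
qed

lemma gap_laplace_bounds: "0 <= gap_laplace t & gap_laplace t <= 1"
proof -
 let ?A = "%om. exp (- max 0 (limit_version t om))"
 have "0 <= expectation ?A" by (intro integral_nonneg_AE) simp
 moreover have "expectation ?A <= 1"
  by (intro integral_le_const integrable_const_bound[where B=1]) auto
 ultimately show ?thesis by (simp add: gap_laplace_def indicator_def)
qed

lemma gap_laplace_continuous: "continuous_on {0<..} gap_laplace"
 unfolding continuous_on_sequentially
proof (intro ballI allI impI)
 fix s :: "nat => real" and t assume t: "t : {0<..}" and s: "(\<forall>n. s n : {0<..}) & s ----> t"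
 have "(%n. expectation (%om. exp (- max 0 (limit_version (s n) om)))) ----> expectation (%om. exp (- max 0 (limit_version t om)))"
 proof (rule integral_dominated_convergence[where w="%_. 1"])
  show "AE om in M. (%n. exp (- max 0 (limit_version (s n) om))) ----> exp (- max 0 (limit_version t om))"
   using max_version_eq AE_space
  proof eventually_elim
   case (elim om)
   have "0 <= s n" for n using s by (simp add: less_imp_le)
   moreover from this have "(%n. gap_functional (s n) om) ----> gap_functional t om"
    unfolding gap_functional_def using s by (intro gap_integral_tendsto_time zero_set_unbounded[OF elim(2)]) auto
   ultimately show ?case using elim(1) t by (auto intro!: tendsto_intros)
  qed
 qed auto
 then show "(gap_laplace \<circ> s) ----> gap_laplace t" using s t by (simp add: comp_def gap_laplace_def)
qed

lemma gap_laplace_measurable: "gap_laplace : borel_measurable borel"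
proof -
 let ?A = "%x. indicator {0<..} x *\<^sub>R gap_laplace x"
 have "?A : borel_measurable borel"
  by (rule borel_measurable_continuous_on_indicator[OF _ gap_laplace_continuous]) simp
 moreover have "?A = gap_laplace"
  by (auto simp: gap_laplace_def fun_eq_iff indicator_def)
 ultimately show ?thesis by simp
qed

lemma approx_tendsto:
 assumes t: "0 < t"
 shows "(%n. approx (1 / 4 ^ n) t) ----> gap_laplace t"
proof -
 have "(%n. expectation (%om. exp (- partial (1 / 4 ^ n) t om))) ----> expectation (%om. exp (- max 0 (limit_version t om)))"
 proof (rule integral_dominated_convergence[where w="%_. 1"])
  show "AE om in M. (%n. exp (- partial (1 / 4 ^ n) t om)) ----> exp (- max 0 (limit_version t om))"
   using partial_tendsto max_version_eq by eventually_elim (use t in \<open>auto intro!: tendsto_intros\<close>)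
  show "AE om in M. norm (exp (- partial (1 / 4 ^ n) t om)) <= 1" for n
   using partial_nonneg[of _ "1 / 4 ^ n" t] by (intro AE_I2) simp
 qed (auto intro!: borel_measurable_exp borel_measurable_uminus partial_at_measurable)
 then show ?thesis using t by (simp add: approx_def gap_laplace_def)
qed

lemma gap_laplace_transform:
 assumes l: "0 < l"
 shows "(\<integral>\<^sup>+t. ennreal (indicator {0<..} t * exp (- l * t) * gap_laplace t) \<partial>lborel) =
  ennreal (age_rate (be / 2) l / (be / 2 * jump_rate (be / 2) l))"
proof (rule LIMSEQ_unique[OF _ approx_transform_limit[OF l]])
 let ?A = "%t n. indicator {0<..} t * exp (- l * t) * approx (1 / 4 ^ n) t"
 let ?B = "%t. indicator {0<..} t * exp (- l * t) * gap_laplace t"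
 let ?C = "%t. indicator {0<..} t * exp (- l * t)"
 have am: "approx (1 / 4 ^ n) : borel_measurable borel" for n :: nat by (rule approx_measurable) simp
 show "(%n. \<integral>\<^sup>+t. ennreal (?A t n) \<partial>lborel) ---->
  (\<integral>\<^sup>+t. ennreal (?B t) \<partial>lborel)"
 proof (rule nn_integral_dominated_convergence[where w="%t. ennreal (?C t)"])
  show "AE t in lborel. ennreal (?A t n) <= ennreal (?C t)" for n
   using approx_bounds[of "1 / 4 ^ n"] by (intro AE_I2 ennreal_leI) (simp add: mult_left_le)
  show "(\<integral>\<^sup>+t. ennreal (?C t) \<partial>lborel) < \<infinity>"
   unfolding nn_exp_half_line[OF l] by simp
  show "AE t in lborel. (%n. ennreal (?A t n)) ----> ennreal (?B t)"
  proof (rule AE_I2)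
   fix t :: real
   show "(%n. ennreal (?A t n)) ----> ennreal (?B t)"
    by (cases "0 < t") (auto intro!: tendsto_ennrealI tendsto_intros approx_tendsto)
  qed
 qed (use am gap_laplace_measurable in measurable)
qed

text \<open>Both sides have the same Laplace transform in t, formed from the rates of index be / 2,
  and both are bounded and continuous.\<close>

lemma gap_laplace_eq_PD:
 assumes "nice_stable N (be / 2) c' sg" and t: "0 < t"
 shows "gap_laplace t = stable_test.PD_laplace N sg f t"
proof -
 interpret N: nice_stable N "be / 2" c' sg by fact
 interpret T: stable_test N "be / 2" c' sg h f et B ..
 show ?thesis
  by (rule laplace_time_unique[OF gap_laplace_measurable T.PD_laplace_measurable gap_laplace_bounds T.PD_laplace_bounds
   gap_laplace_continuous T.PD_laplace_continuous _ t]) (simp only: gap_laplace_transform T.PD_laplace_transform)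
qed

end

section \<open>Infinitely many intervals and equality of the ranked laws\<close>

text \<open>Choose a point in each of finitely many intervals. Below all chosen points there is a
  positive zero z, and below z a positive point outside \<open>Z\<close>. The component of that
  point cannot cross z, so its chosen point cannot lie beyond z.\<close>

lemma infinite_components:
 assumes Z: "closed Z" "0 : Z" "unbounded_above Z" and t: "0 < t"
  and zeros: "!!e. 0 < e ==> \<exists>z\<in>Z. 0 < z & z < e" and holes: "!!e. 0 < e ==> \<exists>u. 0 < u & u < e & u \<notin> Z"
 shows "infinite {C : components ({0..t} - Z). 0 < measure lborel C}" (is "infinite ?F")
proof
 assume fin: "finite ?F"
 have "\<exists>x. x : C" if "C : ?F" for C using that by (metis (no_types, lifting) all_not_in_conv in_components_nonempty mem_Collect_eq)
 then obtain x where x: "!!C. C : ?F ==> x C : C" by metis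
 have sub: "C \<subseteq> {0..t} - Z" if "C : ?F" for C using that in_components_subset by blast
 define m where "m = Min (insert t (x ` ?F))"
 have m: "0 < m" "m <= t" "!!C. C : ?F ==> m <= x C"
 proof -
  have "0 < x C" if "C : ?F" for C
  proof -
   have "x C : {0..t} - Z" using sub[OF that] x[OF that] by (rule subsetD)
   then show ?thesis using Z(2) by (cases "x C = 0") auto
  qed
  then show "0 < m" unfolding m_def using fin t by (subst Min_gr_iff) auto
 qed (use fin in \<open>auto simp: m_def\<close>)
 obtain z where z: "z : Z" "0 < z" "z < m" using zeros[OF m(1)] by blast
 obtain u where u: "0 < u" "u < z" "u \<notin> Z" using holes[OF z(2)] by blast
 let ?C = "connected_component_set ({0..t} - Z) u"
 have u': "u : {0..t} - Z" using u z m(2) by auto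
 note C = connected_component_gap[OF Z u']
 have "0 < measure lborel ?C" unfolding C(1,2) using C(3) by (auto simp: gap_def)
 then have F: "?C : ?F" using u' by (simp add: componentsI)
 have c: "connected ?C" "u : ?C" using u' by (auto simp: connected_component_refl)
 have "z <= x ?C" using m(3)[OF F] z(3) by linarith
 from connectedD_interval[OF c x[OF F] less_imp_le[OF u(2)] this] show False using sub[OF F] z(1) by blast
qed

context subordinated
begin

text \<open>By \<open>mark_rate_limit\<close> the expectation of 1 - exp (- first mark) is of order
  1 / 2 ^ n. Hence its infimum over n has expectation 0, and arbitrarily small first marks exist
  almost surely.\<close>

lemma AE_zeros_accumulate: "AE om in M. \<forall>e>0. \<exists>z\<in>zero_set om. 0 < z & z < e"
proof -
 let ?A = "%n. %om. exp (- mark (1 / 4 ^ n) 1 om)"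
 let ?g = "%n om. ennreal (1 - exp (- mark (1 / 4 ^ n) 1 om))"
 have d: "1 / 4 ^ n : dyadics" for n :: nat using dyadicI[of 1 "2 * n"] by (simp add: power_mult)
 have mk: "0 < mark (1 / 4 ^ n) 1 om" if "om : space M" for n om
 proof -
  have p: "(0::real) < 1 / 4 ^ n" by simp
  have "0 < ret (1 / 4 ^ n) 1 om"
   using ret_facts(3)[OF that less_imp_le[OF p], of 0] ret_facts(1)[OF that less_imp_le[OF p], of 0] p unfolding One_nat_def by linarith
  then show ?thesis using strict[OF that order_refl, of "ret (1 / 4 ^ n) 1 om"] nice_zero[OF path[OF that]] by (simp only: mark_def)
 qed
 have mm [measurable]: "mark (1 / 4 ^ n) 1 : borel_measurable M" for n by (rule mark_measurable) simp
 have int: "integrable M (?A n)" for n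
  by (rule integrable_const_bound[where B=1, OF AE_I2 measurable_compose[OF borel_measurable_uminus[OF mm] borel_measurable_exp]])
    (use mk in \<open>simp add: less_imp_le\<close>)
 define a where "a n = 1 - expectation (?A n)" for n
 have g: "(\<integral>\<^sup>+om. ?g n om \<partial>M) = ennreal (a n)" for n
  using int[of n] mk by (subst nn_integral_eq_integral) (auto simp: a_def prob_space less_imp_le)
 have "a ----> 0"
 proof -
  have h: "(%n. (1 / 2) ^ n) ----> (0::real)" by (rule LIMSEQ_realpow_zero) auto
  have "(%n. (2 ^ n * a n) * (1 / 2) ^ n) ----> 0"
   using tendsto_mult[OF mark_rate_limit[of 1] h] by (simp add: a_def)
  then show ?thesis by (simp add: power_one_over)
 qed
 have "(\<integral>\<^sup>+om. (INF n. ?g n om) \<partial>M) <= ennreal (a n)" for n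
  unfolding g[symmetric] by (intro nn_integral_mono INF_lower) simp
 then have "(\<integral>\<^sup>+om. (INF n. ?g n om) \<partial>M) <= 0"
  using tendsto_ennrealI[OF \<open>a ----> 0\<close>] by (intro LIMSEQ_le_const[of "%n. ennreal (a n)"]) auto
 moreover have "(%om. INF n. ?g n om) : borel_measurable M"
  by (intro borel_measurable_INF measurable_compose[OF _ measurable_ennreal] borel_measurable_diff measurable_compose[OF _ borel_measurable_exp] borel_measurable_uminus mm) auto
 ultimately have "AE om in M. (INF n. ?g n om) = 0" by (simp only: nn_integral_0_iff_AE le_zero_eq)
 then show ?thesis using AE_space
 proof eventually_elim
  case (elim om)
  show ?case
  proof (intro allI impI)
   fix e :: real assume "0 < e"
   then have "(INF n. ?g n om) < ennreal (1 - exp (- e))" using elim(1) by simp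
   then obtain n where "?g n om < ennreal (1 - exp (- e))" by (auto simp: INF_less_iff)
   then have "mark (1 / 4 ^ n) 1 om < e" using mk[OF elim(2), of n] by (simp add: ennreal_less_iff)
   then show "\<exists>z\<in>zero_set om. 0 < z & z < e" using mk[OF elim(2), of n] mark_in_zero_set[OF elim(2), of "1 / 4 ^ n" 1] by auto
  qed
 qed
qed

text \<open>Positive rationals are almost surely outside the zero set, so there are holes
  arbitrarily near 0; the accumulating zeros separate them into infinitely many intervals.\<close>

lemma ranked_lengths_pos:
 assumes t: "0 < t"
 shows "AE om in M. \<forall>n. 0 < ranked (measure lborel) (components ({0..t} - zero_set om)) n"
proof -
 have "AE om in M. \<forall>u\<in>\<rat> \<inter> {0<..}. X (path_inverse (%s. S s om) u) om ~= 0"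
  using AE_not_zero countable_rat by (intro AE_ball_countable[THEN iffD2]) auto
 then show ?thesis using AE_zeros_accumulate AE_space
 proof eventually_elim
  case (elim om)
  note Z = zero_set_closed[OF elim(3)] zero_in_zero_set[OF elim(3)] zero_set_unbounded[OF elim(3)]
  have "\<exists>u. 0 < u & u < e & u \<notin> zero_set om" if e: "0 < e" for e
   using Rats_dense_in_real[OF e] elim(1) by (force simp: zero_set_def)
  then show ?case using elim(2) by (intro allI ranked_pos finite_large_components infinite_components Z t) auto
 qed
qed

text \<open>The families are compared at scale t, component lengths against jumps multiplied by t /
  sg 1, because that is where the functionals agree. The common division by t comes last.\<close>

lemma ranked_lengths_law:
 assumes N: "nice_stable N (be / 2) c' sg" and t: "0 < t"
 defines "V \<equiv> %om n. ranked (measure lborel) (components ({0..t} - zero_set om)) n / t"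
  and "W \<equiv> %om n. ranked (%s. sg s om - left_value (%s. sg s om) s) {0<..1} n / sg 1 om"
 shows "V : completion M \<rightarrow>\<^sub>M (\<Pi>\<^sub>M n\<in>UNIV. borel)" "W : N \<rightarrow>\<^sub>M (\<Pi>\<^sub>M n\<in>UNIV. borel)"
  and "distr (completion M) (\<Pi>\<^sub>M n\<in>UNIV. borel) V = distr N (\<Pi>\<^sub>M n\<in>UNIV. borel) W"
proof -
 let ?P = "\<Pi>\<^sub>M n\<in>(UNIV::nat set). borel :: real measure"
 interpret N: nice_stable N "be / 2" c' sg by fact
 interpret C: prob_space "completion M" by (rule prob_space_completion)
 let ?I = "%om. components ({0..t} - zero_set om)" and ?J = "%om s. sg s om - left_value (%s. sg s om) s"
 let ?len = "%om s. t / sg 1 om * ?J om s"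
 have s1: "0 < sg 1 om" if "om : space N" for om
  using N.strict[OF that, of 0 1] nice_zero[OF N.path[OF that]] by simp
 have fin: "finite {C\<in>?I om. x < measure lborel C}" if "om : space (completion M)" "0 < x" for om x
  using that by (intro finite_large_components zero_set_closed zero_in_zero_set zero_set_unbounded) auto
 have finJ: "finite {s\<in>{0<..1}. x < ?J om s}" if "om : space N" "0 < x" for om x
  using finite_large_jumps[OF N.path[OF that(1)] that(2)] .
 have fin': "finite {s\<in>{0<..1}. x < ?len om s}" if "om : space N" "0 < x" for om x
 proof -
  have "x < ?len om s \<longleftrightarrow> x * sg 1 om / t < ?J om s" for s
   using s1[OF that(1)] t by (simp add: field_simps)
  then show ?thesis using finJ[OF that(1), of "x * sg 1 om / t"] s1[OF that(1)] t that(2) by simp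
 qed
 have meas: "(%om. family_sum et f (measure lborel) (?I om)) : borel_measurable (completion M)" if "gap_test h f et B" for h f et B
 proof -
  interpret gap_test h f et B by fact
  interpret T: subordinated_test M ka X be c S h f et B ..
  show ?thesis using T.gap_functional_measurable[of t] t
   by (subst measurable_cong[where g="T.gap_functional t"]) (auto simp: T.gap_functional_components)
 qed
 have meas': "(%om. family_sum et f (?len om) {0<..1}) : borel_measurable N" if "gap_test h f et B" for h f et B
 proof -
  interpret gap_test h f et B by fact
  interpret T: stable_test N "be / 2" c' sg h f et B ..
  show ?thesis using T.jump_functional_scaled_measurable[OF t] by (simp add: T.jump_functional_def)
 qed
 have eq: "(LINT om|completion M. exp (- family_sum et f (measure lborel) (?I om))) = (LINT om|N. exp (- family_sum et f (?len om) {0<..1}))"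
  if "gap_test h f et B" for h f et B
 proof -
  interpret gap_test h f et B by fact
  interpret T: subordinated_test M ka X be c S h f et B ..
  interpret T': stable_test N "be / 2" c' sg h f et B ..
  have "(LINT om|completion M. exp (- family_sum et f (measure lborel) (?I om))) = T.gap_laplace t"
   unfolding T.gap_laplace_eq[OF t] by (intro Bochner_Integration.integral_cong) (simp_all add: T.gap_functional_components)
  also have "... = T'.PD_laplace t" by (rule T.gap_laplace_eq_PD[OF N t])
  also have "... = (LINT om|N. exp (- family_sum et f (?len om) {0<..1}))"
   unfolding T'.PD_laplace_eq[OF t] T'.jump_functional_def ..
  finally show ?thesis .
 qed
 interpret V: ranked_family "completion M" "%_. measure lborel" ?I by unfold_locales (fact fin meas)+
 interpret W: ranked_family N ?len "%_. {0<..1}" by unfold_locales (fact fin' meas')+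
 let ?V = "%om. ranked (measure lborel) (?I om)" and ?W = "%om. ranked (?len om) {0<..1}"
 have law: "distr (completion M) ?P ?V = distr N ?P ?W"
  by (rule ranked_law_unique[OF V.ranked_family_axioms W.ranked_family_axioms eq])
 note Vm = V.rank_path_measurable and Wm = W.rank_path_measurable
 define D where "D v n = v n / t" for v :: "nat => real" and n
 have Dm: "D : ?P \<rightarrow>\<^sub>M ?P"
  by (rule measurable_PiM_single') (auto simp: D_def)
 have V: "V = D \<circ> ?V" by (simp add: V_def D_def fun_eq_iff)
 have W: "W om = (D \<circ> ?W) om" if "om : space N" for om
 proof
  fix n
  have "ranked (?len om) {0<..1} n = t / sg 1 om * ranked (?J om) {0<..1} n"
   using s1[OF that] t by (intro ranked_scale finJ[OF that]) auto
  then show "W om n = (D \<circ> ?W) om n" using t by (simp add: W_def D_def)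
 qed
 show Vm': "V : completion M \<rightarrow>\<^sub>M ?P" unfolding V by (rule measurable_comp[OF Vm Dm])
 have DW: "(D \<circ> ?W) : N \<rightarrow>\<^sub>M ?P" by (rule measurable_comp[OF Wm Dm])
 show Wm': "W : N \<rightarrow>\<^sub>M ?P" by (rule measurable_cong[THEN iffD2, OF W DW])
 have "distr (completion M) ?P V = distr (distr (completion M) ?P ?V) ?P D"
  unfolding V by (rule distr_distr[OF Dm Vm, symmetric])
 also have "... = distr N ?P (D \<circ> ?W)" unfolding law by (rule distr_distr[OF Dm Wm])
 also have "... = distr N ?P W" by (rule distr_cong) (simp_all add: W)
 finally show "distr (completion M) ?P V = distr N ?P W" .
qed

end

section \<open>Existence of a stable subordinator of half the index\<close>

text \<open>Factorising integer Laplace transforms identify the joint law with the product law. The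
  exponent 0 drops a coordinate, which covers all finite subfamilies.\<close>

lemma (in prob_space) indep_vars_lessThan_laplace:
 fixes Y :: "nat => 'a => real"
 assumes Ym: "!!i. Y i : borel_measurable M" and Y0: "!!i. AE x in M. 0 <= Y i x"
  and prod: "!!k :: nat => nat. expectation (%x. \<Prod>i<n. exp (- real (k i) * Y i x)) = (\<Prod>i<n. expectation (%x. exp (- real (k i) * Y i x)))"
 shows "indep_vars (%_. borel) Y {..<n}"
proof (cases "n = 0")
 case True
 then show ?thesis by (simp add: indep_vars_def2 indep_sets_def)
next
 case False
 let ?D = "%i. distr M borel (Y i)" and ?B = "\<Pi>\<^sub>M i\<in>{..<n}. borel :: real measure"
 have Dp: "prob_space (?D i)" for i by (rule prob_space_distr[OF Ym])
 interpret D: product_prob_space ?D "{..<n}" by (simp add: product_prob_space_def product_sigma_finite_def product_prob_space_axioms_def Dp prob_space_imp_sigma_finite)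
 let ?P = "\<Pi>\<^sub>M i\<in>{..<n}. ?D i"
 have s: "sets ?P = sets ?B" by (simp cong: sets_PiM_cong)
 have D0: "AE z in ?D i. 0 <= z" for i by (subst AE_distr_iff[OF Ym]) (use Y0 in auto)
 have "distr M ?B (%x. \<lambda>i\<in>{..<n}. Y i x) = distr ?P ?B (%x. \<lambda>i\<in>{..<n}. x i)"
 proof (rule determining_law[OF determining_laplace _ prob_space_axioms prob_space_PiM[OF Dp] Ym])
  show "(%x. x i) : borel_measurable ?P" if "i : {..<n}" for i
   unfolding measurable_cong_sets[OF s refl] by (rule measurable_component_singleton[OF that])
  show "AE x in ?P. x i : {0..}" if "i : {..<n}" for i
   by (rule AE_PiM_component[OF Dp that]) (use D0 in simp)
  fix J and ph :: "nat => real => real"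
  assume J: "finite J" "J \<subseteq> {..<n}" and "!!i. ph i : range (%(k::nat) x. exp (- real k * x))"
  then have "\<forall>i. \<exists>k::nat. ph i = (%x. exp (- real k * x))" by blast
  then obtain k :: "nat => nat" where k: "!!i. ph i = (%x. exp (- real (k i) * x))" by metis
  let ?k = "%i. if i : J then k i else 0"
  have e: "(\<Prod>i\<in>J. ph i (z i)) = (\<Prod>i<n. exp (- real (?k i) * z i))" for z
   using J by (intro prod.mono_neutral_cong_left) (auto simp: k)
  have "integrable (?D i) (%x. exp (- real (?k i) * x))" for i
   by (rule finite_measure.integrable_const_bound[OF prob_space.axioms(1)[OF Dp], where B=1])
     (use D0[of i] in \<open>auto elim!: eventually_mono\<close>)
  then have "(LINT x|?P. (\<Prod>i<n. exp (- real (?k i) * x i))) = (\<Prod>i<n. \<integral>z. exp (- real (?k i) * z) \<partial>?D i)"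
   by (intro D.product_integral_prod) auto
  also have "... = (\<Prod>i<n. expectation (%x. exp (- real (?k i) * Y i x)))"
   by (intro prod.cong refl integral_distr Ym) measurable
  finally show "expectation (%x. \<Prod>i\<in>J. ph i (Y i x)) = (LINT x|?P. (\<Prod>i\<in>J. ph i (x i)))"
   unfolding e prod[of ?k] ..
 qed (use Y0 in auto)
 also have "... = distr ?P ?P (%x. x)" using s by (intro distr_cong) (auto simp: space_PiM PiE_iff extensional_restrict)
 finally show ?thesis using False Ym by (subst indep_vars_iff_distr_eq_PiM') (auto simp: distr_id)
qed

text \<open>The additional 1 / 2 ^ m places this dyadic time strictly after s, so limits along it
  are limits from the right; rounding keeps it monotone in s.\<close>

definition above :: "nat => real => real" where
 "above m s = dyadic_up m s + 1 / 2 ^ m"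

lemma above:
 assumes "0 <= s"
 shows "above m s : dyadics" "s < above m s" "(%m. above m s) ----> s"
proof -
 show "above m s : dyadics"
  unfolding above_def using dyadic_up_bounds(3)[OF assms] dyadicI[of 1 m] by (intro dyadic_add) simp_all
 have "0 < 1 / (2::real) ^ m" by simp
 then show "s < above m s" unfolding above_def using dyadic_up_bounds(1)[OF assms, of m] by linarith
 have "(%m. dyadic_up m s + 1 / 2 ^ m) ----> s + 0" by (intro tendsto_add dyadic_up_tendsto assms) real_asymp
 then show "(%m. above m s) ----> s" by (simp add: above_def)
qed

lemma above_mono: "s <= r ==> above m s <= above m r"
proof -
 assume "s <= r"
 then have "\<lceil>s * 2 ^ m\<rceil> <= \<lceil>r * 2 ^ m\<rceil>" by (intro ceiling_mono mult_right_mono) auto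
 then have "nat \<lceil>s * 2 ^ m\<rceil> <= nat \<lceil>r * 2 ^ m\<rceil>" by (rule nat_mono)
 then have "real (nat \<lceil>s * 2 ^ m\<rceil>) <= real (nat \<lceil>r * 2 ^ m\<rceil>)" by (simp only: of_nat_le_iff)
 then show ?thesis unfolding above_def dyadic_up_def by (intro add_right_mono divide_right_mono) simp_all
qed

text \<open>The right-continuous regularisation of a monotone function known at dyadic
  times.\<close>

definition right_values :: "(real => real) => real => real" where
 "right_values w s = lim (%m. w (above m s))"

locale dyadic_monotone =
 fixes w :: "real => real"
 assumes mono: "!!q r. q : dyadics ==> r : dyadics ==> q <= r ==> w q <= w r" and zero: "w 0 = 0"
begin

lemma nonneg: "q : dyadics ==> 0 <= w q"
 using mono[OF zero_dyadic, of q] zero dyadics_nonneg[of q] by simp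

lemma values_bdd: "bdd_below (w ` (dyadics \<inter> {s<..}))"
 using nonneg by (intro bdd_belowI[of _ 0]) auto

lemma above_tendsto_Inf:
 assumes s: "0 <= s"
 shows "(%m. w (above m s)) ----> Inf (w ` (dyadics \<inter> {s<..}))"
proof (rule tendstoI)
 fix e :: real assume e: "0 < e"
 let ?I = "Inf (w ` (dyadics \<inter> {s<..}))"
 have ne: "w ` (dyadics \<inter> {s<..}) ~= {}" using above(1,2)[OF s, of 0] by auto
 obtain q where q: "q : dyadics" "s < q" "w q < ?I + e"
  using cInf_lessD[OF ne, of "?I + e"] e by auto
 have "\<forall>\<^sub>F m in sequentially. above m s < q" by (rule order_tendstoD(2)[OF above(3)[OF s] q(2)])
 then show "\<forall>\<^sub>F m in sequentially. dist (w (above m s)) ?I < e"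
 proof eventually_elim
  case (elim m)
  have "w (above m s) <= w q" using elim by (intro mono above(1)[OF s] q(1)) simp
  moreover have "?I <= w (above m s)" using above(1,2)[OF s, of m] by (intro cInf_lower values_bdd) auto
  ultimately show ?case using q(3) by (simp add: dist_real_def)
 qed
qed

lemma right_values_eq: "0 <= s ==> right_values w s = Inf (w ` (dyadics \<inter> {s<..}))"
 unfolding right_values_def by (rule limI[OF above_tendsto_Inf])

lemma above_tendsto: "0 <= s ==> (%m. w (above m s)) ----> right_values w s"
 using above_tendsto_Inf by (simp add: right_values_eq)

lemma right_values_upper: "0 <= s ==> q : dyadics ==> s < q ==> right_values w s <= w q"
 by (simp add: right_values_eq values_bdd cInf_lower)

lemma right_values_mono: "0 <= s ==> s <= r ==> right_values w s <= right_values w r"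
 using above(1)[of s] above(1)[of r]
 by (intro LIMSEQ_le[OF above_tendsto above_tendsto]) (auto intro!: mono above_mono)

lemma right_values_continuous:
 assumes s: "0 <= s"
 shows "continuous (at_right s) (right_values w)"
proof -
 have "(right_values w \<longlongrightarrow> right_values w s) (at_right s)"
 proof (rule tendstoI)
  fix e :: real assume e: "0 < e"
  from tendstoD[OF above_tendsto[OF s] e] obtain m where m: "dist (w (above m s)) (right_values w s) < e"
   by (auto simp: eventually_sequentially)
  have "dist (right_values w r) (right_values w s) < e" if "s < r" "r < above m s" for r
   using right_values_mono[OF s, of r] right_values_upper[of r "above m s"] that m s above(1)[OF s, of m]
   by (simp add: dist_real_def)
  then show "\<forall>\<^sub>F r in at_right s. dist (right_values w r) (right_values w s) < e"
   using above(2)[OF s, of m] unfolding eventually_at_right_field by blast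
 qed
 then show ?thesis by (simp add: continuous_within)
qed

end

text \<open>The joint transform of increments extends to real times along \<open>above\<close> by
  dominated convergence, and it contains independence, stationarity and the index. The value at 0 is
  subtracted because the right limit of a dyadic monotone path at 0 can be positive.\<close>

lemma stable_from_dyadic_increments:
 fixes W :: "real => 'a => real"
 assumes L: "prob_space L" and Wm: "!!q. q : dyadics ==> W q : borel_measurable L"
  and good: "AE om in L. dyadic_monotone (%q. W q om)"
  and \<alpha>: "0 < \<alpha>" "\<alpha> < 1" and K: "0 < K"
  and joint: "!!(u :: nat => real) (th :: nat => real) n. (!!i. u i : dyadics) ==> mono u ==> (!!i. 0 <= th i) ==>
   (LINT om|L. (\<Prod>i<n. exp (- th i * (W (u (Suc i)) om - W (u i) om)))) = (\<Prod>i<n. exp (- K * (u (Suc i) - u i) * th i powr \<alpha>))"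
 shows "stable_subordinator L \<alpha> K (%s om. right_values (%q. W q om) s - right_values (%q. W q om) 0)"
proof -
 interpret prob_space L by (rule L)
 let ?R = "%s om. right_values (%q. W q om) s"
 let ?sg = "%s om. ?R s om - ?R 0 om"
 have Rm: "?R s : borel_measurable L" if "0 <= s" for s
  unfolding right_values_def using above(1)[OF that] by (intro borel_measurable_lim_metric Wm)
 have sgm: "?sg s : borel_measurable L" if "0 <= s" for s using Rm[OF that] Rm[of 0] by measurable
 have d: "?sg r om - ?sg s om = ?R r om - ?R s om" for r s om by simp
 have joint': "expectation (%om. \<Prod>i<n. exp (- th i * (?R (u (Suc i)) om - ?R (u i) om))) = (\<Prod>i<n. exp (- K * (u (Suc i) - u i) * th i powr \<alpha>))"
  if u: "0 <= u 0" "mono u" and th: "!!i. 0 <= th i" for u th :: "nat => real" and n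
 proof -
  have u0: "0 <= u i" for i using u monoD[OF u(2), of 0 i] by simp
  let ?v = "%m i. above m (u i)"
  have vm: "mono (?v m)" for m using u(2) by (intro monoI above_mono monoD[OF u(2)])
  have vd: "?v m i : dyadics" for m i by (rule above(1)[OF u0])
  have "(%m. expectation (%om. \<Prod>i<n. exp (- th i * (W (?v m (Suc i)) om - W (?v m i) om)))) ---->
   expectation (%om. \<Prod>i<n. exp (- th i * (?R (u (Suc i)) om - ?R (u i) om)))"
  proof (rule integral_dominated_convergence[where w="%_. 1"])
   show "AE om in L. (%m. \<Prod>i<n. exp (- th i * (W (?v m (Suc i)) om - W (?v m i) om))) ----> (\<Prod>i<n. exp (- th i * (?R (u (Suc i)) om - ?R (u i) om)))"
    using good
   proof eventually_elim
    case (elim om)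
    interpret w: dyadic_monotone "%q. W q om" by (rule elim)
    show ?case by (intro tendsto_prod tendsto_exp tendsto_mult tendsto_const tendsto_diff w.above_tendsto u0)
   qed
   show "AE om in L. norm (\<Prod>i<n. exp (- th i * (W (?v m (Suc i)) om - W (?v m i) om))) <= 1" for m
    using good
   proof eventually_elim
    case (elim om)
    interpret w: dyadic_monotone "%q. W q om" by (rule elim)
    have "0 <= W (?v m (Suc i)) om - W (?v m i) om" for i
     using w.mono[OF vd vd monoD[OF vm[of m], of i "Suc i"]] by simp
    then have "0 <= th i * (W (?v m (Suc i)) om - W (?v m i) om)" for i by (intro mult_nonneg_nonneg th)
    then show ?case by (simp add: abs_prod prod_le_1)
   qed
   show "(%om. \<Prod>i<n. exp (- th i * (?R (u (Suc i)) om - ?R (u i) om))) : borel_measurable L"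
    using Rm[OF u0] by measurable
   show "(%om. \<Prod>i<n. exp (- th i * (W (?v m (Suc i)) om - W (?v m i) om))) : borel_measurable L" for m
    using Wm[OF vd] by measurable
  qed simp
  moreover have "(%m. \<Prod>i<n. exp (- K * (?v m (Suc i) - ?v m i) * th i powr \<alpha>)) ----> (\<Prod>i<n. exp (- K * (u (Suc i) - u i) * th i powr \<alpha>))"
   by (intro tendsto_prod tendsto_exp tendsto_mult tendsto_const tendsto_diff above(3) u0)
  ultimately show ?thesis using joint[OF vd vm th] by (simp add: LIMSEQ_unique)
 qed
 have incr: "AE om in L. 0 <= ?R r om - ?R s om" if "0 <= s" "s <= r" for s r
  using good by eventually_elim (simp add: dyadic_monotone.right_values_mono[OF _ that])
 have one: "expectation (%om. exp (- th * (?R r om - ?R s om))) = exp (- K * (r - s) * th powr \<alpha>)"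
  if "0 <= s" "s <= r" "0 <= th" for s r th
 proof -
  have "mono (%i::nat. if i = 0 then s else r)" using that by (auto simp: mono_def)
  from joint'[OF _ this, of "%_. th" 1] that show ?thesis by simp
 qed
 show ?thesis
 proof
  show "?sg s : borel_measurable L" if "0 <= s" for s by (rule sgm[OF that])
  show "AE om in L. ?sg 0 om = 0" by simp
  show "indep_vars (%_. borel) (%i om. ?sg (u (Suc i)) om - ?sg (u i) om) {..<n}" if u: "0 <= u 0" "mono u" for u :: "nat => real" and n
   unfolding d
  proof (rule indep_vars_lessThan_laplace)
   have u0: "0 <= u i" "u i <= u (Suc i)" for i using u monoD[OF u(2), of 0 i] monoD[OF u(2), of i "Suc i"] by auto
   show "(%om. ?R (u (Suc i)) om - ?R (u i) om) : borel_measurable L" for i using Rm[OF u0(1)] by measurable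
   show "AE om in L. 0 <= ?R (u (Suc i)) om - ?R (u i) om" for i by (rule incr[OF u0])
   show "expectation (%om. \<Prod>i<n. exp (- real (k i) * (?R (u (Suc i)) om - ?R (u i) om))) =
    (\<Prod>i<n. expectation (%om. exp (- real (k i) * (?R (u (Suc i)) om - ?R (u i) om))))" for k :: "nat => nat"
    using joint'[OF u, of "%i. real (k i)" n] one[OF u0] by simp
  qed
  show "distr L borel (%om. ?sg (s + h) om - ?sg s om) = distr L borel (?sg h)" if sh: "0 <= s" "0 <= h" for s h
   unfolding d
  proof -
   have m1: "(%om. ?R (s + h) om - ?R s om) : borel_measurable L" using sh by (intro borel_measurable_diff Rm) auto
   have m2: "?sg h : borel_measurable L" by (rule sgm[OF sh(2)])
   show "distr L borel (%om. ?R (s + h) om - ?R s om) = distr L borel (?sg h)"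
   proof (rule laplace_unique)
    show "finite_measure (distr L borel (%om. ?R (s + h) om - ?R s om))" by (rule prob_space.axioms(1)[OF prob_space_distr[OF m1]])
    show "finite_measure (distr L borel (?sg h))" by (rule prob_space.axioms(1)[OF prob_space_distr[OF m2]])
    show "AE x in distr L borel (%om. ?R (s + h) om - ?R s om). 0 <= x"
     by (subst AE_distr_iff[OF m1]) (use incr[of s "s + h"] sh in auto)
    show "AE x in distr L borel (?sg h). 0 <= x"
     by (subst AE_distr_iff[OF m2]) (use incr[of 0 h] sh in auto)
    show "(\<integral>x. exp (- real k * x) \<partial>distr L borel (%om. ?R (s + h) om - ?R s om)) = (\<integral>x. exp (- real k * x) \<partial>distr L borel (?sg h))" for k :: nat
     using one[of s "s + h" "real k"] one[of 0 h "real k"] sh by (simp add: integral_distr[OF m1] integral_distr[OF m2])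
   qed simp_all
  qed
  show "AE om in L. mono_on {0..} (%s. ?sg s om)"
   using good by eventually_elim (auto intro!: mono_onI diff_right_mono dyadic_monotone.right_values_mono)
  show "AE om in L. \<forall>s\<ge>0. continuous (at_right s) (%r. ?sg r om)"
   using good by eventually_elim (auto intro!: continuous_intros dyadic_monotone.right_values_continuous)
  show "expectation (%om. exp (- th * ?sg s om)) = exp (- K * s * th powr \<alpha>)" if "0 < s" "0 < th" for s th
   using one[of 0 s th] that by simp
 qed (rule \<alpha> K)+
qed

text \<open>Brownian hitting times form a subordinator of index 1/2. Running \<open>S\<close> along
  them, on the product space, gives the exponent \<open>ka * sqrt (c * th powr be)\<close> and so
  the index be / 2. The law is then moved to dyadic paths, since \<open>poisson_dirichlet\<close>
  quantifies over measures on real functions.\<close>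

lemma stable_subordinator_exists:
 fixes N :: "'b measure" and M :: "'a measure"
 assumes "recurrent_cbm N B" and "nice_stable M be c S"
 obtains L :: "(real => real) measure" and K sg where "stable_subordinator L (be / 2) K sg"
proof -
 let ?A = "%n th H u x. \<Prod>i<n. ennreal (exp (- (c * th i powr be) * (H (u (Suc i)) x - H (u i) x)))"
 let ?B = "%n th W u. \<integral>\<^sup>+z. ennreal (\<Prod>i<n. exp (- th i * (W (u (Suc i)) z - W (u i) z))) \<partial>(N \<Otimes>\<^sub>M M)"
 let ?C = "%B x q. %s. B (hit (%s. B s x) q + s) x - B (hit (%s. B s x) q) x"
 let ?E = "%W z. \<lambda>q\<in>dyadics. W q z"
 interpret B: recurrent_cbm N B by fact
 interpret S: nice_stable M be c S by fact
 interpret P: pair_prob_space N M ..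
 obtain ka where ka: "0 < ka" "!!a th. 0 <= th ==> (LINT om|N. exp (- th * hit (B.dyadic_path om) a)) = exp (- ka * \<bar>a\<bar> * sqrt th)"
  by (rule B.hit_laplace) blast
 let ?D = dyadic_paths
 define H where "H q x = hit (B.dyadic_path x) q" for q x
 define W where "W q z = S (H q (fst z)) (snd z)" for q and z :: "'b \<times> 'a"
 have sp: "fst z : space N" "snd z : space M" if "z : space (N \<Otimes>\<^sub>M M)" for z using that by (auto simp: space_pair_measure)
 have H0: "0 <= H q x" if "x : space N" for q x unfolding H_def by (rule B.hit_nonneg[OF that])
 have Hmono: "H q x <= H r x" if "x : space N" "0 <= q" "q <= r" for q r x
 proof -
  note w = B.recurrent[OF that(1)]
  have "hit (%s. B s x) (q + (r - q)) = hit (%s. B s x) q + hit (?C B x q) (r - q)"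
   using that by (intro hit_add[OF w]) auto
  moreover have "0 <= hit (?C B x q) (r - q)"
   by (rule hit(1)[OF recurrent_path_shift[OF w hit(1)[OF w]]])
  ultimately show ?thesis by (simp add: H_def B.hit_dyadic_path)
 qed
 have Hz: "H 0 x = 0" if "x : space N" for x using B.recurrent[OF that] by (simp add: H_def B.hit_dyadic_path hit_0)
 have Sm: "dyadic_values S : M \<rightarrow>\<^sub>M ?D" by (rule dyadic_values_measurable) (rule S.rv)
 have Hm: "H q : borel_measurable N" for q unfolding H_def[abs_def] by (rule B.hit_path_measurable)
 have Wm: "W q : borel_measurable (N \<Otimes>\<^sub>M M)" for q
 proof -
  have "(%z. extension (dyadic_values S (snd z)) (H q (fst z))) : borel_measurable (N \<Otimes>\<^sub>M M)"
   by (intro extension_measurable measurable_compose[OF measurable_snd Sm] measurable_compose[OF measurable_fst Hm])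
  moreover have "extension (dyadic_values S (snd z)) (H q (fst z)) = W q z" if "z : space (N \<Otimes>\<^sub>M M)" for z
   unfolding W_def dyadic_values_def by (intro extension_right S.sigma_right sp[OF that] H0)
  ultimately show ?thesis by (rule measurable_cong[THEN iffD1, rotated])
 qed
 have goodW: "dyadic_monotone (%q. W q z)" if z: "z : space (N \<Otimes>\<^sub>M M)" for z
 proof
  show "W 0 z = 0" unfolding W_def using Hz[OF sp(1)[OF z]] nice_zero[OF S.path[OF sp(2)[OF z]]] by simp
  show "W q z <= W r z" if "q : dyadics" "r : dyadics" "q <= r" for q r
   unfolding W_def using that by (intro nice_mono[OF S.path[OF sp(2)[OF z]]] H0[OF sp(1)[OF z]] Hmono[OF sp(1)[OF z]] dyadics_nonneg)
 qed
 let ?K = "ka * sqrt c"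
 have jointW: "(\<integral>z. (\<Prod>i<n. exp (- th i * (W (u (Suc i)) z - W (u i) z))) \<partial>(N \<Otimes>\<^sub>M M)) = (\<Prod>i<n. exp (- ?K * (u (Suc i) - u i) * th i powr (be / 2)))"
  if u: "!!i. u i : dyadics" "mono u" and th: "!!i. 0 <= th i" for u th :: "nat => real" and n
 proof -
  have u0: "0 <= u i" "u i <= u (Suc i)" for i using dyadics_nonneg[OF u(1)] monoD[OF u(2), of i "Suc i"] by auto
  have pm: "(%z. \<Prod>i<n. exp (- th i * (W (u (Suc i)) z - W (u i) z))) : borel_measurable (N \<Otimes>\<^sub>M M)"
   using Wm by measurable
  have Wi: "0 <= th i * (W (u (Suc i)) z - W (u i) z)" if "z : space (N \<Otimes>\<^sub>M M)" for z i
   using dyadic_monotone.mono[OF goodW[OF that] u(1) u(1) u0(2), of i] th[of i] by simp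
  have inner: "(\<integral>\<^sup>+y. ennreal (\<Prod>i<n. exp (- th i * (W (u (Suc i)) (x, y) - W (u i) (x, y)))) \<partial>M) =
   (?A n th H u x)" if x: "x : space N" for x
  proof -
   have "mono (%i. H (u i) x)" using u0 by (intro monoI Hmono[OF x]) (auto intro: monoD[OF u(2)])
   moreover have "0 <= H (u 0) x" by (rule H0[OF x])
   ultimately have "(\<integral>\<^sup>+y. (\<Prod>i<n. ennreal ((%i z. exp (- th i * z)) i (S (H (u (Suc i)) x) y - S (H (u i) x) y))) \<partial>M) =
    (\<Prod>i<n. \<integral>\<^sup>+y. ennreal ((%i z. exp (- th i * z)) i (S (H (u (Suc i)) x - H (u i) x) y)) \<partial>M)"
    using th by (intro S.nn_increments) auto
   moreover have "(\<integral>\<^sup>+y. ennreal (exp (- th i * S r y)) \<partial>M) = ennreal (exp (- (c * th i powr be) * r))" if r: "0 <= r" for i r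
   proof -
    have "(\<integral>\<^sup>+y. ennreal (exp (- th i * S r y)) \<partial>M) = ennreal (LINT y|M. exp (- th i * S r y))"
     using S.rv[OF r] th[of i] nice_nonneg[OF S.path r] by (intro nn_integral_eq_integral S.integrable_const_bound[where B=1] AE_I2) auto
    then show ?thesis using S.laplace[OF r th[of i]] by (simp add: mult_ac)
   qed
   moreover have "0 <= H (u (Suc i)) x - H (u i) x" for i using Hmono[OF x u0] by simp
   ultimately show ?thesis by (simp add: W_def prod_ennreal)
  qed
  have "?B n th W u =
   (\<integral>\<^sup>+x. (\<integral>\<^sup>+y. ennreal (\<Prod>i<n. exp (- th i * (W (u (Suc i)) (x, y) - W (u i) (x, y)))) \<partial>M) \<partial>N)"
   by (rule S.nn_integral_fst[symmetric]) (use pm in measurable)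
  also have "... = (\<integral>\<^sup>+x. ?A n th H u x \<partial>N)"
   by (intro nn_integral_cong inner)
  also have "... = (\<Prod>i<n. ennreal (exp (- ?K * (u (Suc i) - u i) * th i powr (be / 2))))"
  proof -
   \<comment> \<open>\<open>hit_product\<close> takes levels as partial sums starting at 0, so b
     starts with u 0. The test function 1 at index 0 discards this initial piece.\<close>
   define b where "b i = (case i of 0 => u 0 | Suc j => u (Suc j) - u j)" for i
   have bs: "(\<Sum>j<Suc i. b j) = u i" for i by (induction i) (simp_all add: b_def)
   have bn: "0 <= b i" for i using u0 by (cases i) (auto simp: b_def)
   let ?ph = "%i z. case i of 0 => 1 | Suc j => ennreal (exp (- (c * th j powr be) * z))"
   have phm: "?ph i : borel_measurable borel" for i by (cases i) simp_all
   have "(\<integral>\<^sup>+x. ?A n th H u x \<partial>N) =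
    (\<integral>\<^sup>+x. (\<Prod>i<Suc n. ?ph i (hit (B.dyadic_path x) (\<Sum>j<Suc i. b j) - hit (B.dyadic_path x) (\<Sum>j<i. b j))) \<partial>N)"
    unfolding prod.lessThan_Suc_shift bs H_def by simp
   also have "... = (\<Prod>i<Suc n. \<integral>\<^sup>+x. ?ph i (hit (B.dyadic_path x) (b i)) \<partial>N)"
    by (rule B.hit_product[OF bn phm])
   also have "... = (\<Prod>i<n. ennreal (exp (- ?K * (u (Suc i) - u i) * th i powr (be / 2))))"
    unfolding prod.lessThan_Suc_shift
   proof (simp add: B.emeasure_space_1, intro prod.cong refl)
    fix i
    have cn: "0 <= c * th i powr be" using S.scale by simp
    have sq: "sqrt (c * th i powr be) = sqrt c * th i powr (be / 2)"
     using th[of i] by (simp add: real_sqrt_mult powr_half_sqrt[symmetric] powr_powr)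
    have "b (Suc i) = u (Suc i) - u i" by (simp add: b_def)
    then show "(\<integral>\<^sup>+x. ennreal (exp (- (c * th i powr be * hit (B.dyadic_path x) (b (Suc i))))) \<partial>N) =
     ennreal (exp (- (ka * sqrt c * (u (Suc i) - u i) * th i powr (be / 2))))"
     using B.hit_nn_laplace[OF cn, of "b (Suc i)"] ka(2)[OF cn, of "b (Suc i)"] u0(2)[of i] sq by (simp add: mult_ac)
   qed
   finally show ?thesis .
  qed
  also have "... = ennreal (\<Prod>i<n. exp (- ?K * (u (Suc i) - u i) * th i powr (be / 2)))" by (rule prod_ennreal) simp
  finally have nn: "?B n th W u =
   ennreal (\<Prod>i<n. exp (- ?K * (u (Suc i) - u i) * th i powr (be / 2)))" .
  show ?thesis
   using integral_eq_nn_integral[OF pm] nn by (simp add: prod_nonneg)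
 qed
 define L where "L = distr (N \<Otimes>\<^sub>M M) ?D (%z. \<lambda>q\<in>dyadics. W q z)"
 have Wr: "(%z. \<lambda>q\<in>dyadics. W q z) : (N \<Otimes>\<^sub>M M) \<rightarrow>\<^sub>M ?D" by (intro measurable_restrict Wm)
 have cm: "(%w. w q) : borel_measurable ?D" if "q : dyadics" for q by (rule measurable_component_singleton[OF that])
 have "stable_subordinator L (be / 2) ?K (%s w. right_values (%q. w q) s - right_values (%q. w q) 0)"
 proof (rule stable_from_dyadic_increments)
  show "prob_space L" unfolding L_def by (rule P.prob_space_distr[OF Wr])
  show "(%w. w q) : borel_measurable L" if "q : dyadics" for q unfolding L_def using cm[OF that] by simp
  show "0 < be / 2" "be / 2 < 1" using S.index by auto
  show "0 < ?K" using ka(1) S.scale by simp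
  show "AE w in L. dyadic_monotone (%q. w q)"
  proof -
   \<comment> \<open>Only properties described by measurable sets of dyadic paths can be pulled
     back, so monotonicity is treated for one pair of times after another.\<close>
   have AE_L: "AE w in L. P w" if "{w\<in>space ?D. P w} : sets ?D" "!!z. z : space (N \<Otimes>\<^sub>M M) ==> P (?E W z)" for P
    unfolding L_def AE_distr_iff[OF Wr that(1)] by (rule AE_I2) (rule that(2))
   have "AE w in L. q <= r --> w q <= w r" if qr: "q : dyadics" "r : dyadics" for q r
   proof (rule AE_L)
    have "{w\<in>space ?D. w q <= w r} : sets ?D" by (rule borel_measurable_le[OF cm[OF qr(1)] cm[OF qr(2)]])
    then show "{w\<in>space ?D. q <= r --> w q <= w r} : sets ?D" by (cases "q <= r") simp_all
    show "q <= r --> (?E W z) q <= (?E W z) r" if "z : space (N \<Otimes>\<^sub>M M)" for z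
     using dyadic_monotone.mono[OF goodW[OF that] qr] qr by simp
   qed
   then have "\<forall>q\<in>dyadics. \<forall>r\<in>dyadics. AE w in L. q <= r --> w q <= w r" by blast
   then have "AE w in L. \<forall>q\<in>dyadics. \<forall>r\<in>dyadics. q <= r --> w q <= w r"
    by (simp only: AE_ball_countable[OF countable_dyadics])
   moreover have "AE w in L. w 0 = 0"
   proof (rule AE_L)
    show "{w\<in>space ?D. w 0 = 0} : sets ?D" by (rule borel_measurable_eq[OF cm[OF zero_dyadic] borel_measurable_const])
    show "(?E W z) 0 = 0" if "z : space (N \<Otimes>\<^sub>M M)" for z
     using dyadic_monotone.zero[OF goodW[OF that]] zero_dyadic by simp
   qed
   ultimately have "AE w in L. (\<forall>q\<in>dyadics. \<forall>r\<in>dyadics. q <= r --> w q <= w r) & w 0 = 0"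
    by eventually_elim simp
   then show ?thesis by eventually_elim (simp add: dyadic_monotone_def)
  qed
  fix u th :: "nat => real" and n assume u: "!!i. u i : dyadics" "mono u" and th: "!!i. 0 <= th i"
  note [measurable] = cm[OF u(1)]
  show "(LINT w|L. (\<Prod>i<n. exp (- th i * (w (u (Suc i)) - w (u i))))) = (\<Prod>i<n. exp (- ?K * (u (Suc i) - u i) * th i powr (be / 2)))"
   unfolding L_def jointW[OF u th, symmetric] by (subst integral_distr[OF Wr]) (simp_all add: u(1))
 qed
 then show ?thesis by (rule that)
qed

lemma ranked_cong: "(!!i. i : I ==> f i = g i) ==> ranked f I n = ranked g I n"
 unfolding ranked_def by (simp cong: conj_cong)

lemma (in nice_stable) ranked_jumps_eq:
 assumes "om : space M"
 shows "ranked_jumps sg om n = ranked (%s. sg s om - left_value (%s. sg s om) s) {0<..1} n"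
 unfolding ranked_jumps_def jump_def using Lim_left[OF path[OF assms]] by (intro ranked_cong) simp

text \<open>The right-hand side does not mention \<open>N\<close>, \<open>c'\<close> or
  \<open>sg\<close>. Thus all stable subordinators of this index give one and the same law, which is
  the uniqueness behind the definite description.\<close>

lemma (in subordinated) poisson_dirichlet_sequence_law:
 assumes N: "stable_subordinator N (be / 2) c' sg" and t: "0 < t"
 shows "sequence_law N (%om n. ranked_jumps sg om n / sg 1 om) =
  distr (completion M) (\<Pi>\<^sub>M n\<in>UNIV. borel) (%om n. ranked (measure lborel) (components ({0..t} - zero_set om)) n / t)"
proof -
 let ?P = "\<Pi>\<^sub>M n\<in>(UNIV::nat set). borel :: real measure"
 obtain sg' where sg': "nice_stable N (be / 2) c' sg'" "AE om in N. \<forall>s. sg' s om = sg s om"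
  by (rule stable_subordinator.nice_version[OF N])
 interpret N: nice_stable N "be / 2" c' sg' by (rule sg'(1))
 let ?W = "%om n. ranked (%s. sg' s om - left_value (%s. sg' s om) s) {0<..1} n / sg' 1 om"
 note W = ranked_lengths_law(2,3)[OF sg'(1) t]
 have "AE om in N. ?W om = (%n. ranked_jumps sg om n / sg 1 om)"
  using sg'(2) AE_space
 proof eventually_elim
  case (elim om)
  then have "jump sg om = jump sg' om" by (simp add: jump_def fun_eq_iff)
  then have "ranked_jumps sg om = ranked_jumps sg' om" by (simp add: ranked_jumps_def)
  then show ?case using elim N.ranked_jumps_eq[OF elim(2)] by (simp add: fun_eq_iff)
 qed
 from completion_AE_eq(2)[OF measurable_completion[OF W(1)] this]
 have "sequence_law N (%om n. ranked_jumps sg om n / sg 1 om) = distr (completion N) ?P ?W"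
  by (simp add: sequence_law_def space_PiM)
 also have "... = distr N ?P ?W" by (rule distr_completion[OF W(1)])
 also have "... = distr (completion M) ?P (%om n. ranked (measure lborel) (components ({0..t} - zero_set om)) n / t)"
  by (rule W(2)[symmetric])
 finally show ?thesis .
qed

text \<open>Independence of the given paths is first restricted to dyadic times, where both
  restrictions are measurable maps, and then carried to the almost surely equal versions.\<close>

lemma subordinated_version:
 assumes X: "reflected_path M ka X'" "AE om in M. \<forall>s. X' s om = X s om" "!!s. 0 <= s ==> X s : borel_measurable M"
  and S: "nice_stable M be c S'" "AE om in M. \<forall>s. S' s om = S s om" "!!s. 0 <= s ==> S s : borel_measurable M"
  and ind: "prob_space.indep_var M path_space (sample_path X) path_space (sample_path S)"
 shows "subordinated M ka X' be c S'"
proof -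
 interpret X: reflected_path M ka X' by (rule X(1))
 interpret S: nice_stable M be c S' by (rule S(1))
 let ?D = dyadic_paths
 have "X.indep_var ?D (dyadic_values X) ?D (dyadic_values S)"
  using X.indep_var_compose[OF ind restrict_dyadics_measurable restrict_dyadics_measurable] by (simp only: comp_def restrict_sample_path)
 then have law: "distr M ?D (dyadic_values X) \<Otimes>\<^sub>M distr M ?D (dyadic_values S) =
  distr M (?D \<Otimes>\<^sub>M ?D) (%om. (dyadic_values X om, dyadic_values S om))"
  by (simp add: X.indep_var_distribution_eq)
 have vm: "dyadic_values Z : M \<rightarrow>\<^sub>M ?D" if "!!s. 0 <= s ==> Z s : borel_measurable M" for Z by (rule dyadic_values_measurable) (rule that)
 have Xm: "dyadic_values X : M \<rightarrow>\<^sub>M ?D" "dyadic_values X' : M \<rightarrow>\<^sub>M ?D" by (rule vm, rule X.X_measurable X(3), assumption)+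
 have Sm: "dyadic_values S : M \<rightarrow>\<^sub>M ?D" "dyadic_values S' : M \<rightarrow>\<^sub>M ?D" by (rule vm, rule S.rv S(3), assumption)+
 have Xe: "AE om in M. dyadic_values X' om = dyadic_values X om" using X(2) by eventually_elim (simp add: dyadic_values_def)
 have Se: "AE om in M. dyadic_values S' om = dyadic_values S om" using S(2) by eventually_elim (simp add: dyadic_values_def)
 have "distr M ?D (dyadic_values X') = distr M ?D (dyadic_values X)" by (rule distr_cong_AE[OF refl refl Xe Xm(2,1)])
 moreover have "distr M ?D (dyadic_values S') = distr M ?D (dyadic_values S)" by (rule distr_cong_AE[OF refl refl Se Sm(2,1)])
 moreover have "distr M (?D \<Otimes>\<^sub>M ?D) (%om. (dyadic_values X' om, dyadic_values S' om)) = distr M (?D \<Otimes>\<^sub>M ?D) (%om. (dyadic_values X om, dyadic_values S om))"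
 proof (rule distr_cong_AE[OF refl refl])
  show "AE om in M. (dyadic_values X' om, dyadic_values S' om) = (dyadic_values X om, dyadic_values S om)"
   using Xe Se by eventually_elim simp
 qed (intro measurable_Pair Xm Sm)+
 ultimately show ?thesis using law by unfold_locales simp
qed

section \<open>The Poisson-Dirichlet law of the positivity intervals\<close>

theorem theorem1:
  fixes M :: "'a measure" and X S E X' :: "real \<Rightarrow> 'a \<Rightarrow> real"
    and U :: "'a \<Rightarrow> nat \<Rightarrow> real" and \<beta> c t :: real
  assumes "0 < \<beta>" "\<beta> < 1" "0 < c"
    and "prob_space M"
    and "reflected_brownian_motion M X"
    and "stable_subordinator M \<beta> c S"
    and "prob_space.indep_var M path_space (sample_path X) path_space (sample_path S)"
    and "0 < t"
  defines "E \<equiv> right_inverse S"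
    and "X' \<equiv> time_change X E"
    and "U \<equiv> positivity_lengths X' t"
  shows "(AE \<omega> in M. \<forall>n. 0 < U \<omega> n) \<and>
    (\<lambda>\<omega> n. U \<omega> n / t) \<in> completion M \<rightarrow>\<^sub>M (\<Pi>\<^sub>M n\<in>UNIV. borel) \<and>
    sequence_law M (\<lambda>\<omega> n. U \<omega> n / t) = poisson_dirichlet (\<beta> / 2)"
proof -
 let ?P = "\<Pi>\<^sub>M n\<in>(UNIV::nat set). borel :: real measure"
 interpret S: stable_subordinator M \<beta> c S by fact
 note t = \<open>0 < t\<close>
 obtain \<kappa> Y where Y: "reflected_path M \<kappa> Y" "AE \<omega> in M. \<forall>s. Y s \<omega> = X s \<omega>"
  by (rule reflected_version[OF \<open>reflected_brownian_motion M X\<close>])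
 obtain S' where S': "nice_stable M \<beta> c S'" "AE \<omega> in M. \<forall>s. S' s \<omega> = S s \<omega>" by (rule S.nice_version)
 have Xm: "X s : borel_measurable M" if "0 <= s" for s
  using \<open>reflected_brownian_motion M X\<close> that by (simp add: reflected_brownian_motion_def)
 interpret subordinated M \<kappa> Y \<beta> c S'
  by (rule subordinated_version[OF Y Xm S' S.random_variable \<open>prob_space.indep_var M path_space (sample_path X) path_space (sample_path S)\<close>])
 let ?V = "%\<omega> n. ranked (measure lborel) (components ({0..t} - zero_set \<omega>)) n"
 \<comment> \<open>The Brownian motion behind \<open>X\<close> supplies the hitting times from which
   a stable subordinator of index \<beta>/2 is built.\<close>
 obtain N :: "(real => real) measure" and B0 where "brownian_motion N B0"
  using \<open>reflected_brownian_motion M X\<close> unfolding reflected_brownian_motion_def by blast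
 then obtain B where B: "recurrent_cbm N B" by (rule brownian_motion.recurrent_version)
 obtain L :: "(real => real) measure" and K \<sigma> where L: "stable_subordinator L (\<beta> / 2) K \<sigma>"
  by (rule stable_subordinator_exists[OF B S'(1)])
 obtain \<sigma>' where \<sigma>': "nice_stable L (\<beta> / 2) K \<sigma>'" by (rule stable_subordinator.nice_version[OF L])
 have UV: "AE \<omega> in M. U \<omega> = ?V \<omega>"
  using Y(2) S'(2) AE_space
 proof eventually_elim
  case (elim \<omega>)
  have inv: "E u \<omega> = path_inverse (%s. S' s \<omega>) u" for u
   using elim(2) by (simp add: E_def right_inverse_def path_inverse_def)
  \<comment> \<open>By nonnegativity the positive set of the time-changed path is the complement of
    its zero set, so components of both coincide.\<close>
  have "0 <= Y (path_inverse (%s. S' s \<omega>) u) \<omega>" for u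
   using recurring_zerosD(2)[OF X_cont[OF elim(3)] X_zeros[OF elim(3)]] path_inverse_nonneg[OF path[OF elim(3)]] by blast
  then have "{u\<in>{0..t}. X' u \<omega> > 0} = {0..t} - zero_set \<omega>"
   using elim(1) by (auto simp: X'_def time_change_def inv zero_set_def less_le)
  then show ?case by (simp add: U_def positivity_lengths_def fun_eq_iff)
 qed
 have "AE \<omega> in M. \<forall>n. 0 < U \<omega> n"
  using UV ranked_lengths_pos[OF t] by eventually_elim simp
 moreover have "AE \<omega> in M. (%n. ?V \<omega> n / t) = (%n. U \<omega> n / t)"
  using UV by eventually_elim simp
 note UV' = completion_AE_eq[OF ranked_lengths_law(1)[OF \<sigma>' t] this]
 have "(%\<omega> n. U \<omega> n / t) : completion M \<rightarrow>\<^sub>M ?P" by (rule UV'(1)) (simp add: space_PiM)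
 moreover have "sequence_law M (%\<omega> n. U \<omega> n / t) = poisson_dirichlet (\<beta> / 2)"
 proof -
  have "sequence_law M (%\<omega> n. U \<omega> n / t) = distr (completion M) ?P (%\<omega> n. ?V \<omega> n / t)"
   unfolding sequence_law_def by (rule UV'(2)) (simp add: space_PiM)
  also have "... = poisson_dirichlet (\<beta> / 2)"
   unfolding poisson_dirichlet_def
  \<comment> \<open>Existence is witnessed by \<open>L\<close>. Uniqueness holds because
    \<open>poisson_dirichlet_sequence_law\<close> evaluates every candidate to the same
    measure.\<close>
  proof (rule the_equality[symmetric])
   show "\<exists>(N :: (real => real) measure) c \<sigma>. stable_subordinator N (\<beta> / 2) c \<sigma> \<and>
    distr (completion M) ?P (%\<omega> n. ?V \<omega> n / t) = sequence_law N (%\<omega> n. ranked_jumps \<sigma> \<omega> n / \<sigma> 1 \<omega>)"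
    using L poisson_dirichlet_sequence_law[OF L t] by metis
   fix \<mu> assume "\<exists>(N :: (real => real) measure) c \<sigma>. stable_subordinator N (\<beta> / 2) c \<sigma> \<and>
    \<mu> = sequence_law N (%\<omega> n. ranked_jumps \<sigma> \<omega> n / \<sigma> 1 \<omega>)"
   then obtain N' :: "(real => real) measure" and c' \<tau> where N': "stable_subordinator N' (\<beta> / 2) c' \<tau>"
    and \<mu>: "\<mu> = sequence_law N' (%\<omega> n. ranked_jumps \<tau> \<omega> n / \<tau> 1 \<omega>)" by blast
   show "\<mu> = distr (completion M) ?P (%\<omega> n. ?V \<omega> n / t)"
    unfolding \<mu> by (rule poisson_dirichlet_sequence_law[OF N' t])
  qed
  finally show ?thesis .
 qed
 ultimately show ?thesis by blast
qed

end
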